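(* Let $N\ge 3$, let $\Sigma$ be a domain in the unit sphere $\mathbb{S}^{N-1}$, let $R>0$, and let $\mathcal{C}_\Sigma^R=\{r\sigma\in\mathbb{R}^N: r\in(0,R),\ \sigma\in\Sigma\}$. Let $c$ satisfy $\lambda_1(\Sigma)<c\le \mu(\mathcal{C}_\Sigma)$, let $p>1$, and let $u\in L^p_{loc}(\mathcal{C}_\Sigma^R)$ be non-negative and satisfy $$-\Delta u-\frac{c}{|x|^2}u\ge u^p\quad\text{in }\mathcal{D}'(\mathcal{C}_\Sigma^R),$$ i.e. $\int u(-\Delta\varphi-c|x|^{-2}\varphi)\,dx\ge\int u^p\varphi\,dx$ for all non-negative $\varphi\in C_c^\infty(\mathcal{C}_\Sigma^R)$. If $p\ge p_\Sigma$, then $u\equiv 0$.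
   Context: $\lambda_1(\Sigma)$ denotes the first Dirichlet eigenvalue of the Laplace–Beltrami operator on $\Sigma$. $\mathcal{C}_\Sigma=\{r\sigma: r>0,\sigma\in\Sigma\}$ and $\mu(\mathcal{C}_\Sigma)=\inf_{u\in C_c^\infty(\mathcal{C}_\Sigma)}\frac{\int|\nabla u|^2dx}{\int|x|^{-2}u^2dx}=\frac{(N-2)^2}{4}+\lambda_1(\Sigma)$. Set $\alpha_\Sigma^-=\frac{N-2}{2}-\sqrt{\mu(\mathcal{C}_\Sigma)-c}$ (which is positive when $c>\lambda_1(\Sigma)$) and $p_\Sigma=1+\frac{2}{\alpha_\Sigma^-}$. *)

theory Defs
  imports "HOL-Analysis.Analysis"
begin

fun dderiv :: "'a::euclidean_space list \<Rightarrow> ('a \<Rightarrow> real) \<Rightarrow> ('a \<Rightarrow> real)" where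
  "dderiv [] f = f"
| "dderiv (v # vs) f = (\<lambda>x. frechet_derivative (dderiv vs f) (at x) v)"

definition smooth_on :: "'a::euclidean_space set \<Rightarrow> ('a \<Rightarrow> real) \<Rightarrow> bool" where
  "smooth_on S f \<longleftrightarrow> (\<forall>vs. dderiv vs f differentiable_on S)"

definition tsupport :: "('a::euclidean_space \<Rightarrow> real) \<Rightarrow> 'a set" where
  "tsupport f = closure {x. f x \<noteq> 0}"

definition test_fun :: "'a::euclidean_space set \<Rightarrow> ('a \<Rightarrow> real) \<Rightarrow> bool" where
  "test_fun \<Omega> \<phi> \<longleftrightarrow> smooth_on UNIV \<phi> \<and> compact (tsupport \<phi>) \<and> tsupport \<phi> \<subseteq> \<Omega>"

definition laplacian :: "('a::euclidean_space \<Rightarrow> real) \<Rightarrow> 'a \<Rightarrow> real" where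
  "laplacian f x = (\<Sum>i\<in>Basis. dderiv [i, i] f x)"

definition grad_sq :: "('a::euclidean_space \<Rightarrow> real) \<Rightarrow> 'a \<Rightarrow> real" where
  "grad_sq f x = (\<Sum>i\<in>Basis. (dderiv [i] f x)\<^sup>2)"

definition sphere_domain :: "'a::euclidean_space set \<Rightarrow> bool" where
  "sphere_domain \<Sigma> \<longleftrightarrow> \<Sigma> \<noteq> {} \<and> connected \<Sigma> \<and> openin (top_of_set (sphere 0 1)) \<Sigma>"

definition cone_of :: "'a::euclidean_space set \<Rightarrow> 'a set" where
  "cone_of \<Sigma> = {r *\<^sub>R \<sigma> | r \<sigma>. 0 < r \<and> \<sigma> \<in> \<Sigma>}"

definition trunc_cone :: "'a::euclidean_space set \<Rightarrow> real \<Rightarrow> 'a set" where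
  "trunc_cone \<Sigma> R = {r *\<^sub>R \<sigma> | r \<sigma>. 0 < r \<and> r < R \<and> \<sigma> \<in> \<Sigma>}"

definition hardy_const :: "'a::euclidean_space set \<Rightarrow> real" where
  "hardy_const \<Sigma> = Inf {(\<integral>x. grad_sq u x \<partial>lebesgue) / (\<integral>x. u x ^ 2 / norm x ^ 2 \<partial>lebesgue) | u.
       test_fun (cone_of \<Sigma>) u \<and> (\<exists>x. u x \<noteq> 0)}"

text \<open>First Dirichlet eigenvalue of the Laplace-Beltrami operator on Sigma, via the Rayleigh
  quotient over smooth phi with compact support in Sigma.  A function phi on the sphere is
  represented through its 0-homogeneous extension psi(x) = phi(x/|x|); then
  |grad_sigma phi (x/|x|)|^2 = |x|^2 |grad psi(x)|^2 and integrating over the unit ball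
  (polar coordinates) gives (1/N) int_Sigma |grad_sigma phi|^2 and (1/N) int_Sigma phi^2.\<close>
definition lambda1 :: "'a::euclidean_space set \<Rightarrow> real" where
  "lambda1 \<Sigma> = Inf {(set_lebesgue_integral lebesgue (ball 0 1)
                          (\<lambda>x. norm x ^ 2 * grad_sq (\<lambda>y. \<phi> (sgn y)) x)) /
                      (set_lebesgue_integral lebesgue (ball 0 1) (\<lambda>x. (\<phi> (sgn x))\<^sup>2)) | \<phi>.
       smooth_on (UNIV - {0}) (\<lambda>y. \<phi> (sgn y)) \<and>
       closure {\<sigma> \<in> sphere 0 1. \<phi> \<sigma> \<noteq> 0} \<subseteq> \<Sigma> \<and> (\<exists>\<sigma>\<in>\<Sigma>. \<phi> \<sigma> \<noteq> 0)}"

definition alpha_minus :: "'a::euclidean_space set \<Rightarrow> real \<Rightarrow> real" where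
  "alpha_minus \<Sigma> c = (real DIM('a) - 2) / 2 - sqrt (hardy_const \<Sigma> - c)"

definition p_Sigma :: "'a::euclidean_space set \<Rightarrow> real \<Rightarrow> real" where
  "p_Sigma \<Sigma> c = 1 + 2 / alpha_minus \<Sigma> c"

definition Lp_loc :: "real \<Rightarrow> 'a::euclidean_space set \<Rightarrow> ('a \<Rightarrow> real) \<Rightarrow> bool" where
  "Lp_loc p \<Omega> u \<longleftrightarrow> u \<in> borel_measurable lebesgue \<and>
     (\<forall>K. compact K \<and> K \<subseteq> \<Omega> \<longrightarrow> (\<integral>\<^sup>+ x\<in>K. ennreal (\<bar>u x\<bar> powr p) \<partial>lebesgue) < \<infinity>)"

end

theory Submission
  imports Defs "HOL-Analysis.Analysis"
begin

text \<open>Suppose that u does not vanish almost everywhere. The strong maximum principle and mollification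
  produce positive smooth supersolutions v that are bounded below on any given compact set,
  uniformly in the mollification parameter.  Put a = (N - 2) / 2 and b = 2 / (p - 1), and let
  M(s) be the integral of Phi(x)^2 ln v(e^{-s} x) for a function Phi on the cone with
  square integral 1.  Testing the inequality with |x|^2 Phi^2 / v and Jensen's inequality give, for y = M',

    y' <= -(y - a)^2 + a^2 + E(Phi) - c + eta - B exp((p - 1) (M - b s)),

  where E(Phi) is the angular energy of Phi.  Let Lambda be the Dirichlet eigenvalue of Sigma and
  kappa^2 = a^2 + Lambda - c.  The hypothesis p >= p_Sigma says b <= a - kappa, and under
  this condition the Riccati inequality with E(Phi) close to Lambda has no solution on long intervals.
  A near-minimizer Phi of E has to be cut off where ln v is very negative in order to bound M(0)
  from below; this costs little, because ln v has a Caccioppoli estimate and because the part of Sigma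
  outside a large compact set has a large eigenvalue.\<close>

section \<open>Continuously differentiable functions with compact support\<close>

text \<open>The order of choices shapes the proof. How long the Riccati inequality must hold depends
  on the lower bound of M(0), so this bound has to be known before Phi and v are. A near-minimizer
  of E, however, is chosen late, its precision being dictated by the Riccati step; and since Sigma
  is an arbitrary open piece of the sphere, its support may come close to the boundary, where
  nothing bounds ln v from below. Hence one compact K inside Sigma is fixed for good, such that the
  eigenvalue of Sigma outside K is at least Lambda + 1. Only a bound of ln v over K enters M(0), and
  the gap 1 controls the cut-off of every near-minimizer at once.

  Lambda is the best constant of the angular Poincare inequality for C^1 functions. With mu for
  \<open>hardy_const\<close>, it is tied to the constants of the statement by a^2 + Lambda <= mu and
  mu < a^2 + c.

  The logarithm is averaged because the squared gradient of ln v and the power v^(p-1) = exp((p-1)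
  ln v) are convex expressions in it, so that Jensen leaves an inequality in M, M' and M''
  alone.\<close>

lemma has_derivative_lebesgue_integral:
  fixes F :: "'a::euclidean_space \<Rightarrow> 'b \<Rightarrow> real" and G :: "'a \<Rightarrow> 'b \<Rightarrow> 'a"
  assumes r: "r > 0"
    and int: "\<And>x. x \<in> ball x0 r \<Longrightarrow> integrable M (F x)"
    and der: "\<And>x y. x \<in> ball x0 r \<Longrightarrow> ((\<lambda>x. F x y) has_derivative (\<lambda>h. G x y \<bullet> h)) (at x)"
    and bd: "\<And>x y. x \<in> ball x0 r \<Longrightarrow> norm (G x y) \<le> B y"
    and B: "integrable M B"
    and G: "G x0 \<in> borel_measurable M"
  shows "((\<lambda>x. \<integral>y. F x y \<partial>M) has_derivative (\<lambda>h. (\<integral>y. G x0 y \<partial>M) \<bullet> h)) (at x0)"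
proof -
  have x0: "x0 \<in> ball x0 r" using r by simp
  have intG: "integrable M (G x0)"
    by (rule Bochner_Integration.integrable_bound[OF B G]) (use bd[OF x0] in \<open>auto intro!: AE_I2 order_trans[OF _ abs_ge_self]\<close>)
  \<comment> \<open>The mean value inequality turns the gradient bound into a Lipschitz bound in
    \<open>x\<close> with constant \<open>B y\<close>; this dominates the difference
    quotients.\<close>
  have lip: "\<bar>F x y - F x0 y\<bar> \<le> B y * norm (x - x0)" if x: "x \<in> ball x0 r" for x y
  proof -
    have "norm (F x y - F x0 y) \<le> B y * norm (x - x0)"
    proof (rule differentiable_bound[where S="ball x0 r" and f="\<lambda>x. F x y" and f'="\<lambda>x h. G x y \<bullet> h"])
      show "((\<lambda>x. F x y) has_derivative (\<bullet>) (G x y)) (at x within ball x0 r)" if "x \<in> ball x0 r" for x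
        using der[OF that] by (rule has_derivative_at_withinI)
      show "onorm ((\<bullet>) (G x y)) \<le> B y" if "x \<in> ball x0 r" for x
      proof (rule onorm_le)
        fix h show "norm (G x y \<bullet> h) \<le> B y * norm h"
          using Cauchy_Schwarz_ineq2[of "G x y" h] 
            mult_right_mono[OF bd[OF that, of y] norm_ge_zero[of h]] by simp
      qed
    qed (use x x0 in auto)
    then show ?thesis by simp
  qed
  \<comment> \<open>The normalized Taylor remainder. It tends to 0 pointwise and is bounded by
    \<open>2 * B\<close>, one \<open>B\<close> for the increment and one for the linear
    term.\<close>
  define E where "E x y = (F x y - F x0 y - G x0 y \<bullet> (x - x0)) / norm (x - x0)" for x y
  have "((\<lambda>x. ((\<integral>y. F x y \<partial>M) - (\<integral>y. F x0 y \<partial>M) - (\<integral>y. G x0 y \<partial>M) \<bullet> (x - x0)) / norm (x - x0)) \<longlongrightarrow> 0) (at x0 within ball x0 r)"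
  proof (subst tendsto_at_iff_sequentially, intro allI impI)
    fix X assume X: "\<forall>i. X i \<in> ball x0 r - {x0}" and Xlim: "X \<longlonglongrightarrow> x0"
    have eq: "((\<integral>y. F (X i) y \<partial>M) - (\<integral>y. F x0 y \<partial>M) - (\<integral>y. G x0 y \<partial>M) \<bullet> (X i - x0)) / norm (X i - x0)
        = (\<integral>y. E (X i) y \<partial>M)" for i
    proof -
      have "(\<integral>y. E (X i) y \<partial>M) = (\<integral>y. F (X i) y - F x0 y - G x0 y \<bullet> (X i - x0) \<partial>M) / norm (X i - x0)"
        unfolding E_def by simp
      also have "(\<integral>y. F (X i) y - F x0 y - G x0 y \<bullet> (X i - x0) \<partial>M) = (\<integral>y. F (X i) y \<partial>M) - (\<integral>y. F x0 y \<partial>M) - (\<integral>y. G x0 y \<bullet> (X i - x0) \<partial>M)"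
        using int[of "X i"] int[OF x0] X intG by simp
      also have "(\<integral>y. G x0 y \<bullet> (X i - x0) \<partial>M) = (\<integral>y. G x0 y \<partial>M) \<bullet> (X i - x0)"
        using intG by simp
      finally show ?thesis by simp
    qed
    have "(\<lambda>i. \<integral>y. E (X i) y \<partial>M) \<longlonglongrightarrow> (\<integral>y. 0 \<partial>M)"
    proof (rule integral_dominated_convergence[where w="\<lambda>y. 2 * B y"])
      show "E (X i) \<in> borel_measurable M" for i
        unfolding E_def using int[of "X i"] int[OF x0] X G
        by (auto intro!: borel_measurable_divide borel_measurable_diff borel_measurable_inner)
      show "AE y in M. (\<lambda>i. E (X i) y) \<longlonglongrightarrow> 0"
      proof (rule AE_I2)
        fix y
        have "((\<lambda>x. E x y) \<longlongrightarrow> 0) (at x0)"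
          using der[OF x0, of y] unfolding has_derivative_at_within E_def
          by (simp add: divide_inverse_commute)
        then show "(\<lambda>i. E (X i) y) \<longlonglongrightarrow> 0"
          using X Xlim unfolding tendsto_at_iff_sequentially comp_def by blast
      qed
      show "AE y in M. norm (E (X i) y) \<le> 2 * B y" for i
      proof (rule AE_I2)
        fix y
        have n: "norm (X i - x0) > 0" and Xi: "X i \<in> ball x0 r" using X by auto
        have "\<bar>F (X i) y - F x0 y - G x0 y \<bullet> (X i - x0)\<bar> \<le> B y * norm (X i - x0) + B y * norm (X i - x0)"
          using lip[OF Xi, of y] Cauchy_Schwarz_ineq2[of "G x0 y" "X i - x0"]
            mult_right_mono[OF bd[OF x0, of y] norm_ge_zero[of "X i - x0"]] by linarith
        then show "norm (E (X i) y) \<le> 2 * B y"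
          using n by (simp add: E_def field_simps)
      qed
    qed (use B in auto)
    then show "((\<lambda>x. ((\<integral>y. F x y \<partial>M) - (\<integral>y. F x0 y \<partial>M) - (\<integral>y. G x0 y \<partial>M) \<bullet> (x - x0)) / norm (x - x0)) \<circ> X) \<longlonglongrightarrow> 0"
      by (simp add: comp_def eq)
  qed
  then have "((\<lambda>x. \<integral>y. F x y \<partial>M) has_derivative (\<lambda>h. (\<integral>y. G x0 y \<partial>M) \<bullet> h)) (at x0 within ball x0 r)"
    unfolding has_derivative_at_within by (simp add: bounded_linear_inner_right divide_inverse_commute)
  then show ?thesis
    using at_within_open[OF x0 open_ball] by simp
qed

text \<open>The gradient is carried along as an argument instead of being read off a derivative
  operator, so that its explicit formula survives products and compositions. Continuity of
  \<open>g\<close> is included: on an open \<open>S\<close> this is C^1.\<close>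

definition has_grad :: "('a::euclidean_space \<Rightarrow> real) \<Rightarrow> ('a \<Rightarrow> 'a) \<Rightarrow> 'a set \<Rightarrow> bool" where
  "has_grad f g S \<longleftrightarrow> (\<forall>x\<in>S. (f has_derivative (\<lambda>h. g x \<bullet> h)) (at x)) \<and> continuous_on S g"

text \<open>The compact set may be larger than the support, and only \<open>f\<close> is required to
  vanish off it; that \<open>g\<close> vanishes there too follows in \<open>C1cE\<close> from
  uniqueness of the gradient on the open complement.\<close>

definition C1c :: "'a::euclidean_space set \<Rightarrow> ('a \<Rightarrow> real) \<Rightarrow> ('a \<Rightarrow> 'a) \<Rightarrow> bool" where
  "C1c \<Omega> f g \<longleftrightarrow> has_grad f g UNIV \<and> (\<exists>K. compact K \<and> K \<subseteq> \<Omega> \<and> (\<forall>x. x \<notin> K \<longrightarrow> f x = 0))"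

lemma has_gradD: "has_grad f g S \<Longrightarrow> x \<in> S \<Longrightarrow> (f has_derivative (\<lambda>h. g x \<bullet> h)) (at x)"
  by (simp add: has_grad_def)

lemma has_grad_continuous: "has_grad f g S \<Longrightarrow> continuous_on S f"
  unfolding has_grad_def
  by (meson continuous_at_imp_continuous_on has_derivative_continuous)

lemma has_grad_continuous_grad: "has_grad f g S \<Longrightarrow> continuous_on S g"
  by (simp add: has_grad_def)

lemma has_grad_mult:
  assumes "has_grad f g S" "has_grad f' g' S"
  shows "has_grad (\<lambda>x. f x * f' x) (\<lambda>x. f x *\<^sub>R g' x + f' x *\<^sub>R g x) S"
  unfolding has_grad_def
proof (intro conjI ballI)
  fix x assume "x \<in> S"
  then show "((\<lambda>x. f x * f' x) has_derivative (\<bullet>) (f x *\<^sub>R g' x + f' x *\<^sub>R g x)) (at x)"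
    by (intro has_derivative_eq_rhs[OF has_derivative_mult[OF has_gradD[OF assms(1)] has_gradD[OF assms(2)]]])
       (auto simp: inner_add_left algebra_simps fun_eq_iff)
qed (use assms has_grad_continuous[OF assms(1)] has_grad_continuous[OF assms(2)]
      in \<open>auto simp: has_grad_def intro!: continuous_intros\<close>)

lemma has_grad_compose:
  assumes "has_grad f g S"
    and "\<And>x. x \<in> S \<Longrightarrow> (\<theta> has_real_derivative \<theta>' (f x)) (at (f x))"
    and "continuous_on S (\<lambda>x. \<theta>' (f x))"
  shows "has_grad (\<lambda>x. \<theta> (f x)) (\<lambda>x. \<theta>' (f x) *\<^sub>R g x) S"
  unfolding has_grad_def
proof (intro conjI ballI)
  fix x assume x: "x \<in> S"
  have "((\<lambda>x. \<theta> (f x)) has_derivative (\<lambda>h. \<theta>' (f x) * (g x \<bullet> h))) (at x)"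
    using has_derivative_compose[OF has_gradD[OF assms(1) x], of \<theta> "(*) (\<theta>' (f x))"] assms(2)[OF x]
    by (simp add: has_field_derivative_def)
  then show "((\<lambda>x. \<theta> (f x)) has_derivative (\<bullet>) (\<theta>' (f x) *\<^sub>R g x)) (at x)"
    by (rule has_derivative_eq_rhs) (auto simp: fun_eq_iff)
qed (use assms in \<open>auto simp: has_grad_def intro!: continuous_intros\<close>)

lemma has_grad_unique:
  assumes "has_grad f g S" "has_grad f g' S" "x \<in> S"
  shows "g x = g' x"
proof -
  have "(\<lambda>h. g x \<bullet> h) = (\<lambda>h. g' x \<bullet> h)"
    using has_derivative_unique[OF has_gradD[OF assms(1,3)] has_gradD[OF assms(2,3)]] .
  then show ?thesis by (metis inner_commute vector_eq_rdot)
qed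

lemma has_grad_cong_open:
  assumes "has_grad f g S" "open S" "\<And>x. x \<in> S \<Longrightarrow> f' x = f x" "\<And>x. x \<in> S \<Longrightarrow> g' x = g x"
  shows "has_grad f' g' S"
  unfolding has_grad_def
proof (intro conjI ballI)
  fix x assume x: "x \<in> S"
  then show "(f' has_derivative (\<bullet>) (g' x)) (at x)"
    using has_derivative_transform_within_open[OF has_gradD[OF assms(1) x] assms(2) x] assms(3,4)
    by simp
next
  show "continuous_on S g'"
    using assms(1,4) by (simp add: has_grad_def cong: continuous_on_cong)
qed

lemma has_grad_zero: "open S \<Longrightarrow> (\<And>x. x \<in> S \<Longrightarrow> f x = 0) \<Longrightarrow> (\<And>x. x \<in> S \<Longrightarrow> g x = 0) \<Longrightarrow> has_grad f g S"
  by (rule has_grad_cong_open[where f="\<lambda>_. 0" and g="\<lambda>_. 0"]) (auto simp: has_grad_def)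

lemma has_grad_Un:
  assumes "has_grad f g S" "has_grad f g T" "open S" "open T"
  shows "has_grad f g (S \<union> T)"
  unfolding has_grad_def using assms continuous_on_open_Un[of S T g] by (auto simp: has_grad_def)

text \<open>\<open>S\<close> and the complement of \<open>K\<close> form an open cover. Typically
  \<open>S\<close> is the punctured space: functions singular at the origin become C^1 everywhere
  once they are cut off near it.\<close>

lemma has_grad_extend_zero:
  assumes "has_grad f g S" "open S" "closed K" "K \<subseteq> S"
    "\<And>x. x \<notin> K \<Longrightarrow> f x = 0" "\<And>x. x \<notin> K \<Longrightarrow> g x = 0"
  shows "has_grad f g UNIV"
proof -
  have "has_grad f g (S \<union> - K)"
    by (rule has_grad_Un) (use assms in \<open>auto intro!: has_grad_zero\<close>)
  moreover have "S \<union> - K = UNIV" using assms(4) by auto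
  ultimately show ?thesis by simp
qed

lemma continuous_on_extend_zero:
  fixes f :: "'a::euclidean_space \<Rightarrow> 'b::real_normed_vector"
  assumes "continuous_on S f" "open S" "closed K" "K \<subseteq> S" "\<And>x. x \<notin> K \<Longrightarrow> f x = 0"
  shows "continuous_on UNIV f"
proof -
  have "continuous_on (- K) f"
    by (rule continuous_on_eq[where f="\<lambda>_. 0"]) (use assms(5) in auto)
  then have "continuous_on (S \<union> - K) f"
    using assms by (intro continuous_on_open_Un) auto
  moreover have "S \<union> - K = UNIV" using assms(4) by auto
  ultimately show ?thesis by simp
qed

lemma C1cE:
  assumes "C1c \<Omega> f g"
  obtains K where "compact K" "K \<subseteq> \<Omega>" "\<And>x. x \<notin> K \<Longrightarrow> f x = 0" "\<And>x. x \<notin> K \<Longrightarrow> g x = 0"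
    "has_grad f g UNIV" "continuous_on UNIV f" "continuous_on UNIV g"
proof -
  from assms obtain K where K: "has_grad f g UNIV" "compact K" "K \<subseteq> \<Omega>" "\<And>x. x \<notin> K \<Longrightarrow> f x = 0"
    by (auto simp: C1c_def)
  have "g x = 0" if "x \<notin> K" for x
  proof -
    have "has_grad f g (- K)" using K(1) by (auto simp: has_grad_def intro: continuous_on_subset)
    moreover have "has_grad f (\<lambda>_. 0) (- K)"
      by (rule has_grad_zero) (use K in \<open>auto simp: compact_imp_closed\<close>)
    ultimately show ?thesis using that by (auto dest: has_grad_unique[of f g "- K" "\<lambda>_. 0" x])
  qed
  then show ?thesis using that K has_grad_continuous[OF K(1)] has_grad_continuous_grad[OF K(1)] by blast
qed

lemma C1c_mono: "C1c \<Omega> f g \<Longrightarrow> \<Omega> \<subseteq> \<Omega>' \<Longrightarrow> C1c \<Omega>' f g"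
  unfolding C1c_def by blast

lemma C1cI:
  assumes "has_grad f g UNIV" "compact K" "K \<subseteq> \<Omega>" "\<And>x. x \<notin> K \<Longrightarrow> f x = 0"
  shows "C1c \<Omega> f g"
  using assms by (auto simp: C1c_def)

lemma C1c_mult_right:
  assumes "C1c \<Omega> f g" "has_grad f' g' UNIV"
  shows "C1c \<Omega> (\<lambda>x. f x * f' x) (\<lambda>x. f x *\<^sub>R g' x + f' x *\<^sub>R g x)"
  using assms has_grad_mult[of f g UNIV f' g'] unfolding C1c_def by (metis mult_zero_left)

section \<open>Continuous functions with compact support\<close>

definition C0c :: "('a::euclidean_space \<Rightarrow> 'b::euclidean_space) \<Rightarrow> bool" where
  "C0c f \<longleftrightarrow> continuous_on UNIV f \<and> (\<exists>R. \<forall>x. norm x > R \<longrightarrow> f x = 0)"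

lemma C0cI_compact:
  assumes "continuous_on UNIV f" "compact K" "\<And>x. x \<notin> K \<Longrightarrow> f x = 0"
  shows "C0c f"
proof -
  obtain R where "\<forall>x\<in>K. norm x \<le> R" using compact_imp_bounded[OF assms(2)] by (auto simp: bounded_iff)
  then have "\<forall>x. norm x > R \<longrightarrow> f x = 0" using assms(3) by force
  with assms(1) show ?thesis by (auto simp: C0c_def)
qed

lemma C0c_continuous: "C0c f \<Longrightarrow> continuous_on UNIV f"
  by (simp add: C0c_def)

lemma C0c_measurable: "C0c f \<Longrightarrow> f \<in> borel_measurable borel"
  by (simp add: C0c_def borel_measurable_continuous_onI)

lemma C0c_integrable: 
  assumes "C0c f" shows "integrable lborel f"
proof -
  obtain R where R: "\<And>x. norm x > R \<Longrightarrow> f x = 0" and c: "continuous_on UNIV f" using assms by (auto simp: C0c_def)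
  have "integrable lborel (\<lambda>x. indicator (cball 0 R) x *\<^sub>R f x)"
    by (rule borel_integrable_compact) (use c in \<open>auto intro: continuous_on_subset\<close>)
  moreover have "(\<lambda>x. indicator (cball 0 R) x *\<^sub>R f x) = f"
    using R by (auto simp: indicator_def fun_eq_iff not_le)
  ultimately show ?thesis by simp
qed

lemma C0c_bounded:
  assumes "C0c f" obtains C where "C > 0" "\<And>x. norm (f x) \<le> C"
proof -
  obtain R where R: "\<And>x. norm x > R \<Longrightarrow> f x = 0" and c: "continuous_on UNIV f" using assms by (auto simp: C0c_def)
  have "compact (f ` cball 0 R)" by (intro compact_continuous_image continuous_on_subset[OF c]) auto
  then obtain C where C: "\<And>x. x \<in> cball 0 R \<Longrightarrow> norm (f x) \<le> C"
    by (meson bounded_iff compact_imp_bounded image_eqI)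
  have "norm (f x) \<le> max C 1" for x
    using C[of x] R[of x] by (cases "norm x \<le> R") (auto simp: not_le)
  then show ?thesis using that[of "max C 1"] by auto
qed

lemma C0c_dominated:
  assumes "C0c f" obtains C R where "C > 0" "R > 0" "\<And>x. norm (f x) \<le> C * indicator (cball 0 R) x"
proof -
  obtain R where R: "\<And>x. norm x > R \<Longrightarrow> f x = 0" using assms by (auto simp: C0c_def)
  obtain C where C: "C > 0" "\<And>x. norm (f x) \<le> C" using C0c_bounded[OF assms] by blast
  show ?thesis
  proof (rule that[of C "max R 1"])
    show "norm (f x) \<le> C * indicator (cball 0 (max R 1)) x" for x
      using C(2)[of x] R[of x] by (auto simp: indicator_def not_le)
  qed (use C in auto)
qed

lemma C0c_mult_left: 
  fixes f h :: "'a::euclidean_space \<Rightarrow> real"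
  shows "C0c f \<Longrightarrow> continuous_on UNIV h \<Longrightarrow> C0c (\<lambda>x. f x * h x)"
  unfolding C0c_def by (intro conjI continuous_on_mult) auto

lemma C0c_mult_right: 
  fixes f h :: "'a::euclidean_space \<Rightarrow> real"
  shows "C0c f \<Longrightarrow> continuous_on UNIV h \<Longrightarrow> C0c (\<lambda>x. h x * f x)"
  unfolding C0c_def by (intro conjI continuous_on_mult) auto

lemma C0c_inner_left: "C0c f \<Longrightarrow> continuous_on UNIV h \<Longrightarrow> C0c (\<lambda>x. f x \<bullet> h x)"
  unfolding C0c_def by (intro conjI continuous_on_inner) (auto, metis inner_zero_left inner_zero_right)

lemma C0c_inner_right: "C0c f \<Longrightarrow> continuous_on UNIV h \<Longrightarrow> C0c (\<lambda>x. h x \<bullet> f x)"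
  unfolding C0c_def by (intro conjI continuous_on_inner) (auto, metis inner_zero_left inner_zero_right)

lemma C0c_add: "C0c f \<Longrightarrow> C0c h \<Longrightarrow> C0c (\<lambda>x. f x + h x)"
proof -
  assume "C0c f" "C0c h"
  then obtain R R' where "\<And>x. norm x > R \<Longrightarrow> f x = 0" "\<And>x. norm x > R' \<Longrightarrow> h x = 0" by (auto simp: C0c_def)
  then have "\<forall>x. norm x > max R R' \<longrightarrow> f x + h x = 0" by auto
  then show "C0c (\<lambda>x. f x + h x)" using \<open>C0c f\<close> \<open>C0c h\<close> unfolding C0c_def by (blast intro: continuous_on_add)
qed

lemma C0c_diff: "C0c f \<Longrightarrow> C0c h \<Longrightarrow> C0c (\<lambda>x. f x - h x)"
proof -
  assume "C0c f" "C0c h"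
  then obtain R R' where "\<And>x. norm x > R \<Longrightarrow> f x = 0" "\<And>x. norm x > R' \<Longrightarrow> h x = 0" by (auto simp: C0c_def)
  then have "\<forall>x. norm x > max R R' \<longrightarrow> f x - h x = 0" by auto
  then show "C0c (\<lambda>x. f x - h x)" using \<open>C0c f\<close> \<open>C0c h\<close> unfolding C0c_def by (blast intro: continuous_on_diff)
qed

lemma C0c_power2: fixes f :: "'a::euclidean_space \<Rightarrow> real" shows "C0c f \<Longrightarrow> C0c (\<lambda>x. (f x)\<^sup>2)"
  unfolding C0c_def by (intro conjI continuous_on_power) auto

lemma C0c_norm_power2: "C0c f \<Longrightarrow> C0c (\<lambda>x. (norm (f x))\<^sup>2)"
  unfolding C0c_def by (intro conjI continuous_on_power continuous_on_norm) auto

lemma C0c_scaleR_left: fixes f :: "'a::euclidean_space \<Rightarrow> real" and h :: "'a \<Rightarrow> 'b::euclidean_space"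
  shows "C0c f \<Longrightarrow> continuous_on UNIV h \<Longrightarrow> C0c (\<lambda>x. f x *\<^sub>R h x)"
  unfolding C0c_def by (intro conjI continuous_on_scaleR) auto

lemma C0c_scaleR_right: fixes f :: "'a::euclidean_space \<Rightarrow> real" and h :: "'a \<Rightarrow> 'b::euclidean_space"
  shows "C0c h \<Longrightarrow> continuous_on UNIV f \<Longrightarrow> C0c (\<lambda>x. f x *\<^sub>R h x)"
  unfolding C0c_def by (intro conjI continuous_on_scaleR) auto

lemmas C0c_intros = C0c_mult_left C0c_mult_right C0c_inner_left C0c_inner_right C0c_add C0c_diff C0c_power2 C0c_norm_power2
  C0c_scaleR_left C0c_scaleR_right

lemma C1c_C0c: assumes "C1c \<Omega> f g" shows "C0c f" "C0c g"
  by (rule C1cE[OF assms], rule C0cI_compact, assumption+)+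

section \<open>Translation and dilation of Lebesgue integrals, and integration by parts\<close>

lemma lborel_integral_translation:
  fixes f :: "'a::euclidean_space \<Rightarrow> real"
  shows "(LBINT x. f (x + z)) = (LBINT x. f x)"
proof -
  have "(LBINT x. f x) = (\<integral>x. f x \<partial>(distr lborel lborel ((+) z)))"
    using lborel_distr_plus[of z] by (metis distr_cong sets_lborel)
  also have "\<dots> = (LBINT x. f (z + x))" if "f \<in> borel_measurable borel"
    by (subst integral_distr) (use that in auto)
  finally have 1: "f \<in> borel_measurable borel \<Longrightarrow> ?thesis" by (simp add: add.commute)
  show ?thesis
  \<comment> \<open>A nonmeasurable \<open>f\<close> is integrable on neither side, and both
    integrals take the default value 0.\<close>
  proof (cases "f \<in> borel_measurable borel")
    case False
    have "(\<lambda>x. f (x + z)) \<notin> borel_measurable borel"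
    proof
      assume "(\<lambda>x. f (x + z)) \<in> borel_measurable borel"
      then have "(\<lambda>x. f ((x - z) + z)) \<in> borel_measurable borel"
        by (rule measurable_compose[rotated]) auto
      then show False using False by simp
    qed
    then have "\<not> integrable lborel f" "\<not> integrable lborel (\<lambda>x. f (x + z))"
      using False by (auto dest: borel_measurable_integrable)
    then show ?thesis by (simp add: not_integrable_integral_eq)
  qed (use 1 in auto)
qed

lemma integrable_translation:
  fixes f :: "'a::euclidean_space \<Rightarrow> real"
  assumes "integrable lborel f" shows "integrable lborel (\<lambda>x. f (x + z))"
proof -
  have "integrable (distr lborel lborel ((+) z)) f"
    using lborel_distr_plus[of z] assms by (metis distr_cong sets_lborel)
  then have "integrable lborel (\<lambda>x. f (z + x))"
    by (subst (asm) integrable_distr_eq) (use assms in auto)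
  then show ?thesis by (simp add: add.commute)
qed

lemma lborel_nn_integral_translation:
  fixes f :: "'a::euclidean_space \<Rightarrow> ennreal"
  assumes "f \<in> borel_measurable borel"
  shows "(\<integral>\<^sup>+x. f (x + z) \<partial>lborel) = (\<integral>\<^sup>+x. f x \<partial>lborel)"
proof -
  have "(\<integral>\<^sup>+x. f x \<partial>lborel) = (\<integral>\<^sup>+x. f x \<partial>(distr lborel lborel ((+) z)))"
    using lborel_distr_plus[of z] by (metis distr_cong sets_lborel)
  also have "\<dots> = (\<integral>\<^sup>+x. f (z + x) \<partial>lborel)"
    by (subst nn_integral_distr) (use assms in auto)
  finally show ?thesis by (simp add: add.commute)
qed

lemma lborel_nn_integral_scale:
  fixes f :: "'a::euclidean_space \<Rightarrow> ennreal"
  assumes f[measurable]: "f \<in> borel_measurable borel" and c: "c > 0"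
  shows "(\<integral>\<^sup>+x. f x \<partial>lborel) = ennreal (c ^ DIM('a)) * (\<integral>\<^sup>+x. f (c *\<^sub>R x) \<partial>lborel)"
proof -
  have "(\<integral>\<^sup>+x. f x \<partial>lborel) = (\<integral>\<^sup>+x. f x \<partial>(density (distr lborel borel (\<lambda>x. 0 + c *\<^sub>R x)) (\<lambda>_. ennreal (\<bar>c\<bar> ^ DIM('a)))))"
    using c by (subst lborel_affine[of c 0]) auto
  also have "\<dots> = ennreal (c ^ DIM('a)) * (\<integral>\<^sup>+x. f (c *\<^sub>R x) \<partial>lborel)"
    using c by (simp add: nn_integral_density nn_integral_distr nn_integral_cmult)
  finally show ?thesis .
qed

lemma lborel_integral_scale:
  fixes f :: "'a::euclidean_space \<Rightarrow> real"
  assumes f[measurable]: "f \<in> borel_measurable borel" and c: "c > 0"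
  shows "(LBINT x. f x) = c ^ DIM('a) * (LBINT x. f (c *\<^sub>R x))"
proof -
  have "(LBINT x. f x) = (\<integral>x. f x \<partial>(density (distr lborel borel (\<lambda>x. 0 + c *\<^sub>R x)) (\<lambda>_. ennreal (\<bar>c\<bar> ^ DIM('a)))))"
    using c by (subst lborel_affine[of c 0]) auto
  also have "\<dots> = c ^ DIM('a) * (LBINT x. f (c *\<^sub>R x))"
    using c by (simp add: integral_density integral_distr)
  finally show ?thesis .
qed

text \<open>By translation invariance the integral of \<open>f\<close> shifted by \<open>t\<close>
  times \<open>z\<close> does not depend on \<open>t\<close>; its derivative at \<open>t = 0\<close>
  is the integral in question. Every integration by parts below is this fact applied to a
  product.\<close>

lemma integral_directional_derivative_zero:
  fixes f :: "'a::euclidean_space \<Rightarrow> real"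
  assumes f: "C1c \<Omega> f g"
  shows "(LBINT x. g x \<bullet> z) = 0"
proof -
  note ccf = C1c_C0c[OF f]
  obtain C R where CR: "C > 0" "R > 0" "\<And>x. norm (g x) \<le> C * indicator (cball 0 R) x"
    using C0c_dominated[OF ccf(2)] by blast
  have hg: "has_grad f g UNIV" using f by (simp add: C1c_def)
  have "((\<lambda>t::real. \<integral>y. f (y + t *\<^sub>R z) \<partial>lborel) has_derivative (\<lambda>h. (LBINT y. g (y + 0 *\<^sub>R z) \<bullet> z) \<bullet> h)) (at 0)"
  proof (rule has_derivative_lebesgue_integral[where r=1 and B="\<lambda>y. C * norm z * indicator (cball 0 (R + norm z)) y"])
    show "integrable lborel (\<lambda>y. f (y + t *\<^sub>R z))" for t
      using integrable_translation[OF C0c_integrable[OF ccf(1)]] .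
    show "((\<lambda>t. f (y + t *\<^sub>R z)) has_derivative (\<bullet>) (g (y + t *\<^sub>R z) \<bullet> z)) (at t)" for t y
    proof -
      have "((\<lambda>t. y + t *\<^sub>R z) has_derivative (\<lambda>h. h *\<^sub>R z)) (at t)"
        by (auto intro!: derivative_eq_intros)
      from has_derivative_compose[OF this has_gradD[OF hg UNIV_I]]
      show ?thesis by (rule has_derivative_eq_rhs) (auto simp: fun_eq_iff)
    qed
    \<comment> \<open>For \<open>t\<close> in the unit ball the shifted supports all lie in the ball
      of radius \<open>R + norm z\<close>.\<close>
    show "norm (g (y + t *\<^sub>R z) \<bullet> z) \<le> C * norm z * indicator (cball 0 (R + norm z)) y" if "t \<in> ball 0 1" for t y
    proof -
      have "norm (g (y + t *\<^sub>R z) \<bullet> z) \<le> norm (g (y + t *\<^sub>R z)) * norm z"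
        using Cauchy_Schwarz_ineq2 by auto
      also have "\<dots> \<le> (C * indicator (cball 0 R) (y + t *\<^sub>R z)) * norm z"
        by (intro mult_right_mono CR) auto
      also have "\<dots> \<le> C * norm z * indicator (cball 0 (R + norm z)) y"
      proof (cases "norm (y + t *\<^sub>R z) \<le> R")
        case True
        have "norm y \<le> norm (y + t *\<^sub>R z) + \<bar>t\<bar> * norm z"
          using norm_triangle_ineq4[of "y + t *\<^sub>R z" "t *\<^sub>R z"] by simp
        moreover have "\<bar>t\<bar> * norm z \<le> norm z" using that by (intro mult_left_le_one_le) auto
        ultimately have "norm y \<le> R + norm z" using True by linarith
        then show ?thesis using CR by (auto simp: indicator_def)
      qed (use CR in \<open>auto simp: indicator_def\<close>)
      finally show ?thesis .
    qed
    show "integrable lborel (\<lambda>y. C * norm z * indicator (cball 0 (R + norm z)) y)"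
      using emeasure_lborel_cball_finite by (intro integrable_mult_right integrable_real_indicator) auto
    show "(\<lambda>y. g (y + 0 *\<^sub>R z) \<bullet> z) \<in> borel_measurable lborel"
      using C0c_measurable[OF ccf(2)] by simp
  qed auto
  then have "((\<lambda>t::real. \<integral>y. f y \<partial>lborel) has_derivative (\<lambda>h. (LBINT y. g y \<bullet> z) * h)) (at 0)"
    by (simp add: lborel_integral_translation)
  then have "(\<lambda>h. (LBINT y. g y \<bullet> z) * h) = (\<lambda>h. 0)"
    by (rule has_derivative_unique) auto
  then show ?thesis by (metis mult.right_neutral)
qed

section \<open>Riccati differential inequalities\<close>

text \<open>With \<open>q = a - k - y\<close> the inequality reads \<open>q' >= q^2 + 2 k q\<close>.
  A start with \<open>q 0 > \<theta>\<close> gives \<open>q' >= q^2\<close>, which blows up within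
  time \<open>1 / \<theta>\<close>. A solution that lives longer cannot start far below the lower
  equilibrium \<open>a - k\<close>.\<close>

lemma riccati_lower:
  fixes y y' :: "real \<Rightarrow> real"
  assumes der: "\<And>s. s \<in> {0..l} \<Longrightarrow> (y has_real_derivative y' s) (at s)"
    and le: "\<And>s. s \<in> {0..l} \<Longrightarrow> y' s \<le> - (y s - a)\<^sup>2 + k\<^sup>2"
    and k: "k \<ge> 0" and th: "\<theta> > 0" and l: "l > 1 / \<theta>"
  shows "y 0 \<ge> a - k - \<theta>"
proof (rule ccontr)
  assume neg: "\<not> ?thesis"
  define q where "q s = a - k - y s" for s
  have q0: "q 0 > \<theta>" using neg by (simp add: q_def)
  have l0: "l > 0" using l th by (meson divide_pos_pos less_trans zero_less_one)
  have dq: "(q has_real_derivative - y' s) (at s)" if "s \<in> {0..l}" for s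
    unfolding q_def by (auto intro!: derivative_eq_intros der that)
  have dqge: "- y' s \<ge> (q s)\<^sup>2 + 2 * k * q s" if "s \<in> {0..l}" for s
  proof -
    have "(y s - a)\<^sup>2 - k\<^sup>2 = (q s)\<^sup>2 + 2 * k * q s"
      by (simp add: q_def power2_eq_square algebra_simps)
    then show ?thesis using le[OF that] by linarith
  qed
  have cont: "continuous_on {0..l} q"
    by (rule DERIV_continuous_on) (use dq in \<open>auto intro: has_field_derivative_at_within\<close>)
  \<comment> \<open>The bound \<open>q' >= q^2\<close> needs \<open>q\<close> nonnegative. Up to the
    earliest time \<open>s1\<close> with \<open>q\<close> at most \<open>\<theta> / 2\<close>,
    \<open>q\<close> is nondecreasing, so it cannot have come down from above
    \<open>\<theta>\<close>.\<close>
  have pos: "q s > \<theta> / 2" if s: "s \<in> {0..l}" for s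
  proof (rule ccontr)
    assume neg: "\<not> q s > \<theta> / 2"
    define s1 where "s1 = Inf {t \<in> {0..l}. q t \<le> \<theta> / 2}"
    have cl: "compact {t \<in> {0..l}. q t \<le> \<theta> / 2}"
    proof -
      have "closed ({0..l} \<inter> q -` {..\<theta>/2})"
        by (rule continuous_closed_preimage[OF cont]) auto
      moreover have "{0..l} \<inter> q -` {..\<theta>/2} = {t \<in> {0..l}. q t \<le> \<theta> / 2}" by auto
      ultimately have "closed {t \<in> {0..l}. q t \<le> \<theta> / 2}" by simp
      moreover have "bounded {t \<in> {0..l}. q t \<le> \<theta> / 2}"
        by (rule bounded_subset[of "{0..l}"]) auto
      ultimately show ?thesis by (simp add: compact_eq_bounded_closed)
    qed
    have ne: "{t \<in> {0..l}. q t \<le> \<theta> / 2} \<noteq> {}" using neg s by force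
    have s1: "s1 \<in> {t \<in> {0..l}. q t \<le> \<theta> / 2}"
      unfolding s1_def using cl ne by (intro closed_contains_Inf) (auto simp: compact_imp_closed bdd_below_def)
    have bef: "q t > \<theta> / 2" if "t \<in> {0..<s1}" for t
    proof (rule ccontr)
      assume "\<not> q t > \<theta> / 2"
      then have "t \<in> {t \<in> {0..l}. q t \<le> \<theta> / 2}" using that s1 by auto
      then have "s1 \<le> t" unfolding s1_def by (intro cInf_lower) (auto simp: bdd_below_def)
      then show False using that by simp
    qed
    have "q 0 \<le> q s1"
    proof (rule DERIV_nonneg_imp_nondecreasing[where f=q])
      show "0 \<le> s1" using s1 by simp
    next
      fix t assume t: "0 \<le> t" "t \<le> s1"
      have "q t \<ge> 0"
      proof (cases "t = s1")
        case True
        have "(\<theta>/2) \<le> q s1" if "s1 > 0"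
        proof -
          have "continuous_on {0..s1} q" using s1 by (intro continuous_on_subset[OF cont]) auto
          then have "(q \<longlongrightarrow> q s1) (at_left s1)"
            using that continuous_on_Icc_at_leftD by blast
          moreover have "eventually (\<lambda>t. q t \<ge> \<theta>/2) (at_left s1)"
            using eventually_at_left_real[OF that] by eventually_elim (use bef in \<open>force simp: less_imp_le\<close>)
          ultimately show ?thesis
            by (intro tendsto_lowerbound[of q "q s1" "at_left s1"]) (auto simp: trivial_limit_at_left_real)
        qed
        then show ?thesis using True th q0 t by (cases "s1 = 0") auto
      qed (use bef[of t] t th in auto)
      then have "(q t)\<^sup>2 + 2 * k * q t \<ge> 0" using k by simp
      moreover have "t \<in> {0..l}" using t s1 by auto
      ultimately show "\<exists>y. (q has_real_derivative y) (at t) \<and> 0 \<le> y"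
        using dq dqge by (meson order_trans)
    qed
    then show False using s1 q0 th by auto
  qed
  \<comment> \<open>\<open>- 1 / q\<close> has derivative \<open>q' / q^2 >= 1\<close>, so
    subtracting \<open>s\<close> leaves a nondecreasing function; since \<open>- 1 / q l\<close> is
    negative, \<open>l\<close> is at most \<open>1 / q 0\<close>.\<close>
  define z where "z s = - 1 / q s - s" for s
  have "z 0 \<le> z l"
  proof (rule DERIV_nonneg_imp_nondecreasing[where f=z])
    fix t assume t: "0 \<le> t" "t \<le> l"
    then have tl: "t \<in> {0..l}" by simp
    have qp: "q t > 0" using pos[OF tl] th by simp
    have "(z has_real_derivative - y' t / (q t)\<^sup>2 - 1) (at t)"
      unfolding z_def using qp dq[OF tl]
      by (auto intro!: derivative_eq_intros simp: power2_eq_square)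
    moreover have "- y' t / (q t)\<^sup>2 - 1 \<ge> 0"
    proof -
      have "- y' t \<ge> (q t)\<^sup>2" using dqge[OF tl] k qp by (smt (verit) mult_nonneg_nonneg)
      then show ?thesis using qp by (simp add: field_simps)
    qed
    ultimately show "\<exists>y. (z has_real_derivative y) (at t) \<and> 0 \<le> y" by blast
  qed (use l0 in simp)
  moreover have "q l > 0" using pos[of l] l0 th by force
  ultimately have "- 1 / q 0 \<le> - l" unfolding z_def using l0
    by (smt (verit) divide_nonneg_nonneg divide_minus_left divide_pos_pos)
  then have "l \<le> 1 / q 0" by simp
  also have "1 / q 0 < 1 / \<theta>" using q0 th by (simp add: field_simps)
  finally show False using l by simp
qed

text \<open>Without equilibria the solution dies in finite time: \<open>arctan ((y - a) / k)\<close>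
  decreases at rate at least \<open>k\<close>, but takes values in an open interval of length
  pi.\<close>

lemma riccati_blowdown:
  fixes y y' :: "real \<Rightarrow> real"
  assumes der: "\<And>s. s \<in> {0..l} \<Longrightarrow> (y has_real_derivative y' s) (at s)"
    and le: "\<And>s. s \<in> {0..l} \<Longrightarrow> y' s \<le> - (y s - a)\<^sup>2 - k\<^sup>2"
    and k: "k > 0" and l: "l \<ge> pi / k"
  shows False
proof -
  define z where "z s = arctan ((y s - a) / k) + k * s" for s
  have l0: "l \<ge> 0" using l k pi_gt_zero by (smt (verit) divide_nonneg_pos)
  have "z l \<le> z 0"
  proof (rule DERIV_nonpos_imp_nonincreasing[where f=z, OF l0])
    fix t assume "0 \<le> t" "t \<le> l"
    then have t: "t \<in> {0..l}" by simp
    have "(z has_real_derivative (y' t / k) / (1 + ((y t - a) / k)\<^sup>2) + k) (at t)"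
      unfolding z_def using k der[OF t] by (auto intro!: derivative_eq_intros simp: field_simps)
    moreover have "(y' t / k) / (1 + ((y t - a) / k)\<^sup>2) + k = (k * y' t + k * ((y t - a)\<^sup>2 + k\<^sup>2)) / (k\<^sup>2 + (y t - a)\<^sup>2)"
    proof -
      have "1 + ((y t - a) / k)\<^sup>2 = (k\<^sup>2 + (y t - a)\<^sup>2) / k\<^sup>2" using k by (simp add: field_simps)
      moreover have "k\<^sup>2 + (y t - a)\<^sup>2 > 0" using k by (intro add_pos_nonneg) auto
      ultimately show ?thesis using k by (simp add: field_simps power2_eq_square)
    qed
    moreover have "\<dots> \<le> 0"
    proof -
      have "y' t + ((y t - a)\<^sup>2 + k\<^sup>2) \<le> 0" using le[OF t] by simp
      then have "k * (y' t + ((y t - a)\<^sup>2 + k\<^sup>2)) \<le> 0" using k by (simp add: mult_nonneg_nonpos)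
      then show ?thesis by (simp add: divide_nonpos_nonneg distrib_left)
    qed
    ultimately show "\<exists>y. (z has_real_derivative y) (at t) \<and> y \<le> 0" by metis
  qed
  moreover have "k * l \<ge> pi" using l k by (simp add: field_simps)
  ultimately show False
    unfolding z_def using arctan_bounded[of "(y l - a) / k"] arctan_bounded[of "(y 0 - a) / k"] by simp
qed

text \<open>The lower bound at time \<open>s\<close> uses the future of \<open>s\<close>, not its
  past; this costs a stretch of length \<open>2 / \<theta>\<close> at the right end.\<close>

lemma riccati_lower_at:
  fixes y y' :: "real \<Rightarrow> real"
  assumes der: "\<And>s. s \<in> {0..T} \<Longrightarrow> (y has_real_derivative y' s) (at s)"
    and le: "\<And>s. s \<in> {0..T} \<Longrightarrow> y' s \<le> - (y s - a)\<^sup>2 + k\<^sup>2"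
    and k: "k \<ge> 0" and th: "\<theta> > 0" and s: "s \<in> {0..T - 2 / \<theta>}"
  shows "y s \<ge> a - k - \<theta>"
proof -
  have "y (0 + s) \<ge> a - k - \<theta>"
  proof (rule riccati_lower[where y="\<lambda>t. y (t + s)" and y'="\<lambda>t. y' (t + s)" and l="2 / \<theta>"])
    fix t assume t: "t \<in> {0..2 / \<theta>}"
    then have ts: "t + s \<in> {0..T}" using s by auto
    show "((\<lambda>t. y (t + s)) has_real_derivative y' (t + s)) (at t)"
      using der[OF ts] DERIV_shift by blast
    show "y' (t + s) \<le> - (y (t + s) - a)\<^sup>2 + k\<^sup>2" by (rule le[OF ts])
  qed (use k th in \<open>auto simp: field_simps\<close>)
  then show ?thesis by simp
qed

lemma growth_lower:
  fixes h :: "real \<Rightarrow> real"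
  assumes "\<And>s. s \<in> {0..T} \<Longrightarrow> (h has_real_derivative h' s) (at s)"
    and "\<And>s. s \<in> {0..T} \<Longrightarrow> h' s \<ge> c" and s: "s \<in> {0..T}"
  shows "h s \<ge> h 0 + c * s"
proof -
  have "h 0 - c * 0 \<le> h s - c * s"
  proof (rule DERIV_nonneg_imp_nondecreasing[where f="\<lambda>s. h s - c * s"])
    fix t assume "0 \<le> t" "t \<le> s"
    then have t: "t \<in> {0..T}" using s by auto
    have "((\<lambda>s. h s - c * s) has_real_derivative h' t - c) (at t)"
      using assms(1)[OF t] by (auto intro!: derivative_eq_intros)
    then show "\<exists>y. ((\<lambda>s. h s - c * s) has_real_derivative y) (at t) \<and> 0 \<le> y"
      using assms(2)[OF t] by (intro exI[of _ "h' t - c"]) auto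
  qed (use s in auto)
  then show ?thesis by simp
qed

text \<open>\<open>e\<close> and \<open>S\<close> depend on the constants only, so that
  \<open>M\<close> may be constructed after them. In the borderline case
  \<open>\<beta> = a - \<kappa>\<close> the equilibrium bound merely prevents
  \<open>M s - \<beta> * s\<close> from dropping by more than 1. That is enough to bound the
  exponential term from below, which lowers \<open>\<kappa>\<close> to some \<open>k1\<close>. The
  improved bound for \<open>y\<close> lies strictly above \<open>\<beta>\<close>, hence
  \<open>M s - \<beta> * s\<close> grows linearly until the exponential term removes all
  equilibria.\<close>

lemma riccati_blowup:
  fixes a \<kappa> \<beta> B m C :: real
  assumes kap: "\<kappa> \<ge> 0" and bet: "\<beta> \<le> a - \<kappa>" and m: "m > 0" and B: "B > 0"
  shows "\<exists>e>0. \<exists>S>0. \<forall>M y y'.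
     (\<forall>s\<in>{0..S}. (M has_real_derivative y s) (at s)) \<longrightarrow>
     (\<forall>s\<in>{0..S}. (y has_real_derivative y' s) (at s)) \<longrightarrow>
     (\<forall>s\<in>{0..S}. y' s \<le> - (y s - a)\<^sup>2 + \<kappa>\<^sup>2 + e - B * exp (m * (M s - \<beta> * s))) \<longrightarrow>
     M 0 \<ge> C \<longrightarrow> False"
proof -
  \<comment> \<open>The size of the exponential term as long as \<open>M s - \<beta> * s\<close> is
    at least \<open>C - 1\<close>.\<close>
  define g0 where "g0 = B * exp (m * (C - 1))"
  have g0: "g0 > 0" using B by (simp add: g0_def)
  define k1 where "k1 = sqrt (\<kappa>\<^sup>2 - g0 / 4)"
  define \<theta> where "\<theta> = (\<kappa> - k1) / 2"
  \<comment> \<open>Growth at rate \<open>\<theta>\<close> from level \<open>C\<close> brings the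
    exponential term to \<open>\<kappa>\<^sup>2 + 2\<close> by this time.\<close>
  define s2 where "s2 = max 0 ((ln ((\<kappa>\<^sup>2 + 2) / B) / m - C) / \<theta>)"
  \<comment> \<open>One length for both cases below: the life span when
    \<open>\<kappa>\<^sup>2\<close> is at most \<open>g0 / 4\<close>, and otherwise
    \<open>s2\<close>, plus pi for the final blow-down, plus the \<open>2 / \<theta>\<close> lost in
    \<open>riccati_lower_at\<close>.\<close>
  define X where "X = max (pi / sqrt (g0 / 4)) (pi + 2 / \<theta> + s2)"
  \<comment> \<open>The perturbation is \<open>e = d\<^sup>2\<close>. A drift of
    \<open>- 2 * d\<close> during \<open>T1 = 1 / (2 * d)\<close> costs exactly 1; the last entry
    makes \<open>T1\<close> at least \<open>X\<close>, and \<open>d \<le> g0 / 2\<close> lets half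
    of \<open>g0\<close> absorb \<open>e\<close>.\<close>
  define d where "d = min 1 (min (g0 / 2) (1 / (2 * (\<bar>X\<bar> + 1))))"
  have d: "d > 0" "d \<le> 1" "d \<le> g0 / 2" "d \<le> 1 / (2 * (\<bar>X\<bar> + 1))" using g0 by (auto simp: d_def)
  have d2: "d\<^sup>2 \<le> d" using d by (simp add: power2_eq_square mult_left_le)
  define T1 where "T1 = 1 / (2 * d)"
  have T1: "T1 \<ge> X" "T1 > 0"
  proof -
    have "\<bar>X\<bar> + 1 \<le> T1" using d(1,4) unfolding T1_def by (simp add: field_simps)
    then show "T1 \<ge> X" "T1 > 0" by linarith+
  qed
  define S where "S = T1 + 2 / d"
  have S: "S > 0" using T1 d by (simp add: S_def add_pos_pos)
  have False if M: "\<forall>s\<in>{0..S}. (M has_real_derivative y s) (at s)"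
    and y: "\<forall>s\<in>{0..S}. (y has_real_derivative y' s) (at s)"
    and le: "\<forall>s\<in>{0..S}. y' s \<le> - (y s - a)\<^sup>2 + \<kappa>\<^sup>2 + d\<^sup>2 - B * exp (m * (M s - \<beta> * s))"
    and M0: "M 0 \<ge> C" for M y y'
  proof -
    define h where "h s = M s - \<beta> * s" for s
    have dh: "(h has_real_derivative y s - \<beta>) (at s)" if "s \<in> {0..S}" for s
      unfolding h_def using M that by (auto intro!: derivative_eq_intros)
    have T1S: "T1 \<le> S" using d by (simp add: S_def)
    have A: "y s \<ge> a - (\<kappa> + d) - d" if "s \<in> {0..T1}" for s
    proof (rule riccati_lower_at[where T=S and y=y and y'=y'])
      fix s assume s: "s \<in> {0..S}"
      show "(y has_real_derivative y' s) (at s)" using y s by blast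
      have "\<kappa>\<^sup>2 + d\<^sup>2 \<le> (\<kappa> + d)\<^sup>2" using kap d by (simp add: power2_eq_square algebra_simps)
      moreover have "B * exp (m * (M s - \<beta> * s)) > 0" using B by simp
      ultimately show "y' s \<le> - (y s - a)\<^sup>2 + (\<kappa> + d)\<^sup>2" using le s by (smt (verit))
    qed (use that kap d in \<open>auto simp: S_def\<close>)
    have hC: "h s \<ge> C - 1" if s: "s \<in> {0..T1}" for s
    proof -
      have "h s \<ge> h 0 + (- 2 * d) * s"
        by (rule growth_lower[where T=T1 and h'="\<lambda>s. y s - \<beta>"]) (use A bet dh T1S s in force)+
      moreover have "2 * d * s \<le> 1" using s d by (simp add: T1_def field_simps)
      ultimately show ?thesis using M0 by (simp add: h_def)
    qed
    have B1: "y' s \<le> - (y s - a)\<^sup>2 + \<kappa>\<^sup>2 - g0 / 2" if s: "s \<in> {0..T1}" for s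
    proof -
      have "g0 \<le> B * exp (m * (M s - \<beta> * s))"
        unfolding g0_def using B m hC[OF s] by (simp add: h_def)
      moreover have "s \<in> {0..S}" using s T1S by auto
      ultimately show ?thesis using le d2 d(3) by (smt (verit) field_sum_of_halves)
    qed
    \<comment> \<open>After absorbing \<open>e\<close>, half of \<open>g0\<close> is left. Either
      \<open>\<kappa>\<^sup>2 - g0 / 2\<close> is at most \<open>- g0 / 4\<close>, and no
      equilibrium remains, or \<open>k1\<close> is a real number strictly below
      \<open>\<kappa>\<close>.\<close>
    show False
    proof (cases "\<kappa>\<^sup>2 \<le> g0 / 4")
      case True
      show False
      proof (rule riccati_blowdown[where y=y and l=T1 and a=a and k="sqrt (g0/4)"])
        show "y' s \<le> - (y s - a)\<^sup>2 - (sqrt (g0/4))\<^sup>2" if "s \<in> {0..T1}" for s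
          using B1[OF that] True g0 by simp
        show "pi / sqrt (g0 / 4) \<le> T1" using T1 by (simp add: X_def)
      qed (use y T1S g0 in auto)
    next
      case False
      have k1: "k1 \<ge> 0" "k1\<^sup>2 = \<kappa>\<^sup>2 - g0 / 4" using False by (auto simp: k1_def)
      have "k1\<^sup>2 < \<kappa>\<^sup>2" using k1 g0 by simp
      then have "k1 < \<kappa>" using kap power2_less_imp_less by blast
      then have th: "\<theta> > 0" by (simp add: \<theta>_def)
      define T2 where "T2 = T1 - 2 / \<theta>"
      have T2: "T2 \<ge> s2 + pi" "T2 \<le> T1" using T1 th unfolding T2_def X_def by auto
      have s2: "s2 \<ge> 0" by (simp add: s2_def)
      have yB: "y s \<ge> a - k1 - \<theta>" if "s \<in> {0..T2}" for s
      proof (rule riccati_lower_at[where T=T1 and y=y and y'=y'])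
        fix s assume s: "s \<in> {0..T1}"
        show "y' s \<le> - (y s - a)\<^sup>2 + k1\<^sup>2" using B1[OF s] k1 g0 by simp
      qed (use that k1 th y T1S in \<open>auto simp: T2_def\<close>)
      have hB: "h s \<ge> C + \<theta> * s" if s: "s \<in> {0..T2}" for s
      proof -
        have "h s \<ge> h 0 + \<theta> * s"
        proof (rule growth_lower[where T=T2 and h'="\<lambda>s. y s - \<beta>"])
          show "y s - \<beta> \<ge> \<theta>" if "s \<in> {0..T2}" for s
            using yB[OF that] bet by (simp add: \<theta>_def field_simps)
        qed (use s dh T1S T2 in auto)
        then show ?thesis using M0 by (simp add: h_def)
      qed
      have large: "B * exp (m * (M s - \<beta> * s)) \<ge> \<kappa>\<^sup>2 + 2" if s: "s \<in> {s2..T2}" for s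
      proof -
        have "(ln ((\<kappa>\<^sup>2 + 2) / B) / m - C) / \<theta> \<le> s" using s by (simp add: s2_def)
        then have "ln ((\<kappa>\<^sup>2 + 2) / B) / m - C \<le> \<theta> * s" using th by (simp add: field_simps)
        then have "ln ((\<kappa>\<^sup>2 + 2) / B) / m \<le> h s" using hB[of s] s s2 by auto
        then have "ln ((\<kappa>\<^sup>2 + 2) / B) \<le> m * h s" using m by (simp add: field_simps)
        then have "exp (ln ((\<kappa>\<^sup>2 + 2) / B)) \<le> exp (m * h s)" by simp
        moreover have "(\<kappa>\<^sup>2 + 2) / B > 0" using B by (simp add: add_nonneg_pos)
        ultimately have "(\<kappa>\<^sup>2 + 2) / B \<le> exp (m * h s)" by simp
        then show ?thesis using B by (simp add: h_def field_simps)
      qed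
      show False
      proof (rule riccati_blowdown[where y="\<lambda>t. y (t + s2)" and y'="\<lambda>t. y' (t + s2)" and l=pi and a=a and k=1])
        fix t :: real assume t: "t \<in> {0..pi}"
        have ts: "t + s2 \<in> {s2..T2}" "t + s2 \<in> {0..S}" using t T2 s2 T1S by auto
        show "((\<lambda>t. y (t + s2)) has_real_derivative y' (t + s2)) (at t)"
          using y ts DERIV_shift by blast
        have "y' (t + s2) \<le> - (y (t + s2) - a)\<^sup>2 + \<kappa>\<^sup>2 + d\<^sup>2 - B * exp (m * (M (t + s2) - \<beta> * (t + s2)))"
          using le ts(2) by blast
        then show "y' (t + s2) \<le> - (y (t + s2) - a)\<^sup>2 - 1\<^sup>2"
          using large[OF ts(1)] d2 d by simp
      qed auto
    qed
  qed
  then show ?thesis using d(1) S by (intro exI[of _ "d\<^sup>2"] conjI exI[of _ S]) auto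
qed

section \<open>Polar coordinates and homogeneous functions\<close>

lemma sgn_sgn_eq: "sgn (sgn x) = sgn (x::'a::real_normed_vector)"
  by (cases "x = 0") (simp_all add: sgn_div_norm[of "sgn x"] norm_sgn)

text \<open>Polar coordinates without a surface measure: over the unit ball, a function of
  \<open>sgn x\<close> integrates to \<open>1 / N\<close> times its spherical integral,
  \<open>N\<close> being the dimension. The shift of \<open>\<tau>\<close> by
  \<open>ln (norm x)\<close> turns the argument of \<open>H\<close> into a multiple of
  \<open>x\<close> itself; after a dilation, \<open>exp (- N \<sigma>)\<close> is integrated over
  \<open>\<sigma> > ln (norm x)\<close>.\<close>

lemma polar_ball:
  fixes H :: "'a::euclidean_space \<Rightarrow> ennreal"
  assumes H[measurable]: "H \<in> borel_measurable borel"
  shows "(\<integral>\<^sup>+\<tau>. \<integral>\<^sup>+x. ennreal (exp (DIM('a) * \<tau>)) * indicator (ball 0 1) x * H (exp \<tau> *\<^sub>R sgn x) \<partial>lborel \<partial>lborel)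
    = ennreal (1 / DIM('a)) * (\<integral>\<^sup>+x. H x \<partial>lborel)"
proof -
  let ?N = "DIM('a)"
  have N: "?N > 0" by simp
  have [measurable]: "(\<lambda>x::'a. indicator (ball 0 1) x :: ennreal) \<in> borel_measurable borel"
    by (intro borel_measurable_indicator) auto
  define k where "k \<sigma> x = ennreal (exp (?N * \<sigma>) * norm x ^ ?N) * indicator (ball 0 1) x * H (exp \<sigma> *\<^sub>R x)" for \<sigma> :: real and x :: 'a
  define m where "m \<sigma> x = ennreal (exp (- (?N * \<sigma>)) * norm x ^ ?N) * (if ln (norm x) < \<sigma> then 1 else 0) * H x" for \<sigma> :: real and x :: 'a
  have "(\<integral>\<^sup>+\<tau>. \<integral>\<^sup>+x. ennreal (exp (?N * \<tau>)) * indicator (ball 0 1) x * H (exp \<tau> *\<^sub>R sgn x) \<partial>lborel \<partial>lborel)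
      = (\<integral>\<^sup>+x. \<integral>\<^sup>+\<tau>. ennreal (exp (?N * \<tau>)) * indicator (ball 0 1) x * H (exp \<tau> *\<^sub>R sgn x) \<partial>lborel \<partial>lborel)"
    by (rule lborel_pair.Fubini') measurable
  also have "\<dots> = (\<integral>\<^sup>+x. \<integral>\<^sup>+\<sigma>. k \<sigma> x \<partial>lborel \<partial>lborel)"
  proof (rule nn_integral_cong_AE, rule AE_mp[OF AE_lborel_singleton[of "0::'a"]], rule AE_I2, rule impI)
    fix x :: 'a assume x: "x \<noteq> 0"
    have "(\<integral>\<^sup>+\<tau>. ennreal (exp (?N * \<tau>)) * indicator (ball 0 1) x * H (exp \<tau> *\<^sub>R sgn x) \<partial>lborel)
      = (\<integral>\<^sup>+\<tau>. ennreal (exp (?N * (\<tau> + ln (norm x)))) * indicator (ball 0 1) x * H (exp (\<tau> + ln (norm x)) *\<^sub>R sgn x) \<partial>lborel)"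
      by (rule lborel_nn_integral_translation[symmetric]) measurable
    also have "\<dots> = (\<integral>\<^sup>+\<sigma>. k \<sigma> x \<partial>lborel)"
    proof (rule nn_integral_cong)
      fix \<sigma> :: real
      have "exp (?N * (\<sigma> + ln (norm x))) = exp (?N * \<sigma>) * norm x ^ ?N"
        using x by (simp add: distrib_left exp_add exp_of_nat_mult)
      moreover have "exp (\<sigma> + ln (norm x)) *\<^sub>R sgn x = exp \<sigma> *\<^sub>R x"
        using x by (simp add: exp_add sgn_div_norm)
      ultimately show "ennreal (exp (?N * (\<sigma> + ln (norm x)))) * indicator (ball 0 1) x * H (exp (\<sigma> + ln (norm x)) *\<^sub>R sgn x) = k \<sigma> x"
        by (simp add: k_def)
    qed
    finally show "(\<integral>\<^sup>+\<tau>. ennreal (exp (?N * \<tau>)) * indicator (ball 0 1) x * H (exp \<tau> *\<^sub>R sgn x) \<partial>lborel) = (\<integral>\<^sup>+\<sigma>. k \<sigma> x \<partial>lborel)" .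
  qed
  also have "\<dots> = (\<integral>\<^sup>+\<sigma>. \<integral>\<^sup>+x. k \<sigma> x \<partial>lborel \<partial>lborel)"
    unfolding k_def by (rule lborel_pair.Fubini') measurable
  also have "\<dots> = (\<integral>\<^sup>+\<sigma>. \<integral>\<^sup>+x. m \<sigma> x \<partial>lborel \<partial>lborel)"
  proof (rule nn_integral_cong)
    fix \<sigma> :: real
    have [measurable]: "m \<sigma> \<in> borel_measurable borel" unfolding m_def by measurable
    have mk: "ennreal (exp \<sigma> ^ ?N) * m \<sigma> (exp \<sigma> *\<^sub>R x) = k \<sigma> x" for x
    proof (cases "x = 0")
      case False
      have i: "(if ln (norm (exp \<sigma> *\<^sub>R x)) < \<sigma> then 1 else 0) = (indicator (ball 0 1) x :: ennreal)"
        using False by (auto simp: indicator_def ln_mult ln_less_zero_iff)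
      have "ennreal (exp \<sigma> ^ ?N) * ennreal (exp (- (?N * \<sigma>)) * norm (exp \<sigma> *\<^sub>R x) ^ ?N) = ennreal (exp (?N * \<sigma>) * norm x ^ ?N)"
        by (subst ennreal_mult[symmetric]) (auto simp: exp_minus exp_of_nat_mult exp_of_nat2_mult power_mult_distrib field_simps)
      then show ?thesis unfolding m_def k_def i by (simp add: mult.assoc[symmetric])
    qed (auto simp: m_def k_def power_0_left)
    have "(\<integral>\<^sup>+x. m \<sigma> x \<partial>lborel) = (\<integral>\<^sup>+x. ennreal (exp \<sigma> ^ ?N) * m \<sigma> (exp \<sigma> *\<^sub>R x) \<partial>lborel)"
      by (subst lborel_nn_integral_scale[where c="exp \<sigma>"]) (auto simp: nn_integral_cmult)
    then show "(\<integral>\<^sup>+x. k \<sigma> x \<partial>lborel) = (\<integral>\<^sup>+x. m \<sigma> x \<partial>lborel)" by (simp add: mk)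
  qed
  also have "\<dots> = (\<integral>\<^sup>+x. \<integral>\<^sup>+\<sigma>. m \<sigma> x \<partial>lborel \<partial>lborel)"
    unfolding m_def by (rule lborel_pair.Fubini') measurable
  also have "\<dots> = (\<integral>\<^sup>+x. ennreal (1 / ?N) * H x \<partial>lborel)"
  proof (rule nn_integral_cong_AE, rule AE_mp[OF AE_lborel_singleton[of "0::'a"]], rule AE_I2, rule impI)
    fix x :: 'a assume x: "x \<noteq> 0"
    have "(\<integral>\<^sup>+\<sigma>. m \<sigma> x \<partial>lborel) = (\<integral>\<^sup>+\<sigma>. ennreal (norm x ^ ?N) * H x * (ennreal (exp (- (?N * \<sigma>))) * indicator {ln (norm x)..} \<sigma>) \<partial>lborel)"
    proof (rule nn_integral_cong_AE, rule AE_mp[OF AE_lborel_singleton[of "ln (norm x)"]], rule AE_I2, rule impI)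
      fix \<sigma> assume "\<sigma> \<noteq> ln (norm x)"
      then have i: "(if ln (norm x) < \<sigma> then 1 else 0) = (indicator {ln (norm x)..} \<sigma> :: ennreal)"
        by (auto simp: indicator_def)
      show "m \<sigma> x = ennreal (norm x ^ ?N) * H x * (ennreal (exp (- (?N * \<sigma>))) * indicator {ln (norm x)..} \<sigma>)"
        unfolding m_def i by (simp add: ennreal_mult mult_ac)
    qed
    also have "\<dots> = ennreal (norm x ^ ?N) * H x * (\<integral>\<^sup>+\<sigma>. ennreal (exp (- (?N * \<sigma>))) * indicator {ln (norm x)..} \<sigma> \<partial>lborel)"
      by (rule nn_integral_cmult) measurable
    also have "(\<integral>\<^sup>+\<sigma>. ennreal (exp (- (?N * \<sigma>))) * indicator {ln (norm x)..} \<sigma> \<partial>lborel)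
      = ennreal (0 - (- exp (- (?N * ln (norm x))) / ?N))"
    proof (rule nn_integral_FTC_atLeast)
      show "((\<lambda>\<sigma>. - exp (- (?N * \<sigma>)) / ?N) has_real_derivative exp (- (?N * \<sigma>))) (at \<sigma>)" for \<sigma> :: real
        by (auto intro!: derivative_eq_intros)
      have "((\<lambda>\<sigma>::real. exp (- (?N * \<sigma>))) \<longlongrightarrow> 0) at_top"
      proof -
        have "filterlim (\<lambda>\<sigma>::real. ?N * \<sigma>) at_top at_top"
          using N by (intro filterlim_tendsto_pos_mult_at_top[OF tendsto_const]) (auto simp: filterlim_ident)
        then have "filterlim (\<lambda>\<sigma>::real. - (?N * \<sigma>)) at_bot at_top" by (simp add: filterlim_uminus_at_bot)
        then show ?thesis using exp_at_bot filterlim_compose by blast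
      qed
      then have "((\<lambda>\<sigma>::real. - exp (- (?N * \<sigma>)) / ?N) \<longlongrightarrow> - 0 / ?N) at_top"
        by (intro tendsto_intros) auto
      then show "((\<lambda>\<sigma>::real. - exp (- (?N * \<sigma>)) / ?N) \<longlongrightarrow> 0) at_top" by simp
    qed auto
    also have "0 - (- exp (- (?N * ln (norm x))) / ?N) = (1 / ?N) / norm x ^ ?N"
      using x by (simp add: exp_minus exp_of_nat_mult field_simps)
    also have "ennreal (norm x ^ ?N) * H x * ennreal ((1 / ?N) / norm x ^ ?N) = ennreal (1 / ?N) * H x"
    proof -
      have "ennreal (norm x ^ ?N) * ennreal ((1 / ?N) / norm x ^ ?N) = ennreal (1 / ?N)"
        using x by (subst ennreal_mult[symmetric]) auto
      then show ?thesis by (metis mult.assoc mult.commute)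
    qed
    finally show "(\<integral>\<^sup>+\<sigma>. m \<sigma> x \<partial>lborel) = ennreal (1 / ?N) * H x" .
  qed
  also have "\<dots> = ennreal (1 / ?N) * (\<integral>\<^sup>+x. H x \<partial>lborel)"
    by (rule nn_integral_cmult) simp
  finally show ?thesis .
qed

text \<open>For \<open>H\<close> constant along rays the inner integral of \<open>polar_ball\<close>
  no longer depends on \<open>\<tau>\<close> except through scalar factors, so radial and angular
  integrals separate.\<close>

lemma radial_times_homogeneous:
  fixes H :: "'a::euclidean_space \<Rightarrow> ennreal"
  assumes H[measurable]: "H \<in> borel_measurable borel" and \<kappa>[measurable]: "\<kappa> \<in> borel_measurable borel"
    and hom: "\<And>x. x \<noteq> 0 \<Longrightarrow> H (sgn x) = H x"
  shows "(\<integral>\<^sup>+x. \<kappa> (norm x) * H x \<partial>lborel)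
     = ennreal (DIM('a)) * (\<integral>\<^sup>+\<tau>. ennreal (exp (DIM('a) * \<tau>)) * \<kappa> (exp \<tau>) \<partial>lborel) * (\<integral>\<^sup>+x. indicator (ball 0 1) x * H x \<partial>lborel)"
proof -
  let ?N = "DIM('a)"
  have [measurable]: "(\<lambda>x::'a. indicator (ball 0 1) x :: ennreal) \<in> borel_measurable borel"
    by (intro borel_measurable_indicator) auto
  let ?J = "\<integral>\<^sup>+x. indicator (ball 0 1) x * H x \<partial>lborel"
  have "ennreal (1 / ?N) * (\<integral>\<^sup>+x. \<kappa> (norm x) * H x \<partial>lborel)
     = (\<integral>\<^sup>+\<tau>. \<integral>\<^sup>+x. ennreal (exp (?N * \<tau>)) * indicator (ball 0 1) x * (\<kappa> (norm (exp \<tau> *\<^sub>R sgn x)) * H (exp \<tau> *\<^sub>R sgn x)) \<partial>lborel \<partial>lborel)"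
    by (rule polar_ball[symmetric]) measurable
  also have "\<dots> = (\<integral>\<^sup>+\<tau>. (ennreal (exp (?N * \<tau>)) * \<kappa> (exp \<tau>)) * ?J \<partial>lborel)"
  proof (rule nn_integral_cong)
    fix \<tau> :: real
    have "(\<integral>\<^sup>+x. ennreal (exp (?N * \<tau>)) * indicator (ball 0 1) x * (\<kappa> (norm (exp \<tau> *\<^sub>R sgn x)) * H (exp \<tau> *\<^sub>R sgn x)) \<partial>lborel)
      = (\<integral>\<^sup>+x. (ennreal (exp (?N * \<tau>)) * \<kappa> (exp \<tau>)) * (indicator (ball 0 1) x * H x) \<partial>lborel)"
    proof (rule nn_integral_cong_AE, rule AE_mp[OF AE_lborel_singleton[of "0::'a"]], rule AE_I2, rule impI)
      fix x :: 'a assume x: "x \<noteq> 0"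
      have "H (exp \<tau> *\<^sub>R sgn x) = H (sgn (exp \<tau> *\<^sub>R sgn x))" using x by (subst hom) (auto simp: sgn_zero_iff)
      also have "\<dots> = H x" using x by (simp add: sgn_scaleR sgn_sgn_eq hom)
      finally show "ennreal (exp (?N * \<tau>)) * indicator (ball 0 1) x * (\<kappa> (norm (exp \<tau> *\<^sub>R sgn x)) * H (exp \<tau> *\<^sub>R sgn x))
        = (ennreal (exp (?N * \<tau>)) * \<kappa> (exp \<tau>)) * (indicator (ball 0 1) x * H x)"
        using x by (simp add: norm_sgn mult_ac)
    qed
    also have "\<dots> = (ennreal (exp (?N * \<tau>)) * \<kappa> (exp \<tau>)) * ?J"
      by (rule nn_integral_cmult) measurable
    finally show "(\<integral>\<^sup>+x. ennreal (exp (?N * \<tau>)) * indicator (ball 0 1) x * (\<kappa> (norm (exp \<tau> *\<^sub>R sgn x)) * H (exp \<tau> *\<^sub>R sgn x)) \<partial>lborel)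
      = (ennreal (exp (?N * \<tau>)) * \<kappa> (exp \<tau>)) * ?J" .
  qed
  also have "\<dots> = (\<integral>\<^sup>+\<tau>. ennreal (exp (?N * \<tau>)) * \<kappa> (exp \<tau>) \<partial>lborel) * ?J"
    by (rule nn_integral_multc) measurable
  finally have eq: "ennreal (1 / ?N) * (\<integral>\<^sup>+x. \<kappa> (norm x) * H x \<partial>lborel) = (\<integral>\<^sup>+\<tau>. ennreal (exp (?N * \<tau>)) * \<kappa> (exp \<tau>) \<partial>lborel) * ?J" .
  have "ennreal ?N * ennreal (1 / ?N) = 1"
    by (subst ennreal_mult[symmetric]) auto
  then have "(\<integral>\<^sup>+x. \<kappa> (norm x) * H x \<partial>lborel) = ennreal ?N * (ennreal (1 / ?N) * (\<integral>\<^sup>+x. \<kappa> (norm x) * H x \<partial>lborel))"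
    by (simp add: mult.assoc[symmetric])
  then show ?thesis unfolding eq by (simp add: mult.assoc)
qed

section \<open>Homogeneous functions of degree zero and their angular energy\<close>

lemma has_derivative_sgn:
  fixes x :: "'a::euclidean_space"
  assumes x: "x \<noteq> 0"
  shows "(sgn has_derivative (\<lambda>h. (h - (sgn x \<bullet> h) *\<^sub>R sgn x) /\<^sub>R norm x)) (at x)"
proof -
  have "((\<lambda>x::'a. inverse (norm x) *\<^sub>R x) has_derivative
     (\<lambda>h. inverse (norm x) *\<^sub>R h + (- (inverse (norm x) * (sgn x \<bullet> h) * inverse (norm x))) *\<^sub>R x)) (at x)"
    using x by (auto intro!: derivative_eq_intros has_derivative_norm simp: inner_commute)
  moreover have "inverse (norm x) *\<^sub>R h + (- (inverse (norm x) * (sgn x \<bullet> h) * inverse (norm x))) *\<^sub>R x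
     = (h - (sgn x \<bullet> h) *\<^sub>R sgn x) /\<^sub>R norm x" for h
    by (simp add: sgn_div_norm algebra_simps)
  ultimately show ?thesis by (simp add: sgn_div_norm[abs_def])
qed

text \<open>Equals |x|^2 times the square of the tangential part of g, that is, the squared spherical gradient.\<close>
definition angular_sq :: "('a::euclidean_space \<Rightarrow> 'a) \<Rightarrow> 'a \<Rightarrow> real" where
  "angular_sq g x = (norm x)\<^sup>2 * (norm (g x))\<^sup>2 - (x \<bullet> g x)\<^sup>2"

text \<open>Functions on the sphere with zero boundary values, represented by extensions constant
  along rays. The class is C^1 rather than smooth because it has to contain the spherical slices of
  functions cut off by C^1 functions of \<open>ln v\<close>. The compact set of directions is the
  Dirichlet condition.\<close>

definition hom_adm :: "'a::euclidean_space set \<Rightarrow> ('a \<Rightarrow> real) \<Rightarrow> ('a \<Rightarrow> 'a) \<Rightarrow> bool" where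
  "hom_adm \<Sigma> \<psi> g \<longleftrightarrow> has_grad \<psi> g (- {0}) \<and> (\<forall>x. \<psi> (sgn x) = \<psi> x) \<and>
     (\<exists>K. compact K \<and> K \<subseteq> \<Sigma> \<and> (\<forall>x. sgn x \<notin> K \<longrightarrow> \<psi> x = 0))"

text \<open>Valued in \<open>ennreal\<close>, so that the Poincare inequality can be stated without
  integrability; finiteness for admissible functions is part of
  \<open>radial_ratios\<close>.\<close>

definition ball_integral :: "('a::euclidean_space \<Rightarrow> real) \<Rightarrow> ennreal" where
  "ball_integral H = (\<integral>\<^sup>+x. indicator (ball 0 1) x * ennreal (H x) \<partial>lborel)"

text \<open>A lower bound lam for the first Dirichlet eigenvalue of Sigma, tested on 0-homogeneous extensions
  as in the definition of lambda1.\<close>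
definition angular_poincare :: "'a::euclidean_space set \<Rightarrow> real \<Rightarrow> bool" where
  "angular_poincare \<Sigma> lam \<longleftrightarrow> (\<forall>\<psi> g. hom_adm \<Sigma> \<psi> g \<longrightarrow>
     ennreal lam * ball_integral (\<lambda>x. (\<psi> x)\<^sup>2) \<le> ball_integral (\<lambda>x. (norm x)\<^sup>2 * (norm (g x))\<^sup>2))"

lemma angular_sq_nonneg: "angular_sq g x \<ge> 0"
  using Cauchy_Schwarz_ineq[of x "g x"] by (simp add: angular_sq_def power2_norm_eq_inner)

lemma C0c_angular_sq: "C0c g \<Longrightarrow> C0c (angular_sq g)"
  unfolding angular_sq_def[abs_def] by (intro C0c_intros continuous_intros)

lemma measurable_punctured:
  fixes f :: "'a::euclidean_space \<Rightarrow> 'b::euclidean_space"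
  assumes "continuous_on (- {0}) f" shows "f \<in> borel_measurable borel"
proof -
  have "f \<in> borel_measurable borel \<longleftrightarrow> (\<lambda>x. if x \<in> - {0} then f x else f 0) \<in> borel_measurable borel"
    by (intro measurable_cong) auto
  also have "\<dots>"
    by (rule borel_measurable_continuous_on_if) (use assms in auto)
  finally show ?thesis .
qed

lemma cone_of_eq:
  assumes "\<Sigma> \<subseteq> sphere 0 1"
  shows "cone_of \<Sigma> = {x. x \<noteq> 0 \<and> sgn x \<in> \<Sigma>}"
proof (intro set_eqI iffI)
  fix x assume "x \<in> cone_of \<Sigma>"
  then obtain r s where x: "x = r *\<^sub>R s" "r > 0" "s \<in> \<Sigma>" by (auto simp: cone_of_def)
  then have "norm s = 1" using assms by auto
  then show "x \<in> {x. x \<noteq> 0 \<and> sgn x \<in> \<Sigma>}" using x by (auto simp: sgn_scaleR sgn_div_norm)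
next
  fix x assume "x \<in> {x. x \<noteq> 0 \<and> sgn x \<in> \<Sigma>}"
  moreover from this have "x = norm x *\<^sub>R sgn x" by (simp add: sgn_div_norm)
  ultimately show "x \<in> cone_of \<Sigma>" unfolding cone_of_def by (metis (mono_tags, lifting) mem_Collect_eq zero_less_norm_iff)
qed

lemma continuous_on_sgn: "continuous_on (- {0}) (sgn :: 'a::euclidean_space \<Rightarrow> 'a)"
  by (intro continuous_intros) auto

text \<open>The restriction of \<open>h\<close> to the sphere of radius \<open>exp \<tau>\<close>,
  spread along rays. The derivative of \<open>sgn\<close> projects the gradient onto the tangent
  space of the sphere.\<close>

lemma hom_adm_slice:
  assumes h: "C1c (cone_of \<Sigma>) h g" and S: "\<Sigma> \<subseteq> sphere 0 1"
  shows "hom_adm \<Sigma> (\<lambda>x. h (exp \<tau> *\<^sub>R sgn x))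
     (\<lambda>x. (exp \<tau> / norm x) *\<^sub>R (g (exp \<tau> *\<^sub>R sgn x) - (sgn x \<bullet> g (exp \<tau> *\<^sub>R sgn x)) *\<^sub>R sgn x))"
proof -
  obtain K where K: "compact K" "K \<subseteq> cone_of \<Sigma>" "\<And>x. x \<notin> K \<Longrightarrow> h x = 0" "has_grad h g UNIV"
    using C1cE[OF h] by metis
  have K0: "K \<subseteq> - {0}" using K(2) by (auto simp: cone_of_eq[OF S])
  have "compact (sgn ` K)"
    using K K0 by (intro compact_continuous_image continuous_on_subset[OF continuous_on_sgn]) auto
  moreover have "sgn ` K \<subseteq> \<Sigma>" using K(2) by (auto simp: cone_of_eq[OF S])
  moreover have "h (exp \<tau> *\<^sub>R sgn x) = 0" if "sgn x \<notin> sgn ` K" for x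
  proof (rule K(3))
    show "exp \<tau> *\<^sub>R sgn x \<notin> K"
    proof
      assume "exp \<tau> *\<^sub>R sgn x \<in> K"
      then have "sgn (exp \<tau> *\<^sub>R sgn x) \<in> sgn ` K" by blast
      then show False using that by (simp add: sgn_scaleR sgn_sgn_eq)
    qed
  qed
  moreover have "has_grad (\<lambda>x. h (exp \<tau> *\<^sub>R sgn x))
     (\<lambda>x. (exp \<tau> / norm x) *\<^sub>R (g (exp \<tau> *\<^sub>R sgn x) - (sgn x \<bullet> g (exp \<tau> *\<^sub>R sgn x)) *\<^sub>R sgn x)) (- {0})"
    unfolding has_grad_def
  proof (intro conjI ballI)
    fix x :: 'a assume "x \<in> - {0}"
    then have x: "x \<noteq> 0" by simp
    have "((\<lambda>x. exp \<tau> *\<^sub>R sgn x) has_derivative (\<lambda>h. exp \<tau> *\<^sub>R ((h - (sgn x \<bullet> h) *\<^sub>R sgn x) /\<^sub>R norm x))) (at x)"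
      by (intro has_derivative_scaleR_right has_derivative_sgn x)
    from has_derivative_compose[OF this has_gradD[OF K(4) UNIV_I]]
    show "((\<lambda>x. h (exp \<tau> *\<^sub>R sgn x)) has_derivative
         (\<bullet>) ((exp \<tau> / norm x) *\<^sub>R (g (exp \<tau> *\<^sub>R sgn x) - (sgn x \<bullet> g (exp \<tau> *\<^sub>R sgn x)) *\<^sub>R sgn x))) (at x)"
      by (rule has_derivative_eq_rhs)
         (auto simp: fun_eq_iff inner_diff_left inner_diff_right divide_inverse algebra_simps inner_commute)
  next
    have "continuous_on (- {0}) (\<lambda>x::'a. g (exp \<tau> *\<^sub>R sgn x))"
      by (intro continuous_on_compose2[OF has_grad_continuous_grad[OF K(4)]] continuous_intros continuous_on_sgn) auto
    then show "continuous_on (- {0}) (\<lambda>x. (exp \<tau> / norm x) *\<^sub>R (g (exp \<tau> *\<^sub>R sgn x) - (sgn x \<bullet> g (exp \<tau> *\<^sub>R sgn x)) *\<^sub>R sgn x))"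
      by (intro continuous_intros continuous_on_sgn) auto
  qed
  ultimately show ?thesis unfolding hom_adm_def by (auto simp: sgn_sgn_eq intro!: exI[of _ "sgn ` K"])
qed

text \<open>The inequality holds for the slice at each radius \<open>exp \<tau>\<close>; weighted by
  \<open>exp (N \<tau>)\<close> and integrated over \<open>\<tau>\<close>, the slices make up the
  cone by \<open>polar_ball\<close>. Both sides carry the same radial weight since
  \<open>angular_sq\<close> already contains the factor \<open>norm x\<close> squared.\<close>

lemma angular_poincare_cone:
  assumes ap: "angular_poincare \<Sigma> lam" and lam: "lam \<ge> 0" and S: "\<Sigma> \<subseteq> sphere 0 1" and h: "C1c (cone_of \<Sigma>) h g"
  shows "lam * (LBINT x. (h x)\<^sup>2) \<le> (LBINT x. angular_sq g x)"
proof -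
  let ?N = "DIM('a)"
  note ccs = C1c_C0c[OF h]
  have [measurable]: "(\<lambda>x::'a. indicator (ball 0 1) x :: ennreal) \<in> borel_measurable borel"
    by (intro borel_measurable_indicator) auto
  have [measurable]: "h \<in> borel_measurable borel" "angular_sq g \<in> borel_measurable borel" "g \<in> borel_measurable borel"
    using ccs C0c_angular_sq C0c_measurable by blast+
  have slice: "ennreal lam * (\<integral>\<^sup>+x. ennreal (exp (?N * \<tau>)) * indicator (ball 0 1) x * ennreal ((h (exp \<tau> *\<^sub>R sgn x))\<^sup>2) \<partial>lborel)
     \<le> (\<integral>\<^sup>+x. ennreal (exp (?N * \<tau>)) * indicator (ball 0 1) x * ennreal (angular_sq g (exp \<tau> *\<^sub>R sgn x)) \<partial>lborel)" for \<tau> :: real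
  proof -
    have eq: "(norm x)\<^sup>2 * (norm ((exp \<tau> / norm x) *\<^sub>R (g (exp \<tau> *\<^sub>R sgn x) - (sgn x \<bullet> g (exp \<tau> *\<^sub>R sgn x)) *\<^sub>R sgn x)))\<^sup>2
       = angular_sq g (exp \<tau> *\<^sub>R sgn x)" if "x \<noteq> 0" for x
    proof -
      define G where "G = g (exp \<tau> *\<^sub>R sgn x)"
      define s where "s = sgn x"
      have s: "s \<bullet> s = 1" using that by (simp add: s_def dot_square_norm norm_sgn)
      have "(norm (G - (s \<bullet> G) *\<^sub>R s))\<^sup>2 = G \<bullet> G - (s \<bullet> G)\<^sup>2"
        unfolding power2_norm_eq_inner by (simp add: inner_diff_left inner_diff_right s power2_eq_square inner_commute)
      then have "(norm x)\<^sup>2 * (norm ((exp \<tau> / norm x) *\<^sub>R (G - (s \<bullet> G) *\<^sub>R s)))\<^sup>2 = (exp \<tau>)\<^sup>2 * (G \<bullet> G - (s \<bullet> G)\<^sup>2)"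
        using that by (simp add: power_mult_distrib power_divide)
      also have "\<dots> = angular_sq g (exp \<tau> *\<^sub>R s)"
        unfolding angular_sq_def power2_norm_eq_inner G_def[folded s_def, symmetric]
        by (simp add: s power2_eq_square algebra_simps)
      finally show ?thesis by (simp add: G_def s_def)
    qed
    have "ennreal lam * ball_integral (\<lambda>x. (h (exp \<tau> *\<^sub>R sgn x))\<^sup>2) \<le> ball_integral (\<lambda>x. angular_sq g (exp \<tau> *\<^sub>R sgn x))"
    proof -
      have "ennreal lam * ball_integral (\<lambda>x. (h (exp \<tau> *\<^sub>R sgn x))\<^sup>2) \<le> ball_integral (\<lambda>x. (norm x)\<^sup>2 * (norm ((exp \<tau> / norm x) *\<^sub>R (g (exp \<tau> *\<^sub>R sgn x) - (sgn x \<bullet> g (exp \<tau> *\<^sub>R sgn x)) *\<^sub>R sgn x)))\<^sup>2)"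
        using ap hom_adm_slice[OF h S] unfolding angular_poincare_def by blast
      also have "\<dots> = ball_integral (\<lambda>x. angular_sq g (exp \<tau> *\<^sub>R sgn x))"
        unfolding ball_integral_def
      proof (rule nn_integral_cong_AE, rule AE_mp[OF AE_lborel_singleton[of "0::'a"]], rule AE_I2, rule impI)
        fix x :: 'a assume "x \<noteq> 0"
        show "indicator (ball 0 1) x * ennreal ((norm x)\<^sup>2 * (norm ((exp \<tau> / norm x) *\<^sub>R (g (exp \<tau> *\<^sub>R sgn x) - (sgn x \<bullet> g (exp \<tau> *\<^sub>R sgn x)) *\<^sub>R sgn x)))\<^sup>2)
          = indicator (ball 0 1) x * ennreal (angular_sq g (exp \<tau> *\<^sub>R sgn x))"
          unfolding eq[OF \<open>x \<noteq> 0\<close>] ..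
      qed
      finally show ?thesis .
    qed
    then have "ennreal (exp (?N * \<tau>)) * (ennreal lam * ball_integral (\<lambda>x. (h (exp \<tau> *\<^sub>R sgn x))\<^sup>2)) \<le> ennreal (exp (?N * \<tau>)) * ball_integral (\<lambda>x. angular_sq g (exp \<tau> *\<^sub>R sgn x))"
      by (rule mult_left_mono) simp
    moreover have "(\<integral>\<^sup>+x. ennreal (exp (?N * \<tau>)) * indicator (ball 0 1) x * ennreal (F x) \<partial>lborel) = ennreal (exp (?N * \<tau>)) * ball_integral F"
      if [measurable]: "F \<in> borel_measurable borel" for F :: "'a \<Rightarrow> real"
      unfolding ball_integral_def mult.assoc by (rule nn_integral_cmult) measurable
    ultimately show ?thesis by (simp add: mult.left_commute)
  qed
  have "ennreal lam * (ennreal (1 / ?N) * (\<integral>\<^sup>+x. ennreal ((h x)\<^sup>2) \<partial>lborel))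
     = (\<integral>\<^sup>+\<tau>. ennreal lam * (\<integral>\<^sup>+x. ennreal (exp (?N * \<tau>)) * indicator (ball 0 1) x * ennreal ((h (exp \<tau> *\<^sub>R sgn x))\<^sup>2) \<partial>lborel) \<partial>lborel)"
    by (subst polar_ball[symmetric]) (measurable, rule nn_integral_cmult[symmetric], measurable)
  also have "\<dots> \<le> (\<integral>\<^sup>+\<tau>. (\<integral>\<^sup>+x. ennreal (exp (?N * \<tau>)) * indicator (ball 0 1) x * ennreal (angular_sq g (exp \<tau> *\<^sub>R sgn x)) \<partial>lborel) \<partial>lborel)"
    by (intro nn_integral_mono slice)
  also have "\<dots> = ennreal (1 / ?N) * (\<integral>\<^sup>+x. ennreal (angular_sq g x) \<partial>lborel)"
    by (rule polar_ball) measurable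
  finally have le: "ennreal lam * (ennreal (1 / ?N) * (\<integral>\<^sup>+x. ennreal ((h x)\<^sup>2) \<partial>lborel)) \<le> ennreal (1 / ?N) * (\<integral>\<^sup>+x. ennreal (angular_sq g x) \<partial>lborel)" .
  have 1: "(\<integral>\<^sup>+x. ennreal ((h x)\<^sup>2) \<partial>lborel) = ennreal (LBINT x. (h x)\<^sup>2)"
    by (rule nn_integral_eq_integral) (auto intro!: C0c_integrable C0c_intros ccs)
  have 2: "(\<integral>\<^sup>+x. ennreal (angular_sq g x) \<partial>lborel) = ennreal (LBINT x. angular_sq g x)"
    by (rule nn_integral_eq_integral) (auto intro!: C0c_integrable C0c_angular_sq ccs angular_sq_nonneg)
  have i1: "0 \<le> (LBINT x. (h x)\<^sup>2)" and i2: "0 \<le> (LBINT x. angular_sq g x)" by (auto intro!: integral_nonneg_AE simp: angular_sq_nonneg)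
  from le have "ennreal (lam * (1 / ?N * (LBINT x. (h x)\<^sup>2))) \<le> ennreal (1 / ?N * (LBINT x. angular_sq g x))"
    unfolding 1 2 using lam i1 i2 by (simp add: ennreal_mult[symmetric])
  then have "lam * (1 / ?N * (LBINT x. (h x)\<^sup>2)) \<le> 1 / ?N * (LBINT x. angular_sq g x)"
    using i2 by (subst (asm) ennreal_le_iff) auto
  then show ?thesis by (simp add: field_simps)
qed

text \<open>The same radial factor occurs for \<open>H\<close> and for the constant function 1, and
  comparing the two eliminates it.\<close>

lemma ball_integral_of_homogeneous:
  fixes H :: "'a::euclidean_space \<Rightarrow> real"
  assumes H[measurable]: "H \<in> borel_measurable borel" and \<kappa>[measurable]: "\<kappa> \<in> borel_measurable borel"
    and kn: "\<And>t. \<kappa> t \<ge> 0" and hom: "\<And>x. x \<noteq> 0 \<Longrightarrow> H (sgn x) = H x"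
  shows "(\<integral>\<^sup>+x. ennreal (\<kappa> (norm x) * H x) \<partial>lborel) * emeasure lborel (ball (0::'a) 1)
     = (\<integral>\<^sup>+(x::'a). ennreal (\<kappa> (norm x)) \<partial>lborel) * ball_integral H"
proof -
  let ?c = "ennreal (DIM('a)) * (\<integral>\<^sup>+\<tau>. ennreal (exp (DIM('a) * \<tau>)) * ennreal (\<kappa> (exp \<tau>)) \<partial>lborel)"
  have "(\<integral>\<^sup>+x. ennreal (\<kappa> (norm x)) * ennreal (H x) \<partial>lborel) = ?c * ball_integral H"
    unfolding ball_integral_def by (rule radial_times_homogeneous) (auto simp: hom)
  then have 1: "(\<integral>\<^sup>+x. ennreal (\<kappa> (norm x) * H x) \<partial>lborel) = ?c * ball_integral H"
    by (simp add: ennreal_mult' kn)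
  have "(\<integral>\<^sup>+(x::'a). ennreal (\<kappa> (norm x)) * 1 \<partial>lborel) = ?c * (\<integral>\<^sup>+(x::'a). indicator (ball 0 1) x * 1 \<partial>lborel)"
    by (rule radial_times_homogeneous) auto
  then have 2: "(\<integral>\<^sup>+(x::'a). ennreal (\<kappa> (norm x)) \<partial>lborel) = ?c * emeasure lborel (ball (0::'a) 1)"
    by simp
  show ?thesis unfolding 1 2 by (simp add: mult_ac)
qed

section \<open>Functions with small support\<close>

lemma DERIV_max0_square:
  "((\<lambda>t::real. (max 0 t)\<^sup>2) has_real_derivative 2 * max 0 t) (at t)"
proof -
  consider "t < 0" | "t > 0" | "t = 0" by linarith
  then show ?thesis
  proof cases
    case 1
    have "((\<lambda>t::real. 0) has_real_derivative 0) (at t)" by simp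
    then have "((\<lambda>t::real. (max 0 t)\<^sup>2) has_real_derivative 0) (at t)"
      by (rule has_field_derivative_transform_within_open[where S="{..<0}"]) (use 1 in auto)
    then show ?thesis using 1 by simp
  next
    case 2
    have "((\<lambda>t::real. t\<^sup>2) has_real_derivative 2 * t) (at t)" by (auto intro!: derivative_eq_intros)
    then have "((\<lambda>t::real. (max 0 t)\<^sup>2) has_real_derivative 2 * t) (at t)"
      by (rule has_field_derivative_transform_within_open[where S="{0<..}"]) (use 2 in auto)
    then show ?thesis using 2 by simp
  next
    case 3
    have "((\<lambda>h. ((max 0 (0 + h))\<^sup>2 - (max 0 0)\<^sup>2) / h) \<longlongrightarrow> (0::real)) (at 0)"
    proof (rule Lim_null_comparison[where g="\<lambda>h. \<bar>h\<bar>"])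
      show "\<forall>\<^sub>F h in at 0. norm (((max 0 (0 + h))\<^sup>2 - (max 0 0)\<^sup>2) / h) \<le> \<bar>h :: real\<bar>"
        by (intro always_eventually allI) (auto simp: max_def power2_eq_square)
      show "((\<lambda>h::real. \<bar>h\<bar>) \<longlongrightarrow> 0) (at 0)" by (intro tendsto_rabs_zero tendsto_ident_at)
    qed
    then show ?thesis using 3 unfolding DERIV_def by simp
  qed
qed

text \<open>Nonzero exactly between the radii \<open>r\<close> and \<open>2 * r\<close>. The squared
  positive part of a polynomial in \<open>x \<bullet> x\<close> is C^1 without any use of the
  derivative of the norm.\<close>

definition radial_bump :: "real \<Rightarrow> 'a::euclidean_space \<Rightarrow> real" where
  "radial_bump r x = (max 0 ((x \<bullet> x - r\<^sup>2) * (4 * r\<^sup>2 - x \<bullet> x)))\<^sup>2"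

definition radial_bump_grad :: "real \<Rightarrow> 'a::euclidean_space \<Rightarrow> 'a" where
  "radial_bump_grad r x = (4 * max 0 ((x \<bullet> x - r\<^sup>2) * (4 * r\<^sup>2 - x \<bullet> x)) * (5 * r\<^sup>2 - 2 * (x \<bullet> x))) *\<^sub>R x"

lemma has_grad_radial_bump: "has_grad (radial_bump r) (radial_bump_grad r) UNIV"
proof -
  let ?f = "\<lambda>x::'a. (x \<bullet> x - r\<^sup>2) * (4 * r\<^sup>2 - x \<bullet> x)"
  have 1: "has_grad ?f (\<lambda>x. (2 * (5 * r\<^sup>2 - 2 * (x \<bullet> x))) *\<^sub>R x) UNIV"
    unfolding has_grad_def
  proof (intro conjI ballI)
    fix x :: 'a
    have "(?f has_derivative (\<lambda>h. (x \<bullet> x - r\<^sup>2) * (- (2 * (x \<bullet> h))) + 2 * (x \<bullet> h) * (4 * r\<^sup>2 - x \<bullet> x))) (at x)"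
      by (auto intro!: derivative_eq_intros simp: inner_commute algebra_simps)
    then show "(?f has_derivative (\<bullet>) ((2 * (5 * r\<^sup>2 - 2 * (x \<bullet> x))) *\<^sub>R x)) (at x)"
      by (rule has_derivative_eq_rhs) (auto simp: fun_eq_iff algebra_simps)
  qed (intro continuous_intros)
  have "has_grad (\<lambda>x. (\<lambda>t. (max 0 t)\<^sup>2) (?f x)) (\<lambda>x. (2 * max 0 (?f x)) *\<^sub>R ((2 * (5 * r\<^sup>2 - 2 * (x \<bullet> x))) *\<^sub>R x)) UNIV"
    by (rule has_grad_compose[OF 1 DERIV_max0_square]) (intro continuous_intros)
  then show ?thesis
    by (rule has_grad_cong_open) (auto simp: radial_bump_def radial_bump_grad_def)
qed

lemma radial_bump_zero: "r > 0 \<Longrightarrow> norm x \<notin> {r..2*r} \<Longrightarrow> radial_bump r x = 0"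
proof -
  assume r: "r > 0" and x: "norm x \<notin> {r..2*r}"
  have "(x \<bullet> x - r\<^sup>2) * (4 * r\<^sup>2 - x \<bullet> x) \<le> 0"
  proof (cases "norm x < r")
    case True
    then have "x \<bullet> x \<le> r\<^sup>2" unfolding power2_norm_eq_inner[symmetric] by (intro power_mono) auto
    moreover have "x \<bullet> x \<le> 4 * r\<^sup>2" using calculation zero_le_power2[of r] by linarith
    ultimately show ?thesis by (intro mult_nonpos_nonneg) auto
  next
    case False
    then have "norm x > 2 * r" using x by auto
    then have "(2*r)\<^sup>2 \<le> x \<bullet> x" unfolding power2_norm_eq_inner[symmetric] using r by (intro power_mono) auto
    then have "4 * r\<^sup>2 \<le> x \<bullet> x" by (simp add: power_mult_distrib)
    moreover have "r\<^sup>2 \<le> x \<bullet> x" using calculation zero_le_power2[of r] by linarith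
    ultimately show ?thesis by (intro mult_nonneg_nonpos) auto
  qed
  then show ?thesis by (simp add: radial_bump_def)
qed

definition radial_bump_profile :: "real \<Rightarrow> real \<Rightarrow> real" where
  "radial_bump_profile r t = (max 0 ((t\<^sup>2 - r\<^sup>2) * (4 * r\<^sup>2 - t\<^sup>2)))\<^sup>2"
definition radial_bump_profile_deriv :: "real \<Rightarrow> real \<Rightarrow> real" where
  "radial_bump_profile_deriv r t = 4 * max 0 ((t\<^sup>2 - r\<^sup>2) * (4 * r\<^sup>2 - t\<^sup>2)) * (5 * r\<^sup>2 - 2 * t\<^sup>2)"

lemma radial_bump_norm: "radial_bump r x = radial_bump_profile r (norm x)" "radial_bump_grad r x = radial_bump_profile_deriv r (norm x) *\<^sub>R x"
  by (simp_all add: radial_bump_def radial_bump_profile_def radial_bump_grad_def radial_bump_profile_deriv_def power2_norm_eq_inner)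

lemma C1c_radial_bump: "r > 0 \<Longrightarrow> C1c (- {0}) (radial_bump r) (radial_bump_grad r)"
proof (rule C1cI[OF has_grad_radial_bump])
  assume r: "r > 0"
  have "{x::'a. norm x \<in> {r..2*r}} = cball 0 (2*r) - ball 0 r" by auto
  then show "compact {x::'a. norm x \<in> {r..2*r}}" by (simp add: compact_diff)
  show "{x::'a. norm x \<in> {r..2*r}} \<subseteq> - {0}" using r by auto
qed (auto simp: radial_bump_zero)

lemma nn_integral_pos_continuous:
  fixes f :: "'a::euclidean_space \<Rightarrow> real"
  assumes "continuous_on S f" "open S" "x0 \<in> S" "f x0 > 0"
  shows "(\<integral>\<^sup>+x. ennreal (f x) * indicator S x \<partial>lborel) > 0"
proof -
  define U where "U = S \<inter> f -` {f x0 / 2<..}"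
  have U: "open U" unfolding U_def using assms by (intro continuous_open_preimage) auto
  have x0: "x0 \<in> U" using assms by (auto simp: U_def)
  have "emeasure lborel U \<noteq> 0"
  proof
    assume "emeasure lborel U = 0"
    then have "U \<in> null_sets lborel" using U by (auto simp: null_sets_def)
    then have "negligible U" by (simp add: negligible_iff_null_sets null_sets_completionI)
    then show False using open_not_negligible[OF U] x0 by auto
  qed
  then have "0 < ennreal (f x0 / 2) * emeasure lborel U"
    using assms by (simp add: ennreal_zero_less_mult_iff zero_less_iff_neq_zero)
  also have "\<dots> = (\<integral>\<^sup>+x. ennreal (f x0 / 2) * indicator U x \<partial>lborel)"
    using U by (simp add: nn_integral_cmult_indicator)
  also have "\<dots> \<le> (\<integral>\<^sup>+x. ennreal (f x) * indicator S x \<partial>lborel)"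
    by (intro nn_integral_mono) (auto simp: U_def indicator_def intro!: ennreal_leI)
  finally show ?thesis .
qed

text \<open>The fundamental theorem of calculus along the segment from \<open>x - z\<close> to
  \<open>x\<close>, followed by Cauchy-Schwarz in \<open>\<theta>\<close>, which appears here as
  nonnegativity of the variance of \<open>k\<close>.\<close>

lemma sq_diff_translate:
  fixes f :: "'a::euclidean_space \<Rightarrow> real"
  assumes f: "has_grad f g UNIV"
  shows "ennreal ((f x - f (x - z))\<^sup>2) \<le> (\<integral>\<^sup>+\<theta>. ennreal ((norm z)\<^sup>2 * (norm (g (x - z + \<theta> *\<^sub>R z)))\<^sup>2) * indicator {0..1::real} \<theta> \<partial>lborel)"
proof -
  define k where "k \<theta> = g (x - z + \<theta> *\<^sub>R z) \<bullet> z" for \<theta> :: real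
  define D where "D = f x - f (x - z)"
  note cg = has_grad_continuous_grad[OF f]
  have ck: "continuous_on UNIV k"
    unfolding k_def by (intro continuous_intros continuous_on_compose2[OF cg]) auto
  have dk: "((\<lambda>\<theta>. f (x - z + \<theta> *\<^sub>R z)) has_real_derivative k \<theta>) (at \<theta>)" for \<theta>
  proof -
    have "((\<lambda>\<theta>. x - z + \<theta> *\<^sub>R z) has_derivative (\<lambda>h. h *\<^sub>R z)) (at \<theta>)"
      by (auto intro!: derivative_eq_intros)
    from has_derivative_compose[OF this has_gradD[OF f UNIV_I]]
    show ?thesis unfolding has_field_derivative_def k_def
      by (rule has_derivative_eq_rhs) (auto simp: fun_eq_iff)
  qed
  have I1: "has_bochner_integral lborel (\<lambda>\<theta>. k \<theta> * indicator {0..1} \<theta>) (f (x - z + 1 *\<^sub>R z) - f (x - z + 0 *\<^sub>R z))"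
    by (rule has_bochner_integral_FTC_Icc_real) (use dk ck in \<open>auto simp: continuous_on_eq_continuous_at\<close>)
  have int2: "integrable lborel (\<lambda>\<theta>. indicator {0..1} \<theta> *\<^sub>R (k \<theta>)\<^sup>2)"
    by (intro borel_integrable_compact continuous_intros continuous_on_subset[OF ck]) auto
  have int1: "integrable lborel (\<lambda>\<theta>. k \<theta> * indicator {0..1} \<theta>)" and I1': "(LBINT \<theta>. k \<theta> * indicator {0..1} \<theta>) = D"
    using I1 by (auto simp: D_def has_bochner_integral_iff)
  have "0 \<le> (LBINT \<theta>. indicator {0..1} \<theta> *\<^sub>R (k \<theta> - D)\<^sup>2)" by simp
  also have "(\<lambda>\<theta>. indicator {0..1} \<theta> *\<^sub>R (k \<theta> - D)\<^sup>2) = (\<lambda>\<theta>. indicator {0..1} \<theta> *\<^sub>R (k \<theta>)\<^sup>2 - 2 * D * (k \<theta> * indicator {0..1} \<theta>) + D\<^sup>2 * indicator {0..1} \<theta>)"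
    by (auto simp: fun_eq_iff indicator_def power2_eq_square algebra_simps)
  also have "(LBINT \<theta>. indicator {0..1} \<theta> *\<^sub>R (k \<theta>)\<^sup>2 - 2 * D * (k \<theta> * indicator {0..1} \<theta>) + D\<^sup>2 * indicator {0..1} \<theta>)
     = (LBINT \<theta>. indicator {0..1} \<theta> *\<^sub>R (k \<theta>)\<^sup>2) - 2 * D * D + D\<^sup>2"
    using int1 int2 I1' by simp
  finally have "D\<^sup>2 \<le> (LBINT \<theta>. indicator {0..1} \<theta> *\<^sub>R (k \<theta>)\<^sup>2)" by (simp add: power2_eq_square)
  then have "ennreal (D\<^sup>2) \<le> ennreal (LBINT \<theta>. indicator {0..1} \<theta> *\<^sub>R (k \<theta>)\<^sup>2)" by (rule ennreal_leI)
  also have "\<dots> = (\<integral>\<^sup>+\<theta>. ennreal (indicator {0..1} \<theta> *\<^sub>R (k \<theta>)\<^sup>2) \<partial>lborel)"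
    by (rule nn_integral_eq_integral[symmetric]) (use int2 in auto)
  also have "\<dots> \<le> (\<integral>\<^sup>+\<theta>. ennreal ((norm z)\<^sup>2 * (norm (g (x - z + \<theta> *\<^sub>R z)))\<^sup>2) * indicator {0..1::real} \<theta> \<partial>lborel)"
  proof (rule nn_integral_mono)
    fix \<theta> :: real
    have "(k \<theta>)\<^sup>2 \<le> (norm (g (x - z + \<theta> *\<^sub>R z)) * norm z)\<^sup>2"
      unfolding k_def by (intro abs_le_square_iff[THEN iffD1]) (simp add: Cauchy_Schwarz_ineq2)
    then show "ennreal (indicator {0..1} \<theta> *\<^sub>R (k \<theta>)\<^sup>2) \<le> ennreal ((norm z)\<^sup>2 * (norm (g (x - z + \<theta> *\<^sub>R z)))\<^sup>2) * indicator {0..1} \<theta>"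
      by (auto simp: indicator_def power_mult_distrib mult.commute intro!: ennreal_leI)
  qed
  finally show ?thesis by (simp add: D_def)
qed

lemma nn_integral_sq_diff_translate:
  fixes f :: "'a::euclidean_space \<Rightarrow> real"
  assumes f: "has_grad f g UNIV"
  shows "(\<integral>\<^sup>+x. ennreal ((f x - f (x - z))\<^sup>2) \<partial>lborel) \<le> ennreal ((norm z)\<^sup>2) * (\<integral>\<^sup>+x. ennreal ((norm (g x))\<^sup>2) \<partial>lborel)"
proof -
  have [measurable]: "g \<in> borel_measurable borel"
    using has_grad_continuous_grad[OF f] by (rule borel_measurable_continuous_onI)
  have "(\<integral>\<^sup>+x. ennreal ((f x - f (x - z))\<^sup>2) \<partial>lborel)
     \<le> (\<integral>\<^sup>+x. \<integral>\<^sup>+\<theta>. ennreal ((norm z)\<^sup>2 * (norm (g (x - z + \<theta> *\<^sub>R z)))\<^sup>2) * indicator {0..1::real} \<theta> \<partial>lborel \<partial>lborel)"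
    by (intro nn_integral_mono sq_diff_translate[OF f])
  also have "\<dots> = (\<integral>\<^sup>+\<theta>. \<integral>\<^sup>+x. ennreal ((norm z)\<^sup>2 * (norm (g (x - z + \<theta> *\<^sub>R z)))\<^sup>2) * indicator {0..1::real} \<theta> \<partial>lborel \<partial>lborel)"
    by (rule lborel_pair.Fubini') measurable
  also have "\<dots> = (\<integral>\<^sup>+\<theta>. (ennreal ((norm z)\<^sup>2) * (\<integral>\<^sup>+x. ennreal ((norm (g x))\<^sup>2) \<partial>lborel)) * indicator {0..1::real} \<theta> \<partial>lborel)"
  proof (rule nn_integral_cong)
    fix \<theta> :: real
    have "(\<integral>\<^sup>+x. ennreal ((norm z)\<^sup>2 * (norm (g (x - z + \<theta> *\<^sub>R z)))\<^sup>2) * indicator {0..1::real} \<theta> \<partial>lborel)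
      = (\<integral>\<^sup>+x. ennreal ((norm z)\<^sup>2) * indicator {0..1::real} \<theta> * ennreal ((norm (g (x + (\<theta> *\<^sub>R z - z))))\<^sup>2) \<partial>lborel)"
      by (simp add: ennreal_mult mult_ac algebra_simps)
    also have "\<dots> = ennreal ((norm z)\<^sup>2) * indicator {0..1::real} \<theta> * (\<integral>\<^sup>+x. ennreal ((norm (g (x + (\<theta> *\<^sub>R z - z))))\<^sup>2) \<partial>lborel)"
      by (rule nn_integral_cmult) measurable
    also have "(\<integral>\<^sup>+x. ennreal ((norm (g (x + (\<theta> *\<^sub>R z - z))))\<^sup>2) \<partial>lborel) = (\<integral>\<^sup>+x. ennreal ((norm (g x))\<^sup>2) \<partial>lborel)"
      by (rule lborel_nn_integral_translation[where f="\<lambda>x. ennreal ((norm (g x))\<^sup>2)"]) measurable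
    finally show "(\<integral>\<^sup>+x. ennreal ((norm z)\<^sup>2 * (norm (g (x - z + \<theta> *\<^sub>R z)))\<^sup>2) * indicator {0..1::real} \<theta> \<partial>lborel)
      = (ennreal ((norm z)\<^sup>2) * (\<integral>\<^sup>+x. ennreal ((norm (g x))\<^sup>2) \<partial>lborel)) * indicator {0..1::real} \<theta>"
      by (simp add: mult_ac)
  qed
  also have "\<dots> = ennreal ((norm z)\<^sup>2) * (\<integral>\<^sup>+x. ennreal ((norm (g x))\<^sup>2) \<partial>lborel)"
    by (subst nn_integral_cmult_indicator) auto
  finally show ?thesis .
qed

text \<open>A weak Faber-Krahn inequality: small support forces a large Dirichlet eigenvalue. On
  \<open>A\<close> one has \<open>f x ^ 2 <= 2 (f x - f (x - z))^2 + 2 f (x - z)^2\<close>. Averaged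
  over \<open>z\<close> in the ball of radius \<open>\<delta>\<close>, the difference costs at most
  \<open>\<delta>^2\<close> times the Dirichlet integral, while the last term contributes at most
  half of the left side, \<open>A\<close> having at most a quarter of the volume of the
  ball.\<close>

lemma small_support_poincare:
  fixes f :: "'a::euclidean_space \<Rightarrow> real"
  assumes f: "C1c UNIV f g" and A[measurable]: "A \<in> sets borel" and fA: "\<And>x. x \<notin> A \<Longrightarrow> f x = 0"
    and d: "\<delta> > 0" and small: "4 * emeasure lborel A \<le> emeasure lborel (ball (0::'a) \<delta>)"
  shows "(LBINT x. (f x)\<^sup>2) \<le> 4 * \<delta>\<^sup>2 * (LBINT x. (norm (g x))\<^sup>2)"
proof -
  note ccs = C1c_C0c[OF f]
  have [measurable]: "f \<in> borel_measurable borel" "g \<in> borel_measurable borel"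
    using ccs C0c_measurable by blast+
  have hg: "has_grad f g UNIV" using f by (simp add: C1c_def)
  let ?B = "ball (0::'a) \<delta>"
  have [measurable]: "(\<lambda>x::'a. indicator ?B x :: ennreal) \<in> borel_measurable borel"
    by (intro borel_measurable_indicator) auto
  define F where "F = (\<integral>\<^sup>+x. ennreal ((f x)\<^sup>2) \<partial>lborel)"
  define G where "G = (\<integral>\<^sup>+x. ennreal ((norm (g x))\<^sup>2) \<partial>lborel)"
  have Fr: "F = ennreal (LBINT x. (f x)\<^sup>2)" unfolding F_def
    by (rule nn_integral_eq_integral) (auto intro!: C0c_integrable C0c_intros ccs)
  have Gr: "G = ennreal (LBINT x. (norm (g x))\<^sup>2)" unfolding G_def
    by (rule nn_integral_eq_integral) (auto intro!: C0c_integrable C0c_intros ccs)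
  have "emeasure lborel ?B * F = (\<integral>\<^sup>+x. \<integral>\<^sup>+z. ennreal ((f x)\<^sup>2) * indicator ?B z \<partial>lborel \<partial>lborel)"
    unfolding F_def by (simp add: nn_integral_cmult_indicator nn_integral_cmult[symmetric]) (simp add: mult.commute)
  also have "\<dots> \<le> (\<integral>\<^sup>+x. \<integral>\<^sup>+z. (2 * ennreal ((f x - f (x - z))\<^sup>2) * indicator ?B z + 2 * (indicator A x * ennreal ((f (x - z))\<^sup>2))) \<partial>lborel \<partial>lborel)"
  proof (intro nn_integral_mono)
    fix x z
    have "(f x)\<^sup>2 \<le> 2 * (f x - f (x - z))\<^sup>2 + 2 * (f (x - z))\<^sup>2"
      using zero_le_power2[of "f x - 2 * f (x - z)"] by (simp add: power2_eq_square algebra_simps)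
    then have "ennreal ((f x)\<^sup>2) \<le> ennreal (2 * (f x - f (x - z))\<^sup>2 + 2 * (f (x - z))\<^sup>2)" by (rule ennreal_leI)
    also have "\<dots> = 2 * ennreal ((f x - f (x - z))\<^sup>2) + 2 * ennreal ((f (x - z))\<^sup>2)"
      by (simp add: ennreal_mult)
    finally show "ennreal ((f x)\<^sup>2) * indicator ?B z \<le> 2 * ennreal ((f x - f (x - z))\<^sup>2) * indicator ?B z + 2 * (indicator A x * ennreal ((f (x - z))\<^sup>2))"
      using fA[of x] by (cases "x \<in> A") (auto simp: indicator_def)
  qed
  also have "\<dots> = (\<integral>\<^sup>+x. \<integral>\<^sup>+z. 2 * ennreal ((f x - f (x - z))\<^sup>2) * indicator ?B z \<partial>lborel \<partial>lborel)
     + (\<integral>\<^sup>+x. \<integral>\<^sup>+z. 2 * (indicator A x * ennreal ((f (x - z))\<^sup>2)) \<partial>lborel \<partial>lborel)"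
    by (subst nn_integral_add[symmetric]) (measurable, intro nn_integral_cong nn_integral_add, measurable)
  also have "(\<integral>\<^sup>+x. \<integral>\<^sup>+z. 2 * (indicator A x * ennreal ((f (x - z))\<^sup>2)) \<partial>lborel \<partial>lborel) = 2 * emeasure lborel A * F"
  proof -
    have "(\<integral>\<^sup>+z. 2 * (indicator A x * ennreal ((f (x - z))\<^sup>2)) \<partial>lborel) = 2 * F * indicator A x" for x
    proof -
      have "(\<integral>\<^sup>+z. ennreal ((f (x - z))\<^sup>2) \<partial>lborel) = (\<integral>\<^sup>+z. ennreal ((f (x - z))\<^sup>2) \<partial>distr lborel borel (\<lambda>t. x + (-1) *\<^sub>R t))"
        by (subst lborel_affine[of "-1" x]) (simp_all add: density_1)
      also have "\<dots> = F" unfolding F_def by (subst nn_integral_distr) auto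
      finally show ?thesis by (simp add: nn_integral_cmult mult_ac)
    qed
    then have "(\<integral>\<^sup>+x. \<integral>\<^sup>+z. 2 * (indicator A x * ennreal ((f (x - z))\<^sup>2)) \<partial>lborel \<partial>lborel) = (\<integral>\<^sup>+x. 2 * F * indicator A x \<partial>lborel)"
      by (simp only:)
    also have "\<dots> = 2 * F * emeasure lborel A" by (rule nn_integral_cmult_indicator) auto
    finally show ?thesis by (simp add: mult_ac)
  qed
  also have "(\<integral>\<^sup>+x. \<integral>\<^sup>+z. 2 * ennreal ((f x - f (x - z))\<^sup>2) * indicator ?B z \<partial>lborel \<partial>lborel)
     = (\<integral>\<^sup>+z. \<integral>\<^sup>+x. 2 * ennreal ((f x - f (x - z))\<^sup>2) * indicator ?B z \<partial>lborel \<partial>lborel)"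
    by (rule lborel_pair.Fubini') measurable
  also have "\<dots> \<le> (\<integral>\<^sup>+z. 2 * ennreal (\<delta>\<^sup>2) * G * indicator ?B z \<partial>lborel)"
  proof (rule nn_integral_mono)
    fix z :: 'a
    have "(\<integral>\<^sup>+x. 2 * ennreal ((f x - f (x - z))\<^sup>2) * indicator ?B z \<partial>lborel) = 2 * indicator ?B z * (\<integral>\<^sup>+x. ennreal ((f x - f (x - z))\<^sup>2) \<partial>lborel)"
      by (subst nn_integral_cmult[symmetric]) (measurable, simp add: mult_ac)
    also have "\<dots> \<le> 2 * indicator ?B z * (ennreal ((norm z)\<^sup>2) * G)"
      unfolding G_def by (intro mult_left_mono nn_integral_sq_diff_translate[OF hg]) auto
    also have "\<dots> \<le> 2 * indicator ?B z * (ennreal (\<delta>\<^sup>2) * G)"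
      by (auto simp: indicator_def intro!: mult_left_mono mult_right_mono ennreal_leI power_mono)
    finally show "(\<integral>\<^sup>+x. 2 * ennreal ((f x - f (x - z))\<^sup>2) * indicator ?B z \<partial>lborel) \<le> 2 * ennreal (\<delta>\<^sup>2) * G * indicator ?B z"
      by (simp add: mult_ac)
  qed
  also have "\<dots> = 2 * ennreal (\<delta>\<^sup>2) * G * emeasure lborel ?B"
    by (simp add: nn_integral_cmult_indicator)
  finally have main: "emeasure lborel ?B * F \<le> 2 * ennreal (\<delta>\<^sup>2) * G * emeasure lborel ?B + 2 * emeasure lborel A * F" by simp
  obtain b where b: "emeasure lborel ?B = ennreal b" "b > 0"
  proof -
    have "emeasure lborel ?B < \<infinity>" by (rule emeasure_lborel_ball_finite)
    moreover have "emeasure lborel ?B \<noteq> 0"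
    proof
      assume "emeasure lborel ?B = 0"
      then have "?B \<in> null_sets lborel" by (auto simp: null_sets_def)
      then have "negligible ?B" by (simp add: negligible_iff_null_sets null_sets_completionI)
      then show False using open_not_negligible[of ?B] d by auto
    qed
    ultimately show ?thesis using that[of "enn2real (emeasure lborel ?B)"]
      by (simp add: enn2real_positive_iff less_top zero_less_iff_neq_zero)
  qed
  obtain a where a: "emeasure lborel A = ennreal a" "a \<ge> 0"
  proof -
    have "emeasure lborel A \<le> 4 * emeasure lborel A"
      using mult_right_mono[of 1 4 "emeasure lborel A"] by simp
    then have "emeasure lborel A < \<infinity>" using small b by (metis ennreal_less_top infinity_ennreal_def le_less_trans)
    then show ?thesis using that[of "enn2real (emeasure lborel A)"] by (simp add: less_top)
  qed
  have F0: "0 \<le> (LBINT x. (f x)\<^sup>2)" and G0: "0 \<le> (LBINT x. (norm (g x))\<^sup>2)" by auto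
  define F' where "F' = (LBINT x. (f x)\<^sup>2)"
  define G' where "G' = (LBINT x. (norm (g x))\<^sup>2)"
  have "ennreal (4 * a) \<le> ennreal b" using small unfolding a b using a by (simp add: ennreal_mult)
  then have ab: "4 * a \<le> b" using b by (simp add: ennreal_le_iff)
  have two: "(2::ennreal) = ennreal 2" by simp
  have "ennreal (b * F') \<le> ennreal (2 * \<delta>\<^sup>2 * G' * b + 2 * a * F')"
    using main unfolding Fr Gr a(1) b(1) two F'_def[symmetric] G'_def[symmetric]
    using a(2) b(2) F0 G0 by (simp add: ennreal_mult[symmetric] ennreal_plus[symmetric] F'_def G'_def del: ennreal_plus ennreal_numeral)
  then have "b * F' \<le> 2 * \<delta>\<^sup>2 * G' * b + 2 * a * F'"
    using a(2) b(2) F0 G0 by (subst (asm) ennreal_le_iff) (auto simp: F'_def G'_def)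
  moreover have "2 * a * F' \<le> b / 2 * F'" using ab F0 by (intro mult_right_mono) (auto simp: F'_def)
  ultimately have "b * F' \<le> b * (4 * \<delta>\<^sup>2 * G')" by (simp add: algebra_simps)
  then show ?thesis using b(2) by (simp add: F'_def G'_def)
qed

section \<open>Lifting homogeneous functions to an annulus\<close>

lemma hom_adm_scale:
  assumes h: "hom_adm \<Sigma> \<psi> g" and c: "c > 0"
  shows "\<psi> (c *\<^sub>R x) = \<psi> x"
proof -
  have "\<psi> (c *\<^sub>R x) = \<psi> (sgn (c *\<^sub>R x))" using h by (simp add: hom_adm_def)
  also have "\<dots> = \<psi> x" using h c by (simp add: hom_adm_def sgn_scaleR)
  finally show ?thesis .
qed

text \<open>Euler's relation in degree zero, obtained by differentiating along the ray through
  \<open>x\<close>. It makes all cross terms with radial functions vanish.\<close>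

lemma hom_adm_euler:
  assumes h: "hom_adm \<Sigma> \<psi> g" and x: "x \<noteq> 0"
  shows "x \<bullet> g x = 0"
proof -
  have d: "(\<psi> has_derivative (\<lambda>h. g x \<bullet> h)) (at x)"
    using h x by (auto simp: hom_adm_def has_grad_def)
  have "((\<lambda>t. x + t *\<^sub>R x) has_derivative (\<lambda>h. h *\<^sub>R x)) (at 0)"
    by (auto intro!: derivative_eq_intros)
  moreover have "(\<psi> has_derivative (\<lambda>h. g x \<bullet> h)) (at (x + 0 *\<^sub>R x))" using d by simp
  ultimately have "((\<lambda>t::real. \<psi> (x + t *\<^sub>R x)) has_derivative (\<lambda>h. g x \<bullet> (h *\<^sub>R x))) (at 0)"
    by (rule has_derivative_compose)
  then have "((\<lambda>t::real. \<psi> x) has_derivative (\<lambda>h. g x \<bullet> (h *\<^sub>R x))) (at 0)"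
  proof (rule has_derivative_transform_within_open[where s="{-1<..}"])
    fix t :: real assume "t \<in> {-1<..}"
    then show "\<psi> (x + t *\<^sub>R x) = \<psi> x"
      using hom_adm_scale[OF h, of "1 + t" x] by (simp add: scaleR_left_distrib)
  qed auto
  then have "(\<lambda>h. g x \<bullet> (h *\<^sub>R x)) = (\<lambda>h. 0)"
    by (rule has_derivative_unique) auto
  from fun_cong[OF this, of 1] show ?thesis by (simp add: inner_commute)
qed

text \<open>The gradient is homogeneous of degree -1; hence \<open>norm x\<close> times its length
  is constant along rays, as \<open>lambda1\<close> uses it.\<close>

lemma hom_adm_grad_sgn:
  assumes h: "hom_adm \<Sigma> \<psi> g" and x: "x \<noteq> 0"
  shows "g (sgn x) = norm x *\<^sub>R g x"
proof -
  have d: "(\<psi> has_derivative (\<lambda>h. g (sgn x) \<bullet> h)) (at (sgn x))" "(\<psi> has_derivative (\<lambda>h. g x \<bullet> h)) (at x)"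
    using h x by (auto simp: hom_adm_def has_grad_def sgn_zero_iff)
  have "((\<lambda>y. inverse (norm x) *\<^sub>R y) has_derivative (\<lambda>h. inverse (norm x) *\<^sub>R h)) (at x)"
    by (auto intro!: derivative_eq_intros)
  moreover have "(\<psi> has_derivative (\<lambda>h. g (sgn x) \<bullet> h)) (at (inverse (norm x) *\<^sub>R x))"
    using d(1) by (simp add: sgn_div_norm)
  ultimately have "((\<lambda>y. \<psi> (inverse (norm x) *\<^sub>R y)) has_derivative (\<lambda>h. g (sgn x) \<bullet> (inverse (norm x) *\<^sub>R h))) (at x)"
    by (rule has_derivative_compose)
  then have "(\<psi> has_derivative (\<lambda>h. g (sgn x) \<bullet> (inverse (norm x) *\<^sub>R h))) (at x)"
    using x by (simp add: hom_adm_scale[OF h])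
  then have "(\<lambda>h. g (sgn x) \<bullet> (inverse (norm x) *\<^sub>R h)) = (\<lambda>h. g x \<bullet> h)"
    using d(2) by (rule has_derivative_unique)
  then have "(inverse (norm x) *\<^sub>R g (sgn x)) \<bullet> h = g x \<bullet> h" for h by (simp add: fun_eq_iff)
  then have "inverse (norm x) *\<^sub>R g (sgn x) = g x" by (metis inner_commute vector_eq_rdot)
  then show ?thesis using x by (metis divideR_right norm_eq_zero scaleR_conv_of_real of_real_def scaleR_scaleR right_inverse scaleR_one)
qed

lemma radial_bump_zero_radial_bump_grad: "radial_bump r x = 0 \<Longrightarrow> radial_bump_grad r x = 0"
  by (simp add: radial_bump_def radial_bump_grad_def)

lemma compact_annulus_cone:
  fixes K :: "'a::euclidean_space set"
  assumes "compact K" "K \<subseteq> sphere 0 1" "a > 0"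
  shows "compact {x. a \<le> norm x \<and> norm x \<le> b \<and> sgn x \<in> K}"
proof -
  have "compact ((\<lambda>z. fst z *\<^sub>R snd z) ` ({a..b} \<times> K))"
    by (intro compact_continuous_image continuous_intros compact_Times assms) auto
  moreover have "(\<lambda>z. fst z *\<^sub>R snd z) ` ({a..b} \<times> K) = {x. a \<le> norm x \<and> norm x \<le> b \<and> sgn x \<in> K}"
  proof (intro set_eqI iffI)
    fix x assume "x \<in> (\<lambda>z. fst z *\<^sub>R snd z) ` ({a..b} \<times> K)"
    then obtain t s where x: "x = t *\<^sub>R s" "t \<in> {a..b}" "s \<in> K" by auto
    then have "norm s = 1" "t > 0" using assms by auto
    then show "x \<in> {x. a \<le> norm x \<and> norm x \<le> b \<and> sgn x \<in> K}"
      using x by (auto simp: sgn_scaleR sgn_div_norm[of s])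
  next
    fix x assume x: "x \<in> {x. a \<le> norm x \<and> norm x \<le> b \<and> sgn x \<in> K}"
    then have "x = (\<lambda>z. fst z *\<^sub>R snd z) (norm x, sgn x)" using assms(3) by (cases "x = 0") (auto simp: sgn_div_norm)
    then show "x \<in> (\<lambda>z. fst z *\<^sub>R snd z) ` ({a..b} \<times> K)" using x by (intro image_eqI) auto
  qed
  ultimately show ?thesis by simp
qed

lemma C1c_radial_bump_hom:
  assumes r: "r > 0" and h: "hom_adm \<Sigma> \<psi> g" and S: "\<Sigma> \<subseteq> sphere 0 1"
    and K: "compact K" "K \<subseteq> \<Sigma>" "\<And>x. sgn x \<notin> K \<Longrightarrow> \<psi> x = 0"
  shows "C1c {x. r \<le> norm x \<and> norm x \<le> 2 * r \<and> sgn x \<in> K} (\<lambda>x. radial_bump r x * \<psi> x) (\<lambda>x. radial_bump r x *\<^sub>R g x + \<psi> x *\<^sub>R radial_bump_grad r x)"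
proof (rule C1cI)
  have "has_grad (radial_bump r) (radial_bump_grad r) (- {0})"
    using has_grad_radial_bump by (auto simp: has_grad_def intro: continuous_on_subset)
  then have "has_grad (\<lambda>x. radial_bump r x * \<psi> x) (\<lambda>x. radial_bump r x *\<^sub>R g x + \<psi> x *\<^sub>R radial_bump_grad r x) (- {0})"
    using h by (intro has_grad_mult) (auto simp: hom_adm_def)
  then show "has_grad (\<lambda>x. radial_bump r x * \<psi> x) (\<lambda>x. radial_bump r x *\<^sub>R g x + \<psi> x *\<^sub>R radial_bump_grad r x) UNIV"
  proof (rule has_grad_extend_zero[where K="cball 0 (2*r) - ball 0 r"])
    fix x :: 'a assume "x \<notin> cball 0 (2*r) - ball 0 r"
    then have "radial_bump r x = 0" using r by (intro radial_bump_zero) auto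
    then show "radial_bump r x * \<psi> x = 0" "radial_bump r x *\<^sub>R g x + \<psi> x *\<^sub>R radial_bump_grad r x = 0"
      using radial_bump_zero_radial_bump_grad by auto
  qed (use r in \<open>auto intro!: closed_Diff\<close>)
  show "compact {x. r \<le> norm x \<and> norm x \<le> 2 * r \<and> sgn x \<in> K}"
    using K S r by (intro compact_annulus_cone) auto
  fix x assume "x \<notin> {x. r \<le> norm x \<and> norm x \<le> 2 * r \<and> sgn x \<in> K}"
  then show "radial_bump r x * \<psi> x = 0" using radial_bump_zero[OF r, of x] K(3)[of x] by auto
qed simp

text \<open>\<open>radial_bump_grad r x\<close> is parallel to \<open>x\<close>, while
  \<open>g x\<close> is orthogonal to it, so the mixed terms drop out and the angular part sees
  \<open>g\<close> only.\<close>

lemma norm_radial_bump_hom: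
  assumes h: "hom_adm \<Sigma> \<psi> g" and r: "r > 0"
  shows "(norm (radial_bump r x *\<^sub>R g x + \<psi> x *\<^sub>R radial_bump_grad r x))\<^sup>2 = (radial_bump r x)\<^sup>2 * (norm (g x))\<^sup>2 + (\<psi> x)\<^sup>2 * (norm (radial_bump_grad r x))\<^sup>2"
    and "angular_sq (\<lambda>x. radial_bump r x *\<^sub>R g x + \<psi> x *\<^sub>R radial_bump_grad r x) x = (radial_bump r x)\<^sup>2 * ((norm x)\<^sup>2 * (norm (g x))\<^sup>2)"
    and "x \<bullet> (radial_bump r x *\<^sub>R g x + \<psi> x *\<^sub>R radial_bump_grad r x) = \<psi> x * (x \<bullet> radial_bump_grad r x)"
proof -
  have e: "radial_bump r x * (x \<bullet> g x) = 0"
    using hom_adm_euler[OF h, of x] radial_bump_zero[OF r, of x] r by (cases "x = 0") auto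
  then have e': "radial_bump r x * (g x \<bullet> x) = 0" by (simp add: inner_commute)
  define p where "p = radial_bump_profile_deriv r (norm x)"
  have dg: "radial_bump_grad r x = p *\<^sub>R x" by (simp add: radial_bump_norm p_def)
  show 3: "x \<bullet> (radial_bump r x *\<^sub>R g x + \<psi> x *\<^sub>R radial_bump_grad r x) = \<psi> x * (x \<bullet> radial_bump_grad r x)"
    using e by (simp add: inner_add_right)
  have "(norm (radial_bump r x *\<^sub>R g x + \<psi> x *\<^sub>R radial_bump_grad r x))\<^sup>2 = (radial_bump r x)\<^sup>2 * (g x \<bullet> g x) + (\<psi> x)\<^sup>2 * (radial_bump_grad r x \<bullet> radial_bump_grad r x)
      + 2 * p * \<psi> x * (radial_bump r x * (g x \<bullet> x))"
    unfolding power2_norm_eq_inner dg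
    by (simp add: inner_add_left inner_add_right power2_eq_square algebra_simps inner_commute)
  then show 1: "(norm (radial_bump r x *\<^sub>R g x + \<psi> x *\<^sub>R radial_bump_grad r x))\<^sup>2 = (radial_bump r x)\<^sup>2 * (norm (g x))\<^sup>2 + (\<psi> x)\<^sup>2 * (norm (radial_bump_grad r x))\<^sup>2"
    unfolding e' power2_norm_eq_inner by simp
  show "angular_sq (\<lambda>x. radial_bump r x *\<^sub>R g x + \<psi> x *\<^sub>R radial_bump_grad r x) x = (radial_bump r x)\<^sup>2 * ((norm x)\<^sup>2 * (norm (g x))\<^sup>2)"
    unfolding angular_sq_def 1 3 unfolding dg power2_norm_eq_inner by (simp add: power2_eq_square algebra_simps)
qed

text \<open>The constants do not depend on \<open>\<Sigma>\<close> or \<open>\<psi>\<close>: the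
  angular Rayleigh quotient of \<open>radial_bump r x * \<psi> x\<close> on the cone equals the
  quotient of \<open>\<psi>\<close> on the unit ball, and the purely radial gradient costs a fixed
  multiple of the mass. The real numbers \<open>X\<close> and \<open>Y\<close> also record that the
  ball integrals are finite. The type argument fixes the dimension.\<close>

definition radial_ratios :: "'a::euclidean_space itself \<Rightarrow> real \<Rightarrow> real \<Rightarrow> real \<Rightarrow> bool" where
  "radial_ratios _ r k1 k2 \<longleftrightarrow> k1 > 0 \<and> k2 \<ge> 0 \<and> (\<forall>\<Sigma> (\<psi>::'a \<Rightarrow> real) g. \<Sigma> \<subseteq> sphere 0 1 \<longrightarrow> hom_adm \<Sigma> \<psi> g \<longrightarrow>
    (\<exists>X\<ge>0. \<exists>Y\<ge>0. ball_integral (\<lambda>x. (\<psi> x)\<^sup>2) = ennreal X \<and> ball_integral (\<lambda>x. (norm x)\<^sup>2 * (norm (g x))\<^sup>2) = ennreal Y \<and>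
      (LBINT x. (radial_bump r x * \<psi> x)\<^sup>2) = k1 * X \<and>
      (LBINT x. (radial_bump r x)\<^sup>2 * ((norm x)\<^sup>2 * (norm (g x))\<^sup>2)) = k1 * Y \<and>
      integrable lborel (\<lambda>x. (\<psi> x)\<^sup>2 * (norm (radial_bump_grad r x))\<^sup>2) \<and>
      (LBINT x. (\<psi> x)\<^sup>2 * (norm (radial_bump_grad r x))\<^sup>2) = k2 * X))"

text \<open>The ratios are the squared L^2 norms of the bump and of its gradient, each divided by
  the volume of the unit ball.\<close>

lemma radial_constants:
  assumes r: "r > 0"
  shows "\<exists>k1 k2. radial_ratios TYPE('a::euclidean_space) r k1 k2"
proof -
  define b where "b = enn2real (emeasure lborel (ball (0::'a) 1))"
  have eb: "emeasure lborel (ball (0::'a) 1) = ennreal b"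
    using emeasure_lborel_ball_finite[of "0::'a" 1] by (simp add: b_def less_top)
  have b: "b > 0"
  proof -
    have "(\<integral>\<^sup>+(x::'a). ennreal 1 * indicator (ball 0 1) x \<partial>lborel) > 0"
      by (rule nn_integral_pos_continuous[of _ _ 0]) auto
    then have "emeasure lborel (ball (0::'a) 1) > 0" by simp
    then show ?thesis unfolding eb by (simp add: ennreal_zero_less_mult_iff)
  qed
  note ccg = C1c_C0c[OF C1c_radial_bump[OF r], where ?'a='a]
  define I1 where "I1 = (LBINT x. (radial_bump r (x::'a))\<^sup>2)"
  define I2 where "I2 = (LBINT x. (norm (radial_bump_grad r (x::'a)))\<^sup>2)"
  have e1: "(\<integral>\<^sup>+(x::'a). ennreal ((radial_bump_profile r (norm x))\<^sup>2) \<partial>lborel) = ennreal I1"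
    unfolding I1_def radial_bump_norm(1)[symmetric]
    by (rule nn_integral_eq_integral) (auto intro!: C0c_integrable C0c_intros ccg)
  have e2: "(\<integral>\<^sup>+(x::'a). ennreal ((radial_bump_profile_deriv r (norm x) * norm x)\<^sup>2) \<partial>lborel) = ennreal I2"
  proof -
    have "(radial_bump_profile_deriv r (norm x) * norm x)\<^sup>2 = (norm (radial_bump_grad r x))\<^sup>2" for x :: 'a
      by (simp add: radial_bump_norm power_mult_distrib)
    then show ?thesis unfolding I2_def
      by (simp only:) (rule nn_integral_eq_integral, auto intro!: C0c_integrable C0c_intros ccg)
  qed
  have I1: "I1 > 0"
  proof -
    obtain e :: 'a where e: "norm e = 1" using vector_choose_size[of 1] by auto
    have "radial_bump r ((3/2*r) *\<^sub>R e) > 0"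
    proof -
      have "radial_bump r ((3/2*r) *\<^sub>R e) = (max 0 ((5/4 * r\<^sup>2) * (7/4 * r\<^sup>2)))\<^sup>2"
        using e unfolding radial_bump_def by (simp add: dot_square_norm power2_eq_square algebra_simps)
      moreover have "(5/4 * r\<^sup>2) * (7/4 * r\<^sup>2) > 0" using r by simp
      ultimately show ?thesis by simp
    qed
    then have p: "(radial_bump r ((3/2*r) *\<^sub>R e))\<^sup>2 > 0" by simp
    have "0 < (\<integral>\<^sup>+(x::'a). ennreal ((radial_bump r x)\<^sup>2) * indicator UNIV x \<partial>lborel)"
      by (rule nn_integral_pos_continuous[where f="\<lambda>x. (radial_bump r x)\<^sup>2", OF _ _ _ p]) (simp_all add: C0c_continuous[OF C0c_power2[OF ccg(1)]])
    then show ?thesis using e1 unfolding radial_bump_norm(1)[symmetric] by (simp add: ennreal_zero_less_mult_iff)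
  qed
  have I2: "I2 \<ge> 0" unfolding I2_def by simp
  have meas: "(\<lambda>t. (radial_bump_profile r t)\<^sup>2) \<in> borel_measurable borel" "(\<lambda>t. (radial_bump_profile_deriv r t * t)\<^sup>2) \<in> borel_measurable borel"
    unfolding radial_bump_profile_def radial_bump_profile_deriv_def by measurable
  have kpos: "I1 / b > 0" "I2 / b \<ge> 0" using I1 I2 b by auto
  show ?thesis
    unfolding radial_ratios_def
  proof (rule exI[of _ "I1 / b"], rule exI[of _ "I2 / b"], rule conjI, rule kpos, rule conjI, rule kpos, intro allI impI)
    fix \<Sigma> :: "'a set" and \<psi> :: "'a \<Rightarrow> real" and g
    assume S: "\<Sigma> \<subseteq> sphere 0 1" and h: "hom_adm \<Sigma> \<psi> g"
    obtain K where K: "compact K" "K \<subseteq> \<Sigma>" "\<And>x. sgn x \<notin> K \<Longrightarrow> \<psi> x = 0" using h unfolding hom_adm_def by blast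
    note c = C1c_radial_bump_hom[OF r h S K]
    have hgp: "has_grad \<psi> g (- {0})" using h by (simp add: hom_adm_def)
    have m1[measurable]: "\<psi> \<in> borel_measurable borel" by (rule measurable_punctured[OF has_grad_continuous[OF hgp]])
    have m2[measurable]: "g \<in> borel_measurable borel" by (rule measurable_punctured[OF has_grad_continuous_grad[OF hgp]])
    have [measurable]: "radial_bump r \<in> borel_measurable (borel :: 'a measure)" "radial_bump_grad r \<in> borel_measurable (borel :: 'a measure)"
      using ccg C0c_measurable by blast+
    have hom1: "(\<psi> (sgn x))\<^sup>2 = (\<psi> x)\<^sup>2" for x using h by (simp add: hom_adm_def)
    have hom2: "(norm (sgn x))\<^sup>2 * (norm (g (sgn x)))\<^sup>2 = (norm x)\<^sup>2 * (norm (g x))\<^sup>2" if "x \<noteq> 0" for x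
      using that by (simp add: hom_adm_grad_sgn[OF h] norm_sgn power_mult_distrib)
    \<comment> \<open>Finiteness of the ball integral comes from here: the integral against the
      squared bump is finite, being that of a continuous function with compact support, and the two
      are proportional.\<close>
    have key: "ball_integral H = ennreal (J * b / I1)"
      if [measurable]: "H \<in> borel_measurable borel" and "\<And>x. x \<noteq> 0 \<Longrightarrow> H (sgn x) = H x"
        and J: "(\<integral>\<^sup>+x. ennreal ((radial_bump_profile r (norm x))\<^sup>2 * H x) \<partial>lborel) = ennreal J" "J \<ge> 0" for H :: "'a \<Rightarrow> real" and J
    proof -
      have "ennreal J * ennreal b = ennreal I1 * ball_integral H"
        using ball_integral_of_homogeneous[of H "\<lambda>t. (radial_bump_profile r t)\<^sup>2"] that meas unfolding e1 eb by simp
      then have "ennreal (1 / I1) * (ennreal J * ennreal b) = (ennreal (1 / I1) * ennreal I1) * ball_integral H" by (simp add: mult.assoc)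
      also have "ennreal (1 / I1) * ennreal I1 = 1" using I1 by (subst ennreal_mult[symmetric]) auto
      finally show ?thesis using I1 b J by (simp add: ennreal_mult[symmetric])
    qed
    define J1 where "J1 = (LBINT x. (radial_bump r x * \<psi> x)\<^sup>2)"
    define J2 where "J2 = (LBINT x. (radial_bump r x)\<^sup>2 * ((norm x)\<^sup>2 * (norm (g x))\<^sup>2))"
    have J: "J1 \<ge> 0" "J2 \<ge> 0" unfolding J1_def J2_def by auto
    have "(\<integral>\<^sup>+x. ennreal ((radial_bump_profile r (norm x))\<^sup>2 * (\<psi> x)\<^sup>2) \<partial>lborel) = ennreal J1"
      unfolding J1_def radial_bump_norm(1)[symmetric] power_mult_distrib[symmetric]
      by (rule nn_integral_eq_integral) (auto intro!: C0c_integrable C0c_intros C1c_C0c[OF c])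
    from key[OF _ hom1 this J(1)] have X: "ball_integral (\<lambda>x. (\<psi> x)\<^sup>2) = ennreal (J1 * b / I1)" by simp
    have "integrable lborel (\<lambda>x. (radial_bump r x)\<^sup>2 * ((norm x)\<^sup>2 * (norm (g x))\<^sup>2))"
      unfolding norm_radial_bump_hom(2)[OF h r, symmetric] by (intro C0c_integrable C0c_angular_sq C1c_C0c[OF c])
    then have "(\<integral>\<^sup>+x. ennreal ((radial_bump_profile r (norm x))\<^sup>2 * ((norm x)\<^sup>2 * (norm (g x))\<^sup>2)) \<partial>lborel) = ennreal J2"
      unfolding J2_def radial_bump_norm(1)[symmetric]
      by (rule nn_integral_eq_integral) auto
    from key[OF _ hom2 this J(2)] have Y: "ball_integral (\<lambda>x. (norm x)\<^sup>2 * (norm (g x))\<^sup>2) = ennreal (J2 * b / I1)" by simp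
    have "(\<integral>\<^sup>+x. ennreal ((radial_bump_profile_deriv r (norm x) * norm x)\<^sup>2 * (\<psi> x)\<^sup>2) \<partial>lborel) * ennreal b = ennreal I2 * ennreal (J1 * b / I1)"
      using ball_integral_of_homogeneous[of "\<lambda>x. (\<psi> x)\<^sup>2" "\<lambda>t. (radial_bump_profile_deriv r t * t)\<^sup>2"] meas hom1 unfolding e2 eb X by simp
    then have "((\<integral>\<^sup>+x. ennreal ((radial_bump_profile_deriv r (norm x) * norm x)\<^sup>2 * (\<psi> x)\<^sup>2) \<partial>lborel) * ennreal b) * ennreal (1 / b) = ennreal I2 * ennreal (J1 * b / I1) * ennreal (1 / b)" by simp
    moreover have "ennreal b * ennreal (1 / b) = 1" using b by (subst ennreal_mult[symmetric]) auto
    ultimately have "(\<integral>\<^sup>+x. ennreal ((radial_bump_profile_deriv r (norm x) * norm x)\<^sup>2 * (\<psi> x)\<^sup>2) \<partial>lborel) = ennreal I2 * ennreal (J1 * b / I1) * ennreal (1 / b)"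
      by (simp add: mult.assoc)
    also have "\<dots> = ennreal (I2 / b * (J1 * b / I1))"
      using I1 I2 J b by (simp add: ennreal_mult[symmetric])
    also have "(\<lambda>x. ennreal ((radial_bump_profile_deriv r (norm x) * norm x)\<^sup>2 * (\<psi> x)\<^sup>2)) = (\<lambda>x. ennreal ((\<psi> x)\<^sup>2 * (norm (radial_bump_grad r x))\<^sup>2))"
      by (simp add: radial_bump_norm power_mult_distrib mult_ac)
    finally have Z: "(\<integral>\<^sup>+x. ennreal ((\<psi> x)\<^sup>2 * (norm (radial_bump_grad r x))\<^sup>2) \<partial>lborel) = ennreal (I2 / b * (J1 * b / I1))" .
    have Zp: "I2 / b * (J1 * b / I1) \<ge> 0" using I1 I2 J b by simp
    have intZ: "integrable lborel (\<lambda>x. (\<psi> x)\<^sup>2 * (norm (radial_bump_grad r x))\<^sup>2)"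
      by (rule integrableI_nonneg) (auto simp: Z)
    have ZZ: "(LBINT x. (\<psi> x)\<^sup>2 * (norm (radial_bump_grad r x))\<^sup>2) = I2 / b * (J1 * b / I1)"
      by (rule integral_eq_nn_integral[THEN trans]) (use Z Zp in auto)
    have f: "J1 * b / I1 \<ge> 0" "J2 * b / I1 \<ge> 0" "J1 = I1 / b * (J1 * b / I1)" "J2 = I1 / b * (J2 * b / I1)"
      using I1 J b by auto
    show "\<exists>X\<ge>0. \<exists>Y\<ge>0. ball_integral (\<lambda>x. (\<psi> x)\<^sup>2) = ennreal X \<and> ball_integral (\<lambda>x. (norm x)\<^sup>2 * (norm (g x))\<^sup>2) = ennreal Y \<and>
      (LBINT x. (radial_bump r x * \<psi> x)\<^sup>2) = I1 / b * X \<and>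
      (LBINT x. (radial_bump r x)\<^sup>2 * ((norm x)\<^sup>2 * (norm (g x))\<^sup>2)) = I1 / b * Y \<and>
      integrable lborel (\<lambda>x. (\<psi> x)\<^sup>2 * (norm (radial_bump_grad r x))\<^sup>2) \<and>
      (LBINT x. (\<psi> x)\<^sup>2 * (norm (radial_bump_grad r x))\<^sup>2) = I2 / b * X"
      by (rule exI[of _ "J1 * b / I1"], rule conjI, rule f, rule exI[of _ "J2 * b / I1"])
         (intro conjI f X Y ZZ intZ f(3)[unfolded J1_def] f(4)[unfolded J2_def], (simp_all add: J1_def[symmetric] J2_def[symmetric] I1 b less_imp_neq[OF I1, symmetric] less_imp_neq[OF b, symmetric]))
  qed
qed

lemma radial_ratiosE:
  assumes "radial_ratios TYPE('a) r k1 k2" "\<Sigma> \<subseteq> sphere 0 1" "hom_adm \<Sigma> (\<psi> :: 'a::euclidean_space \<Rightarrow> real) g"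
  obtains X Y where "X \<ge> 0" "Y \<ge> 0" "ball_integral (\<lambda>x. (\<psi> x)\<^sup>2) = ennreal X" "ball_integral (\<lambda>x. (norm x)\<^sup>2 * (norm (g x))\<^sup>2) = ennreal Y"
      "(LBINT x. (radial_bump r x * \<psi> x)\<^sup>2) = k1 * X"
      "(LBINT x. (radial_bump r x)\<^sup>2 * ((norm x)\<^sup>2 * (norm (g x))\<^sup>2)) = k1 * Y"
      "integrable lborel (\<lambda>x. (\<psi> x)\<^sup>2 * (norm (radial_bump_grad r x))\<^sup>2)"
      "(LBINT x. (\<psi> x)\<^sup>2 * (norm (radial_bump_grad r x))\<^sup>2) = k2 * X"
proof -
  from assms(1) have "\<forall>\<Sigma> (\<psi>::'a \<Rightarrow> real) g. \<Sigma> \<subseteq> sphere 0 1 \<longrightarrow> hom_adm \<Sigma> \<psi> g \<longrightarrow>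
    (\<exists>X\<ge>0. \<exists>Y\<ge>0. ball_integral (\<lambda>x. (\<psi> x)\<^sup>2) = ennreal X \<and> ball_integral (\<lambda>x. (norm x)\<^sup>2 * (norm (g x))\<^sup>2) = ennreal Y \<and>
      (LBINT x. (radial_bump r x * \<psi> x)\<^sup>2) = k1 * X \<and>
      (LBINT x. (radial_bump r x)\<^sup>2 * ((norm x)\<^sup>2 * (norm (g x))\<^sup>2)) = k1 * Y \<and>
      integrable lborel (\<lambda>x. (\<psi> x)\<^sup>2 * (norm (radial_bump_grad r x))\<^sup>2) \<and>
      (LBINT x. (\<psi> x)\<^sup>2 * (norm (radial_bump_grad r x))\<^sup>2) = k2 * X)"
    unfolding radial_ratios_def by (elim conjE)
  from this[rule_format, OF assms(2,3)] show ?thesis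
    by (elim exE conjE) (rule that)
qed

lemma sphere_openin_cone_open:
  fixes \<Sigma> :: "'a::euclidean_space set"
  assumes "openin (top_of_set (sphere 0 1)) \<Sigma>"
  shows "open {x. x \<noteq> 0 \<and> sgn x \<in> \<Sigma>}"
proof -
  obtain U where U: "open U" "\<Sigma> = sphere 0 1 \<inter> U" using assms by (auto simp: openin_open)
  have "open ((- {0}) \<inter> sgn -` U)"
    by (rule continuous_open_preimage[OF continuous_on_sgn _ U(1)]) auto
  moreover have "{x. x \<noteq> 0 \<and> sgn x \<in> \<Sigma>} = (- {0}) \<inter> sgn -` U" using U by (auto simp: norm_sgn)
  ultimately show ?thesis by simp
qed

text \<open>By inner regularity a closed \<open>T\<close> exhausts the annular cone \<open>W\<close>
  up to small measure. A function with directions outside \<open>K\<close> lifts to one supported in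
  \<open>W - T\<close>, to which \<open>small_support_poincare\<close> applies; the boundary of
  \<open>\<Sigma>\<close> is never examined.\<close>

lemma exists_compact_angular_poincare_complement:
  fixes \<Sigma> :: "'a::euclidean_space set"
  assumes S: "openin (top_of_set (sphere 0 1)) \<Sigma>" and lam: "lam > 0"
  shows "\<exists>K. compact K \<and> K \<subseteq> \<Sigma> \<and> angular_poincare (\<Sigma> - K) lam"
proof -
  have Ss: "\<Sigma> \<subseteq> sphere 0 1" using openin_imp_subset[OF S] by simp
  \<comment> \<open>With inner radius 1, \<open>norm (g x)\<close> is at most
    \<open>norm x * norm (g x)\<close> wherever the bump is nonzero.\<close>
  define r :: real where "r = 1"
  have r: "r > 0" by (simp add: r_def)
  obtain k1 k2 where kk: "radial_ratios TYPE('a) r k1 k2" using radial_constants[OF r] by blast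
  then have k: "k1 > 0" "k2 \<ge> 0" by (simp_all add: radial_ratios_def)
  \<comment> \<open>The bound \<open>k1 / (8 * k2 + 1)\<close> absorbs the radial part of the
    gradient into half of the left side, and \<open>1 / (8 * lam)\<close> then produces the constant
    \<open>lam\<close>.\<close>
  define d2 where "d2 = min (k1 / (8 * k2 + 1)) (1 / (8 * lam))"
  have d2: "d2 > 0" using k lam by (auto simp: d2_def)
  define \<delta> where "\<delta> = sqrt d2"
  have \<delta>: "\<delta> > 0" "\<delta>\<^sup>2 = d2" using d2 by (auto simp: \<delta>_def)
  define W where "W = {x. x \<noteq> 0 \<and> sgn x \<in> \<Sigma>} \<inter> (ball 0 (2*r + 1) - cball 0 (r/2))"
  have W: "open W" unfolding W_def by (intro open_Int open_Diff sphere_openin_cone_open S) auto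
  have epos: "emeasure lborel (ball (0::'a) \<delta>) > 0"
  proof -
    have "(\<integral>\<^sup>+(x::'a). ennreal 1 * indicator (ball 0 \<delta>) x \<partial>lborel) > 0"
      by (rule nn_integral_pos_continuous[of _ _ 0]) (use \<delta> in auto)
    then show ?thesis by simp
  qed
  define e where "e = enn2real (emeasure lborel (ball (0::'a) \<delta>))"
  have e: "emeasure lborel (ball (0::'a) \<delta>) = ennreal e" "e > 0"
  proof -
    show 1: "emeasure lborel (ball (0::'a) \<delta>) = ennreal e"
      using emeasure_lborel_ball_finite[of "0::'a" \<delta>] by (simp add: e_def less_top)
    show "e > 0" using epos unfolding 1 by simp
  qed
  have Wl: "W \<in> sets lebesgue" using W by (intro sets_completionI_sets) simp
  have e4: "e / 4 > 0" using e(2) by simp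
  obtain T where T: "closed T" "T \<subseteq> W" "emeasure lebesgue (W - T) < ennreal (e / 4)"
    by (rule sets_lebesgue_inner_closed[OF Wl e4])
  have "bounded T" by (rule bounded_subset[OF bounded_ball[of 0 "2*r+1"]]) (use T(2) W_def in blast)
  then have cT: "compact T" using T(1) by (simp add: compact_eq_bounded_closed)
  have T0: "T \<subseteq> - {0}" using T(2) W_def by blast
  \<comment> \<open>Every point of \<open>T\<close> has its direction in \<open>K\<close>, so
    whatever vanishes over \<open>K\<close> vanishes on \<open>T\<close>.\<close>
  define K where "K = sgn ` T"
  have K: "compact K" "K \<subseteq> \<Sigma>"
  proof -
    show "compact K" unfolding K_def by (rule compact_continuous_image[OF continuous_on_subset[OF continuous_on_sgn T0] cT])
    show "K \<subseteq> \<Sigma>" using T(2) unfolding K_def W_def by blast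
  qed
  define A where "A = W - T"
  have A: "A \<in> sets borel" unfolding A_def using W T(1) by (intro sets.Diff) auto
  have "emeasure lborel A < ennreal (e / 4)"
    using T(3) A unfolding A_def by (simp add: emeasure_completion)
  then have "4 * emeasure lborel A \<le> 4 * ennreal (e / 4)" by (intro mult_left_mono) auto
  also have "\<dots> = ennreal (4 * (e / 4))" using e(2) by (subst ennreal_mult) auto
  finally have small: "4 * emeasure lborel A \<le> emeasure lborel (ball (0::'a) \<delta>)" unfolding e(1) by simp
  have "angular_poincare (\<Sigma> - K) lam"
    unfolding angular_poincare_def
  proof (intro allI impI)
    fix \<psi> g assume h: "hom_adm (\<Sigma> - K) \<psi> g"
    have SK: "\<Sigma> - K \<subseteq> sphere 0 1" using Ss by auto
    obtain K' where K': "compact K'" "K' \<subseteq> \<Sigma> - K" "\<And>x. sgn x \<notin> K' \<Longrightarrow> \<psi> x = 0" using h unfolding hom_adm_def by blast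
    note c = C1c_radial_bump_hom[OF r h SK K']
    note ccs = C1c_C0c[OF c]
    obtain X Y where XY: "X \<ge> 0" "Y \<ge> 0" "ball_integral (\<lambda>x. (\<psi> x)\<^sup>2) = ennreal X" "ball_integral (\<lambda>x. (norm x)\<^sup>2 * (norm (g x))\<^sup>2) = ennreal Y"
      "(LBINT x. (radial_bump r x * \<psi> x)\<^sup>2) = k1 * X"
      "(LBINT x. (radial_bump r x)\<^sup>2 * ((norm x)\<^sup>2 * (norm (g x))\<^sup>2)) = k1 * Y"
      "integrable lborel (\<lambda>x. (\<psi> x)\<^sup>2 * (norm (radial_bump_grad r x))\<^sup>2)"
      "(LBINT x. (\<psi> x)\<^sup>2 * (norm (radial_bump_grad r x))\<^sup>2) = k2 * X"
      by (rule radial_ratiosE[OF kk SK h])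
    have "(LBINT x. (radial_bump r x * \<psi> x)\<^sup>2) \<le> 4 * \<delta>\<^sup>2 * (LBINT x. (norm (radial_bump r x *\<^sub>R g x + \<psi> x *\<^sub>R radial_bump_grad r x))\<^sup>2)"
    proof (rule small_support_poincare[OF C1c_mono[OF c] A _ \<delta>(1) small])
      fix x assume "x \<notin> A"
      show "radial_bump r x * \<psi> x = 0"
      proof (rule ccontr)
        assume "radial_bump r x * \<psi> x \<noteq> 0"
        then have "norm x \<in> {r..2*r}" "sgn x \<in> K'" using radial_bump_zero[OF r, of x] K'(3)[of x] by auto
        then have "x \<in> W" "sgn x \<notin> K" using K'(2) r by (auto simp: W_def)
        then show False using \<open>x \<notin> A\<close> by (auto simp: A_def K_def)
      qed
    qed auto
    also have "(LBINT x. (norm (radial_bump r x *\<^sub>R g x + \<psi> x *\<^sub>R radial_bump_grad r x))\<^sup>2) \<le> (LBINT x. (radial_bump r x)\<^sup>2 * ((norm x)\<^sup>2 * (norm (g x))\<^sup>2) + (\<psi> x)\<^sup>2 * (norm (radial_bump_grad r x))\<^sup>2)"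
    proof (rule integral_mono)
      show "integrable lborel (\<lambda>x. (norm (radial_bump r x *\<^sub>R g x + \<psi> x *\<^sub>R radial_bump_grad r x))\<^sup>2)"
        by (intro C0c_integrable C0c_intros ccs)
      have "integrable lborel (\<lambda>x. (radial_bump r x)\<^sup>2 * ((norm x)\<^sup>2 * (norm (g x))\<^sup>2))"
        unfolding norm_radial_bump_hom(2)[OF h r, symmetric] by (intro C0c_integrable C0c_angular_sq ccs)
      then show "integrable lborel (\<lambda>x. (radial_bump r x)\<^sup>2 * ((norm x)\<^sup>2 * (norm (g x))\<^sup>2) + (\<psi> x)\<^sup>2 * (norm (radial_bump_grad r x))\<^sup>2)"
        using XY(7) by (rule Bochner_Integration.integrable_add)
      fix x :: 'a
      have "(radial_bump r x)\<^sup>2 * (norm (g x))\<^sup>2 \<le> (radial_bump r x)\<^sup>2 * ((norm x)\<^sup>2 * (norm (g x))\<^sup>2)"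
      proof (cases "radial_bump r x = 0")
        case False
        then have "1 \<le> norm x" using radial_bump_zero[OF r, of x] by (auto simp: r_def)
        then have "1 \<le> (norm x)\<^sup>2" by simp
        then have "1 * (norm (g x))\<^sup>2 \<le> (norm x)\<^sup>2 * (norm (g x))\<^sup>2" by (intro mult_right_mono) auto
        then show ?thesis by (intro mult_left_mono) auto
      qed simp
      then show "(norm (radial_bump r x *\<^sub>R g x + \<psi> x *\<^sub>R radial_bump_grad r x))\<^sup>2 \<le> (radial_bump r x)\<^sup>2 * ((norm x)\<^sup>2 * (norm (g x))\<^sup>2) + (\<psi> x)\<^sup>2 * (norm (radial_bump_grad r x))\<^sup>2"
        unfolding norm_radial_bump_hom(1)[OF h r] by simp
    qed
    also have "\<dots> = k1 * Y + k2 * X"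
    proof -
      have "integrable lborel (\<lambda>x. (radial_bump r x)\<^sup>2 * ((norm x)\<^sup>2 * (norm (g x))\<^sup>2))"
        unfolding norm_radial_bump_hom(2)[OF h r, symmetric] by (intro C0c_integrable C0c_angular_sq ccs)
      then show ?thesis using XY by simp
    qed
    finally have "k1 * X \<le> 4 * d2 * (k1 * Y + k2 * X)"
      using XY \<delta> d2 by (simp add: mult_left_mono)
    moreover have "4 * d2 * k2 \<le> k1 / 2"
    proof -
      have "d2 \<le> k1 / (8 * k2 + 1)" by (simp add: d2_def)
      then have "d2 * (8 * k2 + 1) \<le> k1" using k by (simp add: field_simps)
      then show ?thesis using d2 by (simp add: algebra_simps)
    qed
    then have "4 * d2 * k2 * X \<le> k1 / 2 * X" using XY by (intro mult_right_mono) auto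
    moreover have "4 * d2 * lam \<le> 1 / 2"
    proof -
      have "d2 \<le> 1 / (8 * lam)" by (simp add: d2_def)
      then show ?thesis using lam by (simp add: field_simps)
    qed
    then have "4 * d2 * lam * (k1 * Y) \<le> 1 / 2 * (k1 * Y)" using XY k by (intro mult_right_mono) auto
    ultimately have 1: "k1 * X / 2 \<le> 4 * d2 * (k1 * Y)" by (simp add: algebra_simps)
    have "k1 * (lam * X) \<le> k1 * Y"
    proof -
      have "lam * (k1 * X / 2) \<le> lam * (4 * d2 * (k1 * Y))" using 1 lam by (intro mult_left_mono) auto
      then show ?thesis using \<open>4 * d2 * lam * (k1 * Y) \<le> 1 / 2 * (k1 * Y)\<close> by (simp add: algebra_simps)
    qed
    then have "lam * X \<le> Y" using k by simp
    then show "ennreal lam * ball_integral (\<lambda>x. (\<psi> x)\<^sup>2) \<le> ball_integral (\<lambda>x. (norm x)\<^sup>2 * (norm (g x))\<^sup>2)"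
      unfolding XY(3,4) using lam XY by (simp add: ennreal_mult[symmetric] ennreal_leI)
  qed
  then show ?thesis using K by blast
qed

section \<open>Test functions built from the logarithm of a supersolution\<close>

text \<open>The polarization of \<open>angular_sq\<close>, a positive semidefinite form at each
  point.\<close>

definition angular_prod :: "('a::euclidean_space \<Rightarrow> 'a) \<Rightarrow> ('a \<Rightarrow> 'a) \<Rightarrow> 'a \<Rightarrow> real" where
  "angular_prod g h x = (norm x)\<^sup>2 * (g x \<bullet> h x) - (x \<bullet> g x) * (x \<bullet> h x)"

lemma C0c_angular_prod: "C0c g \<Longrightarrow> continuous_on UNIV h \<Longrightarrow> C0c (angular_prod g h)"
  unfolding angular_prod_def[abs_def] by (intro C0c_intros continuous_intros) (auto intro!: continuous_intros)

lemma angular_sq_lincomb: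
  "angular_sq (\<lambda>x. a x *\<^sub>R g x + b x *\<^sub>R h x) x = (a x)\<^sup>2 * angular_sq g x + 2 * a x * b x * angular_prod g h x + (b x)\<^sup>2 * angular_sq h x"
  unfolding angular_sq_def angular_prod_def power2_norm_eq_inner
  by (simp add: inner_add_left inner_add_right power2_eq_square algebra_simps inner_commute)

lemma angular_prod_lincomb: "angular_prod g (\<lambda>x. a x *\<^sub>R g x + b x *\<^sub>R h x) x = a x * angular_sq g x + b x * angular_prod g h x"
  unfolding angular_sq_def angular_prod_def power2_norm_eq_inner
  by (simp add: inner_add_left inner_add_right power2_eq_square algebra_simps inner_commute)

lemma angular_sq_add_le: "angular_sq (\<lambda>x. a x *\<^sub>R g x + b x *\<^sub>R h x) x \<le> 2 * (a x)\<^sup>2 * angular_sq g x + 2 * (b x)\<^sup>2 * angular_sq h x"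
proof -
  have "0 \<le> angular_sq (\<lambda>x. a x *\<^sub>R g x + (- b x) *\<^sub>R h x) x" by (rule angular_sq_nonneg)
  then show ?thesis unfolding angular_sq_lincomb by (simp add: algebra_simps)
qed

lemma angular_prod_young: "2 * t * angular_prod g h x \<le> angular_sq g x + t\<^sup>2 * angular_sq h x"
proof -
  have "0 \<le> angular_sq (\<lambda>x. 1 *\<^sub>R g x + (- t) *\<^sub>R h x) x" by (rule angular_sq_nonneg)
  then show ?thesis unfolding angular_sq_lincomb by simp
qed

lemma C1c_lincomb:
  assumes f: "C1c \<Omega> f g" and f': "C1c \<Omega> f' g'"
  shows "C1c \<Omega> (\<lambda>x. a * f x + b * f' x) (\<lambda>x. a *\<^sub>R g x + b *\<^sub>R g' x)"
proof -
  obtain K where K: "compact K" "K \<subseteq> \<Omega>" "\<And>x. x \<notin> K \<Longrightarrow> f x = 0" "has_grad f g UNIV" using C1cE[OF f] by metis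
  obtain K' where K': "compact K'" "K' \<subseteq> \<Omega>" "\<And>x. x \<notin> K' \<Longrightarrow> f' x = 0" "has_grad f' g' UNIV" using C1cE[OF f'] by metis
  show ?thesis
  proof (rule C1cI)
    show "has_grad (\<lambda>x. a * f x + b * f' x) (\<lambda>x. a *\<^sub>R g x + b *\<^sub>R g' x) UNIV"
      unfolding has_grad_def
    proof (intro conjI ballI)
      fix x
      have "((\<lambda>x. a * f x + b * f' x) has_derivative (\<lambda>h. a * (g x \<bullet> h) + b * (g' x \<bullet> h))) (at x)"
        by (intro has_derivative_add has_derivative_mult_right has_gradD[OF K(4)] has_gradD[OF K'(4)]) auto
      then show "((\<lambda>x. a * f x + b * f' x) has_derivative (\<bullet>) (a *\<^sub>R g x + b *\<^sub>R g' x)) (at x)"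
        by (rule has_derivative_eq_rhs) (auto simp: fun_eq_iff inner_add_left)
    qed (intro continuous_intros has_grad_continuous_grad[OF K(4)] has_grad_continuous_grad[OF K'(4)])
    show "compact (K \<union> K')" using K K' by (intro compact_Un)
  qed (use K K' in auto)
qed

text \<open>The form \<open>angular energy - lam * square integral\<close> is nonnegative; its value
  at \<open>\<Phi> - \<sigma> \<xi>\<close> bounds the first variation at \<open>\<Phi>\<close>.
  This is Cauchy-Schwarz for the form, written with a free parameter
  \<open>\<sigma>\<close>.\<close>

lemma near_minimizer_almost_critical:
  assumes ap: "angular_poincare \<Sigma> lam" and lam: "lam \<ge> 0" and S: "\<Sigma> \<subseteq> sphere 0 1"
    and \<Phi>: "C1c (cone_of \<Sigma>) \<Phi> g" and \<xi>: "C1c (cone_of \<Sigma>) \<xi> h"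
    and e: "(LBINT x. angular_sq g x) - lam * (LBINT x. (\<Phi> x)\<^sup>2) \<le> e" and \<sigma>: "\<sigma> > 0"
  shows "(LBINT x. angular_prod g h x) - lam * (LBINT x. \<Phi> x * \<xi> x) \<le> e / (2 * \<sigma>) + \<sigma> / 2 * (LBINT x. angular_sq h x)"
proof -
  note c\<Phi> = C1c_C0c[OF \<Phi>] and c\<xi> = C1c_C0c[OF \<xi>]
  have cont: "continuous_on UNIV \<Phi>" "continuous_on UNIV \<xi>" "continuous_on UNIV h"
    using c\<Phi> c\<xi> C0c_continuous by blast+
  have i: "integrable lborel (angular_sq g)" "integrable lborel (angular_sq h)" "integrable lborel (angular_prod g h)"
    "integrable lborel (\<lambda>x. (\<Phi> x)\<^sup>2)" "integrable lborel (\<lambda>x. \<Phi> x * \<xi> x)" "integrable lborel (\<lambda>x. (\<xi> x)\<^sup>2)"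
    by (intro C0c_integrable C0c_angular_sq C0c_angular_prod C0c_intros c\<Phi> c\<xi> cont)+
  have "lam * (LBINT x. (1 * \<Phi> x + (- \<sigma>) * \<xi> x)\<^sup>2) \<le> (LBINT x. angular_sq (\<lambda>x. 1 *\<^sub>R g x + (- \<sigma>) *\<^sub>R h x) x)"
    by (rule angular_poincare_cone[OF ap lam S C1c_lincomb[OF \<Phi> \<xi>]])
  also have "(LBINT x. angular_sq (\<lambda>x. 1 *\<^sub>R g x + (- \<sigma>) *\<^sub>R h x) x) = (LBINT x. angular_sq g x) - 2 * \<sigma> * (LBINT x. angular_prod g h x) + \<sigma>\<^sup>2 * (LBINT x. angular_sq h x)"
    unfolding angular_sq_lincomb using i by simp
  also have "(\<lambda>x. (1 * \<Phi> x + (- \<sigma>) * \<xi> x)\<^sup>2) = (\<lambda>x. (\<Phi> x)\<^sup>2 - 2 * \<sigma> * (\<Phi> x * \<xi> x) + \<sigma>\<^sup>2 * (\<xi> x)\<^sup>2)"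
    by (simp add: fun_eq_iff power2_eq_square algebra_simps)
  also have "(LBINT x. (\<Phi> x)\<^sup>2 - 2 * \<sigma> * (\<Phi> x * \<xi> x) + \<sigma>\<^sup>2 * (\<xi> x)\<^sup>2)
     = (LBINT x. (\<Phi> x)\<^sup>2) - 2 * \<sigma> * (LBINT x. \<Phi> x * \<xi> x) + \<sigma>\<^sup>2 * (LBINT x. (\<xi> x)\<^sup>2)"
    using i by simp
  finally have 1: "lam * ((LBINT x. (\<Phi> x)\<^sup>2) - 2 * \<sigma> * (LBINT x. \<Phi> x * \<xi> x) + \<sigma>\<^sup>2 * (LBINT x. (\<xi> x)\<^sup>2))
     \<le> (LBINT x. angular_sq g x) - 2 * \<sigma> * (LBINT x. angular_prod g h x) + \<sigma>\<^sup>2 * (LBINT x. angular_sq h x)" .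
  have "lam * (\<sigma>\<^sup>2 * (LBINT x. (\<xi> x)\<^sup>2)) \<ge> 0" using lam by simp
  then have "2 * \<sigma> * ((LBINT x. angular_prod g h x) - lam * (LBINT x. \<Phi> x * \<xi> x)) \<le> e + \<sigma>\<^sup>2 * (LBINT x. angular_sq h x)"
    using 1 e by (simp add: algebra_simps)
  then have "((LBINT x. angular_prod g h x) - lam * (LBINT x. \<Phi> x * \<xi> x)) \<le> (e + \<sigma>\<^sup>2 * (LBINT x. angular_sq h x)) / (2 * \<sigma>)"
    using \<sigma> by (simp add: pos_le_divide_eq mult.commute)
  also have "\<dots> = e / (2 * \<sigma>) + \<sigma> / 2 * (LBINT x. angular_sq h x)"
    using \<sigma> by (simp add: add_divide_distrib power2_eq_square)
  finally show ?thesis .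
qed

lemma C1c_times_compose:
  assumes \<Phi>: "C1c \<Omega> \<Phi> g" and L: "has_grad L gL UNIV"
    and d: "\<And>t. (\<theta> has_real_derivative \<theta>' t) (at t)" and c: "continuous_on UNIV \<theta>'"
  shows "C1c \<Omega> (\<lambda>x. \<Phi> x * \<theta> (L x)) (\<lambda>x. \<theta> (L x) *\<^sub>R g x + (\<Phi> x * \<theta>' (L x)) *\<^sub>R gL x)"
proof -
  have cL: "continuous_on UNIV L" by (rule has_grad_continuous[OF L])
  have "has_grad (\<lambda>x. \<theta> (L x)) (\<lambda>x. \<theta>' (L x) *\<^sub>R gL x) UNIV"
    by (rule has_grad_compose[OF L d continuous_on_compose2[OF c cL]]) auto
  from C1c_mult_right[OF \<Phi> this] show ?thesis by (simp add: add.commute)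
qed

text \<open>The excess energy of \<open>\<Phi> \<theta>(L)\<close> is the integral of
  \<open>\<Phi>^2 \<theta>'(L)^2\<close> times the angular square of the gradient of
  \<open>L\<close>, plus the first variation of the excess at \<open>\<Phi>\<close> in the direction
  \<open>\<Phi> \<theta>(L)^2\<close>. The former is controlled by \<open>A\<close>, the latter by
  near-minimality, even though no Euler-Lagrange equation holds.\<close>

lemma cutoff_energy:
  assumes ap: "angular_poincare \<Sigma> lam" and lam: "lam \<ge> 0" and S: "\<Sigma> \<subseteq> sphere 0 1"
    and \<Phi>: "C1c (cone_of \<Sigma>) \<Phi> g" and L: "has_grad L gL UNIV"
    and e: "(LBINT x. angular_sq g x) - lam * (LBINT x. (\<Phi> x)\<^sup>2) \<le> e" and \<sigma>: "\<sigma> > 0"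
    and d: "\<And>t. (\<theta> has_real_derivative \<theta>' t) (at t)" and c: "continuous_on UNIV \<theta>'"
    and l: "\<And>t. \<bar>\<theta>' t\<bar> \<le> l" and B: "\<And>t. \<bar>\<theta> t\<bar> \<le> B"
    and P: "(LBINT x. angular_sq g x) \<le> P" and A: "(LBINT x. (\<Phi> x)\<^sup>2 * angular_sq gL x) \<le> A"
  shows "(LBINT x. angular_sq (\<lambda>x. \<theta> (L x) *\<^sub>R g x + (\<Phi> x * \<theta>' (L x)) *\<^sub>R gL x) x) - lam * (LBINT x. (\<Phi> x * \<theta> (L x))\<^sup>2)
     \<le> l\<^sup>2 * A + e / (2 * \<sigma>) + \<sigma> * (B ^ 4 * P + 4 * B\<^sup>2 * l\<^sup>2 * A)"
proof -
  let ?\<theta> = "\<lambda>x. \<theta> (L x)" and ?\<theta>' = "\<lambda>x. \<theta>' (L x)"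
  have l0: "l \<ge> 0" using l[of 0] by linarith
  have B0: "B \<ge> 0" using B[of 0] by linarith
  have c\<theta>: "continuous_on UNIV \<theta>" using d by (meson DERIV_isCont continuous_at_imp_continuous_on)
  have cL: "continuous_on UNIV L" by (rule has_grad_continuous[OF L])
  have cgL: "continuous_on UNIV gL" by (rule has_grad_continuous_grad[OF L])
  have ct: "continuous_on UNIV ?\<theta>" "continuous_on UNIV ?\<theta>'"
    by (rule continuous_on_compose2[OF c\<theta> cL], simp, rule continuous_on_compose2[OF c cL], simp)
  note c\<Phi> = C1c_C0c[OF \<Phi>]
  have cont: "continuous_on UNIV \<Phi>" "continuous_on UNIV g" using c\<Phi> C0c_continuous by blast+
  have h: "C1c (cone_of \<Sigma>) (\<lambda>x. \<Phi> x * ?\<theta> x) (\<lambda>x. ?\<theta> x *\<^sub>R g x + (\<Phi> x * ?\<theta>' x) *\<^sub>R gL x)"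
    by (rule C1c_times_compose[OF \<Phi> L d c])
  have dsq: "((\<lambda>t. (\<theta> t)\<^sup>2) has_real_derivative 2 * \<theta> t * \<theta>' t) (at t)" for t
    by (rule derivative_eq_intros d refl)+ simp
  have \<xi>: "C1c (cone_of \<Sigma>) (\<lambda>x. \<Phi> x * (?\<theta> x)\<^sup>2) (\<lambda>x. (?\<theta> x)\<^sup>2 *\<^sub>R g x + (\<Phi> x * (2 * ?\<theta> x * ?\<theta>' x)) *\<^sub>R gL x)"
    by (rule C1c_times_compose[OF \<Phi> L dsq]) (intro continuous_intros c c\<theta>)
  let ?h = "\<lambda>x. ?\<theta> x *\<^sub>R g x + (\<Phi> x * ?\<theta>' x) *\<^sub>R gL x"
  let ?k = "\<lambda>x. (?\<theta> x)\<^sup>2 *\<^sub>R g x + (\<Phi> x * (2 * ?\<theta> x * ?\<theta>' x)) *\<^sub>R gL x"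
  have casq: "continuous_on UNIV (angular_sq gL)" unfolding angular_sq_def[abs_def] by (intro continuous_intros cgL)
  have i: "integrable lborel (angular_sq ?h)" "integrable lborel (\<lambda>x. (\<Phi> x * ?\<theta> x)\<^sup>2)" "integrable lborel (angular_prod g ?k)" "integrable lborel (angular_sq ?k)"
     "integrable lborel (\<lambda>x. \<Phi> x * (\<Phi> x * (?\<theta> x)\<^sup>2))"
     "integrable lborel (\<lambda>x. (\<Phi> x)\<^sup>2 * angular_sq gL x)" "integrable lborel (angular_sq g)"
     "integrable lborel (\<lambda>x. (\<Phi> x)\<^sup>2 * angular_sq gL x * (?\<theta>' x)\<^sup>2)"
    by (intro C0c_integrable C0c_angular_sq C0c_angular_prod C0c_intros C1c_C0c[OF h] C1c_C0c[OF \<xi>] c\<Phi> C0c_continuous[OF C1c_C0c(2)[OF \<xi>]] C0c_continuous[OF C1c_C0c(1)[OF \<xi>]] casq cont ct continuous_intros)+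
  have "(LBINT x. angular_sq ?h x) - lam * (LBINT x. (\<Phi> x * ?\<theta> x)\<^sup>2)
     = (LBINT x. angular_sq ?h x - lam * (\<Phi> x * ?\<theta> x)\<^sup>2)" using i by simp
  \<comment> \<open>The pointwise localization identity: the cross terms of the square of the
    product rule are exactly those of the first variation in the direction
    \<open>\<Phi> \<theta>^2\<close>.\<close>
  also have "\<dots> = (LBINT x. (\<Phi> x)\<^sup>2 * angular_sq gL x * (?\<theta>' x)\<^sup>2 + (angular_prod g ?k x - lam * (\<Phi> x * (\<Phi> x * (?\<theta> x)\<^sup>2))))"
    by (rule Bochner_Integration.integral_cong[OF refl], unfold angular_sq_lincomb angular_prod_lincomb) (simp add: power2_eq_square algebra_simps)
  also have "\<dots> = (LBINT x. (\<Phi> x)\<^sup>2 * angular_sq gL x * (?\<theta>' x)\<^sup>2) + ((LBINT x. angular_prod g ?k x) - lam * (LBINT x. \<Phi> x * (\<Phi> x * (?\<theta> x)\<^sup>2)))"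
    using i by simp
  also have "\<dots> \<le> l\<^sup>2 * A + (e / (2 * \<sigma>) + \<sigma> / 2 * (LBINT x. angular_sq ?k x))"
  proof (rule add_mono)
    have "(LBINT x. (\<Phi> x)\<^sup>2 * angular_sq gL x * (?\<theta>' x)\<^sup>2) \<le> (LBINT x. (\<Phi> x)\<^sup>2 * angular_sq gL x * l\<^sup>2)"
    proof (rule integral_mono)
      fix x show "(\<Phi> x)\<^sup>2 * angular_sq gL x * (?\<theta>' x)\<^sup>2 \<le> (\<Phi> x)\<^sup>2 * angular_sq gL x * l\<^sup>2"
        using l[of "L x"] l0 angular_sq_nonneg[of gL x] by (intro mult_left_mono) (auto simp: abs_le_square_iff[symmetric])
    qed (use i in auto)
    also have "\<dots> = l\<^sup>2 * (LBINT x. (\<Phi> x)\<^sup>2 * angular_sq gL x)" by simp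
    also have "\<dots> \<le> l\<^sup>2 * A" by (rule mult_left_mono[OF A]) simp
    finally show "(LBINT x. (\<Phi> x)\<^sup>2 * angular_sq gL x * (?\<theta>' x)\<^sup>2) \<le> l\<^sup>2 * A" .
  qed (rule near_minimizer_almost_critical[OF ap lam S \<Phi> \<xi> e \<sigma>])
  also have "(LBINT x. angular_sq ?k x) \<le> 2 * B ^ 4 * P + 8 * B\<^sup>2 * l\<^sup>2 * A"
  proof -
    have "(LBINT x. angular_sq ?k x) \<le> (LBINT x. 2 * B ^ 4 * angular_sq g x + 8 * B\<^sup>2 * l\<^sup>2 * ((\<Phi> x)\<^sup>2 * angular_sq gL x))"
    proof (rule integral_mono)
      fix x
      have t2: "(?\<theta> x)\<^sup>2 \<le> B\<^sup>2" "(?\<theta>' x)\<^sup>2 \<le> l\<^sup>2"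
        using l[of "L x"] l0 B[of "L x"] B0 by (auto simp: abs_le_square_iff[symmetric])
      have "angular_sq ?k x \<le> 2 * ((?\<theta> x)\<^sup>2)\<^sup>2 * angular_sq g x + 2 * (\<Phi> x * (2 * ?\<theta> x * ?\<theta>' x))\<^sup>2 * angular_sq gL x"
        by (rule angular_sq_add_le)
      also have "\<dots> = 2 * angular_sq g x * (((?\<theta> x)\<^sup>2) * ((?\<theta> x)\<^sup>2)) + 8 * ((\<Phi> x)\<^sup>2 * angular_sq gL x) * ((?\<theta> x)\<^sup>2 * (?\<theta>' x)\<^sup>2)"
        by (simp add: power2_eq_square algebra_simps)
      also have "\<dots> \<le> 2 * angular_sq g x * (B\<^sup>2 * B\<^sup>2) + 8 * ((\<Phi> x)\<^sup>2 * angular_sq gL x) * (B\<^sup>2 * l\<^sup>2)"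
        using t2 angular_sq_nonneg[of g x] angular_sq_nonneg[of gL x] by (intro add_mono mult_left_mono mult_mono) auto
      also have "\<dots> = 2 * B ^ 4 * angular_sq g x + 8 * B\<^sup>2 * l\<^sup>2 * ((\<Phi> x)\<^sup>2 * angular_sq gL x)"
        by (simp add: power2_eq_square power4_eq_xxxx)
      finally show "angular_sq ?k x \<le> 2 * B ^ 4 * angular_sq g x + 8 * B\<^sup>2 * l\<^sup>2 * ((\<Phi> x)\<^sup>2 * angular_sq gL x)" .
    qed (use i in auto)
    also have "\<dots> = 2 * B ^ 4 * (LBINT x. angular_sq g x) + 8 * B\<^sup>2 * l\<^sup>2 * (LBINT x. (\<Phi> x)\<^sup>2 * angular_sq gL x)"
      using i by simp
    also have "\<dots> \<le> 2 * B ^ 4 * P + 8 * B\<^sup>2 * l\<^sup>2 * A"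
      using P A B0 by (intro add_mono mult_left_mono) auto
    finally show ?thesis .
  qed
  then have "\<sigma> / 2 * (LBINT x. angular_sq ?k x) \<le> \<sigma> / 2 * (2 * B ^ 4 * P + 8 * B\<^sup>2 * l\<^sup>2 * A)"
    using \<sigma> by (intro mult_left_mono) auto
  then have "l\<^sup>2 * A + (e / (2 * \<sigma>) + \<sigma> / 2 * (LBINT x. angular_sq ?k x)) \<le> l\<^sup>2 * A + (e / (2 * \<sigma>) + \<sigma> / 2 * (2 * B ^ 4 * P + 8 * B\<^sup>2 * l\<^sup>2 * A))" by simp
  also have "\<dots> = l\<^sup>2 * A + e / (2 * \<sigma>) + \<sigma> * (B ^ 4 * P + 4 * B\<^sup>2 * l\<^sup>2 * A)" by (simp add: algebra_simps)
  finally show ?thesis by simp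
qed

text \<open>The inequality \<open>- laplacian v >= q v\<close> in \<open>Q\<close>, tested in
  gradient form against C^1 functions, so that quotients by \<open>v\<close> are allowed as test
  functions. The nonlinear term is put into \<open>q\<close>, which may depend on
  \<open>v\<close>.\<close>

definition weak_supersol :: "('a::euclidean_space \<Rightarrow> real) \<Rightarrow> ('a \<Rightarrow> 'a) \<Rightarrow> ('a \<Rightarrow> real) \<Rightarrow> 'a set \<Rightarrow> bool" where
  "weak_supersol v gv q Q \<longleftrightarrow> (\<forall>\<zeta> g. C1c Q \<zeta> g \<longrightarrow> (\<forall>x. \<zeta> x \<ge> 0) \<longrightarrow>
     (LBINT x. q x * v x * \<zeta> x) \<le> (LBINT x. gv x \<bullet> g x))"

lemma has_grad_ln:
  assumes "has_grad v gv UNIV" "\<And>x. v x > 0"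
  shows "has_grad (\<lambda>x. ln (v x)) (\<lambda>x. inverse (v x) *\<^sub>R gv x) UNIV"
proof (rule has_grad_compose[OF assms(1)])
  show "(ln has_real_derivative inverse (v x)) (at (v x))" for x
    using assms(2)[of x] by (auto intro!: derivative_eq_intros simp: inverse_eq_divide)
  have "v x \<noteq> 0" for x using assms(2)[of x] by simp
  then show "continuous_on UNIV (\<lambda>x. inverse (v x))"
    by (intro continuous_intros has_grad_continuous[OF assms(1)]) auto
qed

text \<open>The test function is \<open>W / v\<close>. The derivative of \<open>1 / v\<close>
  produces the square of the gradient of \<open>ln v\<close>, that is,
  \<open>- laplacian L >= q + norm gL ^ 2\<close> in weak form.\<close>

lemma log_test:
  assumes v: "has_grad v gv UNIV" "\<And>x. v x > 0" and ws: "weak_supersol v gv q Q"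
    and W: "C1c Q W gW" "\<And>x. W x \<ge> 0"
  defines "gL \<equiv> \<lambda>x. inverse (v x) *\<^sub>R gv x"
  shows "(LBINT x. q x * W x) \<le> (LBINT x. gW x \<bullet> gL x - W x * (norm (gL x))\<^sup>2)"
proof -
  have vn: "v x \<noteq> 0" for x using v(2)[of x] by simp
  have iv: "has_grad (\<lambda>x. inverse (v x)) (\<lambda>x. (- (inverse (v x) * inverse (v x))) *\<^sub>R gv x) UNIV"
  proof (rule has_grad_compose[OF v(1)])
    show "(inverse has_real_derivative - (inverse (v x) * inverse (v x))) (at (v x))" for x
      using vn[of x] by (auto intro!: derivative_eq_intros simp: power2_eq_square)
    show "continuous_on UNIV (\<lambda>x. - (inverse (v x) * inverse (v x)))"
      using vn by (intro continuous_intros has_grad_continuous[OF v(1)]) auto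
  qed
  have "(LBINT x. q x * v x * (W x * inverse (v x))) \<le> (LBINT x. gv x \<bullet> (W x *\<^sub>R (- (inverse (v x) * inverse (v x))) *\<^sub>R gv x + inverse (v x) *\<^sub>R gW x))"
    using ws C1c_mult_right[OF W(1) iv] W(2) v(2) unfolding weak_supersol_def
    by (simp add: less_imp_le)
  moreover have "q x * v x * (W x * inverse (v x)) = q x * W x" for x using vn[of x] by simp
  moreover have "gv x \<bullet> (W x *\<^sub>R (- (inverse (v x) * inverse (v x))) *\<^sub>R gv x + inverse (v x) *\<^sub>R gW x) = gW x \<bullet> gL x - W x * (norm (gL x))\<^sup>2" for x
    unfolding gL_def power2_norm_eq_inner by (simp add: inner_add_right inner_diff_right inner_commute algebra_simps)
  ultimately show ?thesis by simp
qed

text \<open>\<open>W = \<Phi>^2\<close> in \<open>log_test\<close>, with the nonnegative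
  \<open>q\<close> dropped and Young's inequality for \<open>2 \<Phi> g \<bullet> gL\<close>. The
  bound does not depend on \<open>v\<close>, hence not on the mollification.\<close>

lemma log_caccioppoli:
  assumes v: "has_grad v gv UNIV" "\<And>x. v x > 0" and ws: "weak_supersol v gv q Q" and q: "\<And>x. x \<in> Q \<Longrightarrow> q x \<ge> 0"
    and \<Phi>: "C1c Q \<Phi> g"
  defines "gL \<equiv> \<lambda>x. inverse (v x) *\<^sub>R gv x"
  shows "(LBINT x. (\<Phi> x)\<^sup>2 * (norm (gL x))\<^sup>2) \<le> 4 * (LBINT x. (norm (g x))\<^sup>2)"
proof -
  have hg: "has_grad \<Phi> g UNIV" using \<Phi> by (simp add: C1c_def)
  note c\<Phi> = C1c_C0c[OF \<Phi>]
  have cgL: "continuous_on UNIV gL" unfolding gL_def using has_grad_continuous_grad[OF has_grad_ln[OF v]] .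
  obtain K where K: "K \<subseteq> Q" "\<And>x. x \<notin> K \<Longrightarrow> \<Phi> x = 0" using C1cE[OF \<Phi>] by metis
  have W: "C1c Q (\<lambda>x. \<Phi> x * \<Phi> x) (\<lambda>x. \<Phi> x *\<^sub>R g x + \<Phi> x *\<^sub>R g x)" by (rule C1c_mult_right[OF \<Phi> hg])
  have i: "integrable lborel (\<lambda>x. (\<Phi> x)\<^sup>2 * (norm (gL x))\<^sup>2)" "integrable lborel (\<lambda>x. (norm (g x))\<^sup>2)"
    by (intro C0c_integrable C0c_intros c\<Phi> continuous_intros cgL)+
  have iL: "integrable lborel (\<lambda>x. (\<Phi> x *\<^sub>R g x + \<Phi> x *\<^sub>R g x) \<bullet> gL x - \<Phi> x * \<Phi> x * (norm (gL x))\<^sup>2)"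
    by (intro C0c_integrable C0c_intros C1c_C0c[OF W] continuous_intros cgL)
  have "0 \<le> (LBINT x. q x * (\<Phi> x * \<Phi> x))"
  proof (intro integral_nonneg_AE AE_I2)
    fix x show "0 \<le> q x * (\<Phi> x * \<Phi> x)" using q[of x] K by (cases "x \<in> K") auto
  qed
  also have "\<dots> \<le> (LBINT x. (\<Phi> x *\<^sub>R g x + \<Phi> x *\<^sub>R g x) \<bullet> gL x - \<Phi> x * \<Phi> x * (norm (gL x))\<^sup>2)"
    unfolding gL_def by (rule log_test[OF v ws W]) simp
  also have "\<dots> \<le> (LBINT x. 2 * (norm (g x))\<^sup>2 - 1 / 2 * ((\<Phi> x)\<^sup>2 * (norm (gL x))\<^sup>2))"
  proof (rule integral_mono[OF iL])
    show "integrable lborel (\<lambda>x. 2 * (norm (g x))\<^sup>2 - 1 / 2 * ((\<Phi> x)\<^sup>2 * (norm (gL x))\<^sup>2))" using i by simp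
    fix x
    have "0 \<le> (norm (2 *\<^sub>R g x - \<Phi> x *\<^sub>R gL x))\<^sup>2" by simp
    then have "4 * (\<Phi> x * (g x \<bullet> gL x)) \<le> 4 * (g x \<bullet> g x) + \<Phi> x * \<Phi> x * (gL x \<bullet> gL x)"
      unfolding power2_norm_eq_inner by (simp add: inner_diff_left inner_diff_right inner_commute algebra_simps)
    then show "(\<Phi> x *\<^sub>R g x + \<Phi> x *\<^sub>R g x) \<bullet> gL x - \<Phi> x * \<Phi> x * (norm (gL x))\<^sup>2 \<le> 2 * (norm (g x))\<^sup>2 - 1 / 2 * ((\<Phi> x)\<^sup>2 * (norm (gL x))\<^sup>2)"
      unfolding power2_norm_eq_inner by (simp add: inner_add_left power2_eq_square)
  qed
  also have "\<dots> = 2 * (LBINT x. (norm (g x))\<^sup>2) - 1 / 2 * (LBINT x. (\<Phi> x)\<^sup>2 * (norm (gL x))\<^sup>2)"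
    using i by simp
  finally show ?thesis by simp
qed

text \<open>The integral of the divergence of the vector field \<open>f x\<close> times
  \<open>x\<close>, one coordinate at a time.\<close>

lemma integral_euler:
  fixes f :: "'a::euclidean_space \<Rightarrow> real"
  assumes f: "C1c \<Omega> f g"
  shows "(LBINT x. x \<bullet> g x + DIM('a) * f x) = 0"
proof -
  note cf = C1c_C0c[OF f]
  have "(LBINT x. (x \<bullet> b) * (g x \<bullet> b) + f x) = 0" if b: "b \<in> Basis" for b
  proof -
    have l: "has_grad (\<lambda>x. x \<bullet> b) (\<lambda>_. b) UNIV"
      by (auto simp: has_grad_def inner_commute intro!: derivative_eq_intros)
    have "(LBINT x. (f x *\<^sub>R b + (x \<bullet> b) *\<^sub>R g x) \<bullet> b) = 0"
      by (rule integral_directional_derivative_zero[OF C1c_mult_right[OF f l]])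
    then show ?thesis using b by (simp add: inner_add_left add.commute)
  qed
  then have "(\<Sum>b\<in>Basis. (LBINT x. (x \<bullet> b) * (g x \<bullet> b) + f x)) = 0" by simp
  also have "(\<Sum>b\<in>Basis. (LBINT x. (x \<bullet> b) * (g x \<bullet> b) + f x)) = (LBINT x. (\<Sum>b\<in>Basis. (x \<bullet> b) * (g x \<bullet> b) + f x))"
    by (rule Bochner_Integration.integral_sum[symmetric]) (intro C0c_integrable C0c_intros cf continuous_intros)
  also have "(\<lambda>x. (\<Sum>b\<in>Basis. (x \<bullet> b) * (g x \<bullet> b) + f x)) = (\<lambda>x. x \<bullet> g x + DIM('a) * f x)"
    by (simp add: fun_eq_iff sum.distrib euclidean_inner[symmetric])
  finally show ?thesis .
qed

lemma deriv_integral_scaled: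
  fixes L :: "'a::euclidean_space \<Rightarrow> real"
  assumes k: "C0c k" and L: "has_grad L gL UNIV"
  shows "((\<lambda>s. \<integral>y. k y * L (exp (- s) *\<^sub>R y) \<partial>lborel) has_real_derivative
     - (LBINT y. k y * (y \<bullet> (exp (- s) *\<^sub>R gL (exp (- s) *\<^sub>R y))))) (at s)"
proof -
  obtain C R where CR: "C > 0" "R > 0" "\<And>x. norm (k x) \<le> C * indicator (cball 0 R) x" using C0c_dominated[OF k] by blast
  have cL: "continuous_on UNIV L" and cgL: "continuous_on UNIV gL"
    using has_grad_continuous[OF L] has_grad_continuous_grad[OF L] by auto
  \<comment> \<open>For parameters within 1 of \<open>s\<close>, the dilated points stay in the ball
    of radius \<open>exp (1 - s) * R\<close>.\<close>
  have "compact (gL ` cball 0 (exp (1 - s) * R))"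
    by (intro compact_continuous_image continuous_on_subset[OF cgL]) auto
  from compact_imp_bounded[OF this] obtain D where "D > 0" and D: "\<And>x. x \<in> cball 0 (exp (1 - s) * R) \<Longrightarrow> norm (gL x) \<le> D"
    unfolding bounded_pos by blast
  then have D0: "D \<ge> 0" by simp
  let ?G = "\<lambda>s y. - (k y * (y \<bullet> (exp (- s) *\<^sub>R gL (exp (- s) *\<^sub>R y))))"
  have "((\<lambda>s. \<integral>y. k y * L (exp (- s) *\<^sub>R y) \<partial>lborel) has_derivative (\<lambda>h. (LBINT y. ?G s y) \<bullet> h)) (at s)"
  proof (rule has_derivative_lebesgue_integral[where r=1 and B="\<lambda>y. C * (R * (exp (1 - s) * D)) * indicator (cball 0 R) y"])
    have cs: "continuous_on UNIV (\<lambda>y::'a. exp (- s) *\<^sub>R y)" for s :: real by (intro continuous_intros)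
    note ce = continuous_on_compose2[OF cL cs subset_UNIV] continuous_on_compose2[OF cgL cs subset_UNIV]
    show "integrable lborel (\<lambda>y. k y * L (exp (- s) *\<^sub>R y))" for s
      by (intro C0c_integrable C0c_intros k ce)
    have "C0c (?G s)" for s
    proof -
      have "C0c (\<lambda>y. k y * - (y \<bullet> (exp (- s) *\<^sub>R gL (exp (- s) *\<^sub>R y))))" by (intro C0c_intros k continuous_intros ce)
      then show ?thesis by simp
    qed
    from C0c_measurable[OF this] show "?G s \<in> borel_measurable lborel" by (simp only: measurable_lborel2)
    show "((\<lambda>s. k y * L (exp (- s) *\<^sub>R y)) has_derivative (\<bullet>) (?G t y)) (at t)" for t y
    proof -
      have "((\<lambda>s. exp (- s) *\<^sub>R y) has_derivative (\<lambda>h. (- exp (- t) * h) *\<^sub>R y)) (at t)"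
        by (auto intro!: derivative_eq_intros simp: fun_eq_iff)
      from has_derivative_mult_right[OF has_derivative_compose[OF this has_gradD[OF L UNIV_I]], of "k y"]
      show ?thesis by (rule has_derivative_eq_rhs) (auto simp: fun_eq_iff inner_commute)
    qed
    show "norm (?G t y) \<le> C * (R * (exp (1 - s) * D)) * indicator (cball 0 R) y" if t: "t \<in> ball s 1" for t y
    proof (cases "norm y \<le> R")
      case True
      have et: "exp (- t) \<le> exp (1 - s)" using t by (auto simp: dist_real_def)
      have "norm (exp (- t) *\<^sub>R y) \<le> exp (1 - s) * R" using et True by (auto intro!: mult_mono)
      then have g: "norm (gL (exp (- t) *\<^sub>R y)) \<le> D" by (intro D) auto
      have "norm (?G t y) = \<bar>k y\<bar> * \<bar>y \<bullet> (exp (- t) *\<^sub>R gL (exp (- t) *\<^sub>R y))\<bar>" by (simp add: abs_mult)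
      also have "\<dots> \<le> C * (norm y * norm (exp (- t) *\<^sub>R gL (exp (- t) *\<^sub>R y)))"
        using CR(3)[of y] True CR(1) by (intro mult_mono Cauchy_Schwarz_ineq2) (auto simp: indicator_def)
      also have "\<dots> \<le> C * (R * (exp (1 - s) * D))"
      proof -
        have "exp (- t) * norm (gL (exp (- t) *\<^sub>R y)) \<le> exp (1 - s) * D"
          by (rule mult_mono[OF et g]) auto
        then show ?thesis using True CR D0 by (intro mult_left_mono mult_mono) auto
      qed
      finally show ?thesis using True by simp
    next
      case False
      then have "k y = 0" using CR(3)[of y] by (auto simp: indicator_def)
      then show ?thesis using CR D0 by simp
    qed
    show "integrable lborel (\<lambda>y. C * (R * (exp (1 - s) * D)) * indicator (cball 0 R) y)"
      using emeasure_lborel_cball_finite by (intro integrable_mult_right integrable_real_indicator) auto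
  qed simp
  then show ?thesis unfolding has_field_derivative_def
    by (rule has_derivative_eq_rhs) (auto simp: fun_eq_iff)
qed

text \<open>Nonnegativity of the variance of \<open>T\<close> under the probability density
  \<open>W\<close>.\<close>

lemma integral_square_ge_square_integral:
  fixes W T :: "'a::euclidean_space \<Rightarrow> real"
  assumes "C0c W" "\<And>x. W x \<ge> 0" "(LBINT x. W x) = 1" "continuous_on UNIV T"
  shows "(LBINT x. W x * T x)\<^sup>2 \<le> (LBINT x. W x * (T x)\<^sup>2)"
proof -
  define m where "m = (LBINT x. W x * T x)"
  have i: "integrable lborel W" "integrable lborel (\<lambda>x. W x * T x)" "integrable lborel (\<lambda>x. W x * (T x)\<^sup>2)"
    by (intro C0c_integrable C0c_intros assms continuous_intros)+
  have "0 \<le> (LBINT x. W x * (T x - m)\<^sup>2)" using assms(2) by (intro integral_nonneg_AE) auto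
  also have "(\<lambda>x. W x * (T x - m)\<^sup>2) = (\<lambda>x. W x * (T x)\<^sup>2 - 2 * m * (W x * T x) + m\<^sup>2 * W x)"
    by (simp add: fun_eq_iff power2_eq_square algebra_simps)
  also have "(LBINT x. W x * (T x)\<^sup>2 - 2 * m * (W x * T x) + m\<^sup>2 * W x) = (LBINT x. W x * (T x)\<^sup>2) - 2 * m * m + m\<^sup>2"
    using i assms(3) by (simp add: m_def)
  finally show ?thesis by (simp add: m_def power2_eq_square)
qed

text \<open>Jensen's inequality, from the tangent line of \<open>exp\<close> at the mean
  \<open>m\<close>.\<close>

lemma integral_exp_ge_exp_integral:
  fixes W T :: "'a::euclidean_space \<Rightarrow> real"
  assumes "C0c W" "\<And>x. W x \<ge> 0" "(LBINT x. W x) = 1" "continuous_on UNIV T"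
  shows "exp (LBINT x. W x * T x) \<le> (LBINT x. W x * exp (T x))"
proof -
  define m where "m = (LBINT x. W x * T x)"
  have i: "integrable lborel W" "integrable lborel (\<lambda>x. W x * T x)" "integrable lborel (\<lambda>x. W x * exp (T x))"
    by (intro C0c_integrable C0c_intros assms continuous_intros)+
  have "(LBINT x. exp m * (1 - m) * W x + exp m * (W x * T x)) \<le> (LBINT x. W x * exp (T x))"
  proof (rule integral_mono)
    fix x
    have "exp m * (1 + (T x - m)) \<le> exp m * exp (T x - m)" by (intro mult_left_mono exp_ge_add_one_self) auto
    then have "exp m * (1 + (T x - m)) \<le> exp (T x)" by (simp add: exp_diff)
    from mult_left_mono[OF this assms(2)[of x]]
    show "exp m * (1 - m) * W x + exp m * (W x * T x) \<le> W x * exp (T x)" by (simp add: algebra_simps)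
  qed (use i in auto)
  also have "(LBINT x. exp m * (1 - m) * W x + exp m * (W x * T x)) = exp m * (1 - m) + exp m * m"
    using i assms(3) by (simp add: m_def)
  finally show ?thesis by (simp add: m_def algebra_simps)
qed

section \<open>The logarithmic mean\<close>

text \<open>\<open>\<Phi>\<close> is allowed any compact support here; that its dilate at time
  \<open>s\<close> is supported in \<open>Q\<close>, off the origin, is assumed separately for each
  \<open>s\<close> where it matters.\<close>

locale log_mean =
  fixes v :: "'a::euclidean_space \<Rightarrow> real" and gv q Q and \<Phi> :: "'a \<Rightarrow> real" and g
  assumes v: "has_grad v gv UNIV" and v_pos: "\<And>x. v x > 0" and ws: "weak_supersol v gv q Q"
    and \<Phi>: "C1c UNIV \<Phi> g" and \<Phi>1: "(LBINT x. (\<Phi> x)\<^sup>2) = 1"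
begin

definition "L x = ln (v x)"
definition "gL x = inverse (v x) *\<^sub>R gv x"
definition "G s y = exp (- s) *\<^sub>R gL (exp (- s) *\<^sub>R y)"
definition "M s = (LBINT y. (\<Phi> y)\<^sup>2 * L (exp (- s) *\<^sub>R y))"
definition "Y s = - (LBINT y. (\<Phi> y)\<^sup>2 * (y \<bullet> G s y))"
text \<open>The second derivative of \<open>M\<close>. One radial derivative has been moved from
  \<open>L\<close> to \<open>\<Phi>^2\<close>, so that only first derivatives of \<open>v\<close>
  occur.\<close>

definition "Y' s = - (LBINT y. (2 * \<Phi> y * (y \<bullet> g y) + DIM('a) * (\<Phi> y)\<^sup>2) * (y \<bullet> G s y))"

lemma L: "has_grad L gL UNIV"
  using has_grad_ln[OF v v_pos] by (simp add: L_def[abs_def] gL_def[abs_def])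

lemma cont: "continuous_on UNIV L" "continuous_on UNIV gL" "continuous_on UNIV \<Phi>" "continuous_on UNIV g"
  "continuous_on UNIV (\<lambda>y. L (exp (- s) *\<^sub>R y))" "continuous_on UNIV (G s)"
proof -
  show 1: "continuous_on UNIV L" "continuous_on UNIV gL"
    using has_grad_continuous[OF L] has_grad_continuous_grad[OF L] by auto
  show "continuous_on UNIV \<Phi>" "continuous_on UNIV g" using C1c_C0c[OF \<Phi>] C0c_continuous by blast+
  have cs: "continuous_on UNIV (\<lambda>y::'a. exp (- s) *\<^sub>R y)" by (intro continuous_intros)
  show "continuous_on UNIV (\<lambda>y. L (exp (- s) *\<^sub>R y))" by (rule continuous_on_compose2[OF 1(1) cs subset_UNIV])
  show "continuous_on UNIV (G s)" unfolding G_def[abs_def]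
    by (intro continuous_intros continuous_on_compose2[OF 1(2) cs subset_UNIV])
qed

lemma Ls: "has_grad (\<lambda>y. L (exp (- s) *\<^sub>R y)) (G s) UNIV"
  unfolding has_grad_def
proof (intro conjI ballI cont)
  fix y :: 'a
  have "((\<lambda>y. exp (- s) *\<^sub>R y) has_derivative (\<lambda>h. exp (- s) *\<^sub>R h)) (at y)"
    by (auto intro!: derivative_eq_intros)
  from has_derivative_compose[OF this has_gradD[OF L UNIV_I]]
  show "((\<lambda>y. L (exp (- s) *\<^sub>R y)) has_derivative (\<bullet>) (G s y)) (at y)"
    by (rule has_derivative_eq_rhs) (auto simp: fun_eq_iff G_def)
qed

lemma C0c\<Phi>: "C0c \<Phi>" "C0c g" "C0c (\<lambda>y. (\<Phi> y)\<^sup>2)" "C0c (\<lambda>y. 2 * \<Phi> y * (y \<bullet> g y) + DIM('a) * (\<Phi> y)\<^sup>2)"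
proof -
  note [simp] = C1c_C0c[OF \<Phi>]
  show "C0c \<Phi>" "C0c g" "C0c (\<lambda>y. (\<Phi> y)\<^sup>2)" by (auto intro!: C0c_intros)
  have "C0c (\<lambda>y. (\<Phi> y * (y \<bullet> g y)) * 2 + (\<Phi> y)\<^sup>2 * DIM('a))"
    by (intro C0c_intros continuous_intros cont C1c_C0c[OF \<Phi>])
  then show "C0c (\<lambda>y. 2 * \<Phi> y * (y \<bullet> g y) + DIM('a) * (\<Phi> y)\<^sup>2)" by (simp add: mult_ac)
qed

lemma M_deriv: "(M has_real_derivative Y s) (at s)"
  using deriv_integral_scaled[OF C0c\<Phi>(3) L, of s] by (simp add: M_def[abs_def] Y_def G_def)

text \<open>Integration by parts along the radial field. In this form \<open>Y\<close> can be
  differentiated again although \<open>L\<close> is merely C^1.\<close>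

lemma Y_alt: "Y s = (LBINT y. (2 * \<Phi> y * (y \<bullet> g y) + DIM('a) * (\<Phi> y)\<^sup>2) * L (exp (- s) *\<^sub>R y))"
proof -
  have hg: "has_grad \<Phi> g UNIV" using \<Phi> by (simp add: C1c_def)
  let ?L = "\<lambda>y. L (exp (- s) *\<^sub>R y)"
  have 1: "C1c UNIV (\<lambda>y. (\<Phi> y * \<Phi> y) * ?L y) (\<lambda>y. (\<Phi> y * \<Phi> y) *\<^sub>R G s y + ?L y *\<^sub>R (\<Phi> y *\<^sub>R g y + \<Phi> y *\<^sub>R g y))"
    by (rule C1c_mult_right[OF C1c_mult_right[OF \<Phi> hg] Ls])
  have i: "integrable lborel (\<lambda>y. (\<Phi> y)\<^sup>2 * (y \<bullet> G s y))" "integrable lborel (\<lambda>y. (2 * \<Phi> y * (y \<bullet> g y) + DIM('a) * (\<Phi> y)\<^sup>2) * ?L y)"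
    by (rule C0c_integrable, intro C0c_intros C0c\<Phi> continuous_intros cont)+
  have "0 = (LBINT y. y \<bullet> ((\<Phi> y * \<Phi> y) *\<^sub>R G s y + ?L y *\<^sub>R (\<Phi> y *\<^sub>R g y + \<Phi> y *\<^sub>R g y)) + DIM('a) * ((\<Phi> y * \<Phi> y) * ?L y))"
    by (rule integral_euler[OF 1, symmetric])
  also have "\<dots> = (LBINT y. (\<Phi> y)\<^sup>2 * (y \<bullet> G s y) + (2 * \<Phi> y * (y \<bullet> g y) + DIM('a) * (\<Phi> y)\<^sup>2) * ?L y)"
    by (rule Bochner_Integration.integral_cong[OF refl]) (simp add: inner_add_right power2_eq_square algebra_simps)
  also have "\<dots> = (LBINT y. (\<Phi> y)\<^sup>2 * (y \<bullet> G s y)) + (LBINT y. (2 * \<Phi> y * (y \<bullet> g y) + DIM('a) * (\<Phi> y)\<^sup>2) * ?L y)"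
    by (rule Bochner_Integration.integral_add[OF i])
  finally show ?thesis by (simp add: Y_def)
qed

lemma Y_deriv: "(Y has_real_derivative Y' s) (at s)"
  using deriv_integral_scaled[OF C0c\<Phi>(4) L, of s]
  by (simp add: Y_alt[abs_def] Y'_def G_def)

text \<open>\<open>log_test\<close> with \<open>W x = norm x ^ 2 * \<Phi> (exp s x)^2\<close>, then
  the substitution \<open>y = exp s x\<close>. The factor \<open>norm x ^ 2\<close> makes the
  inequality dilation invariant; its gradient changes the coefficient of \<open>Y\<close> from
  \<open>N\<close> to \<open>N - 2\<close>.\<close>

lemma mean_log_test:
  assumes Q: "\<And>x. \<Phi> (exp s *\<^sub>R x) \<noteq> 0 \<Longrightarrow> x \<in> Q" and cQ: "compact Q" "Q \<subseteq> - {0}" and cq: "continuous_on (- {0}) q"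
  shows "(LBINT y. (exp (- s))\<^sup>2 * q (exp (- s) *\<^sub>R y) * (norm y)\<^sup>2 * (\<Phi> y)\<^sup>2)
     \<le> (LBINT y. angular_sq g y) + (real DIM('a) - 2) * Y s - Y' s - (Y s)\<^sup>2"
proof -
  let ?N = "DIM('a)"
  have hg: "has_grad \<Phi> g UNIV" using \<Phi> by (simp add: C1c_def)
  let ?P = "\<lambda>x. \<Phi> (exp s *\<^sub>R x)" and ?gP = "\<lambda>x. exp s *\<^sub>R g (exp s *\<^sub>R x)"
  have cs: "continuous_on UNIV (\<lambda>y::'a. exp s *\<^sub>R y)" by (intro continuous_intros)
  have P: "has_grad ?P ?gP UNIV"
    unfolding has_grad_def
  proof (intro conjI ballI)
    fix y :: 'a
    have "((\<lambda>y. exp s *\<^sub>R y) has_derivative (\<lambda>h. exp s *\<^sub>R h)) (at y)"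
      by (auto intro!: derivative_eq_intros)
    from has_derivative_compose[OF this has_gradD[OF hg UNIV_I]]
    show "(?P has_derivative (\<bullet>) (?gP y)) (at y)"
      by (rule has_derivative_eq_rhs) (auto simp: fun_eq_iff)
    show "continuous_on UNIV ?gP" by (intro continuous_intros continuous_on_compose2[OF cont(4) cs subset_UNIV])
  qed
  have xx: "has_grad (\<lambda>x::'a. x \<bullet> x) (\<lambda>x. 2 *\<^sub>R x) UNIV"
    by (auto simp: has_grad_def inner_commute intro!: derivative_eq_intros continuous_intros)
  have C1P: "C1c Q ?P ?gP" by (rule C1cI[OF P cQ(1) order_refl]) (use Q in blast)
  let ?W = "\<lambda>x. (?P x * ?P x) * (x \<bullet> x)"
  let ?gW = "\<lambda>x. (?P x * ?P x) *\<^sub>R (2 *\<^sub>R x) + (x \<bullet> x) *\<^sub>R (?P x *\<^sub>R ?gP x + ?P x *\<^sub>R ?gP x)"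
  have W: "C1c Q ?W ?gW" by (rule C1c_mult_right[OF C1c_mult_right[OF C1P P] xx])
  have le: "(LBINT x. q x * ?W x) \<le> (LBINT x. ?gW x \<bullet> gL x - ?W x * (norm (gL x))\<^sup>2)"
    unfolding gL_def by (rule log_test[OF v v_pos ws W]) simp
  let ?r = "\<lambda>y. 2 * (\<Phi> y)\<^sup>2 * (y \<bullet> G s y) + 2 * (norm y)\<^sup>2 * \<Phi> y * (g y \<bullet> G s y) - (\<Phi> y)\<^sup>2 * ((norm y)\<^sup>2 * (norm (G s y))\<^sup>2)"
  let ?l = "\<lambda>y. (exp (- s))\<^sup>2 * q (exp (- s) *\<^sub>R y) * (norm y)\<^sup>2 * (\<Phi> y)\<^sup>2"
  have mq: "q \<in> borel_measurable borel"
    using measurable_punctured[OF cq] .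
  have [measurable]: "\<Phi> \<in> borel_measurable borel" "g \<in> borel_measurable borel" "G s \<in> borel_measurable borel"
    using C0c\<Phi>(1,2) C0c_measurable cont(6) borel_measurable_continuous_onI by blast+
  note [measurable] = mq
  have ef: "exp (- s) * exp s = 1" "exp s * exp (- s) = 1" by (simp_all add: exp_minus)
  have Gs: "G s (exp s *\<^sub>R x) = exp (- s) *\<^sub>R gL x" for x by (simp add: G_def ef)
  have nx: "(norm (exp s *\<^sub>R x))\<^sup>2 = (exp s * exp s) * (x \<bullet> x)" for x :: 'a
    by (simp add: power_mult_distrib dot_square_norm power2_eq_square)
  have l_eq: "?l (exp s *\<^sub>R x) = q x * ?W x" for x
  proof -
    have "?l (exp s *\<^sub>R x) = (exp (- s) * exp s) * (exp (- s) * exp s) * (q x * ?W x)"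
      unfolding nx by (simp add: exp_minus power2_eq_square field_simps)
    then show ?thesis by (simp add: ef)
  qed
  have r_eq: "?r (exp s *\<^sub>R x) = ?gW x \<bullet> gL x - ?W x * (norm (gL x))\<^sup>2" for x
  proof -
    define Z where "Z = gL x"
    define z where "z = g (exp s *\<^sub>R x)"
    define f where "f = \<Phi> (exp s *\<^sub>R x)"
    have "?r (exp s *\<^sub>R x) = 2 * f\<^sup>2 * ((exp s * exp (- s)) * (x \<bullet> Z)) + 2 * (exp s * exp (- s)) * (exp s * ((x \<bullet> x) * f * (z \<bullet> Z)))
       - f\<^sup>2 * ((exp s * exp (- s)) * (exp s * exp (- s)) * ((x \<bullet> x) * (Z \<bullet> Z)))"
      unfolding nx Gs z_def[symmetric] f_def[symmetric] Z_def[symmetric]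
      by (simp add: power_mult_distrib dot_square_norm power2_eq_square mult_ac)
    also have "\<dots> = 2 * f\<^sup>2 * (x \<bullet> Z) + 2 * (exp s * ((x \<bullet> x) * f * (z \<bullet> Z))) - f\<^sup>2 * ((x \<bullet> x) * (Z \<bullet> Z))"
      unfolding ef by simp
    also have "\<dots> = ?gW x \<bullet> gL x - ?W x * (norm (gL x))\<^sup>2"
      unfolding z_def[symmetric] f_def[symmetric] Z_def[symmetric] power2_norm_eq_inner
      by (simp add: inner_add_left power2_eq_square)
    finally show ?thesis .
  qed
  have "(LBINT y. ?l y) = exp s ^ ?N * (LBINT x. q x * ?W x)"
    by (subst lborel_integral_scale[where c="exp s"]) (measurable, simp only: l_eq)
  also have "\<dots> \<le> exp s ^ ?N * (LBINT x. ?gW x \<bullet> gL x - ?W x * (norm (gL x))\<^sup>2)"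
    using le by (intro mult_left_mono) auto
  also have "\<dots> = (LBINT y. ?r y)"
    by (subst lborel_integral_scale[where c="exp s" and f="?r"]) (measurable, simp only: r_eq)
  also have "\<dots> \<le> (LBINT y. angular_sq g y + 2 * ((\<Phi> y)\<^sup>2 * (y \<bullet> G s y)) + 2 * \<Phi> y * (y \<bullet> g y) * (y \<bullet> G s y) - (\<Phi> y)\<^sup>2 * (y \<bullet> G s y)\<^sup>2)"
  proof (rule integral_mono)
    have cA: "C0c (\<lambda>y. (\<Phi> y)\<^sup>2 * (y \<bullet> G s y) * 2)" "C0c (\<lambda>y. \<Phi> y * ((norm y)\<^sup>2 * (g y \<bullet> G s y)) * 2)" "C0c (\<lambda>y. (\<Phi> y)\<^sup>2 * ((norm y)\<^sup>2 * (norm (G s y))\<^sup>2))"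
      "C0c (\<lambda>y. \<Phi> y * ((y \<bullet> g y) * (y \<bullet> G s y)) * 2)" "C0c (\<lambda>y. (\<Phi> y)\<^sup>2 * (y \<bullet> G s y)\<^sup>2)"
      by (intro C0c_intros C0c\<Phi> continuous_intros cont)+
    have "C0c (\<lambda>y. (\<Phi> y)\<^sup>2 * (y \<bullet> G s y) * 2 + \<Phi> y * ((norm y)\<^sup>2 * (g y \<bullet> G s y)) * 2 - (\<Phi> y)\<^sup>2 * ((norm y)\<^sup>2 * (norm (G s y))\<^sup>2))"
      by (intro C0c_add C0c_diff cA)
    from C0c_integrable[OF this] show "integrable lborel ?r" by (simp add: mult_ac)
    have "C0c (\<lambda>y. angular_sq g y + (\<Phi> y)\<^sup>2 * (y \<bullet> G s y) * 2 + \<Phi> y * ((y \<bullet> g y) * (y \<bullet> G s y)) * 2 - (\<Phi> y)\<^sup>2 * (y \<bullet> G s y)\<^sup>2)"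
      by (intro C0c_add C0c_diff cA C0c_angular_sq C0c\<Phi>)
    from C0c_integrable[OF this] show "integrable lborel (\<lambda>y. angular_sq g y + 2 * ((\<Phi> y)\<^sup>2 * (y \<bullet> G s y)) + 2 * \<Phi> y * (y \<bullet> g y) * (y \<bullet> G s y) - (\<Phi> y)\<^sup>2 * (y \<bullet> G s y)\<^sup>2)"
      by (simp add: mult_ac)
    fix y
    \<comment> \<open>Young's inequality is spent on the angular part only. The radial part has to
      stay exact, since it becomes \<open>Y\<close> and \<open>Y'\<close>.\<close>
    have "2 * \<Phi> y * angular_prod g (G s) y \<le> angular_sq g y + (\<Phi> y)\<^sup>2 * angular_sq (G s) y" by (rule angular_prod_young)
    then show "?r y \<le> angular_sq g y + 2 * ((\<Phi> y)\<^sup>2 * (y \<bullet> G s y)) + 2 * \<Phi> y * (y \<bullet> g y) * (y \<bullet> G s y) - (\<Phi> y)\<^sup>2 * (y \<bullet> G s y)\<^sup>2"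
      unfolding angular_prod_def angular_sq_def[of "G s"] by (simp add: algebra_simps)
  qed
  \<comment> \<open>The coefficient 2 of \<open>\<Phi>^2 (y \<bullet> G s y)\<close> is split as
    \<open>(2 - N) + N\<close>; the second share completes the integrand of
    \<open>- Y'\<close>.\<close>
  also have "\<dots> = (LBINT y. angular_sq g y + (2 - real ?N) * ((\<Phi> y)\<^sup>2 * (y \<bullet> G s y)) + (2 * \<Phi> y * (y \<bullet> g y) + ?N * (\<Phi> y)\<^sup>2) * (y \<bullet> G s y) - (\<Phi> y)\<^sup>2 * (y \<bullet> G s y)\<^sup>2)"
    by (rule Bochner_Integration.integral_cong[OF refl]) (simp add: algebra_simps)
  also have "\<dots> = (LBINT y. angular_sq g y) + (2 - real ?N) * (LBINT y. (\<Phi> y)\<^sup>2 * (y \<bullet> G s y))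
       + (LBINT y. (2 * \<Phi> y * (y \<bullet> g y) + ?N * (\<Phi> y)\<^sup>2) * (y \<bullet> G s y)) - (LBINT y. (\<Phi> y)\<^sup>2 * (y \<bullet> G s y)\<^sup>2)"
  proof -
    have "integrable lborel (angular_sq g)" "integrable lborel (\<lambda>y. (\<Phi> y)\<^sup>2 * (y \<bullet> G s y))"
      "integrable lborel (\<lambda>y. (2 * \<Phi> y * (y \<bullet> g y) + ?N * (\<Phi> y)\<^sup>2) * (y \<bullet> G s y))" "integrable lborel (\<lambda>y. (\<Phi> y)\<^sup>2 * (y \<bullet> G s y)\<^sup>2)"
      by (rule C0c_integrable, intro C0c_intros C0c_angular_sq C0c\<Phi> continuous_intros cont)+
    then show ?thesis by simp
  qed
  also have "\<dots> = (LBINT y. angular_sq g y) + (real ?N - 2) * Y s - Y' s - (LBINT y. (\<Phi> y)\<^sup>2 * (y \<bullet> G s y)\<^sup>2)"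
    by (simp add: Y_def Y'_def algebra_simps)
  also have "\<dots> \<le> (LBINT y. angular_sq g y) + (real ?N - 2) * Y s - Y' s - (Y s)\<^sup>2"
    using integral_square_ge_square_integral[OF C0c\<Phi>(3) _ \<Phi>1 continuous_on_inner[OF continuous_on_id cont(6)], of s]
    by (simp add: Y_def)
  finally show ?thesis .
qed

text \<open>Jensen for \<open>exp\<close> bounds the mean of the nonlinear term by the exponential
  of the mean of its logarithm. The term \<open>- 2 s\<close> in the exponent comes from
  \<open>norm x = exp (- s) * norm y\<close>, the factor \<open>r^2\<close> from
  \<open>norm y >= r\<close> on the support.\<close>

lemma riccati_inequality:
  assumes Q: "\<And>x. \<Phi> (exp s *\<^sub>R x) \<noteq> 0 \<Longrightarrow> x \<in> Q" and cQ: "compact Q" "Q \<subseteq> - {0}" and cq: "continuous_on (- {0}) q"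
    and q: "\<And>x. x \<in> Q \<Longrightarrow> (norm x)\<^sup>2 * q x \<ge> c + (norm x)\<^sup>2 * v x powr (p - 1)"
    and r: "r > 0" "\<And>x. \<Phi> x \<noteq> 0 \<Longrightarrow> norm x \<ge> r" and p: "p > 1"
  shows "Y' s \<le> - (Y s)\<^sup>2 + (real DIM('a) - 2) * Y s + (LBINT y. angular_sq g y) - c - r\<^sup>2 * exp ((p - 1) * (M s - 2 / (p - 1) * s))"
proof -
  \<comment> \<open>The logarithm of the lower bound \<open>r^2 exp (- 2 s) v^(p - 1)\<close> for
    \<open>norm x ^ 2\<close> times the nonlinear coefficient, at
    \<open>x = exp (- s) y\<close>.\<close>
  let ?X = "\<lambda>y. 2 * ln r - 2 * s + (p - 1) * L (exp (- s) *\<^sub>R y)"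
  have iM: "integrable lborel (\<lambda>y. (\<Phi> y)\<^sup>2)" "integrable lborel (\<lambda>y. (\<Phi> y)\<^sup>2 * L (exp (- s) *\<^sub>R y))"
    "integrable lborel (\<lambda>y. (\<Phi> y)\<^sup>2 * exp (?X y))"
    by (rule C0c_integrable, intro C0c_intros C0c\<Phi> continuous_intros cont)+
  have m: "(LBINT y. (\<Phi> y)\<^sup>2 * ?X y) = 2 * ln r - 2 * s + (p - 1) * M s"
  proof -
    have "(LBINT y. (\<Phi> y)\<^sup>2 * ?X y) = (LBINT y. (2 * ln r - 2 * s) * (\<Phi> y)\<^sup>2 + (p - 1) * ((\<Phi> y)\<^sup>2 * L (exp (- s) *\<^sub>R y)))"
      by (rule Bochner_Integration.integral_cong[OF refl]) (simp add: algebra_simps)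
    also have "\<dots> = 2 * ln r - 2 * s + (p - 1) * M s" using iM \<Phi>1 by (simp add: M_def)
    finally show ?thesis .
  qed
  have "c + r\<^sup>2 * exp ((p - 1) * (M s - 2 / (p - 1) * s)) = c + exp (LBINT y. (\<Phi> y)\<^sup>2 * ?X y)"
  proof -
    have "(p - 1) * (M s - 2 / (p - 1) * s) = (p - 1) * M s - 2 * s" using p by (simp add: field_simps)
    moreover have "r\<^sup>2 = exp (2 * ln r)" using r by (simp add: exp_double)
    ultimately show ?thesis unfolding m by (simp add: exp_add[symmetric] algebra_simps)
  qed
  also have "\<dots> \<le> c + (LBINT y. (\<Phi> y)\<^sup>2 * exp (?X y))"
    by (intro add_left_mono integral_exp_ge_exp_integral C0c\<Phi> \<Phi>1 continuous_intros cont) auto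
  also have "\<dots> = (LBINT y. c * (\<Phi> y)\<^sup>2 + (\<Phi> y)\<^sup>2 * exp (?X y))"
    using iM \<Phi>1 by simp
  also have "\<dots> \<le> (LBINT y. (exp (- s))\<^sup>2 * q (exp (- s) *\<^sub>R y) * (norm y)\<^sup>2 * (\<Phi> y)\<^sup>2)"
  proof (rule integral_mono)
    show "integrable lborel (\<lambda>y. c * (\<Phi> y)\<^sup>2 + (\<Phi> y)\<^sup>2 * exp (?X y))" using iM by auto
    let ?l = "\<lambda>y. (exp (- s))\<^sup>2 * q (exp (- s) *\<^sub>R y) * (norm y)\<^sup>2 * (\<Phi> y)\<^sup>2"
    \<comment> \<open>\<open>q\<close> may be singular at the origin, but \<open>\<Phi>\<close>
      vanishes off the dilate of \<open>Q\<close>, which stays away from it.\<close>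
    have "continuous_on UNIV ?l"
    proof (rule continuous_on_extend_zero[where S="- {0}" and K="(\<lambda>x. exp s *\<^sub>R x) ` Q"])
      have "continuous_on (- {0}) (\<lambda>y::'a. q (exp (- s) *\<^sub>R y))"
        by (rule continuous_on_compose2[OF cq]) (auto intro!: continuous_intros)
      then show "continuous_on (- {0}) ?l"
        by (intro continuous_intros continuous_on_subset[OF cont(3)]) auto
      show "closed ((\<lambda>x. exp s *\<^sub>R x) ` Q)" using cQ by (intro compact_imp_closed compact_scaling)
      show "?l x = 0" if "x \<notin> (\<lambda>x. exp s *\<^sub>R x) ` Q" for x
      proof -
        have "exp (- s) *\<^sub>R x \<notin> Q"
        proof
          assume "exp (- s) *\<^sub>R x \<in> Q"
          then have "exp s *\<^sub>R (exp (- s) *\<^sub>R x) \<in> (\<lambda>x. exp s *\<^sub>R x) ` Q" by blast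
          then show False using that by (simp add: exp_minus)
        qed
        then have "\<Phi> (exp s *\<^sub>R (exp (- s) *\<^sub>R x)) = 0" using Q by blast
        then show ?thesis by (simp add: exp_minus)
      qed
    qed (use cQ in auto)
    moreover obtain R where "\<And>x. norm x > R \<Longrightarrow> \<Phi> x = 0" using C0c\<Phi>(1) by (auto simp: C0c_def)
    then have "\<exists>R. \<forall>x. norm x > R \<longrightarrow> ?l x = 0" by (intro exI[of _ R]) auto
    ultimately have "C0c ?l" by (simp add: C0c_def)
    then show "integrable lborel ?l" by (rule C0c_integrable)
    fix y
    show "c * (\<Phi> y)\<^sup>2 + (\<Phi> y)\<^sup>2 * exp (?X y) \<le> ?l y"
    proof (cases "\<Phi> y = 0")
      case False
      define x where "x = exp (- s) *\<^sub>R y"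
      have y: "y = exp s *\<^sub>R x" by (simp add: x_def exp_minus)
      have xQ: "x \<in> Q" using Q[of x] False y by simp
      have nx: "norm x = exp (- s) * norm y" by (simp add: x_def)
      have ny: "norm y \<ge> r" by (rule r(2)[OF False])
      have "(exp (- s))\<^sup>2 * q x * (norm y)\<^sup>2 = (norm x)\<^sup>2 * q x" by (simp add: nx power_mult_distrib)
      also have "\<dots> \<ge> c + (norm x)\<^sup>2 * v x powr (p - 1)" by (rule q[OF xQ])
      moreover have "exp (?X y) \<le> (norm x)\<^sup>2 * v x powr (p - 1)"
      proof -
        have "exp (?X y) = exp (2 * ln r) * exp (- (2 * s)) * exp ((p - 1) * L x)"
          by (simp add: x_def exp_add[symmetric])
        also have "exp (2 * ln r) = r\<^sup>2" using r by (simp add: exp_double)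
        also have "exp (- (2 * s)) = (exp (- s))\<^sup>2" using exp_double[of "- s"] by simp
        also have "exp ((p - 1) * L x) = v x powr (p - 1)" using v_pos[of x] by (simp add: powr_def L_def)
        also have "r\<^sup>2 * (exp (- s))\<^sup>2 * v x powr (p - 1) \<le> (norm y)\<^sup>2 * (exp (- s))\<^sup>2 * v x powr (p - 1)"
          using ny r by (intro mult_right_mono power_mono) auto
        finally show ?thesis by (simp add: nx power_mult_distrib mult.commute)
      qed
      ultimately have "c + exp (?X y) \<le> (exp (- s))\<^sup>2 * q x * (norm y)\<^sup>2" by linarith
      from mult_right_mono[OF this, of "(\<Phi> y)\<^sup>2"] show ?thesis by (simp add: x_def[symmetric] algebra_simps)
    qed simp
  qed
  also have "\<dots> \<le> (LBINT y. angular_sq g y) + (real DIM('a) - 2) * Y s - Y' s - (Y s)\<^sup>2"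
    by (rule mean_log_test[OF Q cQ cq])
  finally show ?thesis by simp
qed

end

section \<open>Cutting off a near-minimizer\<close>

text \<open>A C^1 substitute for the positive part: zero on the negative axis, slope between 0 and
  1, and below the positive part by at most 1.\<close>

definition soft :: "real \<Rightarrow> real" where "soft t = sqrt (1 + (max 0 t)\<^sup>2) - 1"
definition soft' :: "real \<Rightarrow> real" where "soft' t = max 0 t / sqrt (1 + (max 0 t)\<^sup>2)"
text \<open>A cut-off with value 1 for \<open>t \<le> 0\<close> and slope at most
  \<open>1 / m\<close>. It decays quadratically in \<open>soft t / m\<close>, so
  \<open>soft t * chi m t\<close> is bounded by \<open>m\<close> with slope at most 1; the same
  family thus also truncates \<open>soft\<close>.\<close>

definition chi :: "real \<Rightarrow> real \<Rightarrow> real" where "chi m t = 1 / (1 + (soft t / m)\<^sup>2)"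
definition chi' :: "real \<Rightarrow> real \<Rightarrow> real" where "chi' m t = - (2 * (soft t / m) * (soft' t / m)) / (1 + (soft t / m)\<^sup>2)\<^sup>2"
definition trunc' :: "real \<Rightarrow> real \<Rightarrow> real" where "trunc' m t = soft' t * chi m t + soft t * chi' m t"

lemma soft_pos: "1 + (max 0 t)\<^sup>2 > (0::real)"
  by (rule add_pos_nonneg) auto

lemma soft_bounds: "soft t \<ge> 0" "t \<le> 0 \<Longrightarrow> soft t = 0" "max 0 t \<le> 1 + soft t" "0 \<le> soft' t" "soft' t \<le> 1"
proof -
  show "soft t \<ge> 0" by (simp add: soft_def)
  show "t \<le> 0 \<Longrightarrow> soft t = 0" by (simp add: soft_def)
  have le: "max 0 t \<le> sqrt (1 + (max 0 t)\<^sup>2)" by (rule real_le_rsqrt) simp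
  then show "max 0 t \<le> 1 + soft t" by (simp add: soft_def)
  show "0 \<le> soft' t" by (simp add: soft'_def)
  show "soft' t \<le> 1" using le soft_pos[of t] by (simp add: soft'_def)
qed

lemma soft_deriv: "(soft has_real_derivative soft' t) (at t)"
proof -
  have "((\<lambda>t. 1 + (max 0 t)\<^sup>2) has_real_derivative 2 * max 0 t) (at t)"
    by (rule DERIV_cong[OF DERIV_add[OF DERIV_const DERIV_max0_square]]) simp
  from DERIV_chain'[OF this DERIV_real_sqrt[OF soft_pos]]
  have "((\<lambda>t. sqrt (1 + (max 0 t)\<^sup>2)) has_real_derivative soft' t) (at t)"
    by (rule DERIV_cong) (simp add: soft'_def field_simps)
  then show ?thesis unfolding soft_def[abs_def] by (rule DERIV_cong[OF DERIV_diff[OF _ DERIV_const]]) simp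
qed

lemma soft_cont: "continuous_on UNIV soft" "continuous_on UNIV soft'"
proof -
  have "sqrt (1 + (max 0 t)\<^sup>2) \<noteq> 0" for t :: real using soft_pos[of t] by simp
  then show "continuous_on UNIV soft" "continuous_on UNIV soft'"
    unfolding soft_def[abs_def] soft'_def[abs_def] by (intro continuous_intros; simp)+
qed

lemma chi_den: "1 + (soft t / m)\<^sup>2 > 0" "1 + (soft t / m)\<^sup>2 \<noteq> 0"
proof -
  show "1 + (soft t / m)\<^sup>2 > 0" by (intro add_pos_nonneg zero_less_one zero_le_power2)
  then show "1 + (soft t / m)\<^sup>2 \<noteq> 0" by (rule less_imp_neq[symmetric])
qed

lemma chi_deriv: "(chi m has_real_derivative chi' m t) (at t)"
proof -
  have "((\<lambda>t. 1 + (soft t / m)\<^sup>2) has_real_derivative 2 * (soft t / m) * (soft' t / m)) (at t)"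
    by (rule DERIV_cong[OF DERIV_add[OF DERIV_const DERIV_power[OF DERIV_cdivide[OF soft_deriv]]]]) simp
  from DERIV_inverse_fun[OF this chi_den(2)]
  show ?thesis unfolding chi_def[abs_def] inverse_eq_divide
    by (rule DERIV_cong) (simp add: chi'_def power2_eq_square inverse_eq_divide)
qed

lemma chi_cont:
  assumes "m \<ge> 1" shows "continuous_on UNIV (chi m)" "continuous_on UNIV (chi' m)"
proof -
  have "m \<noteq> 0" "(1 + (soft t / m)\<^sup>2)\<^sup>2 \<noteq> 0" "1 + (soft t / m)\<^sup>2 \<noteq> 0" for t
    using assms chi_den(2)[of t m] by (simp_all only: power_eq_0_iff) auto
  then show "continuous_on UNIV (chi m)" "continuous_on UNIV (chi' m)"
    unfolding chi_def[abs_def] chi'_def[abs_def] by (intro continuous_intros soft_cont; blast)+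
qed

lemma trunc_deriv: "((\<lambda>t. soft t * chi m t) has_real_derivative trunc' m t) (at t)"
  unfolding trunc'_def by (rule DERIV_cong[OF DERIV_mult[OF soft_deriv chi_deriv]]) simp

lemma chi_bounds:
  assumes m: "m \<ge> 1"
  shows "0 \<le> chi m t" "chi m t \<le> 1" "\<bar>chi' m t\<bar> \<le> 1 / m" "t \<le> 0 \<Longrightarrow> chi m t = 1"
    "0 \<le> soft t * chi m t" "soft t * chi m t \<le> m" "\<bar>trunc' m t\<bar> \<le> 1"
proof -
  define y where "y = soft t / m"
  have y: "y \<ge> 0" using m soft_bounds(1)[of t] by (simp add: y_def)
  have d: "1 + y\<^sup>2 > 0" using chi_den(1) by (simp add: y_def)
  have sy: "soft t = m * y" using m by (simp add: y_def)
  show "0 \<le> chi m t" "chi m t \<le> 1" using d by (auto simp: chi_def y_def[symmetric])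
  show "t \<le> 0 \<Longrightarrow> chi m t = 1" by (simp add: chi_def soft_bounds)
  then show "0 \<le> soft t * chi m t" using soft_bounds(1)[of t] d by (simp add: chi_def y_def[symmetric])
  have y1: "2 * y \<le> 1 + y\<^sup>2" using zero_le_power2[of "y - 1"] by (simp add: power2_eq_square algebra_simps)
  have d1: "1 + y\<^sup>2 \<le> (1 + y\<^sup>2)\<^sup>2" using mult_left_mono[of 1 "1 + y\<^sup>2" "1 + y\<^sup>2"] by (simp add: power2_eq_square)
  have yy: "2 * y / (1 + y\<^sup>2)\<^sup>2 \<le> 1" using y1 d1 d by (simp add: field_simps)
  have "\<bar>chi' m t\<bar> = (2 * y / (1 + y\<^sup>2)\<^sup>2) * (soft' t / m)"
    using y soft_bounds(4)[of t] m unfolding chi'_def y_def[symmetric] by (simp add: abs_mult)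
  also have "\<dots> \<le> 1 * (1 / m)"
    using yy y soft_bounds(4,5)[of t] m d by (intro mult_mono divide_right_mono) auto
  finally show "\<bar>chi' m t\<bar> \<le> 1 / m" by simp
  have "soft t * chi m t = m * (y / (1 + y\<^sup>2))" by (simp add: chi_def y_def[symmetric] sy)
  also have "\<dots> \<le> m * 1" using y1 y d m by (intro mult_left_mono) (auto simp: field_simps)
  finally show "soft t * chi m t \<le> m" by simp
  have "trunc' m t = soft' t * ((1 - y\<^sup>2) / (1 + y\<^sup>2)\<^sup>2)"
  proof -
    have "trunc' m t = soft' t * (1 / (1 + y\<^sup>2)) + (m * y) * (- (2 * y * (soft' t / m)) / (1 + y\<^sup>2)\<^sup>2)"
      unfolding trunc'_def chi_def chi'_def y_def[symmetric] by (simp add: sy)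
    also have "(m * y) * (- (2 * y * (soft' t / m)) / (1 + y\<^sup>2)\<^sup>2) = soft' t * (- 2 * y\<^sup>2 / (1 + y\<^sup>2)\<^sup>2)"
    proof -
      have "m \<noteq> 0" using m by simp
      then show ?thesis by (simp add: power2_eq_square)
    qed
    also have "1 / (1 + y\<^sup>2) = (1 + y\<^sup>2) / (1 + y\<^sup>2)\<^sup>2" using d by (simp add: power2_eq_square)
    finally show ?thesis by (simp add: distrib_left[symmetric] add_divide_distrib[symmetric] diff_divide_distrib[symmetric] right_diff_distrib[symmetric])
  qed
  then have "\<bar>trunc' m t\<bar> = soft' t * (\<bar>1 - y\<^sup>2\<bar> / (1 + y\<^sup>2)\<^sup>2)"
    using soft_bounds(4)[of t] by (simp add: abs_mult)
  also have "\<dots> \<le> 1 * 1"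
  proof (rule mult_mono)
    have "\<bar>1 - y\<^sup>2\<bar> \<le> (1 + y\<^sup>2)\<^sup>2" using d1 by (intro order_trans[OF _ d1]) (auto simp: abs_le_iff)
    then show "\<bar>1 - y\<^sup>2\<bar> / (1 + y\<^sup>2)\<^sup>2 \<le> 1" using d by simp
  qed (use soft_bounds in auto)
  finally show "\<bar>trunc' m t\<bar> \<le> 1" by simp
qed

text \<open>If \<open>F\<close> vanishes on the negative axis, \<open>\<Phi> F(t)\<close> lives over
  \<open>\<Sigma> - K\<close>, where the Poincare constant is \<open>lam + 1\<close>. By
  \<open>cutoff_energy\<close> its energy is at most \<open>lam\<close> times its square integral
  plus an error, so the gap 1 bounds the square integral itself by the error. For
  \<open>F = 1 - chi m\<close> this says that the cut-off loses little mass, for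
  \<open>F = soft * chi m\<close> that the truncated negative part of \<open>L\<close> is square
  integrable against \<open>\<Phi>^2\<close> with a bound \<open>C\<close> free of
  \<open>m\<close>.\<close>

lemma good_test_function:
  fixes \<Sigma> :: "'a::euclidean_space set"
  assumes S: "\<Sigma> \<subseteq> sphere 0 1" and ap: "angular_poincare \<Sigma> lam" and lam: "lam \<ge> 0" and apK: "angular_poincare (\<Sigma> - K) (lam + 1)"
    and r: "r > 0" and \<Phi>: "C1c {x. r \<le> norm x \<and> norm x \<le> 2 * r \<and> sgn x \<in> K'} \<Phi> g" and K': "K' \<subseteq> \<Sigma>"
    and \<Phi>1: "(LBINT x. (\<Phi> x)\<^sup>2) = 1"
    and L: "has_grad L gL UNIV" and A: "(LBINT x. (\<Phi> x)\<^sup>2 * angular_sq gL x) \<le> A"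
    and Lk: "\<And>x. r \<le> norm x \<Longrightarrow> norm x \<le> 2 * r \<Longrightarrow> sgn x \<in> K \<Longrightarrow> L x \<ge> - k0"
    and m: "m \<ge> 1" "m \<ge> 4 * (5 * A + lam + 2)"
    and e: "(LBINT x. angular_sq g x) \<le> lam + 1 / m ^ 4"
  shows "\<exists>\<Phi>' g'. C1c {x. r \<le> norm x \<and> norm x \<le> 2 * r \<and> sgn x \<in> K'} \<Phi>' g' \<and> (LBINT x. (\<Phi>' x)\<^sup>2) = 1 \<and>
     (LBINT x. angular_sq g' x) \<le> lam + 4 * (5 * A + lam + 2) / m \<and>
     (LBINT x. (\<Phi>' x)\<^sup>2 * L x) \<ge> - (k0 + 4 + 2 * (5 * A + lam + 2))"
proof -
  let ?R = "{x. r \<le> norm x \<and> norm x \<le> 2 * r \<and> sgn x \<in> K'}"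
  define C where "C = 5 * A + lam + 2"
  have m0: "m > 0" using m by simp
  have m4: "1 / m ^ 4 \<le> 1 / m\<^sup>2" "1 / m\<^sup>2 \<le> 1 / m" "1 / m \<le> 1"
    using m(1) by (auto simp: field_simps power_increasing[of 1 2 m] power_increasing[of 2 4 m] self_le_power)
  have Rc: "?R \<subseteq> cone_of \<Sigma>" using K' r by (auto simp: cone_of_eq[OF S])
  note c\<Phi> = C1c_C0c[OF \<Phi>]
  have contL: "continuous_on UNIV L" by (rule has_grad_continuous[OF L])
  have contgL: "continuous_on UNIV gL" by (rule has_grad_continuous_grad[OF L])
  have A0: "A \<ge> 0"
  proof -
    have "0 \<le> (LBINT x. (\<Phi> x)\<^sup>2 * angular_sq gL x)" by (intro integral_nonneg_AE) (auto simp: angular_sq_nonneg)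
    then show ?thesis using A by simp
  qed
  \<comment> \<open>Positive where \<open>L\<close> is very negative. The extra 1 makes
    \<open>t \<le> - 1\<close> over \<open>K\<close>, so that the closed set
    \<open>t \<ge> 0\<close> misses \<open>K\<close> and the supports are compact inside the cone
    over \<open>\<Sigma> - K\<close>.\<close>
  define t where "t x = - L x - (k0 + 1)" for x
  have en: "C1c ?R (\<lambda>x. \<Phi> x * F (t x)) (\<lambda>x. F (t x) *\<^sub>R g x + (\<Phi> x * - F' (t x)) *\<^sub>R gL x) \<and>
      (LBINT x. angular_sq (\<lambda>x. F (t x) *\<^sub>R g x + (\<Phi> x * - F' (t x)) *\<^sub>R gL x) x) - lam * (LBINT x. (\<Phi> x * F (t x))\<^sup>2)
       \<le> l\<^sup>2 * A + (1 / m ^ 4) / (2 * \<sigma>) + \<sigma> * (B ^ 4 * (lam + 1) + 4 * B\<^sup>2 * l\<^sup>2 * A)"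
    if F: "\<And>t. (F has_real_derivative F' t) (at t)" "continuous_on UNIV F'" "\<And>t. \<bar>F' t\<bar> \<le> l" "\<And>t. \<bar>F t\<bar> \<le> B" and "\<sigma> > 0"
    for F F' :: "real \<Rightarrow> real" and l B \<sigma>
  proof -
    have d: "((\<lambda>l. F (- l - (k0 + 1))) has_real_derivative - F' (- l - (k0 + 1))) (at l)" for l
    proof -
      have "((\<lambda>l. - l - (k0 + 1)) has_real_derivative -1) (at l)" by (auto intro!: derivative_eq_intros)
      from DERIV_chain2[OF F(1) this] show ?thesis by simp
    qed
    have c: "continuous_on UNIV (\<lambda>l. - F' (- l - (k0 + 1)))"
      by (intro continuous_intros continuous_on_compose2[OF F(2)]) auto
    have "(LBINT x. angular_sq g x) - lam * (LBINT x. (\<Phi> x)\<^sup>2) \<le> 1 / m ^ 4" using e \<Phi>1 by simp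
    from cutoff_energy[OF ap lam S C1c_mono[OF \<Phi> Rc] L this \<open>\<sigma> > 0\<close> d c, of l B "lam + 1" A] F(3,4) e A m4
    show ?thesis using C1c_times_compose[OF \<Phi> L d c] unfolding t_def by simp
  qed
  have E1: "C1c (cone_of (\<Sigma> - K)) (\<lambda>x. \<Phi> x * F (t x)) gg \<Longrightarrow> (lam + 1) * (LBINT x. (\<Phi> x * F (t x))\<^sup>2) \<le> (LBINT x. angular_sq gg x)" for F gg
  proof -
    assume C: "C1c (cone_of (\<Sigma> - K)) (\<lambda>x. \<Phi> x * F (t x)) gg"
    have "\<Sigma> - K \<subseteq> sphere 0 1" using S by auto
    from angular_poincare_cone[OF apK _ this C] lam show ?thesis by simp
  qed
  have sup: "C1c (cone_of (\<Sigma> - K)) (\<lambda>x. \<Phi> x * F (t x)) gg"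
    if C: "C1c ?R (\<lambda>x. \<Phi> x * F (t x)) gg" and F: "\<And>t. t \<le> 0 \<Longrightarrow> F t = 0" for F gg
  proof -
    obtain K1 where K1: "compact K1" "K1 \<subseteq> ?R" "\<forall>x. x \<notin> K1 \<longrightarrow> \<Phi> x * F (t x) = 0" and hg: "has_grad (\<lambda>x. \<Phi> x * F (t x)) gg UNIV"
      using C unfolding C1c_def by (elim conjE exE)
    have cl: "closed {x. t x \<ge> 0}" unfolding t_def
      by (intro closed_Collect_le continuous_intros contL)
    show ?thesis
    proof (rule C1cI[OF hg])
      show "compact (K1 \<inter> {x. t x \<ge> 0})" by (rule compact_Int_closed[OF K1(1) cl])
      show "K1 \<inter> {x. t x \<ge> 0} \<subseteq> cone_of (\<Sigma> - K)"
      proof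
        fix x assume x: "x \<in> K1 \<inter> {x. t x \<ge> 0}"
        then have x2: "r \<le> norm x" "norm x \<le> 2 * r" "sgn x \<in> K'" "t x \<ge> 0" using K1(2) by auto
        have "sgn x \<notin> K" using Lk[OF x2(1,2)] x2(4) by (auto simp: t_def)
        moreover have "\<Sigma> - K \<subseteq> sphere 0 1" using S by auto
        ultimately show "x \<in> cone_of (\<Sigma> - K)" using x2 K' r by (auto simp: cone_of_eq)
      qed
      show "\<Phi> x * F (t x) = 0" if "x \<notin> K1 \<inter> {x. t x \<ge> 0}" for x
        using that K1(3) F[of "t x"] by (cases "x \<in> K1") auto
    qed
  qed
  have ct: "continuous_on UNIV t" unfolding t_def[abs_def] by (intro continuous_intros contL)
  have c1: "continuous_on UNIV (\<lambda>x. chi m (t x))" by (rule continuous_on_compose2[OF chi_cont(1)[OF m(1)] ct]) auto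
  have c2: "continuous_on UNIV (\<lambda>x. soft (t x))" by (rule continuous_on_compose2[OF soft_cont(1) ct]) auto
  have ints: "integrable lborel (\<lambda>x. (\<Phi> x * chi m (t x))\<^sup>2)" "integrable lborel (\<lambda>x. (\<Phi> x * (1 - chi m (t x)))\<^sup>2)"
    "integrable lborel (\<lambda>x. (\<Phi> x * (soft (t x) * chi m (t x)))\<^sup>2)" "integrable lborel (\<lambda>x. (\<Phi> x)\<^sup>2)"
    "integrable lborel (\<lambda>x. (\<Phi> x * chi m (t x))\<^sup>2 * L x)"
    by (intro C0c_integrable C0c_intros c\<Phi> continuous_intros c1 c2 contL)+
  have f_bound: "(LBINT x. (\<Phi> x * (soft (t x) * chi m (t x)))\<^sup>2) \<le> C"
  proof -
    have cf: "continuous_on UNIV (trunc' m)" unfolding trunc'_def[abs_def] by (intro continuous_intros chi_cont[OF m(1)] soft_cont)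
    have bf: "\<bar>soft t * chi m t\<bar> \<le> m" for t using chi_bounds[OF m(1), of t] by simp
    \<comment> \<open>The truncation is as large as \<open>m\<close>, so
      \<open>\<sigma> = 1 / m ^ 4\<close> is needed against \<open>B ^ 4\<close>; then
      \<open>e / (2 * \<sigma>)\<close> stays bounded only because the near-minimizer is precise to
      \<open>1 / m ^ 4\<close>.\<close>
    have "1 / m ^ 4 > 0" using m0 by simp
    from en[OF trunc_deriv cf chi_bounds(7)[OF m(1)] bf this]
    have X: "C1c ?R (\<lambda>x. \<Phi> x * (soft (t x) * chi m (t x))) (\<lambda>x. (soft (t x) * chi m (t x)) *\<^sub>R g x + (\<Phi> x * - trunc' m (t x)) *\<^sub>R gL x)"
      and Y: "(LBINT x. angular_sq (\<lambda>x. (soft (t x) * chi m (t x)) *\<^sub>R g x + (\<Phi> x * - trunc' m (t x)) *\<^sub>R gL x) x)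
        - lam * (LBINT x. (\<Phi> x * (soft (t x) * chi m (t x)))\<^sup>2)
        \<le> 1\<^sup>2 * A + (1 / m ^ 4) / (2 * (1 / m ^ 4)) + 1 / m ^ 4 * (m ^ 4 * (lam + 1) + 4 * m\<^sup>2 * 1\<^sup>2 * A)" by blast+
    have "C1c (cone_of (\<Sigma> - K)) (\<lambda>x. \<Phi> x * (soft (t x) * chi m (t x))) (\<lambda>x. (soft (t x) * chi m (t x)) *\<^sub>R g x + (\<Phi> x * - trunc' m (t x)) *\<^sub>R gL x)"
      by (rule sup[where F="\<lambda>t. soft t * chi m t", OF X]) (simp add: soft_bounds)
    from E1[where F="\<lambda>t. soft t * chi m t", OF this] Y
    have "(LBINT x. (\<Phi> x * (soft (t x) * chi m (t x)))\<^sup>2) \<le> 1\<^sup>2 * A + (1 / m ^ 4) / (2 * (1 / m ^ 4)) + 1 / m ^ 4 * (m ^ 4 * (lam + 1) + 4 * m\<^sup>2 * 1\<^sup>2 * A)"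
      by (simp add: algebra_simps)
    also have "\<dots> = A + 1 / 2 + (lam + 1) + 4 * A * (1 / m\<^sup>2)"
    proof -
      have "1 / m ^ 4 * (m ^ 4 * (lam + 1) + 4 * m\<^sup>2 * 1\<^sup>2 * A) = (lam + 1) + 4 * A * (1 / m\<^sup>2)"
        using m0 by (simp add: field_simps power2_eq_square power4_eq_xxxx)
      moreover have "(1 / m ^ 4) / (2 * (1 / m ^ 4)) = 1 / 2" using m0 by simp
      ultimately show ?thesis by simp
    qed
    also have "\<dots> \<le> A + 1 / 2 + (lam + 1) + 4 * A * 1"
      using m4 A0 by (intro add_mono mult_left_mono) auto
    finally show ?thesis by (simp add: C_def)
  qed
  \<comment> \<open>For cut-offs bounded by 1 with slope \<open>1 / m\<close>, the choice
    \<open>\<sigma> = 1 / m\<close> makes every error term of order \<open>1 / m\<close>.\<close>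
  have small: "l\<^sup>2 * A + (1 / m ^ 4) / (2 * (1 / m)) + 1 / m * (1 ^ 4 * (lam + 1) + 4 * 1\<^sup>2 * l\<^sup>2 * A) \<le> C / m" if l: "l = 1 / m" for l
  proof -
    have l2: "l\<^sup>2 \<le> 1 / m" "l\<^sup>2 \<le> 1" using m4 by (auto simp: l power_divide)
    have "l\<^sup>2 * A \<le> 1 / m * A" "4 * (l\<^sup>2 * A) \<le> 4 * A"
      using mult_right_mono[OF l2(1) A0] mult_right_mono[OF l2(2) A0] by simp_all
    moreover have "(1 / m ^ 4) / (2 * (1 / m)) \<le> 1 / m"
    proof -
      have "(1 / m ^ 4) / (2 * (1 / m)) = (1 / m ^ 4) * m / 2" using m0 by simp
      also have "\<dots> \<le> (1 / m\<^sup>2) * m / 2" using m4 m0 by (intro divide_right_mono mult_right_mono) auto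
      also have "\<dots> \<le> 1 / m" using m0 by (simp add: field_simps power2_eq_square)
      finally show ?thesis .
    qed
    moreover have "1 / m * (1 ^ 4 * (lam + 1) + 4 * 1\<^sup>2 * l\<^sup>2 * A) \<le> 1 / m * (lam + 1 + 4 * A)"
      using \<open>4 * (l\<^sup>2 * A) \<le> 4 * A\<close> m0 by (intro mult_left_mono) auto
    ultimately have "l\<^sup>2 * A + (1 / m ^ 4) / (2 * (1 / m)) + 1 / m * (1 ^ 4 * (lam + 1) + 4 * 1\<^sup>2 * l\<^sup>2 * A) \<le> 1 / m * A + 1 / m + 1 / m * (lam + 1 + 4 * A)" by linarith
    also have "\<dots> = C / m" by (simp add: C_def add_divide_distrib algebra_simps)
    finally show ?thesis .
  qed
  have m1: "1 / m > 0" using m0 by simp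
  have one_minus: "(LBINT x. (\<Phi> x * (1 - chi m (t x)))\<^sup>2) \<le> C / m"
  proof -
    have d: "((\<lambda>t. 1 - chi m t) has_real_derivative - chi' m t) (at t)" for t
      by (auto intro!: derivative_eq_intros chi_deriv)
    have c: "continuous_on UNIV (\<lambda>t. - chi' m t)" by (intro continuous_intros chi_cont[OF m(1)])
    have b1: "\<bar>- chi' m t\<bar> \<le> 1 / m" "\<bar>1 - chi m t\<bar> \<le> 1" for t using chi_bounds[OF m(1), of t] by auto
    from en[OF d c b1 m1]
    have X: "C1c ?R (\<lambda>x. \<Phi> x * (1 - chi m (t x))) (\<lambda>x. (1 - chi m (t x)) *\<^sub>R g x + (\<Phi> x * - (- chi' m (t x))) *\<^sub>R gL x)"
      and Y: "(LBINT x. angular_sq (\<lambda>x. (1 - chi m (t x)) *\<^sub>R g x + (\<Phi> x * - (- chi' m (t x))) *\<^sub>R gL x) x)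
        - lam * (LBINT x. (\<Phi> x * (1 - chi m (t x)))\<^sup>2)
        \<le> (1 / m)\<^sup>2 * A + (1 / m ^ 4) / (2 * (1 / m)) + 1 / m * (1 ^ 4 * (lam + 1) + 4 * 1\<^sup>2 * (1 / m)\<^sup>2 * A)" by blast+
    have "C1c (cone_of (\<Sigma> - K)) (\<lambda>x. \<Phi> x * (1 - chi m (t x))) (\<lambda>x. (1 - chi m (t x)) *\<^sub>R g x + (\<Phi> x * - (- chi' m (t x))) *\<^sub>R gL x)"
      by (rule sup[where F="\<lambda>t. 1 - chi m t", OF X]) (simp add: chi_bounds[OF m(1)])
    from E1[where F="\<lambda>t. 1 - chi m t", OF this] Y small[OF refl]
    show ?thesis by (simp only: distrib_right mult_1)
  qed
  \<comment> \<open>The retained mass. From \<open>1 <= 2 I + 2 C / m\<close> and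
    \<open>m >= 4 C\<close> it is at least 1/4, whence the factors 4 in the conclusion.\<close>
  define I where "I = (LBINT x. (\<Phi> x * chi m (t x))\<^sup>2)"
  have I: "I \<ge> 1 / 4"
  proof -
    have "(LBINT x. (\<Phi> x)\<^sup>2) \<le> (LBINT x. 2 * (\<Phi> x * chi m (t x))\<^sup>2 + 2 * (\<Phi> x * (1 - chi m (t x)))\<^sup>2)"
    proof (rule integral_mono)
      fix x
      have "0 \<le> (\<Phi> x * chi m (t x) - \<Phi> x * (1 - chi m (t x)))\<^sup>2" by simp
      then show "(\<Phi> x)\<^sup>2 \<le> 2 * (\<Phi> x * chi m (t x))\<^sup>2 + 2 * (\<Phi> x * (1 - chi m (t x)))\<^sup>2"
        by (simp add: power2_eq_square algebra_simps)
    qed (use ints in auto)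
    also have "\<dots> = 2 * I + 2 * (LBINT x. (\<Phi> x * (1 - chi m (t x)))\<^sup>2)" using ints by (simp add: I_def)
    also have "\<dots> \<le> 2 * I + 2 * (C / m)" using one_minus by simp
    also have "C / m \<le> 1 / 4" using m m0 by (simp add: C_def field_simps)
    finally show ?thesis using \<Phi>1 by simp
  qed
  have b1: "\<bar>chi' m t\<bar> \<le> 1 / m" "\<bar>chi m t\<bar> \<le> 1" for t using chi_bounds[OF m(1), of t] by auto
  define gc where "gc = (\<lambda>x. chi m (t x) *\<^sub>R g x + (\<Phi> x * - chi' m (t x)) *\<^sub>R gL x)"
  from en[OF chi_deriv chi_cont(2)[OF m(1)] b1 m1]
  have X: "C1c ?R (\<lambda>x. \<Phi> x * chi m (t x)) gc"
    and Y: "(LBINT x. angular_sq gc x) - lam * I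
      \<le> (1 / m)\<^sup>2 * A + (1 / m ^ 4) / (2 * (1 / m)) + 1 / m * (1 ^ 4 * (lam + 1) + 4 * 1\<^sup>2 * (1 / m)\<^sup>2 * A)"
    unfolding gc_def I_def by blast+
  \<comment> \<open>Restores square integral 1. The summand with coefficient 0 in the witness lets
    \<open>C1c_lincomb\<close> serve for scalar multiples.\<close>
  define \<nu> where "\<nu> = 1 / sqrt I"
  have \<nu>2: "\<nu>\<^sup>2 = 1 / I" using I by (simp add: \<nu>_def power_divide)
  show ?thesis
  proof (intro exI conjI)
    show "C1c ?R (\<lambda>x. \<nu> * (\<Phi> x * chi m (t x)) + 0 * (\<Phi> x * chi m (t x))) (\<lambda>x. \<nu> *\<^sub>R gc x + 0 *\<^sub>R gc x)"
      by (rule C1c_lincomb[OF X X])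
    show "(LBINT x. (\<nu> * (\<Phi> x * chi m (t x)) + 0 * (\<Phi> x * chi m (t x)))\<^sup>2) = 1"
      using I by (simp add: power_mult_distrib[of \<nu>] \<nu>2 I_def[symmetric])
    have "(LBINT x. angular_sq (\<lambda>x. \<nu> *\<^sub>R gc x + 0 *\<^sub>R gc x) x) = (LBINT x. angular_sq gc x) / I"
      unfolding angular_sq_lincomb by (simp add: \<nu>2)
    also have "\<dots> \<le> (lam * I + C / m) / I"
      using Y small[OF refl] I by (intro divide_right_mono) auto
    also have "\<dots> = lam + (C / m) * (1 / I)" using I by (simp add: field_simps)
    also have "\<dots> \<le> lam + (C / m) * 4"
    proof -
      have "1 / I \<le> 4" using I by (simp add: field_simps)
      moreover have "C / m \<ge> 0" using A0 lam m0 by (simp add: C_def)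
      ultimately show ?thesis by (intro add_left_mono mult_left_mono)
    qed
    finally show "(LBINT x. angular_sq (\<lambda>x. \<nu> *\<^sub>R gc x + 0 *\<^sub>R gc x) x) \<le> lam + 4 * (5 * A + lam + 2) / m" by (simp add: C_def mult.commute)
    have "(LBINT x. - (k0 + 2) * (\<Phi> x * chi m (t x))\<^sup>2 - (\<Phi> x)\<^sup>2 / 2 - (\<Phi> x * (soft (t x) * chi m (t x)))\<^sup>2 / 2)
       \<le> (LBINT x. (\<Phi> x * chi m (t x))\<^sup>2 * L x)"
    proof (rule integral_mono)
      fix x
      define w where "w = (chi m (t x))\<^sup>2"
      have w: "0 \<le> w" "w \<le> 1" using chi_bounds[OF m(1), of "t x"] by (auto simp: w_def power_le_one)
      have "L x \<ge> - (k0 + 1) - max 0 (t x)" by (simp add: t_def)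
      then have "L x \<ge> - (k0 + 2) - soft (t x)" using soft_bounds(3)[of "t x"] by linarith
      then have "w * L x \<ge> w * (- (k0 + 2) - soft (t x))" using w by (intro mult_left_mono)
      \<comment> \<open>The linear growth of \<open>- L\<close> is traded for a square, since
        \<open>soft * chi m\<close> is what has been controlled, and in the square.\<close>
      moreover have "w * soft (t x) \<le> 1 / 2 + (soft (t x))\<^sup>2 * w / 2"
      proof -
        have "0 \<le> (1 - soft (t x))\<^sup>2" by simp
        then have "soft (t x) \<le> (1 + (soft (t x))\<^sup>2) / 2" by (simp add: power2_eq_square algebra_simps)
        from mult_left_mono[OF this w(1)] w show ?thesis by (simp add: algebra_simps)
      qed
      ultimately have "w * L x \<ge> - (k0 + 2) * w - 1 / 2 - (soft (t x))\<^sup>2 * w / 2" by (simp add: algebra_simps)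
      from mult_left_mono[OF this, of "(\<Phi> x)\<^sup>2"]
      show "- (k0 + 2) * (\<Phi> x * chi m (t x))\<^sup>2 - (\<Phi> x)\<^sup>2 / 2 - (\<Phi> x * (soft (t x) * chi m (t x)))\<^sup>2 / 2 \<le> (\<Phi> x * chi m (t x))\<^sup>2 * L x"
        by (simp add: w_def power_mult_distrib algebra_simps)
    qed (use ints in auto)
    also have "(LBINT x. - (k0 + 2) * (\<Phi> x * chi m (t x))\<^sup>2 - (\<Phi> x)\<^sup>2 / 2 - (\<Phi> x * (soft (t x) * chi m (t x)))\<^sup>2 / 2)
      = - (k0 + 2) * I - 1 / 2 - (LBINT x. (\<Phi> x * (soft (t x) * chi m (t x)))\<^sup>2) / 2"
      using ints \<Phi>1 by (simp add: I_def)
    finally have "- (k0 + 2) * I - 1 / 2 - C / 2 \<le> (LBINT x. (\<Phi> x * chi m (t x))\<^sup>2 * L x)" using f_bound by simp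
    then have "(- (k0 + 2) * I - (1 + C) / 2) / I \<le> (LBINT x. (\<Phi> x * chi m (t x))\<^sup>2 * L x) / I"
      using I by (intro divide_right_mono) (auto simp: field_simps)
    moreover have "(LBINT x. (\<nu> * (\<Phi> x * chi m (t x)) + 0 * (\<Phi> x * chi m (t x)))\<^sup>2 * L x) = (LBINT x. (\<Phi> x * chi m (t x))\<^sup>2 * L x) / I"
      by (simp add: power_mult_distrib[of \<nu>] \<nu>2)
    moreover have "(- (k0 + 2) * I - (1 + C) / 2) / I = - (k0 + 2) - (1 + C) / 2 * (1 / I)" using I by (simp add: field_simps)
    moreover have "(1 + C) / 2 * (1 / I) \<le> (1 + C) / 2 * 4"
    proof -
      have "1 / I \<le> 4" using I by (simp add: field_simps)
      moreover have "(1 + C) / 2 \<ge> 0" using A0 lam by (simp add: C_def)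
      ultimately show ?thesis by (intro mult_left_mono)
    qed
    ultimately have "- (k0 + 2) - (1 + C) / 2 * 4 \<le> (LBINT x. (\<nu> * (\<Phi> x * chi m (t x)) + 0 * (\<Phi> x * chi m (t x)))\<^sup>2 * L x)"
      by linarith
    moreover have "- (k0 + 2) - (1 + C) / 2 * 4 = - (k0 + 4 + 2 * (5 * A + lam + 2))" by (simp add: C_def field_simps)
    ultimately show "- (k0 + 4 + 2 * (5 * A + lam + 2)) \<le> (LBINT x. (\<nu> * (\<Phi> x * chi m (t x)) + 0 * (\<Phi> x * chi m (t x)))\<^sup>2 * L x)"
      by simp
  qed
qed

lemma angular_sq_scale: "angular_sq (\<lambda>x. b *\<^sub>R g x + 0 *\<^sub>R g x) x = b\<^sup>2 * angular_sq g x"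
  by (simp add: angular_sq_def power_mult_distrib right_diff_distrib mult_ac)

text \<open>A function violating the Poincare inequality with \<open>lam + e\<close>, multiplied by
  the radial bump and normalized. The bound on the full Dirichlet integral does not depend on
  \<open>e\<close>; this keeps the Caccioppoli constant fixed while the precision is
  refined.\<close>

lemma near_minimizer:
  fixes \<Sigma> :: "'a::euclidean_space set"
  assumes Ss: "\<Sigma> \<subseteq> sphere 0 1" and nap: "\<not> angular_poincare \<Sigma> (lam + e)" and lam: "lam \<ge> 0" and e: "0 < e" "e \<le> 1" and r: "r > 0"
    and k: "radial_ratios TYPE('a) r k1 k2"
  shows "\<exists>K' \<Phi> g. compact K' \<and> K' \<subseteq> \<Sigma> \<and> C1c {x. r \<le> norm x \<and> norm x \<le> 2 * r \<and> sgn x \<in> K'} \<Phi> g \<and>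
     (LBINT x. (\<Phi> x)\<^sup>2) = 1 \<and> (LBINT x. angular_sq g x) \<le> lam + e \<and>
     r\<^sup>2 * (LBINT x. (norm (g x))\<^sup>2) \<le> lam + 1 + r\<^sup>2 * k2 / k1"
proof -
  from nap obtain \<psi> :: "'a \<Rightarrow> real" and g where h: "hom_adm \<Sigma> \<psi> g"
    and lt: "\<not> ennreal (lam + e) * ball_integral (\<lambda>x. (\<psi> x)\<^sup>2) \<le> ball_integral (\<lambda>x. (norm x)\<^sup>2 * (norm (g x))\<^sup>2)"
    unfolding angular_poincare_def by blast
  obtain X Y where XY: "X \<ge> 0" "Y \<ge> 0" "ball_integral (\<lambda>x. (\<psi> x)\<^sup>2) = ennreal X" "ball_integral (\<lambda>x. (norm x)\<^sup>2 * (norm (g x))\<^sup>2) = ennreal Y"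
      "(LBINT x. (radial_bump r x * \<psi> x)\<^sup>2) = k1 * X"
      "(LBINT x. (radial_bump r x)\<^sup>2 * ((norm x)\<^sup>2 * (norm (g x))\<^sup>2)) = k1 * Y"
      "integrable lborel (\<lambda>x. (\<psi> x)\<^sup>2 * (norm (radial_bump_grad r x))\<^sup>2)"
      "(LBINT x. (\<psi> x)\<^sup>2 * (norm (radial_bump_grad r x))\<^sup>2) = k2 * X"
    by (rule radial_ratiosE[OF k Ss h])
  have k1: "k1 > 0" "k2 \<ge> 0" using k by (simp_all add: radial_ratios_def)
  have lt2: "Y < (lam + e) * X"
  proof (rule ccontr)
    assume "\<not> Y < (lam + e) * X"
    then have "ennreal ((lam + e) * X) \<le> ennreal Y" by (intro ennreal_leI) simp
    then show False using lt lam e XY(1) unfolding XY(3,4) by (simp add: ennreal_mult)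
  qed
  have X: "X > 0"
  proof (rule ccontr)
    assume "\<not> X > 0" then have "X = 0" using XY by simp
    then show False using lt2 XY(2) by simp
  qed
  obtain K' where K': "compact K'" "K' \<subseteq> \<Sigma>" "\<And>x. sgn x \<notin> K' \<Longrightarrow> \<psi> x = 0" using h unfolding hom_adm_def by blast
  note c = C1c_radial_bump_hom[OF r h Ss K']
  note C0c = C1c_C0c[OF c]
  define \<nu> where "\<nu> = 1 / sqrt (k1 * X)"
  have \<nu>: "\<nu>\<^sup>2 = 1 / (k1 * X)" using k1 X by (simp add: \<nu>_def power_divide)
  let ?f = "\<lambda>x. radial_bump r x * \<psi> x" and ?g = "\<lambda>x. radial_bump r x *\<^sub>R g x + \<psi> x *\<^sub>R radial_bump_grad r x"
  have i1: "integrable lborel (\<lambda>x. (radial_bump r x)\<^sup>2 * ((norm x)\<^sup>2 * (norm (g x))\<^sup>2))"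
    unfolding norm_radial_bump_hom(2)[OF h r, symmetric] by (intro C0c_integrable C0c_angular_sq C0c)
  show ?thesis
  proof (intro exI conjI)
    show "C1c {x. r \<le> norm x \<and> norm x \<le> 2 * r \<and> sgn x \<in> K'} (\<lambda>x. \<nu> * ?f x + 0 * ?f x) (\<lambda>x. \<nu> *\<^sub>R ?g x + 0 *\<^sub>R ?g x)"
      by (rule C1c_lincomb[OF c c])
    show "(LBINT x. (\<nu> * ?f x + 0 * ?f x)\<^sup>2) = 1"
      using k1 X by (simp add: power_mult_distrib[of \<nu>] \<nu> XY(5))
    have "(LBINT x. angular_sq (\<lambda>x. \<nu> *\<^sub>R ?g x + 0 *\<^sub>R ?g x) x) = \<nu>\<^sup>2 * (k1 * Y)"
      unfolding angular_sq_scale norm_radial_bump_hom(2)[OF h r] by (simp add: XY(6))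
    also have "\<dots> = Y / X" using k1 by (simp add: \<nu>)
    also have "\<dots> \<le> lam + e" using lt2 X by (simp add: field_simps)
    finally show "(LBINT x. angular_sq (\<lambda>x. \<nu> *\<^sub>R ?g x + 0 *\<^sub>R ?g x) x) \<le> lam + e" .
    have "r\<^sup>2 * (LBINT x. (norm (\<nu> *\<^sub>R ?g x + 0 *\<^sub>R ?g x))\<^sup>2) = \<nu>\<^sup>2 * (LBINT x. r\<^sup>2 * (norm (?g x))\<^sup>2)"
      by (simp add: power_mult_distrib)
    also have "\<dots> \<le> \<nu>\<^sup>2 * (LBINT x. (radial_bump r x)\<^sup>2 * ((norm x)\<^sup>2 * (norm (g x))\<^sup>2) + r\<^sup>2 * ((\<psi> x)\<^sup>2 * (norm (radial_bump_grad r x))\<^sup>2))"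
    proof (intro mult_left_mono integral_mono)
      show "integrable lborel (\<lambda>x. r\<^sup>2 * (norm (?g x))\<^sup>2)" by (intro integrable_mult_right C0c_integrable C0c_intros C0c)
      show "integrable lborel (\<lambda>x. (radial_bump r x)\<^sup>2 * ((norm x)\<^sup>2 * (norm (g x))\<^sup>2) + r\<^sup>2 * ((\<psi> x)\<^sup>2 * (norm (radial_bump_grad r x))\<^sup>2))"
        using i1 XY(7) by simp
      fix x :: 'a
      have "r\<^sup>2 * ((radial_bump r x)\<^sup>2 * (norm (g x))\<^sup>2) \<le> (radial_bump r x)\<^sup>2 * ((norm x)\<^sup>2 * (norm (g x))\<^sup>2)"
      proof (cases "radial_bump r x = 0")
        case False
        then have "r \<le> norm x" using radial_bump_zero[OF r, of x] by auto
        then have "r\<^sup>2 \<le> (norm x)\<^sup>2" using r by (intro power_mono) auto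
        then have "r\<^sup>2 * ((radial_bump r x)\<^sup>2 * (norm (g x))\<^sup>2) \<le> (norm x)\<^sup>2 * ((radial_bump r x)\<^sup>2 * (norm (g x))\<^sup>2)" by (intro mult_right_mono) auto
        then show ?thesis by (simp add: mult_ac)
      qed simp
      then show "r\<^sup>2 * (norm (?g x))\<^sup>2 \<le> (radial_bump r x)\<^sup>2 * ((norm x)\<^sup>2 * (norm (g x))\<^sup>2) + r\<^sup>2 * ((\<psi> x)\<^sup>2 * (norm (radial_bump_grad r x))\<^sup>2)"
        unfolding norm_radial_bump_hom(1)[OF h r] by (simp add: distrib_left)
    qed simp
    also have "\<dots> = \<nu>\<^sup>2 * (k1 * Y + r\<^sup>2 * (k2 * X))" using i1 XY(6,7,8) by simp
    also have "\<dots> = Y / X + r\<^sup>2 * k2 / k1" using k1 X by (simp add: \<nu> add_divide_distrib)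
    also have "Y / X \<le> lam + 1"
    proof -
      have "(lam + e) * X \<le> (lam + 1) * X" using e X by (intro mult_right_mono) auto
      then have "Y \<le> (lam + 1) * X" using lt2 by linarith
      then show ?thesis using X by (simp add: pos_divide_le_eq)
    qed
    finally show "r\<^sup>2 * (LBINT x. (norm (\<nu> *\<^sub>R ?g x + 0 *\<^sub>R ?g x))\<^sup>2) \<le> lam + 1 + r\<^sup>2 * k2 / k1" by simp
  qed (rule K')+
qed

text \<open>The quantifiers of \<open>moll\<close> are decisive: \<open>k\<close> is given before
  \<open>Q\<close> and \<open>\<eta>\<close>. From \<open>k\<close> come the lower bound for
  \<open>M 0\<close>, then \<open>e\<close> and the length \<open>T\<close>, then the precision
  \<open>m\<close>, then the near-minimizer, and only then the set \<open>Q\<close> on which a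
  supersolution is requested.\<close>

lemma no_supersolution_family:
  fixes \<Sigma> :: "'a::euclidean_space set" and a c p r \<kappa> lam :: real
  assumes S: "openin (top_of_set (sphere 0 1)) \<Sigma>" and ap: "angular_poincare \<Sigma> lam" and lam: "lam \<ge> 0"
    and nap: "\<And>e. e > 0 \<Longrightarrow> \<not> angular_poincare \<Sigma> (lam + e)"
    and a: "a = (real DIM('a) - 2) / 2" and \<kappa>: "\<kappa> \<ge> 0" "\<kappa>\<^sup>2 = a\<^sup>2 + lam - c" and c: "c > 0" and p: "p > 1"
    and beta: "2 / (p - 1) \<le> a - \<kappa>" and r: "r > 0"
    and moll: "\<And>K1. compact K1 \<Longrightarrow> K1 \<subseteq> {x \<in> cone_of \<Sigma>. norm x \<le> 2 * r} \<Longrightarrow>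
      \<exists>k>0. \<forall>Q \<eta>. compact Q \<longrightarrow> Q \<subseteq> {x \<in> cone_of \<Sigma>. norm x \<le> 2 * r} \<longrightarrow> \<eta> > 0 \<longrightarrow>
        (\<exists>v gv. has_grad v gv UNIV \<and> (\<forall>x. v x > 0) \<and>
           weak_supersol v gv (\<lambda>x. (c - \<eta>) / (norm x)\<^sup>2 + v x powr (p - 1)) Q \<and> (\<forall>x\<in>K1. k \<le> v x))"
  shows False
proof -
  have Ss: "\<Sigma> \<subseteq> sphere 0 1" using openin_imp_subset[OF S] by simp
  obtain k1 k2 where kk: "radial_ratios TYPE('a) r k1 k2" using radial_constants[OF r] by blast
  obtain K where K: "compact K" "K \<subseteq> \<Sigma>" "angular_poincare (\<Sigma> - K) (lam + 1)"
    using exists_compact_angular_poincare_complement[OF S, of "lam + 1"] lam by auto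
  define K1 where "K1 = {x. r \<le> norm x \<and> norm x \<le> 2 * r \<and> sgn x \<in> K}"
  have K1: "compact K1" unfolding K1_def by (rule compact_annulus_cone) (use K Ss r in auto)
  have "K1 \<subseteq> {x \<in> cone_of \<Sigma>. norm x \<le> 2 * r}" using K(2) r by (auto simp: K1_def cone_of_eq[OF Ss])
  from moll[OF K1 this] obtain k where k: "k > 0" and mol: "\<forall>Q \<eta>. compact Q \<longrightarrow> Q \<subseteq> {x \<in> cone_of \<Sigma>. norm x \<le> 2 * r} \<longrightarrow> \<eta> > 0 \<longrightarrow>
        (\<exists>v gv. has_grad v gv UNIV \<and> (\<forall>x. v x > 0) \<and>
           weak_supersol v gv (\<lambda>x. (c - \<eta>) / (norm x)\<^sup>2 + v x powr (p - 1)) Q \<and> (\<forall>x\<in>K1. k \<le> v x))" by blast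
  define k0 where "k0 = - ln k"
  \<comment> \<open>16 is 4 from the Caccioppoli inequality times 4 from
    \<open>norm x \<le> 2 * r\<close>; the other factor bounds the Dirichlet integral of all
    near-minimizers.\<close>
  define A where "A = 16 * (lam + 1 + r\<^sup>2 * k2 / k1)"
  have k12: "k1 > 0" "k2 \<ge> 0" using kk by (simp_all add: radial_ratios_def)
  have A0: "A \<ge> 0" using lam k12 by (simp add: A_def)
  define C where "C = 5 * A + lam + 2"
  have C0: "C > 0" using A0 lam by (simp add: C_def)
  obtain e T where e: "e > 0" and T: "T > 0" and ode: "\<forall>M y y'.
     (\<forall>s\<in>{0..T}. (M has_real_derivative y s) (at s)) \<longrightarrow>
     (\<forall>s\<in>{0..T}. (y has_real_derivative y' s) (at s)) \<longrightarrow>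
     (\<forall>s\<in>{0..T}. y' s \<le> - (y s - a)\<^sup>2 + \<kappa>\<^sup>2 + e - r\<^sup>2 * exp ((p - 1) * (M s - 2 / (p - 1) * s))) \<longrightarrow>
     M 0 \<ge> - (k0 + 4 + 2 * C) \<longrightarrow> False"
    using riccati_blowup[OF \<kappa>(1) beta, of "p - 1" "r\<^sup>2" "- (k0 + 4 + 2 * C)"] p r by auto
  \<comment> \<open>\<open>4 * C\<close> is demanded by the cut-off, \<open>8 * C / e\<close> makes
    the energy excess at most \<open>e / 2\<close>; the other half of \<open>e\<close> is reserved
    for \<open>\<eta>\<close>.\<close>
  define m where "m = max 1 (max (4 * C) (8 * C / e))"
  have m: "m \<ge> 1" "m \<ge> 4 * C" "m \<ge> 8 * C / e" by (auto simp: m_def)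
  have mC: "4 * C / m \<le> e / 2" using m(1,3) e by (simp add: field_simps)
  have m4: "0 < 1 / m ^ 4" "1 / m ^ 4 \<le> 1" using m(1) by auto
  obtain K' \<Phi>0 g0 where K': "compact K'" "K' \<subseteq> \<Sigma>" and \<Phi>0: "C1c {x. r \<le> norm x \<and> norm x \<le> 2 * r \<and> sgn x \<in> K'} \<Phi>0 g0"
    and \<Phi>1: "(LBINT x. (\<Phi>0 x)\<^sup>2) = 1" and \<Phi>e: "(LBINT x. angular_sq g0 x) \<le> lam + 1 / m ^ 4"
    and \<Phi>g: "r\<^sup>2 * (LBINT x. (norm (g0 x))\<^sup>2) \<le> lam + 1 + r\<^sup>2 * k2 / k1"
    using near_minimizer[OF Ss nap[OF m4(1)] lam m4 r kk] by blast
  \<comment> \<open>The region swept out by the dilates by \<open>exp (- s)\<close>, with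
    \<open>s\<close> between 0 and \<open>T\<close>, of the support of the test function.\<close>
  define Q where "Q = {x. r * exp (- T) \<le> norm x \<and> norm x \<le> 2 * r \<and> sgn x \<in> K'}"
  have Q: "compact Q" unfolding Q_def by (rule compact_annulus_cone) (use K' Ss r in auto)
  have Q0: "Q \<subseteq> - {0}" using r by (auto simp: Q_def mult_le_0_iff)
  have Qc: "Q \<subseteq> {x \<in> cone_of \<Sigma>. norm x \<le> 2 * r}" using K' Q0 by (auto simp: Q_def cone_of_eq[OF Ss])
  have RQ: "{x. r \<le> norm x \<and> norm x \<le> 2 * r \<and> sgn x \<in> K'} \<subseteq> Q"
  proof -
    have "r * exp (- T) \<le> r" using r T by simp
    then show ?thesis by (auto simp: Q_def)
  qed
  \<comment> \<open>\<open>\<eta> \<le> c\<close> keeps the zeroth order coefficient nonnegative,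
    which the Caccioppoli inequality uses.\<close>
  define \<eta> where "\<eta> = min (e / 2) c"
  have \<eta>: "\<eta> > 0" "\<eta> \<le> e / 2" "\<eta> \<le> c" using e c by (auto simp: \<eta>_def)
  define qq where "qq v x = (c - \<eta>) / (norm x)\<^sup>2 + v x powr (p - 1)" for v :: "'a \<Rightarrow> real" and x :: 'a
  obtain v gv where v: "has_grad v gv UNIV" "\<And>x. v x > 0" "weak_supersol v gv (qq v) Q" "\<And>x. x \<in> K1 \<Longrightarrow> k \<le> v x"
    using mol Q Qc \<eta>(1) unfolding qq_def by meson
  define gL where "gL x = inverse (v x) *\<^sub>R gv x" for x
  have L: "has_grad (\<lambda>x. ln (v x)) gL UNIV"
    using has_grad_ln[OF v(1,2)] by (simp add: gL_def[abs_def])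
  have qq0: "qq v x \<ge> 0" for x using \<eta> by (simp add: qq_def)
  have cgL: "continuous_on UNIV gL" by (rule has_grad_continuous_grad[OF L])
  have A: "(LBINT x. (\<Phi>0 x)\<^sup>2 * angular_sq gL x) \<le> A"
  proof -
    note C0c = C1c_C0c[OF \<Phi>0]
    have casq: "continuous_on UNIV (angular_sq gL)" unfolding angular_sq_def[abs_def] by (intro continuous_intros cgL)
    have "(LBINT x. (\<Phi>0 x)\<^sup>2 * angular_sq gL x) \<le> (LBINT x. 4 * r\<^sup>2 * ((\<Phi>0 x)\<^sup>2 * (norm (gL x))\<^sup>2))"
    proof (rule integral_mono)
      show "integrable lborel (\<lambda>x. (\<Phi>0 x)\<^sup>2 * angular_sq gL x)" by (intro C0c_integrable C0c_intros C0c casq)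
      show "integrable lborel (\<lambda>x. 4 * r\<^sup>2 * ((\<Phi>0 x)\<^sup>2 * (norm (gL x))\<^sup>2))"
        by (intro integrable_mult_right C0c_integrable C0c_intros C0c continuous_intros cgL)
      fix x
      show "(\<Phi>0 x)\<^sup>2 * angular_sq gL x \<le> 4 * r\<^sup>2 * ((\<Phi>0 x)\<^sup>2 * (norm (gL x))\<^sup>2)"
      proof (cases "\<Phi>0 x = 0")
        case False
        then have "norm x \<le> 2 * r" using \<Phi>0 unfolding C1c_def by blast
        then have "(norm x)\<^sup>2 \<le> (2 * r)\<^sup>2" by (intro power_mono) auto
        then have "(norm x)\<^sup>2 * (norm (gL x))\<^sup>2 \<le> (2 * r)\<^sup>2 * (norm (gL x))\<^sup>2" by (intro mult_right_mono) auto
        then have "angular_sq gL x \<le> (2 * r)\<^sup>2 * (norm (gL x))\<^sup>2" unfolding angular_sq_def using zero_le_power2[of "x \<bullet> gL x"] by linarith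
        from mult_left_mono[OF this, of "(\<Phi>0 x)\<^sup>2"] show ?thesis by (simp add: power_mult_distrib mult_ac)
      qed simp
    qed
    also have "\<dots> = 4 * r\<^sup>2 * (LBINT x. (\<Phi>0 x)\<^sup>2 * (norm (gL x))\<^sup>2)" by simp
    also have "\<dots> \<le> 4 * r\<^sup>2 * (4 * (LBINT x. (norm (g0 x))\<^sup>2))"
      unfolding gL_def by (intro mult_left_mono log_caccioppoli[OF v(1,2,3) qq0 C1c_mono[OF \<Phi>0 RQ]]) auto
    also have "\<dots> \<le> A" using \<Phi>g by (simp add: A_def)
    finally show ?thesis .
  qed
  have Lk: "ln (v x) \<ge> - k0" if "r \<le> norm x" "norm x \<le> 2 * r" "sgn x \<in> K" for x
  proof -
    have "k \<le> v x" using that by (intro v(4)) (simp add: K1_def)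
    then show ?thesis using k by (simp add: k0_def ln_le_cancel_iff[OF k v(2)])
  qed
  have m2: "m \<ge> 4 * (5 * A + lam + 2)" using m(2) by (simp add: C_def)
  obtain \<Phi> g where \<Phi>: "C1c {x. r \<le> norm x \<and> norm x \<le> 2 * r \<and> sgn x \<in> K'} \<Phi> g" "(LBINT x. (\<Phi> x)\<^sup>2) = 1"
     "(LBINT x. angular_sq g x) \<le> lam + 4 * (5 * A + lam + 2) / m"
     "(LBINT x. (\<Phi> x)\<^sup>2 * ln (v x)) \<ge> - (k0 + 4 + 2 * (5 * A + lam + 2))"
    using good_test_function[OF Ss ap lam K(3) r \<Phi>0 K'(2) \<Phi>1 L A Lk m(1) m2 \<Phi>e] by blast
  interpret lm: log_mean v gv "qq v" Q \<Phi> g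
    using v \<Phi> C1c_mono[OF \<Phi>(1) subset_UNIV] by unfold_locales
  have \<Phi>s: "r \<le> norm x" "norm x \<le> 2 * r" "sgn x \<in> K'" if "\<Phi> x \<noteq> 0" for x
    using \<Phi>(1) that unfolding C1c_def by blast+
  have cq: "continuous_on (- {0}) (qq v)"
  proof -
    have "v x \<noteq> 0" for x using v(2)[of x] by simp
    then show ?thesis unfolding qq_def[abs_def]
      by (intro continuous_intros continuous_on_subset[OF has_grad_continuous[OF v(1)]]) auto
  qed
  have ineq: "lm.Y' s \<le> - (lm.Y s - a)\<^sup>2 + \<kappa>\<^sup>2 + e - r\<^sup>2 * exp ((p - 1) * (lm.M s - 2 / (p - 1) * s))" if s: "s \<in> {0..T}" for s
  proof -
    have "lm.Y' s \<le> - (lm.Y s)\<^sup>2 + (real DIM('a) - 2) * lm.Y s + (LBINT y. angular_sq g y) - (c - \<eta>) - r\<^sup>2 * exp ((p - 1) * (lm.M s - 2 / (p - 1) * s))"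
    proof (rule lm.riccati_inequality[OF _ Q Q0 cq _ r \<Phi>s(1) p])
      fix x assume "\<Phi> (exp s *\<^sub>R x) \<noteq> 0"
      note x = \<Phi>s[OF this]
      have ee: "exp (- s) * norm (exp s *\<^sub>R x) = norm x" by (simp add: exp_minus)
      have "exp (- T) * r \<le> exp (- s) * norm (exp s *\<^sub>R x)" using s x(1) r by (intro mult_mono) auto
      moreover have "exp (- s) * norm (exp s *\<^sub>R x) \<le> 1 * (2 * r)" using s x(2) by (intro mult_mono) auto
      ultimately show "x \<in> Q" using x(3) unfolding ee by (simp add: Q_def sgn_scaleR mult.commute)
    next
      fix x assume "x \<in> Q"
      then have "x \<noteq> 0" using Q0 by auto
      then show "c - \<eta> + (norm x)\<^sup>2 * v x powr (p - 1) \<le> (norm x)\<^sup>2 * qq v x"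
        by (simp add: qq_def distrib_left)
    qed
    moreover have "(LBINT y. angular_sq g y) \<le> lam + e / 2" using \<Phi>(3) mC unfolding C_def by linarith
    moreover have "- (lm.Y s)\<^sup>2 + (real DIM('a) - 2) * lm.Y s = - (lm.Y s - a)\<^sup>2 + a\<^sup>2"
      unfolding a by (simp add: power2_eq_square field_simps)
    ultimately show ?thesis using \<eta>(2) \<kappa>(2) by simp
  qed
  have "lm.M 0 \<ge> - (k0 + 4 + 2 * C)" using \<Phi>(4) by (simp add: lm.M_def lm.L_def C_def)
  then show False using ode ineq lm.M_deriv lm.Y_deriv by blast
qed

section \<open>Hardy's inequality on the cone\<close>

lemma integrable_div_norm2:
  fixes f :: "'a::euclidean_space \<Rightarrow> real"
  assumes "C1c \<Omega> f g" "\<Omega> \<subseteq> - {0}"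
  shows "C1c \<Omega> (\<lambda>x. f x / norm x) (\<lambda>x. (1 / norm x) *\<^sub>R g x - (f x / norm x ^ 3) *\<^sub>R x)"
proof -
  obtain K where K: "compact K" "K \<subseteq> \<Omega>" "\<And>x. x \<notin> K \<Longrightarrow> f x = 0" "\<And>x. x \<notin> K \<Longrightarrow> g x = 0" "has_grad f g UNIV"
    "continuous_on UNIV f" "continuous_on UNIV g" using C1cE[OF assms(1)] by metis
  have n: "has_grad (\<lambda>x. 1 / norm x) (\<lambda>x::'a. - (1 / norm x ^ 3) *\<^sub>R x) (- {0})"
    unfolding has_grad_def
  proof (intro conjI ballI)
    fix x :: 'a assume "x \<in> - {0}"
    then have x: "x \<noteq> 0" by simp
    have "((\<lambda>x. inverse (norm x)) has_derivative (\<lambda>h. - (inverse (norm x) * (sgn x \<bullet> h) * inverse (norm x)))) (at x)"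
      using x by (auto intro!: derivative_eq_intros has_derivative_norm simp: inner_commute)
    then show "((\<lambda>x. 1 / norm x) has_derivative (\<bullet>) (- (1 / norm x ^ 3) *\<^sub>R x)) (at x)"
      unfolding inverse_eq_divide
      by (rule has_derivative_eq_rhs) (use x in \<open>auto simp: fun_eq_iff sgn_div_norm power3_eq_cube field_simps\<close>)
  qed (auto intro!: continuous_intros)
  have f: "has_grad f g (- {0})" using K(5) by (auto simp: has_grad_def intro: continuous_on_subset)
  show ?thesis
  proof (rule C1cI[OF _ K(1,2)])
    have "has_grad (\<lambda>x. f x / norm x) (\<lambda>x. (1 / norm x) *\<^sub>R g x - (f x / norm x ^ 3) *\<^sub>R x) (- {0})"
      by (rule has_grad_cong_open[OF has_grad_mult[OF f n]]) auto
    then show "has_grad (\<lambda>x. f x / norm x) (\<lambda>x. (1 / norm x) *\<^sub>R g x - (f x / norm x ^ 3) *\<^sub>R x) UNIV"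
      by (rule has_grad_extend_zero[where K=K]) (use K assms(2) compact_imp_closed in auto)
  qed (use K in auto)
qed

text \<open>For \<open>h = u / norm x\<close> the square of the gradient of \<open>u\<close> splits
  into the angular part of \<open>h\<close>, its squared radial derivative, and terms that
  \<open>integral_euler\<close> evaluates. The angular part gives \<open>lam\<close>; the radial
  part gives \<open>N^2 / 4 - N + 1 = ((N - 2) / 2)^2\<close>.\<close>

lemma cone_hardy:
  fixes u :: "'a::euclidean_space \<Rightarrow> real"
  assumes ap: "angular_poincare \<Sigma> lam" and lam: "lam \<ge> 0" and S: "\<Sigma> \<subseteq> sphere 0 1" and u: "C1c (cone_of \<Sigma>) u g"
  shows "(((real DIM('a) - 2) / 2)\<^sup>2 + lam) * (LBINT x. (u x)\<^sup>2 / (norm x)\<^sup>2) \<le> (LBINT x. (norm (g x))\<^sup>2)"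
proof -
  define a where "a = (real DIM('a) - 2) / 2"
  let ?h = "\<lambda>x. u x / norm x" and ?g = "\<lambda>x. (1 / norm x) *\<^sub>R g x - (u x / norm x ^ 3) *\<^sub>R x"
  have c0: "cone_of \<Sigma> \<subseteq> - {0}" by (auto simp: cone_of_eq[OF S])
  have h: "C1c (cone_of \<Sigma>) ?h ?g" by (rule integrable_div_norm2[OF u c0])
  have hg: "has_grad ?h ?g UNIV" using h by (simp add: C1c_def)
  obtain K where K: "K \<subseteq> cone_of \<Sigma>" "\<And>x. x \<notin> K \<Longrightarrow> u x = 0" "\<And>x. x \<notin> K \<Longrightarrow> g x = 0"
    using C1cE[OF u] by metis
  have z: "u 0 = 0" "g 0 = 0" using K c0 by auto
  note ch = C1c_C0c[OF h] and cu = C1c_C0c[OF u]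
  have conts: "continuous_on UNIV ?h" "continuous_on UNIV ?g" using ch C0c_continuous by blast+
  define I where "I = (LBINT x. (?h x)\<^sup>2)"
  have ints: "integrable lborel (\<lambda>x. (?h x)\<^sup>2)" "integrable lborel (angular_sq ?g)" "integrable lborel (\<lambda>x. (norm (g x))\<^sup>2)"
    "integrable lborel (\<lambda>x. (x \<bullet> ?g x)\<^sup>2)" "integrable lborel (\<lambda>x. ?h x * (x \<bullet> ?g x))"
    by (rule C0c_integrable, intro C0c_intros C0c_angular_sq ch cu continuous_intros conts)+
  have id: "(norm (g x))\<^sup>2 = angular_sq ?g x + (x \<bullet> ?g x)\<^sup>2 + 2 * (?h x * (x \<bullet> ?g x)) + (?h x)\<^sup>2" for x
  proof (cases "x = 0")
    case True then show ?thesis using z by (simp add: angular_sq_def)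
  next
    case False
    define G where "G = ?g x"
    have n: "norm x \<noteq> 0" using False by simp
    have gx: "g x = norm x *\<^sub>R G + (u x / (norm x)\<^sup>2) *\<^sub>R x"
      using False by (simp add: G_def scaleR_diff_right power2_eq_square power3_eq_cube)
    have ex: "(norm (n *\<^sub>R G + k *\<^sub>R x))\<^sup>2 = n\<^sup>2 * (G \<bullet> G) + 2 * (n * k) * (x \<bullet> G) + k\<^sup>2 * (x \<bullet> x)" for n k
      unfolding power2_norm_eq_inner
      by (simp add: inner_add_left inner_add_right inner_commute power2_eq_square algebra_simps)
    have "(norm (g x))\<^sup>2 = (norm x)\<^sup>2 * (G \<bullet> G) + 2 * (norm x * (u x / (norm x)\<^sup>2)) * (x \<bullet> G) + (u x / (norm x)\<^sup>2)\<^sup>2 * (norm x)\<^sup>2"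
      unfolding gx ex by (simp add: dot_square_norm)
    also have "norm x * (u x / (norm x)\<^sup>2) = u x / norm x" using n by (simp add: power2_eq_square)
    also have "(u x / (norm x)\<^sup>2)\<^sup>2 * (norm x)\<^sup>2 = (u x / norm x)\<^sup>2" using n by (simp add: power2_eq_square)
    finally show ?thesis
      unfolding angular_sq_def G_def[symmetric] by (simp add: dot_square_norm)
  qed
  have e: "(LBINT x. ?h x * (x \<bullet> ?g x)) = - (real DIM('a) / 2) * I"
  proof -
    have "0 = (LBINT x. x \<bullet> (?h x *\<^sub>R ?g x + ?h x *\<^sub>R ?g x) + DIM('a) * (?h x * ?h x))"
      by (rule integral_euler[OF C1c_mult_right[OF h hg], symmetric])
    also have "\<dots> = (LBINT x. 2 * (?h x * (x \<bullet> ?g x)) + DIM('a) * (?h x)\<^sup>2)"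
      by (rule Bochner_Integration.integral_cong[OF refl]) (simp only: inner_add_right inner_scaleR_right power2_eq_square mult_2)
    also have "\<dots> = 2 * (LBINT x. ?h x * (x \<bullet> ?g x)) + DIM('a) * I" using ints by (simp add: I_def del: times_divide_eq_left)
    finally show ?thesis by simp
  qed
  \<comment> \<open>\<open>a + 1\<close> is half the dimension, the optimal coefficient for
    completing the square in the radial Hardy inequality.\<close>
  have "0 \<le> (LBINT x. (x \<bullet> ?g x + (a + 1) * ?h x)\<^sup>2)" by simp
  also have "(\<lambda>x. (x \<bullet> ?g x + (a + 1) * ?h x)\<^sup>2) = (\<lambda>x. (x \<bullet> ?g x)\<^sup>2 + 2 * (a + 1) * (?h x * (x \<bullet> ?g x)) + (a + 1)\<^sup>2 * (?h x)\<^sup>2)"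
    by (rule ext) (simp only: power2_sum power_mult_distrib mult_ac)
  also have "(LBINT x. (x \<bullet> ?g x)\<^sup>2 + 2 * (a + 1) * (?h x * (x \<bullet> ?g x)) + (a + 1)\<^sup>2 * (?h x)\<^sup>2)
     = (LBINT x. (x \<bullet> ?g x)\<^sup>2) + 2 * (a + 1) * (- (real DIM('a) / 2) * I) + (a + 1)\<^sup>2 * I"
    using ints e by (simp add: I_def del: times_divide_eq_left)
  finally have "0 \<le> (LBINT x. (x \<bullet> ?g x)\<^sup>2) + 2 * (a + 1) * (- (real DIM('a) / 2) * I) + (a + 1)\<^sup>2 * I" .
  moreover have "2 * (a + 1) * (- (real DIM('a) / 2) * I) = - 2 * ((a + 1)\<^sup>2 * I)"
    by (simp add: a_def power2_eq_square field_simps)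
  ultimately have T: "(a + 1)\<^sup>2 * I \<le> (LBINT x. (x \<bullet> ?g x)\<^sup>2)" by linarith
  have angular_poincare: "lam * I \<le> (LBINT x. angular_sq ?g x)" unfolding I_def by (rule angular_poincare_cone[OF ap lam S h])
  have "(LBINT x. (norm (g x))\<^sup>2) = (LBINT x. angular_sq ?g x + (x \<bullet> ?g x)\<^sup>2 + 2 * (?h x * (x \<bullet> ?g x)) + (?h x)\<^sup>2)"
    by (simp only: id)
  also have "\<dots> = (LBINT x. angular_sq ?g x) + (LBINT x. (x \<bullet> ?g x)\<^sup>2) + 2 * (- (real DIM('a) / 2) * I) + I"
    using ints e by (simp add: I_def del: times_divide_eq_left)
  also have "\<dots> \<ge> lam * I + (a + 1)\<^sup>2 * I - real DIM('a) * I + I" using T angular_poincare by simp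
  also have "lam * I + (a + 1)\<^sup>2 * I - real DIM('a) * I + I = (a\<^sup>2 + lam) * I"
    by (simp add: a_def power2_eq_square field_simps)
  finally show ?thesis by (simp add: I_def power_divide a_def)
qed

section \<open>Smooth functions\<close>

lemma frechet_derivative_cong_open:
  assumes "open S" "x \<in> S" "\<And>y. y \<in> S \<Longrightarrow> f y = g y"
  shows "frechet_derivative f (at x) = frechet_derivative g (at x)"
proof -
  have "(f has_derivative D) (at x) \<longleftrightarrow> (g has_derivative D) (at x)" for D
    using has_derivative_transform_within_open[OF _ assms(1,2)] assms(3) by metis
  then show ?thesis by (simp add: frechet_derivative_def)
qed

lemma differentiable_on_cong_open:
  assumes "open S" "f differentiable_on S" "\<And>y. y \<in> S \<Longrightarrow> f y = g y"
  shows "g differentiable_on S"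
  unfolding differentiable_on_eq_differentiable_at[OF assms(1)] differentiable_def
proof
  fix x assume x: "x \<in> S"
  then obtain D where "(f has_derivative D) (at x)"
    using assms(2) unfolding differentiable_on_eq_differentiable_at[OF assms(1)] differentiable_def by blast
  from has_derivative_transform_within_open[OF this assms(1) x assms(3)]
  show "\<exists>D. (g has_derivative D) (at x)" by blast
qed

lemma dderiv_append: "dderiv (vs @ ws) f = dderiv vs (dderiv ws f)"
  by (induction vs) auto

text \<open>\<open>smooth_on\<close> speaks of all iterated directional derivatives; it suffices to
  find a class of differentiable functions closed under one such derivative. Equality on
  \<open>S\<close> only is enough because \<open>S\<close> is open.\<close>

lemma smooth_on_coinduct:
  assumes S: "open S" and f: "f \<in> F" and d: "\<And>h. h \<in> F \<Longrightarrow> h differentiable_on S"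
    and D: "\<And>h v. h \<in> F \<Longrightarrow> \<exists>k\<in>F. \<forall>x\<in>S. frechet_derivative h (at x) v = k x"
  shows "smooth_on S f"
proof -
  have "\<exists>k\<in>F. \<forall>x\<in>S. dderiv vs f x = k x" for vs
  proof (induction vs)
    case (Cons v vs)
    then obtain k where k: "k \<in> F" "\<forall>x\<in>S. dderiv vs f x = k x" by blast
    obtain k2 where k2: "k2 \<in> F" "\<forall>x\<in>S. frechet_derivative k (at x) v = k2 x" using D[OF k(1)] by blast
    have "dderiv (v # vs) f x = k2 x" if "x \<in> S" for x
      using frechet_derivative_cong_open[OF S that, of "dderiv vs f" k] k(2) k2(2) that by simp
    then show ?case using k2(1) by blast
  qed (use f in auto)
  then show ?thesis unfolding smooth_on_def
    using differentiable_on_cong_open[OF S] d by (metis (no_types, lifting))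
qed

lemma smooth_on_differentiable: "smooth_on S f \<Longrightarrow> f differentiable_on S"
  unfolding smooth_on_def by (metis dderiv.simps(1))

lemma smooth_on_dderiv: "smooth_on S f \<Longrightarrow> smooth_on S (dderiv ws f)"
  unfolding smooth_on_def by (metis dderiv_append)

lemma smooth_on_cong:
  assumes "open S" "smooth_on S f" "\<And>y. y \<in> S \<Longrightarrow> f y = g y"
  shows "smooth_on S g"
proof (rule smooth_on_coinduct[where F="{g. \<exists>f. smooth_on S f \<and> (\<forall>y\<in>S. f y = g y)}"])
  show "g \<in> {g. \<exists>f. smooth_on S f \<and> (\<forall>y\<in>S. f y = g y)}" using assms by blast
  fix h assume "h \<in> {g. \<exists>f. smooth_on S f \<and> (\<forall>y\<in>S. f y = g y)}"
  then obtain f where f: "smooth_on S f" "\<forall>y\<in>S. f y = h y" by blast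
  show "h differentiable_on S"
    by (rule differentiable_on_cong_open[OF assms(1) smooth_on_differentiable[OF f(1)]]) (use f in auto)
  show "\<exists>k\<in>{g. \<exists>f. smooth_on S f \<and> (\<forall>y\<in>S. f y = g y)}. \<forall>x\<in>S. frechet_derivative h (at x) v = k x" for v
  proof (rule bexI[of _ "dderiv [v] f"])
    show "\<forall>x\<in>S. frechet_derivative h (at x) v = dderiv [v] f x"
      using frechet_derivative_cong_open[OF assms(1), of _ f h] f(2) by auto
  qed (use smooth_on_dderiv[OF f(1)] in blast)
qed (rule assms)

lemma smooth_on_Un: "smooth_on S f \<Longrightarrow> smooth_on T f \<Longrightarrow> open S \<Longrightarrow> open T \<Longrightarrow> smooth_on (S \<union> T) f"
  unfolding smooth_on_def by (simp add: differentiable_on_eq_differentiable_at open_Un) blast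

lemma smooth_on_subset: "smooth_on S f \<Longrightarrow> T \<subseteq> S \<Longrightarrow> smooth_on T f"
  unfolding smooth_on_def using differentiable_on_subset by blast

text \<open>The algebra generated by the smooth functions and the functions h (q x), h in H. It is closed under
  differentiation when H is, so that coinduction applies.\<close>
inductive smooth_gen :: "'a::euclidean_space set \<Rightarrow> (real \<Rightarrow> real) set \<Rightarrow> ('a \<Rightarrow> real) \<Rightarrow> ('a \<Rightarrow> real) \<Rightarrow> bool" for S H q where
  base: "smooth_on S f \<Longrightarrow> smooth_gen S H q f"
| comp: "h \<in> H \<Longrightarrow> smooth_gen S H q (\<lambda>x. h (q x))"
| add: "smooth_gen S H q f \<Longrightarrow> smooth_gen S H q g \<Longrightarrow> smooth_gen S H q (\<lambda>x. f x + g x)"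
| mult: "smooth_gen S H q f \<Longrightarrow> smooth_gen S H q g \<Longrightarrow> smooth_gen S H q (\<lambda>x. f x * g x)"

lemma smooth_on_quadratic: "smooth_on UNIV (\<lambda>x::'a::euclidean_space. \<alpha> * (x \<bullet> x) + x \<bullet> b + c)"
proof (rule smooth_on_coinduct[where F="{h. \<exists>\<alpha> b c. h = (\<lambda>x::'a. \<alpha> * (x \<bullet> x) + x \<bullet> b + c)}"])
  fix h assume "h \<in> {h. \<exists>\<alpha> b c. h = (\<lambda>x::'a. \<alpha> * (x \<bullet> x) + x \<bullet> b + c)}"
  then obtain \<alpha> b c where h: "h = (\<lambda>x::'a. \<alpha> * (x \<bullet> x) + x \<bullet> b + c)" by blast
  have d: "(h has_derivative (\<lambda>v. \<alpha> * (2 * (x \<bullet> v)) + v \<bullet> b)) (at x)" for x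
    unfolding h by (auto intro!: derivative_eq_intros simp: inner_commute)
  then show "h differentiable_on UNIV" by (auto simp: differentiable_on_def differentiable_def)
  have "frechet_derivative h (at x) v = 0 * (x \<bullet> x) + x \<bullet> ((2 * \<alpha>) *\<^sub>R v) + v \<bullet> b" for x v
    using fun_cong[OF frechet_derivative_at[OF d, of x], of v] by simp
  then show "\<exists>k\<in>{h. \<exists>\<alpha> b c. h = (\<lambda>x::'a. \<alpha> * (x \<bullet> x) + x \<bullet> b + c)}. \<forall>x\<in>UNIV. frechet_derivative h (at x) v = k x" for v
    by (intro bexI[of _ "\<lambda>x. 0 * (x \<bullet> x) + x \<bullet> ((2 * \<alpha>) *\<^sub>R v) + v \<bullet> b"]) blast+
qed auto

lemma smooth_on_const: "open S \<Longrightarrow> smooth_on S (\<lambda>x. c)"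
  using smooth_on_subset[OF smooth_on_quadratic[of 0 0 c]] by simp

text \<open>By induction every generated function has a derivative with generated components. Two
  members of \<open>H\<close> are allowed in the derivative of \<open>h\<close> because
  \<open>bump k\<close> needs two.\<close>

lemma smooth_gen_smooth:
  assumes S: "open S" and q: "smooth_on S q"
    and H: "\<And>h. h \<in> H \<Longrightarrow> \<exists>h1\<in>H. \<exists>h2\<in>H. \<exists>c1 c2. \<forall>x\<in>S. (h has_real_derivative c1 * h1 (q x) + c2 * h2 (q x)) (at (q x))"
    and f: "smooth_gen S H q f"
  shows "smooth_on S f"
proof (rule smooth_on_coinduct[where F="Collect (smooth_gen S H q)"])
  have diff: "(g has_derivative frechet_derivative g (at x)) (at x)" if "smooth_on S g" "x \<in> S" for g x
    using smooth_on_differentiable[OF that(1)] that(2) S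
    by (metis differentiable_on_eq_differentiable_at frechet_derivative_works)
  have main: "\<exists>D. (\<forall>x\<in>S. (f has_derivative (\<lambda>v. D v x)) (at x)) \<and> (\<forall>v. smooth_gen S H q (D v))" if "smooth_gen S H q f" for f
    using that
  proof induction
    case (base f)
    have "smooth_gen S H q (dderiv [v] f)" for v by (rule smooth_gen.base[OF smooth_on_dderiv[OF base]])
    then show ?case using diff[OF base] by (intro exI[of _ "\<lambda>v. dderiv [v] f"]) auto
  next
    case (comp h)
    then obtain h1 h2 c1 c2 where h: "h1 \<in> H" "h2 \<in> H" "\<forall>x\<in>S. (h has_real_derivative c1 * h1 (q x) + c2 * h2 (q x)) (at (q x))"
      using H by meson
    let ?D = "\<lambda>v x. (c1 * h1 (q x) + c2 * h2 (q x)) * dderiv [v] q x"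
    have "((\<lambda>x. h (q x)) has_derivative (\<lambda>v. ?D v x)) (at x)" if "x \<in> S" for x
      using has_derivative_compose[OF diff[OF q that], of h] h(3) that
      by (auto simp: has_field_derivative_def)
    moreover have "smooth_gen S H q (?D v)" for v
      by (intro smooth_gen.mult smooth_gen.add smooth_gen.comp h smooth_gen.base[OF smooth_on_const[OF S]] smooth_gen.base[OF smooth_on_dderiv[OF q]])
    ultimately show ?case by (intro exI[of _ ?D]) auto
  next
    case (add f g)
    then obtain D E where "\<forall>x\<in>S. (f has_derivative (\<lambda>v. D v x)) (at x)" "\<forall>x\<in>S. (g has_derivative (\<lambda>v. E v x)) (at x)"
      "\<forall>v. smooth_gen S H q (D v)" "\<forall>v. smooth_gen S H q (E v)" by blast
    then show ?case
      by (intro exI[of _ "\<lambda>v x. D v x + E v x"]) (auto intro: has_derivative_add smooth_gen.add)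
  next
    case (mult f g)
    then obtain D E where "\<forall>x\<in>S. (f has_derivative (\<lambda>v. D v x)) (at x)" "\<forall>x\<in>S. (g has_derivative (\<lambda>v. E v x)) (at x)"
      "\<forall>v. smooth_gen S H q (D v)" "\<forall>v. smooth_gen S H q (E v)" by blast
    then show ?case using mult
      by (intro exI[of _ "\<lambda>v x. f x * E v x + D v x * g x"]) (auto intro!: has_derivative_mult smooth_gen.add smooth_gen.mult)
  qed
  show "f \<in> Collect (smooth_gen S H q)" using f by simp
  fix h assume "h \<in> Collect (smooth_gen S H q)"
  then obtain D where D: "\<forall>x\<in>S. (h has_derivative (\<lambda>v. D v x)) (at x)" "\<forall>v. smooth_gen S H q (D v)" using main by blast
  show "h differentiable_on S"
    using D(1) S by (auto simp: differentiable_on_eq_differentiable_at differentiable_def)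
  show "\<exists>k\<in>Collect (smooth_gen S H q). \<forall>x\<in>S. frechet_derivative h (at x) v = k x" for v
  proof (rule bexI[of _ "D v"])
    show "\<forall>x\<in>S. frechet_derivative h (at x) v = D v x"
      using D(1) frechet_derivative_at by metis
  qed (use D in auto)
qed (rule S)

lemma smooth_on_add: "open S \<Longrightarrow> smooth_on S f \<Longrightarrow> smooth_on S g \<Longrightarrow> smooth_on S (\<lambda>x. f x + g x)"
  by (rule smooth_gen_smooth[where H="{}" and q=f]) (auto intro: smooth_gen.intros)

lemma smooth_on_mult: "open S \<Longrightarrow> smooth_on S f \<Longrightarrow> smooth_on S g \<Longrightarrow> smooth_on S (\<lambda>x. f x * g x)"
  by (rule smooth_gen_smooth[where H="{}" and q=f]) (auto intro: smooth_gen.intros)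

text \<open>The derivative of bump k is a combination of bump (k + 1) and bump (k + 2).\<close>
definition bump :: "nat \<Rightarrow> real \<Rightarrow> real" where
  "bump k t = (if t > 0 then (1 / t) ^ k * exp (- (1 / t)) else 0)"

text \<open>In the variable \<open>1 / t\<close> this is the decay of a power against
  \<open>exp\<close>. Applied with \<open>Suc k\<close>, it gives the derivative of
  \<open>bump k\<close> at 0.\<close>

lemma bump_tendsto: "((bump k) \<longlongrightarrow> 0) (at 0)"
proof -
  have "((\<lambda>t::real. (inverse t) ^ k / exp (inverse t)) \<longlongrightarrow> 0) (at_right 0)"
    using filterlim_compose[OF tendsto_power_div_exp_0 filterlim_inverse_at_top_right] .
  then have r: "(bump k \<longlongrightarrow> 0) (at_right 0)"
  proof (rule Lim_transform_eventually)
    show "\<forall>\<^sub>F t in at_right 0. (inverse t) ^ k / exp (inverse t) = bump k t"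
      using eventually_at_right_less[of "0::real"] by eventually_elim (simp add: bump_def exp_minus divide_inverse)
  qed
  have l: "(bump k \<longlongrightarrow> 0) (at_left 0)"
  proof (rule Lim_transform_eventually[OF tendsto_const])
    show "\<forall>\<^sub>F t in at_left 0. 0 = bump k t"
      unfolding eventually_at_filter by (auto simp: bump_def intro!: always_eventually)
  qed
  show ?thesis using l r by (simp add: filterlim_at_split)
qed

lemma bump_deriv: "(bump k has_real_derivative - real k * bump (Suc k) t + 1 * bump (k + 2) t) (at t)"
proof -
  consider "t < 0" | "t > 0" | "t = 0" by linarith
  then show ?thesis
  proof cases
    case 1
    have "((\<lambda>t::real. 0) has_real_derivative 0) (at t)" by simp
    then have "(bump k has_real_derivative 0) (at t)"
      by (rule has_field_derivative_transform_within_open[where S="{..<0}"]) (use 1 in \<open>auto simp: bump_def\<close>)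
    then show ?thesis using 1 by (simp add: bump_def)
  next
    case 2
    have "((\<lambda>t::real. (1 / t) ^ k * exp (- (1 / t))) has_real_derivative
       (1 / t) ^ k * (exp (- (1 / t)) * (1 / t\<^sup>2)) + real k * (1 / t) ^ (k - 1) * (- (1 / t\<^sup>2)) * exp (- (1 / t))) (at t)"
      using 2 by (auto intro!: derivative_eq_intros simp: power2_eq_square)
    moreover have "(1 / t) ^ k * (exp (- (1 / t)) * (1 / t\<^sup>2)) + real k * (1 / t) ^ (k - 1) * (- (1 / t\<^sup>2)) * exp (- (1 / t))
       = - real k * ((1 / t) ^ Suc k * exp (- (1 / t))) + 1 * ((1 / t) ^ (k + 2) * exp (- (1 / t)))"
      using 2 by (cases k) (auto simp: power2_eq_square field_simps)
    ultimately have "((\<lambda>t::real. (1 / t) ^ k * exp (- (1 / t))) has_real_derivative - real k * bump (Suc k) t + 1 * bump (k + 2) t) (at t)"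
      using 2 by (simp add: bump_def)
    then show ?thesis
      by (rule has_field_derivative_transform_within_open[where S="{0<..}"]) (use 2 in \<open>auto simp: bump_def\<close>)
  next
    case 3
    have "((\<lambda>h. (bump k (0 + h) - bump k 0) / h) \<longlongrightarrow> 0) (at 0)"
      by (rule Lim_transform_eventually[OF bump_tendsto[of "Suc k"]])
         (auto simp: bump_def field_simps intro!: always_eventually)
    then have "(bump k has_real_derivative 0) (at 0)" unfolding DERIV_def .
    then show ?thesis using 3 by (simp add: bump_def)
  qed
qed

lemma smooth_on_bump:
  assumes "open S" "smooth_on S q" shows "smooth_on S (\<lambda>x. bump k (q x))"
proof (rule smooth_gen_smooth[where H="range bump" and q=q])
  fix h assume "h \<in> range bump"
  then obtain k where h: "h = bump k" by blast
  show "\<exists>h1\<in>range bump. \<exists>h2\<in>range bump. \<exists>c1 c2. \<forall>x\<in>S. (h has_real_derivative c1 * h1 (q x) + c2 * h2 (q x)) (at (q x))"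
    unfolding h using bump_deriv[of k] by blast
qed (auto intro: assms smooth_gen.comp)

lemma powr_deriv: "(0::real) < t \<Longrightarrow> ((\<lambda>t. t powr b) has_real_derivative b * t powr (b - 1) + 0 * t powr b) (at t)"
  by (auto intro!: derivative_eq_intros)

lemma smooth_on_powr:
  assumes "open S" "smooth_on S q" "\<And>x. x \<in> S \<Longrightarrow> q x > 0" shows "smooth_on S (\<lambda>x. q x powr b)"
proof (rule smooth_gen_smooth[where H="range (\<lambda>b t. t powr b)" and q=q])
  fix h assume "h \<in> range (\<lambda>b (t::real). t powr b)"
  then obtain b where h: "h = (\<lambda>t. t powr b)" by blast
  show "\<exists>h1\<in>range (\<lambda>b t. t powr b). \<exists>h2\<in>range (\<lambda>b t. t powr b). \<exists>c1 c2. \<forall>x\<in>S. (h has_real_derivative c1 * h1 (q x) + c2 * h2 (q x)) (at (q x))"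
    unfolding h
    by (rule bexI[of _ "\<lambda>t. t powr (b - 1)"], rule bexI[of _ "\<lambda>t. t powr b"], rule exI[of _ b], rule exI[of _ 0], rule ballI, rule powr_deriv, rule assms(3)) auto
next
  show "smooth_gen S (range (\<lambda>b t. t powr b)) q (\<lambda>x. q x powr b)"
    by (rule smooth_gen.comp[where h="\<lambda>t. t powr b"]) auto
qed (rule assms)+

lemma smooth_on_ln:
  assumes "open S" "smooth_on S q" "\<And>x. x \<in> S \<Longrightarrow> q x > 0" shows "smooth_on S (\<lambda>x. ln (q x))"
proof (rule smooth_gen_smooth[where H="insert ln (range (\<lambda>b t. t powr b))" and q=q])
  let ?H = "insert ln (range (\<lambda>b (t::real). t powr b))"
  fix h assume "h \<in> ?H"
  then consider "h = ln" | b where "h = (\<lambda>t. t powr b)" by blast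
  then show "\<exists>h1\<in>?H. \<exists>h2\<in>?H. \<exists>c1 c2. \<forall>x\<in>S. (h has_real_derivative c1 * h1 (q x) + c2 * h2 (q x)) (at (q x))"
  proof cases
    case 1
    have "(ln has_real_derivative 1 * t powr (-1) + 0 * t powr (-1)) (at t)" if "t > 0" for t :: real
      using that by (auto intro!: derivative_eq_intros simp: powr_minus_divide)
    note ln = this
    have m: "(\<lambda>t. t powr (- 1)) \<in> ?H" by blast
    show ?thesis unfolding 1
      by (rule bexI[OF _ m], rule bexI[OF _ m], rule exI[of _ 1], rule exI[of _ 0], rule ballI, rule ln, rule assms(3))
  next
    case 2
    show ?thesis unfolding 2
      by (rule bexI[of _ "\<lambda>t. t powr (b - 1)"], rule bexI[of _ "\<lambda>t. t powr b"], rule exI[of _ b], rule exI[of _ 0], rule ballI, rule powr_deriv, rule assms(3)) auto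
  qed
qed (auto intro: assms smooth_gen.comp)

text \<open>The bridge from the \<open>dderiv\<close> of the statement to the pairs of
  \<open>has_grad\<close>.\<close>

definition fgrad :: "('a::euclidean_space \<Rightarrow> real) \<Rightarrow> 'a \<Rightarrow> 'a" where
  "fgrad f x = (\<Sum>i\<in>Basis. dderiv [i] f x *\<^sub>R i)"

lemma smooth_on_has_grad:
  assumes S: "open S" and f: "smooth_on S f"
  shows "has_grad f (fgrad f) S"
  unfolding has_grad_def
proof (intro conjI ballI)
  fix x assume x: "x \<in> S"
  have d: "(f has_derivative frechet_derivative f (at x)) (at x)"
    using smooth_on_differentiable[OF f] x S
    by (metis differentiable_on_eq_differentiable_at frechet_derivative_works)
  then have lin: "linear (frechet_derivative f (at x))" by (rule has_derivative_linear)
  have "frechet_derivative f (at x) h = fgrad f x \<bullet> h" for h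
  proof -
    have "frechet_derivative f (at x) h = frechet_derivative f (at x) (\<Sum>i\<in>Basis. (h \<bullet> i) *\<^sub>R i)"
      by (simp add: euclidean_representation)
    also have "\<dots> = (\<Sum>i\<in>Basis. (h \<bullet> i) * frechet_derivative f (at x) i)"
      by (simp add: linear_sum[OF lin] linear_scale[OF lin])
    also have "\<dots> = fgrad f x \<bullet> h"
      by (simp add: fgrad_def inner_sum_left inner_sum_right mult.commute inner_commute)
    finally show ?thesis .
  qed
  then have "frechet_derivative f (at x) = (\<bullet>) (fgrad f x)" by (simp add: fun_eq_iff)
  then show "(f has_derivative (\<bullet>) (fgrad f x)) (at x)" using d by simp
next
  show "continuous_on S (fgrad f)" unfolding fgrad_def[abs_def]
    by (intro continuous_intros differentiable_imp_continuous_on smooth_on_differentiable smooth_on_dderiv f)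
qed

lemma grad_sq_fgrad: "grad_sq f x = (norm (fgrad f x))\<^sup>2"
proof -
  have "fgrad f x \<bullet> i = dderiv [i] f x" if "i \<in> Basis" for i
    using that by (simp add: fgrad_def inner_sum_left inner_Basis if_distrib sum.delta cong: if_cong)
  then show ?thesis unfolding grad_sq_def power2_norm_eq_inner
    by (subst euclidean_inner) (simp add: power2_eq_square)
qed

lemma test_fun_C1c: "test_fun \<Omega> u \<Longrightarrow> C1c \<Omega> u (fgrad u)"
  unfolding test_fun_def
  by (rule C1cI[of _ _ "tsupport u"])
     (auto intro: smooth_on_has_grad simp: tsupport_def closure_def)

lemma smooth_on_imp_has_grad_punctured:
  "smooth_on (- {0}) f \<Longrightarrow> has_grad f (fgrad f) (- {0})"
  by (rule smooth_on_has_grad) auto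

lemma fgrad_cong_open:
  assumes "open S" "x \<in> S" "\<And>y. y \<in> S \<Longrightarrow> f y = g y"
  shows "fgrad f x = fgrad g x"
  unfolding fgrad_def using frechet_derivative_cong_open[OF assms] by simp

section \<open>The constants of the statement\<close>

lemma powr_neg_half_norm: "x \<noteq> 0 \<Longrightarrow> (x \<bullet> x) powr (- 1 / 2) = 1 / norm (x::'a::euclidean_space)"
proof -
  assume x: "x \<noteq> 0"
  have "(x \<bullet> x) powr (- 1 / 2) = inverse ((x \<bullet> x) powr (1 / 2))"
    by (simp add: powr_minus[symmetric])
  also have "(x \<bullet> x) powr (1 / 2) = norm x" by (simp add: powr_half_sqrt norm_eq_sqrt_inner)
  finally show ?thesis by (simp add: inverse_eq_divide)
qed

text \<open>The set whose infimum is \<open>lambda1\<close> is nonempty; without this, an inequality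
  for the infimum would yield no test function. The example is a bump on a spherical cap about
  \<open>\<sigma>0\<close>.\<close>

lemma sphere_bump:
  fixes \<Sigma> :: "'a::euclidean_space set"
  assumes S: "openin (top_of_set (sphere 0 1)) \<Sigma>" and s: "\<sigma>0 \<in> \<Sigma>"
  shows "\<exists>\<phi>. smooth_on (UNIV - {0}) (\<lambda>y. \<phi> (sgn y)) \<and> closure {\<sigma> \<in> sphere 0 1. \<phi> \<sigma> \<noteq> 0} \<subseteq> \<Sigma> \<and> (\<exists>\<sigma>\<in>\<Sigma>. \<phi> \<sigma> \<noteq> (0::real))"
proof -
  have Ss: "\<Sigma> \<subseteq> sphere 0 1" using openin_imp_subset[OF S] by simp
  obtain \<rho> where \<rho>: "\<rho> > 0" "ball \<sigma>0 \<rho> \<inter> sphere 0 1 \<subseteq> \<Sigma>"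
    using S s unfolding openin_contains_ball by auto
  have s1: "\<sigma>0 \<bullet> \<sigma>0 = 1" using s Ss by (auto simp: dot_square_norm)
  \<comment> \<open>On the sphere the squared distance to \<open>\<sigma>0\<close> is
    \<open>2 - 2 (y \<bullet> \<sigma>0)\<close>, so the cap above height \<open>k\<close> lies
    within distance \<open>\<rho> / 2\<close>.\<close>
  define k where "k = 1 - \<rho>\<^sup>2 / 8"
  define \<phi> where "\<phi> y = bump 0 (y \<bullet> \<sigma>0 + - k)" for y
  have "smooth_on (- {0}) (\<lambda>y::'a. (y \<bullet> \<sigma>0) * (y \<bullet> y) powr (- 1 / 2) + - k)"
  proof (intro smooth_on_add smooth_on_mult smooth_on_powr smooth_on_const)
    show "smooth_on (- {0}) (\<lambda>y::'a. y \<bullet> \<sigma>0)" using smooth_on_subset[OF smooth_on_quadratic[of 0 \<sigma>0 0]] by simp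
    show "smooth_on (- {0}) (\<lambda>y::'a. y \<bullet> y)" using smooth_on_subset[OF smooth_on_quadratic[of 1 0 0]] by simp
  qed auto
  then have "smooth_on (- {0}) (\<lambda>y::'a. bump 0 ((y \<bullet> \<sigma>0) * (y \<bullet> y) powr (- 1 / 2) + - k))"
    by (rule smooth_on_bump[rotated]) auto
  note bs = this
  have eq: "bump 0 ((y \<bullet> \<sigma>0) * (y \<bullet> y) powr (- 1 / 2) + - k) = \<phi> (sgn y)" if "y \<in> - {0}" for y
  proof -
    have "y \<noteq> 0" using that by simp
    then show ?thesis unfolding \<phi>_def powr_neg_half_norm[OF \<open>y \<noteq> 0\<close>] by (simp add: sgn_div_norm divide_inverse mult.commute)
  qed
  have sm: "smooth_on (- {0}) (\<lambda>y::'a. \<phi> (sgn y))"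
    by (rule smooth_on_cong[OF _ bs eq]) auto
  have U: "UNIV - {0} = - {0::'a}" by auto
  have "smooth_on (UNIV - {0}) (\<lambda>y::'a. \<phi> (sgn y))" unfolding U by (rule sm)
  moreover have "closure {\<sigma> \<in> sphere 0 1. \<phi> \<sigma> \<noteq> 0} \<subseteq> \<Sigma>"
  proof -
    have "{\<sigma> \<in> sphere 0 1. \<phi> \<sigma> \<noteq> 0} \<subseteq> cball \<sigma>0 (\<rho> / 2) \<inter> sphere 0 1"
    proof
      fix y :: 'a assume "y \<in> {\<sigma> \<in> sphere 0 1. \<phi> \<sigma> \<noteq> 0}"
      then have y: "norm y = 1" "\<phi> y \<noteq> 0" by auto
      then have "y \<bullet> \<sigma>0 > k" by (auto simp: \<phi>_def bump_def split: if_splits)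
      moreover have "(norm (\<sigma>0 - y))\<^sup>2 = 2 - 2 * (y \<bullet> \<sigma>0)"
      proof -
        have "y \<bullet> y = 1" using y(1) by (simp add: dot_square_norm)
        then show ?thesis unfolding power2_norm_eq_inner
          by (simp add: inner_diff_left inner_diff_right inner_commute s1)
      qed
      ultimately have "(norm (\<sigma>0 - y))\<^sup>2 \<le> (\<rho> / 2)\<^sup>2" by (simp add: k_def power_divide)
      then have "norm (\<sigma>0 - y) \<le> \<rho> / 2" by (rule power2_le_imp_le) (use \<rho>(1) in simp)
      then show "y \<in> cball \<sigma>0 (\<rho> / 2) \<inter> sphere 0 1" using y(1) by (simp add: dist_norm)
    qed
    then have "closure {\<sigma> \<in> sphere 0 1. \<phi> \<sigma> \<noteq> 0} \<subseteq> cball \<sigma>0 (\<rho> / 2) \<inter> sphere 0 1"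
      by (rule closure_minimal) auto
    also have "\<dots> \<subseteq> ball \<sigma>0 \<rho> \<inter> sphere 0 1" using \<rho>(1) by auto
    finally show ?thesis using \<rho>(2) by blast
  qed
  moreover have "\<phi> \<sigma>0 \<noteq> 0" using \<rho>(1) by (simp add: \<phi>_def k_def s1 bump_def)
  ultimately show ?thesis using s by blast
qed

lemma ball_integral_eq_lebesgue_integral:
  fixes H :: "'a::euclidean_space \<Rightarrow> real"
  assumes [measurable]: "H \<in> borel_measurable borel" and "\<And>x. H x \<ge> 0" and b: "ball_integral H = ennreal X" "X \<ge> 0"
  shows "set_lebesgue_integral lebesgue (ball 0 1) H = X"
proof -
  have m: "(\<lambda>x. indicator (ball 0 1) x *\<^sub>R H x) \<in> borel_measurable lborel"
    unfolding real_scaleR_def measurable_lborel2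
    by (rule borel_measurable_times[OF borel_measurable_indicator]) auto
  have "set_lebesgue_integral lebesgue (ball 0 1) H = (LBINT x. indicator (ball 0 1) x *\<^sub>R H x)"
    unfolding set_lebesgue_integral_def by (rule integral_completion[OF m])
  also have "\<dots> = enn2real (\<integral>\<^sup>+x. ennreal (indicator (ball 0 1) x *\<^sub>R H x) \<partial>lborel)"
    by (rule integral_eq_nn_integral) (use m assms(2) in auto)
  also have "(\<integral>\<^sup>+x. ennreal (indicator (ball 0 1) x *\<^sub>R H x) \<partial>lborel) = ball_integral H"
    unfolding ball_integral_def by (rule nn_integral_cong) (auto simp: indicator_def)
  finally show ?thesis using b by simp
qed

text \<open>Extracts from the infimum one admissible function with quotient below \<open>c\<close>
  and converts its Lebesgue integrals to ball integrals. Only such a function, not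
  \<open>lambda1\<close> itself, is used afterwards.\<close>

lemma lambda1_lessE:
  fixes \<Sigma> :: "'a::euclidean_space set"
  assumes S: "sphere_domain \<Sigma>" and c: "lambda1 \<Sigma> < c"
  shows "\<exists>\<psi> X Y. smooth_on (- {0}) \<psi> \<and> hom_adm \<Sigma> \<psi> (fgrad \<psi>) \<and> ball_integral (\<lambda>x. (\<psi> x)\<^sup>2) = ennreal X \<and>
     ball_integral (\<lambda>x. (norm x)\<^sup>2 * (norm (fgrad \<psi> x))\<^sup>2) = ennreal Y \<and> X > 0 \<and> Y \<ge> 0 \<and> Y < c * X"
proof -
  have So: "openin (top_of_set (sphere 0 1)) \<Sigma>" and ne: "\<Sigma> \<noteq> {}" using S by (auto simp: sphere_domain_def)
  have Ss: "\<Sigma> \<subseteq> sphere 0 1" using openin_imp_subset[OF So] by simp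
  define adm where "adm \<phi> \<longleftrightarrow> smooth_on (UNIV - {0}) (\<lambda>y. \<phi> (sgn y)) \<and>
       closure {\<sigma> \<in> sphere 0 1. \<phi> \<sigma> \<noteq> 0} \<subseteq> \<Sigma> \<and> (\<exists>\<sigma>\<in>\<Sigma>. \<phi> \<sigma> \<noteq> 0)" for \<phi> :: "'a \<Rightarrow> real"
  define q where "q \<phi> = (set_lebesgue_integral lebesgue (ball 0 1) (\<lambda>x. norm x ^ 2 * grad_sq (\<lambda>y. \<phi> (sgn y)) x)) /
                      (set_lebesgue_integral lebesgue (ball 0 1) (\<lambda>x::'a. (\<phi> (sgn x))\<^sup>2))" for \<phi> :: "'a \<Rightarrow> real"
  obtain \<sigma>0 where "\<sigma>0 \<in> \<Sigma>" using ne by blast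
  from sphere_bump[OF So this] obtain \<phi>0 where "adm \<phi>0" unfolding adm_def by (elim exE)
  then have Lne: "{q \<phi> | \<phi>. adm \<phi>} \<noteq> {}" by blast
  have "Inf {q \<phi> | \<phi>. adm \<phi>} < c" using c unfolding lambda1_def q_def adm_def .
  from cInf_lessD[OF Lne this] obtain \<phi> where ad: "adm \<phi>" and z: "q \<phi> < c" by blast
  have \<phi>: "smooth_on (UNIV - {0}) (\<lambda>y. \<phi> (sgn y))" "closure {\<sigma> \<in> sphere 0 1. \<phi> \<sigma> \<noteq> 0} \<subseteq> \<Sigma>" "\<exists>\<sigma>\<in>\<Sigma>. \<phi> \<sigma> \<noteq> 0"
    by (rule ad[unfolded adm_def, THEN conjunct1], rule ad[unfolded adm_def, THEN conjunct2, THEN conjunct1],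
        rule ad[unfolded adm_def, THEN conjunct2, THEN conjunct2])
  \<comment> \<open>\<open>sgn 0 = 0\<close> is not on the sphere, and \<open>\<phi> 0\<close> is
    arbitrary; admissibility requires the value 0 there.\<close>
  define \<psi> where "\<psi> x = (if x = 0 then 0 else \<phi> (sgn x))" for x
  have U: "UNIV - {0} = - {0::'a}" by auto
  have sm: "smooth_on (- {0}) \<psi>"
    by (rule smooth_on_cong[OF _ \<phi>(1)[unfolded U]]) (auto simp: \<psi>_def)
  have fg: "fgrad \<psi> x = fgrad (\<lambda>y. \<phi> (sgn y)) x" if "x \<noteq> 0" for x
    by (rule fgrad_cong_open[of "- {0}"]) (use that in \<open>auto simp: \<psi>_def\<close>)
  define K where "K = closure {\<sigma> \<in> sphere 0 1. \<phi> \<sigma> \<noteq> 0}"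
  have K: "compact K" unfolding K_def compact_closure by (rule bounded_subset[of "sphere 0 1"]) auto
  have h: "hom_adm \<Sigma> \<psi> (fgrad \<psi>)"
    unfolding hom_adm_def
  proof (intro conjI allI exI[of _ K])
    show "has_grad \<psi> (fgrad \<psi>) (- {0})" by (rule smooth_on_imp_has_grad_punctured[OF sm])
    show "\<psi> (sgn x) = \<psi> x" for x by (simp add: \<psi>_def sgn_sgn_eq sgn_zero_iff)
    show "sgn x \<notin> K \<longrightarrow> \<psi> x = 0" for x
    proof
      assume x: "sgn x \<notin> K"
      show "\<psi> x = 0"
      proof (rule ccontr)
        assume nz: "\<psi> x \<noteq> 0"
        have x0: "x \<noteq> 0" using nz unfolding \<psi>_def by metis
        have "\<phi> (sgn x) \<noteq> 0" using nz unfolding \<psi>_def if_not_P[OF x0] .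
        moreover have "norm (sgn x) = 1" using x0 by (simp add: norm_sgn)
        ultimately have "sgn x \<in> {\<sigma> \<in> sphere 0 1. \<phi> \<sigma> \<noteq> 0}" by simp
        then have "sgn x \<in> K" unfolding K_def by (rule subsetD[OF closure_subset])
        then show False using x by simp
      qed
    qed
    show "compact K" by (rule K)
    show "K \<subseteq> \<Sigma>" unfolding K_def by (rule \<phi>(2))
  qed
  \<comment> \<open>Taken for the finiteness of both ball integrals.\<close>
  obtain k1 k2 where kk: "radial_ratios TYPE('a) 1 k1 k2" using radial_constants[OF zero_less_one] by blast
  obtain X Y where XY: "X \<ge> 0" "Y \<ge> 0" "ball_integral (\<lambda>x. (\<psi> x)\<^sup>2) = ennreal X" "ball_integral (\<lambda>x. (norm x)\<^sup>2 * (norm (fgrad \<psi> x))\<^sup>2) = ennreal Y"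
    by (rule radial_ratiosE[OF kk Ss h])
  have hg: "has_grad \<psi> (fgrad \<psi>) (- {0})" using h by (simp add: hom_adm_def)
  have m1[measurable]: "\<psi> \<in> borel_measurable borel" by (rule measurable_punctured[OF has_grad_continuous[OF hg]])
  have m2[measurable]: "fgrad \<psi> \<in> borel_measurable borel" by (rule measurable_punctured[OF has_grad_continuous_grad[OF hg]])
  have X: "X > 0"
  proof -
    obtain \<sigma> where \<sigma>: "\<sigma> \<in> \<Sigma>" "\<phi> \<sigma> \<noteq> 0" using \<phi>(3) by blast
    then have n: "norm \<sigma> = 1" using Ss by auto
    then have s0: "\<sigma> \<noteq> 0" by auto
    have "sgn ((1/2) *\<^sub>R \<sigma>) = \<sigma>" using n by (simp add: sgn_div_norm)
    then have p: "(\<psi> ((1/2) *\<^sub>R \<sigma>))\<^sup>2 > 0" using \<sigma>(2) s0 by (simp add: \<psi>_def)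
    have "0 < (\<integral>\<^sup>+x. ennreal ((\<psi> x)\<^sup>2) * indicator (ball 0 1 - {0}) x \<partial>lborel)"
    proof (rule nn_integral_pos_continuous[where f="\<lambda>x. (\<psi> x)\<^sup>2", OF _ _ _ p])
      show "continuous_on (ball 0 1 - {0}) (\<lambda>x. (\<psi> x)\<^sup>2)"
        by (intro continuous_intros continuous_on_subset[OF has_grad_continuous[OF hg]]) auto
    qed (use n s0 in auto)
    also have "\<dots> \<le> ball_integral (\<lambda>x. (\<psi> x)\<^sup>2)" unfolding ball_integral_def
      by (rule nn_integral_mono) (auto simp: indicator_def)
    finally show ?thesis unfolding XY(3) by simp
  qed
  have "set_lebesgue_integral lebesgue (ball 0 1) (\<lambda>x::'a. norm x ^ 2 * grad_sq (\<lambda>y. \<phi> (sgn y)) x) = Y"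
  proof -
    have "(\<lambda>x::'a. norm x ^ 2 * grad_sq (\<lambda>y. \<phi> (sgn y)) x) = (\<lambda>x. (norm x)\<^sup>2 * (norm (fgrad \<psi> x))\<^sup>2)"
    proof (rule ext)
      fix x :: 'a
      show "norm x ^ 2 * grad_sq (\<lambda>y. \<phi> (sgn y)) x = (norm x)\<^sup>2 * (norm (fgrad \<psi> x))\<^sup>2"
        by (cases "x = 0") (simp_all add: grad_sq_fgrad fg)
    qed
    then show ?thesis using ball_integral_eq_lebesgue_integral[OF _ _ XY(4) XY(2)] by simp
  qed
  moreover have "set_lebesgue_integral lebesgue (ball 0 1) (\<lambda>x::'a. (\<phi> (sgn x))\<^sup>2) = X"
  proof (rule ball_integral_eq_lebesgue_integral)
    have "(\<lambda>y. \<phi> (sgn y)) \<in> borel_measurable (borel :: 'a measure)"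
      by (rule measurable_punctured[OF has_grad_continuous[OF smooth_on_imp_has_grad_punctured[OF \<phi>(1)[unfolded U]]]])
    then show "(\<lambda>x::'a. (\<phi> (sgn x))\<^sup>2) \<in> borel_measurable borel" by (rule borel_measurable_power)
    have "ball_integral (\<lambda>x::'a. (\<phi> (sgn x))\<^sup>2) = ball_integral (\<lambda>x. (\<psi> x)\<^sup>2)"
      unfolding ball_integral_def by (rule nn_integral_cong_AE, rule AE_mp[OF AE_lborel_singleton[of "0::'a"]], rule AE_I2) (auto simp: \<psi>_def)
    then show "ball_integral (\<lambda>x::'a. (\<phi> (sgn x))\<^sup>2) = ennreal X" using XY by simp
  qed (use XY in auto)
  ultimately have "Y / X < c" using z unfolding q_def by simp
  then have "Y < c * X" using X by (simp add: field_simps)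
  then show ?thesis using sm h XY X by blast
qed

lemma C1c_lebesgue_integral:
  "C0c f \<Longrightarrow> (\<integral>x. f x \<partial>lebesgue) = (LBINT x. f x)" for f :: "'a::euclidean_space \<Rightarrow> real"
  by (rule integral_completion) (simp add: C0c_measurable)

lemma C0c_div_norm2:
  assumes u: "C1c \<Omega> u g" and \<Omega>: "\<Omega> \<subseteq> - {0::'a::euclidean_space}"
  shows "C0c (\<lambda>x. (u x)\<^sup>2 / (norm x)\<^sup>2)"
  using C0c_power2[OF C1c_C0c(1)[OF integrable_div_norm2[OF u \<Omega>]]] by (simp add: power_divide)

lemma hardy_integral_pos:
  assumes u: "C1c \<Omega> u g" and \<Omega>: "\<Omega> \<subseteq> - {0::'a::euclidean_space}" and ne: "u x0 \<noteq> 0"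
  shows "(LBINT x. (u x)\<^sup>2 / (norm x)\<^sup>2) > 0"
proof -
  note c = C0c_div_norm2[OF u \<Omega>]
  have "x0 \<noteq> 0" using u ne \<Omega> unfolding C1c_def by blast
  then have p: "(u x0)\<^sup>2 / (norm x0)\<^sup>2 > 0" using ne by simp
  have "0 < (\<integral>\<^sup>+x. ennreal ((u x)\<^sup>2 / (norm x)\<^sup>2) * indicator UNIV x \<partial>lborel)"
    by (rule nn_integral_pos_continuous[where f="\<lambda>x. (u x)\<^sup>2 / (norm x)\<^sup>2", OF C0c_continuous[OF c] _ _ p]) auto
  also have "\<dots> = ennreal (LBINT x. (u x)\<^sup>2 / (norm x)\<^sup>2)"
    using nn_integral_eq_integral[OF C0c_integrable[OF c]] by simp
  finally show ?thesis by simp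
qed

text \<open>\<open>cone_hardy\<close> bounds each quotient of the infimum; a nontrivial test
  function makes the infimum that of a nonempty set.\<close>

lemma hardy_const_ge:
  fixes \<Sigma> :: "'a::euclidean_space set"
  assumes ap: "angular_poincare \<Sigma> lam" and lam: "lam \<ge> 0" and Ss: "\<Sigma> \<subseteq> sphere 0 1"
    and ne: "\<exists>u. test_fun (cone_of \<Sigma>) u \<and> (\<exists>x. u x \<noteq> 0)"
  shows "((real DIM('a) - 2) / 2)\<^sup>2 + lam \<le> hardy_const \<Sigma>"
  unfolding hardy_const_def
proof (rule cInf_greatest)
  fix z assume "z \<in> {(\<integral>x. grad_sq u x \<partial>lebesgue) / (\<integral>x. u x ^ 2 / norm x ^ 2 \<partial>lebesgue) | u.
       test_fun (cone_of \<Sigma>) u \<and> (\<exists>x. u x \<noteq> 0)}"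
  then obtain u x0 where z: "z = (\<integral>x. grad_sq u x \<partial>lebesgue) / (\<integral>x. u x ^ 2 / norm x ^ 2 \<partial>lebesgue)"
    and u: "test_fun (cone_of \<Sigma>) u" "u x0 \<noteq> 0" by blast
  have c0: "cone_of \<Sigma> \<subseteq> - {0}" by (auto simp: cone_of_eq[OF Ss])
  note C = test_fun_C1c[OF u(1)]
  have "z = (LBINT x. (norm (fgrad u x))\<^sup>2) / (LBINT x. (u x)\<^sup>2 / (norm x)\<^sup>2)"
    unfolding z grad_sq_fgrad
    by (simp only: C1c_lebesgue_integral[OF C0c_norm_power2[OF C1c_C0c(2)[OF C]]] C1c_lebesgue_integral[OF C0c_div_norm2[OF C c0]])
  then show "((real DIM('a) - 2) / 2)\<^sup>2 + lam \<le> z"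
    using cone_hardy[OF ap lam Ss C] hardy_integral_pos[OF C c0 u(2)] by (simp add: pos_le_divide_eq)
qed (use ne in blast)

section \<open>Upper bound for the Hardy constant by separation of variables\<close>

definition profile :: "real \<Rightarrow> real" where "profile t = bump 0 (1 - t\<^sup>2)"
definition profile_deriv :: "real \<Rightarrow> real" where "profile_deriv t = bump 2 (1 - t\<^sup>2) * (- 2 * t)"

lemma profile_deriv: "(profile has_real_derivative profile_deriv t) (at t)"
proof -
  have "((\<lambda>t::real. 1 - t\<^sup>2) has_real_derivative (- 2 * t)) (at t)"
    by (auto intro!: derivative_eq_intros)
  from DERIV_chain2[OF bump_deriv[of 0] this]
  show ?thesis unfolding profile_def[abs_def] profile_deriv_def by (simp add: numeral_2_eq_2)
qed

lemma bump_cont: "continuous_on UNIV (bump k)"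
  by (rule DERIV_continuous_on) (use bump_deriv in \<open>auto intro: has_field_derivative_at_within\<close>)

lemma profile_cont: "continuous_on UNIV profile" "continuous_on UNIV profile_deriv"
  unfolding profile_def[abs_def] profile_deriv_def[abs_def]
  by (intro continuous_intros continuous_on_compose2[OF bump_cont]; auto)+

lemma profile_zero: "\<bar>t\<bar> \<ge> 1 \<Longrightarrow> profile t = 0" "\<bar>t\<bar> \<ge> 1 \<Longrightarrow> profile_deriv t = 0"
proof -
  assume "\<bar>t\<bar> \<ge> 1"
  then have "1 - t\<^sup>2 \<le> 0" using power_mono[of 1 "\<bar>t\<bar>" 2] by simp
  then show "profile t = 0" "profile_deriv t = 0" by (simp_all add: profile_def profile_deriv_def bump_def)
qed

lemma profile_C0c: "C0c profile" "C0c profile_deriv"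
  unfolding C0c_def using profile_cont profile_zero by (auto intro!: exI[of _ 1])

lemma profile_pos: "(LBINT t. (profile t)\<^sup>2) > 0"
proof -
  have p: "(profile 0)\<^sup>2 > 0" by (simp add: profile_def bump_def)
  have "0 < (\<integral>\<^sup>+x. ennreal ((profile x)\<^sup>2) * indicator UNIV x \<partial>lborel)"
    by (rule nn_integral_pos_continuous[where f="\<lambda>t. (profile t)\<^sup>2", OF _ _ _ p]) (auto intro!: continuous_intros profile_cont)
  also have "\<dots> = ennreal (LBINT x. (profile x)\<^sup>2)"
    using nn_integral_eq_integral[OF C0c_integrable[OF C0c_power2[OF profile_C0c(1)]]] by simp
  finally show ?thesis by simp
qed

text \<open>The mixed term is the integral of a derivative and vanishes, leaving \<open>a^2\<close>
  plus the quotient for the derivative alone; stretching by \<open>n\<close> divides that quotient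
  by \<open>n^2\<close>.\<close>

lemma radial_profile_ratio:
  fixes a e :: real
  assumes e: "e > 0"
  shows "\<exists>n\<ge>1. (LBINT t. (profile_deriv (t / n) / n - a * profile (t / n))\<^sup>2) \<le> (a\<^sup>2 + e) * (LBINT t. (profile (t / n))\<^sup>2)"
proof -
  define P where "P = (LBINT t. (profile t)\<^sup>2)"
  define D where "D = (LBINT t. (profile_deriv t)\<^sup>2)"
  have P: "P > 0" using profile_pos by (simp add: P_def)
  have D: "D \<ge> 0" by (simp add: D_def)
  define n where "n = max 1 (D / (P * e) + 1)"
  have n: "n \<ge> 1" "n \<ge> D / (P * e)" by (auto simp: n_def)
  have zero: "(LBINT t. profile t * profile_deriv t) = 0"
  proof -
    have hg: "has_grad profile profile_deriv UNIV"
      unfolding has_grad_def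
    proof (intro conjI ballI profile_cont)
      show "(profile has_derivative (\<bullet>) (profile_deriv x)) (at x)" for x
        using profile_deriv[of x] unfolding has_field_derivative_def by (rule has_derivative_eq_rhs) (auto simp: fun_eq_iff)
    qed
    have C: "C1c UNIV profile profile_deriv"
      by (rule C1cI[OF hg, of "{-1..1}"]) (auto intro!: profile_zero)
    have "(LBINT t. (profile t *\<^sub>R profile_deriv t + profile t *\<^sub>R profile_deriv t) \<bullet> 1) = 0"
      by (rule integral_directional_derivative_zero[OF C1c_mult_right[OF C hg]])
    then show ?thesis by (simp add: mult.commute)
  qed
  have ints: "integrable lborel (\<lambda>t. (profile t)\<^sup>2)" "integrable lborel (\<lambda>t. (profile_deriv t)\<^sup>2)" "integrable lborel (\<lambda>t. profile t * profile_deriv t)"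
    by (rule C0c_integrable, intro C0c_intros profile_C0c profile_cont)+
  have n0: "n > 0" using n by simp
  have m[measurable]: "profile \<in> borel_measurable borel" "profile_deriv \<in> borel_measurable borel" using profile_C0c C0c_measurable by blast+
  have s1: "(LBINT t. (profile_deriv (t / n) / n - a * profile (t / n))\<^sup>2) = n * (LBINT t. (profile_deriv t / n - a * profile t)\<^sup>2)"
    by (subst lborel_integral_scale[where c=n]) (use n0 in \<open>simp_all\<close>)
  have s2: "(\<lambda>t. (profile_deriv t / n - a * profile t)\<^sup>2) = (\<lambda>t. (1 / n\<^sup>2) * (profile_deriv t)\<^sup>2 - (2 * a / n) * (profile t * profile_deriv t) + a\<^sup>2 * (profile t)\<^sup>2)"
    by (simp add: fun_eq_iff power2_eq_square algebra_simps)
  have s3: "(LBINT t. (1 / n\<^sup>2) * (profile_deriv t)\<^sup>2 - (2 * a / n) * (profile t * profile_deriv t) + a\<^sup>2 * (profile t)\<^sup>2)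
     = (1 / n\<^sup>2) * D - (2 * a / n) * 0 + a\<^sup>2 * P"
    using ints zero by (simp add: P_def D_def del: times_divide_eq_left)
  have s4: "n * ((1 / n\<^sup>2) * D - (2 * a / n) * 0 + a\<^sup>2 * P) \<le> n * ((a\<^sup>2 + e) * P)"
  proof -
    have "D \<le> n * (P * e)" using n(2) P e by (simp add: field_simps)
    also have "\<dots> \<le> n\<^sup>2 * (P * e)" using n P e by (intro mult_right_mono) (auto simp: power2_eq_square)
    finally have "(1 / n\<^sup>2) * D \<le> P * e" using n0 by (simp add: field_simps)
    then have "(1 / n\<^sup>2) * D - (2 * a / n) * 0 + a\<^sup>2 * P \<le> (a\<^sup>2 + e) * P" by (simp add: algebra_simps)
    then show ?thesis by (rule mult_left_mono) (rule less_imp_le[OF n0])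
  qed
  have 1: "(LBINT t. (profile_deriv (t / n) / n - a * profile (t / n))\<^sup>2) \<le> n * ((a\<^sup>2 + e) * P)"
    unfolding s1 s2 s3 by (rule s4)
  have 2: "n * ((a\<^sup>2 + e) * P) = (a\<^sup>2 + e) * (LBINT t. (profile (t / n))\<^sup>2)"
  proof -
    have "(LBINT t. (profile (t / n))\<^sup>2) = n * P"
      by (subst lborel_integral_scale[where c=n]) (use n0 in \<open>simp_all add: P_def\<close>)
    then show ?thesis by (simp only: mult.left_commute)
  qed
  show ?thesis by (rule exI[of _ n], rule conjI[OF n(1) 1[unfolded 2]])
qed

text \<open>The trial function is \<open>norm x ^ (- a)\<close> times a long plateau in
  \<open>ln (norm x)\<close> times \<open>\<psi>\<close>. Its Hardy quotient is exactly
  \<open>Y / X\<close> plus the one-dimensional quotient of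
  \<open>radial_profile_ratio\<close>.\<close>

lemma hardy_const_le:
  fixes \<Sigma> :: "'a::euclidean_space set"
  assumes Ss: "\<Sigma> \<subseteq> sphere 0 1" and sm: "smooth_on (- {0}) \<psi>" and h: "hom_adm \<Sigma> \<psi> (fgrad \<psi>)"
    and X: "ball_integral (\<lambda>x. (\<psi> x)\<^sup>2) = ennreal X" "X > 0" and Y: "ball_integral (\<lambda>x. (norm x)\<^sup>2 * (norm (fgrad \<psi> x))\<^sup>2) = ennreal Y" "Y \<ge> 0"
    and e: "e > 0"
  shows "(\<exists>u. test_fun (cone_of \<Sigma>) u \<and> (\<exists>x. u x \<noteq> 0)) \<and> hardy_const \<Sigma> \<le> ((real DIM('a) - 2) / 2)\<^sup>2 + Y / X + e"
proof -
  define a where "a = (real DIM('a) - 2) / 2"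
  obtain n where n: "n \<ge> 1" and ratio: "(LBINT t. (profile_deriv (t / n) / n - a * profile (t / n))\<^sup>2) \<le> (a\<^sup>2 + e) * (LBINT t. (profile (t / n))\<^sup>2)"
    using radial_profile_ratio[OF e, of a] by blast
  have n0: "n > 0" using n by simp
  define F where "F t = profile (t / n)" for t
  define F' where "F' t = profile_deriv (t / n) / n" for t
  have dF: "(F has_real_derivative F' t) (at t)" for t
  proof -
    have "((\<lambda>t. t / n) has_real_derivative 1 / n) (at t)" using n0 by (auto intro!: derivative_eq_intros)
    from DERIV_chain2[OF profile_deriv this] show ?thesis by (simp add: F_def[abs_def] F'_def)
  qed
  have ct: "continuous_on UNIV (\<lambda>t. t / n)" by (rule continuous_on_divide[OF continuous_on_id continuous_on_const]) (rule ballI, rule less_imp_neq[OF n0, symmetric])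
  have cF: "continuous_on UNIV F"
    unfolding F_def[abs_def] by (rule continuous_on_compose2[OF profile_cont(1) ct subset_UNIV])
  have cF': "continuous_on UNIV F'"
    unfolding F'_def[abs_def]
    by (rule continuous_on_divide[OF continuous_on_compose2[OF profile_cont(2) ct subset_UNIV] continuous_on_const]) (rule ballI, rule less_imp_neq[OF n0, symmetric])
  note cF = cF cF'
  have zF: "F t = 0" "F' t = 0" if "\<bar>t\<bar> \<ge> n" for t
    using profile_zero[of "t / n"] that n0 by (auto simp: F_def F'_def)
  have ccF: "C0c F" "C0c F'" unfolding C0c_def using cF zF by (auto intro!: exI[of _ n])
  \<comment> \<open>In the variable \<open>t = ln (norm x)\<close>, \<open>exp (- a * t)\<close> is
    the radial ground state of the Hardy quotient.\<close>
  define f where "f t = exp (- a * t) * F t" for t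
  define f' where "f' t = exp (- a * t) * (F' t - a * F t)" for t
  have df: "(f has_real_derivative f' t) (at t)" for t
    unfolding f_def f'_def by (auto intro!: derivative_eq_intros dF simp: algebra_simps)
  have cf: "continuous_on UNIV f" "continuous_on UNIV f'"
    unfolding f_def[abs_def] f'_def[abs_def] by (intro continuous_intros cF)+
  have mf[measurable]: "f \<in> borel_measurable borel" "f' \<in> borel_measurable borel"
    using cf by (auto intro: borel_measurable_continuous_onI)
  have zf: "f t = 0" "f' t = 0" if "\<bar>t\<bar> \<ge> n" for t using zF[OF that] by (auto simp: f_def f'_def)
  obtain K where K: "compact K" "K \<subseteq> \<Sigma>" "\<And>x. sgn x \<notin> K \<Longrightarrow> \<psi> x = 0" using h unfolding hom_adm_def by blast
  define u where "u x = f (ln (norm x)) * \<psi> x" for x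
  define A where "A = {x. exp (- n) \<le> norm x \<and> norm x \<le> exp n \<and> sgn x \<in> K}"
  have cA: "compact A" unfolding A_def by (rule compact_annulus_cone) (use K Ss in auto)
  have Ac: "A \<subseteq> cone_of \<Sigma>"
  proof
    fix x assume x: "x \<in> A"
    then have "norm x > 0" using exp_gt_zero[of "- n"] unfolding A_def by (auto intro: less_le_trans)
    then show "x \<in> cone_of \<Sigma>" using x K(2) by (auto simp: cone_of_eq[OF Ss] A_def)
  qed
  have p0: "\<psi> 0 = 0" using K Ss by (intro K(3)) auto
  have uA: "u x = 0" if "x \<notin> A" for x
  proof (cases "x = 0")
    case True then show ?thesis using p0 by (simp add: u_def)
  next
    case False
    then have np: "norm x > 0" by simp
    have lz: "f (ln (norm x)) = 0" if "norm x < exp (- n) \<or> norm x > exp n"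
    proof (rule zf)
      from that show "\<bar>ln (norm x)\<bar> \<ge> n"
      proof
        assume "norm x < exp (- n)"
        then have "ln (norm x) < ln (exp (- n))" using np by (subst ln_less_cancel_iff) auto
        then show ?thesis by simp
      next
        assume "norm x > exp n"
        then have "ln (norm x) > ln (exp n)" using np by (subst ln_less_cancel_iff) auto
        then show ?thesis by simp
      qed
    qed
    then show ?thesis using that K(3)[of x] by (auto simp: u_def A_def not_le)
  qed
  have smu: "smooth_on UNIV u"
  proof -
    have sq: "smooth_on (- {0}) (\<lambda>y::'a. y \<bullet> y)" using smooth_on_subset[OF smooth_on_quadratic[of 1 0 0]] by simp
    have op: "open (- {0::'a})" by (intro open_Compl) simp
    have pos: "y \<bullet> y > 0" if "y \<in> - {0}" for y :: 'a using that by simp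
    \<comment> \<open>Everything is expressed through \<open>x \<bullet> x\<close>, which is smooth
      everywhere, in place of \<open>norm x\<close>: hence the exponent \<open>- a / 2\<close> and
      the factor \<open>1 / (4 * n\<^sup>2)\<close>.\<close>
    have "smooth_on (- {0}) (\<lambda>x::'a. (x \<bullet> x) powr (- a / 2) * bump 0 (1 + (- 1 / (4 * n\<^sup>2)) * (ln (x \<bullet> x) * ln (x \<bullet> x))) * \<psi> x)"
      by (intro smooth_on_mult[OF op] smooth_on_powr[OF op] smooth_on_bump[OF op] smooth_on_add[OF op] smooth_on_const[OF op] smooth_on_ln[OF op] sq pos sm)
    then have 1: "smooth_on (- {0}) u"
    proof (rule smooth_on_cong[OF op])
      fix x :: 'a assume "x \<in> - {0}"
      then have np: "norm x > 0" by simp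
      have l: "ln (x \<bullet> x) = 2 * ln (norm x)"
        unfolding dot_square_norm using np by (simp add: ln_realpow)
      have p: "(x \<bullet> x) powr (- a / 2) = exp (- a * ln (norm x))"
        using np by (simp add: powr_def l)
      have "1 + (- 1 / (4 * n\<^sup>2)) * (ln (x \<bullet> x) * ln (x \<bullet> x)) = 1 - (ln (norm x) / n)\<^sup>2"
        unfolding l using n0 by (simp add: power2_eq_square)
      then show "(x \<bullet> x) powr (- a / 2) * bump 0 (1 + (- 1 / (4 * n\<^sup>2)) * (ln (x \<bullet> x) * ln (x \<bullet> x))) * \<psi> x = u x"
        unfolding p u_def f_def F_def profile_def by (simp only:)
    qed
    have "smooth_on (ball 0 (exp (- n))) (\<lambda>x::'a. 0)" by (rule smooth_on_const) simp
    then have 2: "smooth_on (ball 0 (exp (- n))) u"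
    proof (rule smooth_on_cong[rotated])
      fix y :: 'a assume "y \<in> ball 0 (exp (- n))"
      then have "y \<notin> A" by (auto simp: A_def)
      then show "0 = u y" using uA by simp
    qed simp
    have "smooth_on (- {0} \<union> ball 0 (exp (- n))) u" by (rule smooth_on_Un[OF 1 2]) auto
    moreover have "- {0} \<union> ball 0 (exp (- n)) = (UNIV :: 'a set)" by auto
    ultimately show ?thesis by (simp only:)
  qed
  have ts: "tsupport u \<subseteq> A" unfolding tsupport_def
    by (rule closure_minimal) (use uA compact_imp_closed[OF cA] in auto)
  have tf: "test_fun (cone_of \<Sigma>) u"
  proof -
    have "compact (A \<inter> tsupport u)" by (rule compact_Int_closed[OF cA]) (simp add: tsupport_def)
    moreover have "A \<inter> tsupport u = tsupport u" using ts by blast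
    ultimately show ?thesis unfolding test_fun_def using smu ts Ac by simp
  qed
  note C = test_fun_C1c[OF tf]
  have c0: "cone_of \<Sigma> \<subseteq> - {0}" by (auto simp: cone_of_eq[OF Ss])
  have hg: "has_grad \<psi> (fgrad \<psi>) (- {0})" using h by (simp add: hom_adm_def)
  have grad: "fgrad u x = f (ln (norm x)) *\<^sub>R fgrad \<psi> x + \<psi> x *\<^sub>R ((f' (ln (norm x)) / (norm x)\<^sup>2) *\<^sub>R x)" if "x \<noteq> 0" for x
  proof -
    have l: "has_grad (\<lambda>x::'a. ln (norm x)) (\<lambda>x. (1 / (norm x)\<^sup>2) *\<^sub>R x) (- {0})"
      unfolding has_grad_def
    proof (intro conjI ballI)
      fix x :: 'a assume "x \<in> - {0}"
      then have x: "x \<noteq> 0" by simp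
      have "((\<lambda>x. ln (norm x)) has_derivative (\<lambda>h. (sgn x \<bullet> h) * inverse (norm x))) (at x)"
        using x by (auto intro!: derivative_eq_intros has_derivative_norm simp: inner_commute divide_inverse)
      then show "((\<lambda>x. ln (norm x)) has_derivative (\<bullet>) ((1 / (norm x)\<^sup>2) *\<^sub>R x)) (at x)"
        by (rule has_derivative_eq_rhs) (use x in \<open>auto simp: fun_eq_iff sgn_div_norm power2_eq_square field_simps\<close>)
    qed (auto intro!: continuous_intros)
    have "has_grad (\<lambda>x::'a. f (ln (norm x))) (\<lambda>x. f' (ln (norm x)) *\<^sub>R ((1 / (norm x)\<^sup>2) *\<^sub>R x)) (- {0})"
      by (rule has_grad_compose[OF l df]) (intro continuous_on_compose2[OF cf(2) has_grad_continuous[OF l]] subset_UNIV)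
    from has_grad_mult[OF this hg]
    have 1: "has_grad u (\<lambda>x. f (ln (norm x)) *\<^sub>R fgrad \<psi> x + \<psi> x *\<^sub>R (f' (ln (norm x)) *\<^sub>R ((1 / (norm x)\<^sup>2) *\<^sub>R x))) (- {0})"
      by (simp add: u_def[abs_def])
    have "has_grad u (fgrad u) UNIV" using C by (simp add: C1c_def)
    then have 2: "has_grad u (fgrad u) (- {0})" by (auto simp: has_grad_def intro: continuous_on_subset)
    have "x \<in> - {0}" using that by simp
    from has_grad_unique[OF 2 1 this] show ?thesis by simp
  qed
  define \<kappa>1 where "\<kappa>1 t = (f (ln t) / t)\<^sup>2" for t
  define \<kappa>2 where "\<kappa>2 t = (f' (ln t) / t)\<^sup>2" for t
  have m\<kappa>[measurable]: "\<kappa>1 \<in> borel_measurable borel" "\<kappa>2 \<in> borel_measurable borel"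
    unfolding \<kappa>1_def[abs_def] \<kappa>2_def[abs_def] by measurable
  have grad2: "(norm (fgrad u x))\<^sup>2 = \<kappa>1 (norm x) * ((norm x)\<^sup>2 * (norm (fgrad \<psi> x))\<^sup>2) + \<kappa>2 (norm x) * (\<psi> x)\<^sup>2" if "x \<noteq> 0" for x
  proof -
    have e: "x \<bullet> fgrad \<psi> x = 0" by (rule hom_adm_euler[OF h that])
    have ex: "(norm (b *\<^sub>R G + c *\<^sub>R (d *\<^sub>R x)))\<^sup>2 = b\<^sup>2 * (norm G)\<^sup>2 + (c * d)\<^sup>2 * (norm x)\<^sup>2 + 2 * b * c * d * (x \<bullet> G)" for b c d G
      unfolding power2_norm_eq_inner
      by (simp add: inner_add_left inner_add_right inner_commute power2_eq_square algebra_simps)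
    have n: "norm x \<noteq> 0" using that by simp
    show ?thesis unfolding grad[OF that] ex e \<kappa>1_def \<kappa>2_def
      using n by (simp add: power_mult_distrib power_divide) (simp add: power2_eq_square power4_eq_xxxx field_simps)
  qed
  have m1[measurable]: "\<psi> \<in> borel_measurable borel" by (rule measurable_punctured[OF has_grad_continuous[OF hg]])
  have m2[measurable]: "fgrad \<psi> \<in> borel_measurable borel" by (rule measurable_punctured[OF has_grad_continuous_grad[OF hg]])
  have hom1: "ennreal ((\<psi> (sgn x))\<^sup>2) = ennreal ((\<psi> x)\<^sup>2)" for x using h by (simp add: hom_adm_def)
  have hom2: "ennreal ((norm (sgn x))\<^sup>2 * (norm (fgrad \<psi> (sgn x)))\<^sup>2) = ennreal ((norm x)\<^sup>2 * (norm (fgrad \<psi> x))\<^sup>2)" if "x \<noteq> 0" for x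
    using that by (simp add: hom_adm_grad_sgn[OF h] norm_sgn power_mult_distrib)
  define P where "P = (LBINT t. (F t)\<^sup>2)"
  define Q where "Q = (LBINT t. (F' t - a * F t)\<^sup>2)"
  have P: "P > 0"
  proof -
    have p: "(F 0)\<^sup>2 > 0" by (simp add: F_def profile_def bump_def)
    have "0 < (\<integral>\<^sup>+x. ennreal ((F x)\<^sup>2) * indicator UNIV x \<partial>lborel)"
      by (rule nn_integral_pos_continuous[where f="\<lambda>t. (F t)\<^sup>2", OF _ _ _ p]) (auto intro!: continuous_intros cF)
    also have "\<dots> = ennreal P" unfolding P_def
      using nn_integral_eq_integral[OF C0c_integrable[OF C0c_power2[OF ccF(1)]]] by simp
    finally show ?thesis by simp
  qed
  have Q: "Q \<ge> 0" "Q \<le> (a\<^sup>2 + e) * P" using ratio by (simp_all add: Q_def P_def F_def F'_def)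
  \<comment> \<open>\<open>DIM('a) = 2 * a + 2\<close>: the volume factor cancels the square of
    \<open>exp (- a * t) / exp t\<close>, so both radial integrals become integrals over the line
    without weight.\<close>
  have expN: "exp (real DIM('a) * t) * (exp (- a * t) * z / exp t)\<^sup>2 = z\<^sup>2" for t z
  proof -
    have "real DIM('a) * t = (a * t + t) + (a * t + t)" by (simp add: a_def field_simps)
    then have "exp (real DIM('a) * t) = (exp (a * t) * exp t)\<^sup>2" by (simp only: exp_add power2_eq_square)
    moreover have "exp (- a * t) * exp (a * t) = 1" by (simp add: exp_minus)
    then have "(exp (a * t) * exp t) * (exp (- a * t) * z / exp t) = z" by (simp add: field_simps)
    ultimately show ?thesis by (metis power_mult_distrib)
  qed
  have r1: "(\<integral>\<^sup>+t. ennreal (exp (real DIM('a) * t)) * ennreal (\<kappa>1 (exp t)) \<partial>lborel) = ennreal P"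
  proof -
    have "(\<integral>\<^sup>+t. ennreal (exp (real DIM('a) * t)) * ennreal (\<kappa>1 (exp t)) \<partial>lborel) = (\<integral>\<^sup>+t. ennreal ((F t)\<^sup>2) \<partial>lborel)"
      by (rule nn_integral_cong) (simp only: \<kappa>1_def ln_exp f_def ennreal_mult'[symmetric] exp_ge_zero expN)
    also have "\<dots> = ennreal P" unfolding P_def
      by (rule nn_integral_eq_integral) (auto intro!: C0c_integrable C0c_intros ccF)
    finally show ?thesis .
  qed
  have r2: "(\<integral>\<^sup>+t. ennreal (exp (real DIM('a) * t)) * ennreal (\<kappa>2 (exp t)) \<partial>lborel) = ennreal Q"
  proof -
    have "(\<integral>\<^sup>+t. ennreal (exp (real DIM('a) * t)) * ennreal (\<kappa>2 (exp t)) \<partial>lborel) = (\<integral>\<^sup>+t. ennreal ((F' t - a * F t)\<^sup>2) \<partial>lborel)"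
      by (rule nn_integral_cong) (simp only: \<kappa>2_def ln_exp f'_def ennreal_mult'[symmetric] exp_ge_zero expN)
    also have "\<dots> = ennreal Q" unfolding Q_def
    proof (rule nn_integral_eq_integral)
      have "C0c (\<lambda>t. F' t - F t * a)" by (intro C0c_intros ccF continuous_intros)
      from C0c_integrable[OF C0c_power2[OF this]] show "integrable lborel (\<lambda>t. (F' t - a * F t)\<^sup>2)" by (simp add: mult.commute)
    qed auto
    finally show ?thesis .
  qed
  let ?N = "real DIM('a)"
  have I1: "(\<integral>\<^sup>+x. ennreal (\<kappa>1 (norm x)) * ennreal ((\<psi> x)\<^sup>2) \<partial>lborel) = ennreal (?N * P * X)"
    using radial_times_homogeneous[of "\<lambda>x. ennreal ((\<psi> x)\<^sup>2)" "\<lambda>t. ennreal (\<kappa>1 t)", OF _ _ hom1] P X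
    unfolding r1 ball_integral_def[symmetric] X(1) by (simp add: ennreal_mult)
  have I2: "(\<integral>\<^sup>+x. ennreal (\<kappa>2 (norm x)) * ennreal ((\<psi> x)\<^sup>2) \<partial>lborel) = ennreal (?N * Q * X)"
    using radial_times_homogeneous[of "\<lambda>x. ennreal ((\<psi> x)\<^sup>2)" "\<lambda>t. ennreal (\<kappa>2 t)", OF _ _ hom1] Q X
    unfolding r2 ball_integral_def[symmetric] X(1) by (simp add: ennreal_mult)
  have I3: "(\<integral>\<^sup>+x. ennreal (\<kappa>1 (norm x)) * ennreal ((norm x)\<^sup>2 * (norm (fgrad \<psi> x))\<^sup>2) \<partial>lborel) = ennreal (?N * P * Y)"
    using radial_times_homogeneous[of "\<lambda>x. ennreal ((norm x)\<^sup>2 * (norm (fgrad \<psi> x))\<^sup>2)" "\<lambda>t. ennreal (\<kappa>1 t)", OF _ _ hom2] P Y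
    unfolding r1 ball_integral_def[symmetric] Y(1) by (simp add: ennreal_mult)
  have den: "(LBINT x. (u x)\<^sup>2 / (norm x)\<^sup>2) = ?N * P * X"
  proof -
    have "ennreal (LBINT x. (u x)\<^sup>2 / (norm x)\<^sup>2) = (\<integral>\<^sup>+x. ennreal ((u x)\<^sup>2 / (norm x)\<^sup>2) \<partial>lborel)"
      by (rule nn_integral_eq_integral[symmetric]) (auto intro!: C0c_integrable C0c_div_norm2[OF C c0])
    also have "\<dots> = (\<integral>\<^sup>+x. ennreal (\<kappa>1 (norm x)) * ennreal ((\<psi> x)\<^sup>2) \<partial>lborel)"
      by (rule nn_integral_cong) (simp add: u_def \<kappa>1_def ennreal_mult'[symmetric] power_mult_distrib power_divide)
    finally show ?thesis unfolding I1 using P X by (subst (asm) ennreal_inj) auto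
  qed
  have num: "(LBINT x. (norm (fgrad u x))\<^sup>2) = ?N * P * Y + ?N * Q * X"
  proof -
    have "ennreal (LBINT x. (norm (fgrad u x))\<^sup>2) = (\<integral>\<^sup>+x. ennreal ((norm (fgrad u x))\<^sup>2) \<partial>lborel)"
      by (rule nn_integral_eq_integral[symmetric]) (auto intro!: C0c_integrable C0c_intros C1c_C0c[OF C])
    also have "\<dots> = (\<integral>\<^sup>+x. ennreal (\<kappa>1 (norm x)) * ennreal ((norm x)\<^sup>2 * (norm (fgrad \<psi> x))\<^sup>2) + ennreal (\<kappa>2 (norm x)) * ennreal ((\<psi> x)\<^sup>2) \<partial>lborel)"
    proof (rule nn_integral_cong_AE, rule AE_mp[OF AE_lborel_singleton[of "0::'a"]], rule AE_I2, rule impI)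
      fix x :: 'a assume x: "x \<noteq> 0"
      show "ennreal ((norm (fgrad u x))\<^sup>2) = ennreal (\<kappa>1 (norm x)) * ennreal ((norm x)\<^sup>2 * (norm (fgrad \<psi> x))\<^sup>2) + ennreal (\<kappa>2 (norm x)) * ennreal ((\<psi> x)\<^sup>2)"
        unfolding grad2[OF x] by (subst ennreal_plus) (auto simp: \<kappa>1_def \<kappa>2_def ennreal_mult)
    qed
    also have "\<dots> = ennreal (?N * P * Y) + ennreal (?N * Q * X)"
      by (subst nn_integral_add) (measurable, simp only: I2 I3)
    also have "\<dots> = ennreal (?N * P * Y + ?N * Q * X)" using P Q X Y by (intro ennreal_plus[symmetric]) auto
    finally show ?thesis using P Q X Y by (subst (asm) ennreal_inj) auto
  qed
  have N: "?N > 0" by simp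
  obtain x0 where x0: "u x0 \<noteq> 0"
  proof -
    have "\<not> (\<forall>x. u x = 0)"
    proof
      assume "\<forall>x. u x = 0"
      then have "(LBINT x. (u x)\<^sup>2 / (norm x)\<^sup>2) = 0" by simp
      then show False unfolding den using N P X(2) by simp
    qed
    then show ?thesis using that by blast
  qed
  have "hardy_const \<Sigma> \<le> (\<integral>x. grad_sq u x \<partial>lebesgue) / (\<integral>x. u x ^ 2 / norm x ^ 2 \<partial>lebesgue)"
    unfolding hardy_const_def
  proof (rule cInf_lower)
    show "bdd_below {(\<integral>x. grad_sq u x \<partial>lebesgue) / (\<integral>x. u x ^ 2 / norm x ^ 2 \<partial>lebesgue) | u. test_fun (cone_of \<Sigma>) u \<and> (\<exists>x. u x \<noteq> 0)}"
      by (rule bdd_belowI[of _ 0]) (auto intro!: divide_nonneg_nonneg integral_nonneg_AE simp: grad_sq_def sum_nonneg)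
  qed (use tf x0 in blast)
  also have "\<dots> = (?N * P * Y + ?N * Q * X) / (?N * P * X)"
    unfolding num[symmetric] den[symmetric] grad_sq_fgrad
    by (simp only: C1c_lebesgue_integral[OF C0c_norm_power2[OF C1c_C0c(2)[OF C]]] C1c_lebesgue_integral[OF C0c_div_norm2[OF C c0]])
  also have "\<dots> = Y / X + Q / P" using N P X(2) by (simp add: field_simps)
  also have "Q / P \<le> a\<^sup>2 + e" using Q P by (simp add: field_simps)
  finally show ?thesis using tf x0 by (auto simp: a_def)
qed

section \<open>Mollification\<close>

definition L1loc :: "('a::euclidean_space \<Rightarrow> real) \<Rightarrow> bool" where
  "L1loc U \<longleftrightarrow> U \<in> borel_measurable borel \<and> (\<forall>r. integrable lborel (\<lambda>y. indicator (cball 0 r) y * U y))"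

text \<open>The dominating function is the same for all \<open>x\<close> with
  \<open>norm x \<le> X\<close>; it serves integrability, continuity and differentiability of
  convolutions.\<close>

lemma conv_bound:
  fixes g :: "'a::euclidean_space \<Rightarrow> 'b::euclidean_space"
  assumes g: "\<And>z. norm (g z) \<le> C * indicator (cball 0 R) z" and C: "C > 0" and x: "norm x \<le> X"
  shows "norm (U y *\<^sub>R g (x - y)) \<le> C * \<bar>indicator (cball 0 (R + X)) y * U y\<bar>"
proof (cases "norm (x - y) \<le> R")
  case True
  have "norm y \<le> norm (x - y) + norm x" by (metis add_diff_cancel_left' diff_add_cancel norm_minus_commute norm_triangle_sub add.commute)
  then have "norm y \<le> R + X" using True x by simp
  then have i: "indicator (cball 0 (R + X)) y = (1::real)" by simp
  have "norm (g (x - y)) \<le> C" using g[of "x - y"] True by simp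
  then have "\<bar>U y\<bar> * norm (g (x - y)) \<le> \<bar>U y\<bar> * C" by (rule mult_left_mono) simp
  then show ?thesis by (simp add: i mult.commute)
next
  case False
  then have "norm (g (x - y)) \<le> 0" using g[of "x - y"] by simp
  then have "g (x - y) = 0" by simp
  then show ?thesis using C by simp
qed

lemma conv_integrable:
  fixes g :: "'a::euclidean_space \<Rightarrow> 'b::euclidean_space"
  assumes U: "L1loc U" and g: "C0c g"
  shows "integrable lborel (\<lambda>y. U y *\<^sub>R g (x - y))"
proof -
  obtain C R where CR: "C > 0" "R > 0" "\<And>z. norm (g z) \<le> C * indicator (cball 0 R) z" using C0c_dominated[OF g] by metis
  have [measurable]: "U \<in> borel_measurable borel" "g \<in> borel_measurable borel" using U C0c_measurable[OF g] by (auto simp: L1loc_def)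
  show ?thesis
  proof (rule Bochner_Integration.integrable_bound)
    show "integrable lborel (\<lambda>y. C * \<bar>indicator (cball 0 (R + norm x)) y * U y\<bar>)"
      using U by (intro integrable_mult_right integrable_abs) (simp add: L1loc_def)
    show "(\<lambda>y. U y *\<^sub>R g (x - y)) \<in> borel_measurable lborel" by measurable
    show "AE y in lborel. norm (U y *\<^sub>R g (x - y)) \<le> norm (C * \<bar>indicator (cball 0 (R + norm x)) y * U y\<bar>)"
      by (rule AE_I2, rule order_trans[OF conv_bound[OF CR(3,1) order_refl]]) simp
  qed
qed

lemma conv_continuous:
  fixes g :: "'a::euclidean_space \<Rightarrow> 'b::euclidean_space"
  assumes U: "L1loc U" and g: "C0c g"
  shows "continuous_on UNIV (\<lambda>x. \<integral>y. U y *\<^sub>R g (x - y) \<partial>lborel)"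
  unfolding continuous_on_sequentially
proof (intro allI ballI impI)
  fix s :: "nat \<Rightarrow> 'a" and x assume "(\<forall>n. s n \<in> UNIV) \<and> s \<longlonglongrightarrow> x"
  then have s: "s \<longlonglongrightarrow> x" by simp
  obtain X where X: "\<And>n. norm (s n) \<le> X" using s convergent_imp_Bseq[OF convergentI[OF s]] by (auto simp: Bseq_def)
  obtain C R where CR: "C > 0" "R > 0" "\<And>z. norm (g z) \<le> C * indicator (cball 0 R) z" using C0c_dominated[OF g] by metis
  have [measurable]: "U \<in> borel_measurable borel" "g \<in> borel_measurable borel" using U C0c_measurable[OF g] by (auto simp: L1loc_def)
  have "(\<lambda>n. \<integral>y. U y *\<^sub>R g (s n - y) \<partial>lborel) \<longlonglongrightarrow> (LBINT y. U y *\<^sub>R g (x - y))"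
  proof (rule integral_dominated_convergence)
    show "integrable lborel (\<lambda>y. C * \<bar>indicator (cball 0 (R + X)) y * U y\<bar>)"
      using U by (intro integrable_mult_right integrable_abs) (simp add: L1loc_def)
    show "AE y in lborel. (\<lambda>n. U y *\<^sub>R g (s n - y)) \<longlonglongrightarrow> U y *\<^sub>R g (x - y)"
    proof (intro AE_I2 tendsto_intros)
      fix y
      have "isCont g (x - y)" using C0c_continuous[OF g] by (simp add: continuous_on_eq_continuous_at)
      then show "(\<lambda>n. g (s n - y)) \<longlonglongrightarrow> g (x - y)" by (rule isCont_tendsto_compose) (intro tendsto_intros s)
    qed
    show "AE y in lborel. norm (U y *\<^sub>R g (s n - y)) \<le> C * \<bar>indicator (cball 0 (R + X)) y * U y\<bar>" for n
      by (rule AE_I2, rule conv_bound[OF CR(3,1) X])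
  qed measurable
  then show "((\<lambda>x. \<integral>y. U y *\<^sub>R g (x - y) \<partial>lborel) \<circ> s) \<longlonglongrightarrow> (LBINT y. U y *\<^sub>R g (x - y))"
    by (simp add: comp_def)
qed

lemma conv_has_grad:
  fixes f :: "'a::euclidean_space \<Rightarrow> real"
  assumes U: "L1loc U" and C: "C1c \<Omega> f g"
  shows "has_grad (\<lambda>x. \<integral>y. U y *\<^sub>R f (x - y) \<partial>lborel) (\<lambda>x. \<integral>y. U y *\<^sub>R g (x - y) \<partial>lborel) UNIV"
  unfolding has_grad_def
proof (intro conjI ballI conv_continuous[OF U C1c_C0c(2)[OF C]])
  fix x0 :: 'a
  note c = C1c_C0c[OF C]
  obtain K R where CR: "K > 0" "R > 0" "\<And>z. norm (g z) \<le> K * indicator (cball 0 R) z" using C0c_dominated[OF c(2)] by metis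
  have [measurable]: "U \<in> borel_measurable borel" "g \<in> borel_measurable borel" using U C0c_measurable[OF c(2)] by (auto simp: L1loc_def)
  have hg: "has_grad f g UNIV" using C by (simp add: C1c_def)
  show "((\<lambda>x. \<integral>y. U y *\<^sub>R f (x - y) \<partial>lborel) has_derivative (\<bullet>) (LBINT y. U y *\<^sub>R g (x0 - y))) (at x0)"
  proof (rule has_derivative_lebesgue_integral[where r=1 and B="\<lambda>y. K * \<bar>indicator (cball 0 (R + (norm x0 + 1))) y * U y\<bar>"])
    show "integrable lborel (\<lambda>y. U y *\<^sub>R f (x - y))" for x by (rule conv_integrable[OF U c(1)])
    show "integrable lborel (\<lambda>y. K * \<bar>indicator (cball 0 (R + (norm x0 + 1))) y * U y\<bar>)"
      using U by (intro integrable_mult_right integrable_abs) (simp add: L1loc_def)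
    show "((\<lambda>x. U y *\<^sub>R f (x - y)) has_derivative (\<bullet>) (U y *\<^sub>R g (x - y))) (at x)" for x y
    proof -
      have "((\<lambda>x. x - y) has_derivative (\<lambda>h. h)) (at x)" by (auto intro!: derivative_eq_intros)
      from has_derivative_compose[OF this has_gradD[OF hg UNIV_I]]
      have "((\<lambda>x. f (x - y)) has_derivative (\<bullet>) (g (x - y))) (at x)" .
      from has_derivative_scaleR_right[OF this, of "U y"] show ?thesis by (rule has_derivative_eq_rhs) (auto simp: fun_eq_iff)
    qed
    show "norm (U y *\<^sub>R g (x - y)) \<le> K * \<bar>indicator (cball 0 (R + (norm x0 + 1))) y * U y\<bar>" if "x \<in> ball x0 1" for x y
    proof (rule conv_bound[OF CR(3,1)])
      have "norm x \<le> norm x0 + norm (x - x0)" by (metis norm_triangle_sub)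
      moreover have "norm (x - x0) < 1" using that by (simp add: dist_norm norm_minus_commute)
      ultimately show "norm x \<le> norm x0 + 1" by simp
    qed
  qed (simp, measurable)
qed

text \<open>Each differentiation in \<open>y\<close> contributes a sign, and two of them cancel. The
  factor \<open>s\<close> in the auxiliary claim allows it to be applied to the negative of the
  derivative.\<close>

lemma dderiv_reflect:
  fixes f :: "'a::euclidean_space \<Rightarrow> real"
  assumes f: "smooth_on UNIV f"
  shows "dderiv [i, i] (\<lambda>y. f (x - y)) y = dderiv [i, i] f (x - y)"
proof -
  have refl1: "frechet_derivative (\<lambda>y. s * h (x - y)) (at y) i = - s * frechet_derivative h (at (x - y)) i"
    if h: "\<And>z. h differentiable (at z)" for h :: "'a \<Rightarrow> real" and y s
  proof -
    have "(h has_derivative frechet_derivative h (at (x - y))) (at (x - y))" using h frechet_derivative_works by blast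
    moreover have "((\<lambda>y. x - y) has_derivative (\<lambda>v. - v)) (at y)" by (auto intro!: derivative_eq_intros)
    ultimately have "((\<lambda>y. h (x - y)) has_derivative (\<lambda>v. frechet_derivative h (at (x - y)) (- v))) (at y)"
      using has_derivative_compose by blast
    then have "((\<lambda>y. s * h (x - y)) has_derivative (\<lambda>v. s * frechet_derivative h (at (x - y)) (- v))) (at y)"
      by (rule has_derivative_mult_right)
    then have "frechet_derivative (\<lambda>y. s * h (x - y)) (at y) = (\<lambda>v. s * frechet_derivative h (at (x - y)) (- v))"
      by (rule frechet_derivative_at[symmetric])
    moreover have "frechet_derivative h (at (x - y)) (- i) = - frechet_derivative h (at (x - y)) i"
      using linear_frechet_derivative[OF h] by (rule linear_neg)
    ultimately show ?thesis by simp
  qed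
  have d: "dderiv vs f differentiable (at z)" for vs z
    using f unfolding smooth_on_def by (simp add: differentiable_on_def)
  have "frechet_derivative (\<lambda>y. f (x - y)) (at y) i = -1 * frechet_derivative f (at (x - y)) i" for y
    using refl1[of f 1 y] d[of "[]"] by simp
  then have 1: "dderiv [i] (\<lambda>y. f (x - y)) = (\<lambda>y. -1 * dderiv [i] f (x - y))" by (simp add: fun_eq_iff)
  have "dderiv [i, i] (\<lambda>y. f (x - y)) y = frechet_derivative (\<lambda>y. -1 * dderiv [i] f (x - y)) (at y) i"
    using 1 by (simp only: dderiv.simps)
  also have "\<dots> = dderiv [i, i] f (x - y)" using refl1[of "dderiv [i] f" "-1" y] d[of "[i]"] by simp
  finally show ?thesis .
qed

lemma laplacian_reflect:
  "smooth_on UNIV f \<Longrightarrow> laplacian (\<lambda>y. f (x - y)) y = laplacian f (x - y)"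
  unfolding laplacian_def by (intro sum.cong refl dderiv_reflect)

definition mollifier :: "real \<Rightarrow> 'a::euclidean_space \<Rightarrow> real" where
  "mollifier e z = bump 0 (e\<^sup>2 - z \<bullet> z) / (LBINT (w::'a). bump 0 (e\<^sup>2 - w \<bullet> w))"

lemma mollifier_facts:
  assumes e: "e > 0"
  shows "smooth_on UNIV (mollifier e :: 'a::euclidean_space \<Rightarrow> real)" "\<And>z::'a. mollifier e z \<ge> 0" "\<And>z::'a. norm z < e \<Longrightarrow> mollifier e z > 0"
    "\<And>z::'a. norm z \<ge> e \<Longrightarrow> mollifier e z = 0" "(LBINT (z::'a). mollifier e z) = 1"
proof -
  define f where "f = (\<lambda>z::'a. bump 0 (e\<^sup>2 - z \<bullet> z))"
  have z2: "z \<bullet> z = (norm z)\<^sup>2" for z :: 'a by (simp add: dot_square_norm)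
  have sm: "smooth_on UNIV f" unfolding f_def
    using smooth_on_bump[OF open_UNIV smooth_on_quadratic[of "-1" 0 "e\<^sup>2"], of 0] by (simp add: algebra_simps)
  have nn: "f z \<ge> 0" for z by (simp add: f_def bump_def)
  have pos: "f z > 0" if "norm z < e" for z
  proof -
    have "(norm z)\<^sup>2 < e\<^sup>2" using that by (intro power_strict_mono) auto
    then show ?thesis by (simp add: f_def bump_def z2)
  qed
  have zer: "f z = 0" if "norm z \<ge> e" for z
  proof -
    have "e\<^sup>2 \<le> (norm z)\<^sup>2" using that e by (intro power_mono) auto
    then show ?thesis by (simp add: f_def bump_def z2)
  qed
  have ct: "continuous_on UNIV f" using smooth_on_has_grad[OF open_UNIV sm] by (rule has_grad_continuous)
  have ccf: "C0c f" unfolding C0c_def using ct zer by (auto intro!: exI[of _ e])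
  have "0 < (\<integral>\<^sup>+x. ennreal (f x) * indicator UNIV x \<partial>lborel)"
    by (rule nn_integral_pos_continuous[where f=f, OF _ _ _ pos[of 0]]) (use ct nn e in auto)
  also have "\<dots> = ennreal (LBINT x. f x)" using nn_integral_eq_integral[OF C0c_integrable[OF ccf]] nn by simp
  finally have J: "(LBINT x. f x) > 0" by simp
  have me: "mollifier e = (\<lambda>z. f z * (1 / (LBINT x. f x)))" by (simp add: fun_eq_iff mollifier_def f_def)
  show "smooth_on UNIV (mollifier e :: 'a \<Rightarrow> real)" unfolding me by (intro smooth_on_mult smooth_on_const sm open_UNIV)
  show "mollifier e z \<ge> 0" for z :: 'a unfolding me using nn J by simp
  show "norm z < e \<Longrightarrow> mollifier e z > 0" for z :: 'a unfolding me using pos J by simp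
  show "norm z \<ge> e \<Longrightarrow> mollifier e z = 0" for z :: 'a unfolding me using zer J by simp
  show "(LBINT (z::'a). mollifier e z) = 1" unfolding me integral_mult_left_zero using J by simp
qed

lemma mollifier_test_fun:
  assumes e: "e > 0"
  shows "test_fun (cball 0 e) (mollifier e :: 'a::euclidean_space \<Rightarrow> real)"
  unfolding test_fun_def
proof (intro conjI mollifier_facts(1)[OF e])
  show ts: "tsupport (mollifier e) \<subseteq> cball (0::'a) e" unfolding tsupport_def
  proof (rule closure_minimal)
    show "{x::'a. mollifier e x \<noteq> 0} \<subseteq> cball 0 e" using mollifier_facts(4)[OF e] by (force simp: not_le)
  qed simp
  have "compact (cball (0::'a) e \<inter> tsupport (mollifier e))" by (rule compact_Int_closed) (auto simp: tsupport_def)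
  then show "compact (tsupport (mollifier e :: 'a \<Rightarrow> real))" using ts by (simp add: Int_absorb1)
qed

lemma mollifier_translate_test_fun:
  fixes x :: "'a::euclidean_space"
  assumes e: "e > 0" and x: "cball x e \<subseteq> \<Omega>"
  shows "test_fun \<Omega> (\<lambda>y. mollifier e (x - y))"
  unfolding test_fun_def
proof (intro conjI)
  have eq: "e\<^sup>2 - (x - y) \<bullet> (x - y) = (-1) * (y \<bullet> y) + y \<bullet> (2 *\<^sub>R x) + (e\<^sup>2 - x \<bullet> x)" for y
    by (simp add: inner_diff_left inner_diff_right inner_commute algebra_simps)
  have "smooth_on UNIV (\<lambda>y. bump 0 ((-1) * (y \<bullet> y) + y \<bullet> (2 *\<^sub>R x) + (e\<^sup>2 - x \<bullet> x)) * (1 / (LBINT (w::'a). bump 0 (e\<^sup>2 - w \<bullet> w))))"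
    by (intro smooth_on_mult smooth_on_const smooth_on_bump smooth_on_quadratic open_UNIV)
  then show "smooth_on UNIV (\<lambda>y. mollifier e (x - y))" unfolding mollifier_def eq[symmetric] by simp
  have ts: "tsupport (\<lambda>y. mollifier e (x - y)) \<subseteq> cball x e" unfolding tsupport_def
  proof (rule closure_minimal)
    show "{y. mollifier e (x - y) \<noteq> 0} \<subseteq> cball x e" using mollifier_facts(4)[OF e] by (force simp: not_le dist_norm)
  qed simp
  then show "tsupport (\<lambda>y. mollifier e (x - y)) \<subseteq> \<Omega>" using x by blast
  have "compact (cball x e \<inter> tsupport (\<lambda>y. mollifier e (x - y)))" by (rule compact_Int_closed) (auto simp: tsupport_def)
  then show "compact (tsupport (\<lambda>y. mollifier e (x - y)))" using ts by (simp add: Int_absorb1)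
qed

text \<open>Bernoulli's inequality with real exponent, from
  \<open>ln s >= 1 - 1 / s\<close>.\<close>

lemma powr_tangent:
  fixes s p :: real
  assumes s: "s \<ge> 0" and p: "p > 1"
  shows "s powr p \<ge> 1 + p * (s - 1)"
proof (cases "s = 0")
  case True then show ?thesis using p by simp
next
  case False
  then have s: "s > 0" using s by simp
  have "ln (1 / s) \<le> 1 / s - 1" using s by (intro ln_le_minus_one) simp
  then have "ln s \<ge> 1 - 1 / s" using s by (simp add: ln_div)
  then have "1 + (p - 1) * (1 - 1 / s) \<le> 1 + (p - 1) * ln s" using p by simp
  also have "\<dots> \<le> exp ((p - 1) * ln s)" by (rule exp_ge_add_one_self)
  finally have "s * (1 + (p - 1) * (1 - 1 / s)) \<le> s * exp ((p - 1) * ln s)" using s by (intro mult_left_mono) auto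
  also have "s * exp ((p - 1) * ln s) = exp (ln s + (p - 1) * ln s)" using s by (simp add: exp_add)
  also have "\<dots> = s powr p" using s by (simp add: powr_def algebra_simps)
  finally have "s * (1 + (p - 1) * (1 - 1 / s)) \<le> s powr p" .
  moreover have "s * (1 + (p - 1) * (1 - 1 / s)) = 1 + p * (s - 1)" using s by (simp add: field_simps)
  ultimately show ?thesis by simp
qed

lemma powr_tangent':
  fixes t m p :: real
  assumes t: "t \<ge> 0" and m: "m > 0" and p: "p > 1"
  shows "t powr p \<ge> m powr p + p * m powr (p - 1) * (t - m)"
proof -
  have "m powr p * (1 + p * (t / m - 1)) \<le> m powr p * (t / m) powr p"
    using t m by (intro mult_left_mono powr_tangent p) auto
  also have "m powr p * (t / m) powr p = t powr p" using t m by (simp add: powr_divide)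
  finally have 1: "m powr p * (1 + p * (t / m - 1)) \<le> t powr p" .
  have "m powr p = m * m powr (p - 1)" using m by (simp add: powr_mult_base)
  then have "m powr p * (p * (t / m - 1)) = p * m powr (p - 1) * (t - m)" using m by (simp add: field_simps)
  then show ?thesis using 1 by (simp add: algebra_simps)
qed

text \<open>Integration by parts in each coordinate. Assumption \<open>nn\<close> makes the
  comparison of integrals valid even if \<open>q x * v x * \<zeta> x\<close> fails to be integrable,
  in which case its integral is 0.\<close>

lemma weak_supersol_of_laplacian:
  assumes v: "has_grad v gv UNIV" and w: "\<And>i. i \<in> Basis \<Longrightarrow> has_grad (\<lambda>x. gv x \<bullet> i) (w i) UNIV"
    and q: "\<And>x. x \<in> Q \<Longrightarrow> q x * v x \<le> - (\<Sum>i\<in>Basis. w i x \<bullet> i)"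
    and nn: "\<And>x. x \<in> Q \<Longrightarrow> 0 \<le> - (\<Sum>i\<in>Basis. w i x \<bullet> i)"
  shows "weak_supersol v gv q Q"
  unfolding weak_supersol_def
proof (intro allI impI)
  fix \<zeta> :: "'a \<Rightarrow> real" and g assume C: "C1c Q \<zeta> g" and z: "\<forall>x. \<zeta> x \<ge> 0"
  obtain K where K: "K \<subseteq> Q" "\<And>x. x \<notin> K \<Longrightarrow> \<zeta> x = 0" using C unfolding C1c_def by blast
  have c\<zeta>: "continuous_on UNIV \<zeta>" using C has_grad_continuous unfolding C1c_def by blast
  note cg = C1c_C0c[OF C]
  have cw: "continuous_on UNIV (\<lambda>x. w i x \<bullet> i)" if "i \<in> Basis" for i
    using has_grad_continuous_grad[OF w[OF that]] by (intro continuous_intros)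
  have ci: "C0c (\<lambda>x. \<zeta> x * (w i x \<bullet> i))" if "i \<in> Basis" for i by (rule C0c_mult_left[OF cg(1) cw[OF that]])
  have cgv: "continuous_on UNIV gv" by (rule has_grad_continuous_grad[OF v])
  have cj: "C0c (\<lambda>x. (gv x \<bullet> i) * (g x \<bullet> i))" for i :: 'a
    by (intro C0c_mult_right C0c_inner_left cg continuous_intros cgv)
  have byparts: "(LBINT x. (gv x \<bullet> i) * (g x \<bullet> i)) = - (LBINT x. \<zeta> x * (w i x \<bullet> i))" if i: "i \<in> Basis" for i
  proof -
    have "(LBINT x. (\<zeta> x *\<^sub>R w i x + (gv x \<bullet> i) *\<^sub>R g x) \<bullet> i) = 0"
      by (rule integral_directional_derivative_zero[OF C1c_mult_right[OF C w[OF i]]])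
    also have "(\<lambda>x. (\<zeta> x *\<^sub>R w i x + (gv x \<bullet> i) *\<^sub>R g x) \<bullet> i) = (\<lambda>x. \<zeta> x * (w i x \<bullet> i) + (gv x \<bullet> i) * (g x \<bullet> i))"
      by (simp add: fun_eq_iff inner_add_left)
    also have "(LBINT x. \<zeta> x * (w i x \<bullet> i) + (gv x \<bullet> i) * (g x \<bullet> i)) = (LBINT x. \<zeta> x * (w i x \<bullet> i)) + (LBINT x. (gv x \<bullet> i) * (g x \<bullet> i))"
      by (intro Bochner_Integration.integral_add C0c_integrable ci[OF i] cj)
    finally show ?thesis by simp
  qed
  have "(LBINT x. gv x \<bullet> g x) = (LBINT x. (\<Sum>i\<in>Basis. (gv x \<bullet> i) * (g x \<bullet> i)))"
    by (subst euclidean_inner) simp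
  also have "\<dots> = (\<Sum>i\<in>Basis. \<integral>x. (gv x \<bullet> i) * (g x \<bullet> i) \<partial>lborel)"
    by (intro Bochner_Integration.integral_sum C0c_integrable cj)
  also have "\<dots> = (\<Sum>i\<in>Basis. - (LBINT x. \<zeta> x * (w i x \<bullet> i)))" by (intro sum.cong refl byparts)
  also have "\<dots> = (LBINT x. - (\<Sum>i\<in>Basis. \<zeta> x * (w i x \<bullet> i)))"
    by (simp add: sum_negf Bochner_Integration.integral_sum C0c_integrable ci)
  finally have eq: "(LBINT x. gv x \<bullet> g x) = (LBINT x. - (\<Sum>i\<in>Basis. \<zeta> x * (w i x \<bullet> i)))" .
  have s: "- (\<Sum>i\<in>Basis. \<zeta> x * (w i x \<bullet> i)) = - (\<Sum>i\<in>Basis. w i x \<bullet> i) * \<zeta> x" for x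
    by (simp add: sum_distrib_left[symmetric] mult.commute)
  show "(LBINT x. q x * v x * \<zeta> x) \<le> (LBINT x. gv x \<bullet> g x)"
    unfolding eq
  proof (rule integral_mono')
    show "integrable lborel (\<lambda>x. - (\<Sum>i\<in>Basis. \<zeta> x * (w i x \<bullet> i)))"
      by (intro integrable_minus Bochner_Integration.integrable_sum C0c_integrable ci)
    fix x
    show "q x * v x * \<zeta> x \<le> - (\<Sum>i\<in>Basis. \<zeta> x * (w i x \<bullet> i))"
    proof (cases "x \<in> K")
      case True
      then show ?thesis unfolding s using q[of x] K z by (intro mult_right_mono) auto
    qed (simp add: K)
    show "0 \<le> - (\<Sum>i\<in>Basis. \<zeta> x * (w i x \<bullet> i))"
    proof (cases "x \<in> K")
      case True
      then show ?thesis unfolding s using nn[of x] K z by (intro mult_nonneg_nonneg) auto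
    qed (simp add: K)
  qed
qed

text \<open>Since mean_kernel z times z is minus the gradient of mean_potential, the derivative of the mean of v over scaled copies of mean_kernel
  is the weak Laplacian tested with mean_potential.\<close>
definition mean_kernel :: "'a::euclidean_space \<Rightarrow> real" where "mean_kernel z = 4 * max 0 (1 - z \<bullet> z)"
definition mean_potential :: "'a::euclidean_space \<Rightarrow> real" where "mean_potential z = (max 0 (1 - z \<bullet> z))\<^sup>2"

lemma mean_kernel_zero: "norm z \<ge> 1 \<Longrightarrow> mean_kernel z = 0" and mean_potential_zero: "norm z \<ge> 1 \<Longrightarrow> mean_potential z = 0"
  using power_mono[of 1 "norm z" 2] by (simp_all add: mean_kernel_def mean_potential_def dot_square_norm)

lemma mean_kernel_nonneg: "mean_kernel z \<ge> 0" and mean_potential_nonneg: "mean_potential z \<ge> 0" by (simp_all add: mean_kernel_def mean_potential_def)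

lemma mean_kernel_le: "mean_kernel z \<le> 4 * indicator (cball 0 1) z"
  by (cases "norm z \<le> 1") (simp_all add: mean_kernel_zero, simp add: mean_kernel_def)

lemma mean_kernel_ge: "3 * indicator (ball 0 (1/2)) z \<le> mean_kernel (z::'a::euclidean_space)"
proof (cases "norm z < 1 / 2")
  case True
  then have "(norm z)\<^sup>2 \<le> (1/2)\<^sup>2" by (intro power_mono) auto
  then show ?thesis using True by (simp add: mean_kernel_def dot_square_norm power2_eq_square)
qed (simp add: mean_kernel_nonneg)

lemma mean_kernel_continuous: "continuous_on UNIV mean_kernel"
  unfolding mean_kernel_def[abs_def] by (intro continuous_intros)

lemma mean_kernel_C0c: "C0c mean_kernel"
  unfolding C0c_def using mean_kernel_continuous by (auto intro!: exI[of _ 1] mean_kernel_zero)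

lemma mean_potential_C1c: "C1c (cball 0 1) mean_potential (\<lambda>z::'a::euclidean_space. - mean_kernel z *\<^sub>R z)"
proof (rule C1cI)
  have 1: "has_grad (\<lambda>z::'a. 1 - z \<bullet> z) (\<lambda>z. (-2) *\<^sub>R z) UNIV"
    unfolding has_grad_def
  proof (intro conjI ballI)
    show "((\<lambda>z::'a. 1 - z \<bullet> z) has_derivative (\<bullet>) (-2 *\<^sub>R x)) (at x)" for x
      by (auto intro!: derivative_eq_intros simp: fun_eq_iff inner_commute)
  qed (intro continuous_intros)
  have "has_grad (\<lambda>z::'a. (max 0 (1 - z \<bullet> z))\<^sup>2) (\<lambda>z. (2 * max 0 (1 - z \<bullet> z)) *\<^sub>R ((-2) *\<^sub>R z)) UNIV"
    by (rule has_grad_compose[OF 1 DERIV_max0_square]) (intro continuous_intros)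
  then show "has_grad mean_potential (\<lambda>z::'a. - mean_kernel z *\<^sub>R z) UNIV" by (simp add: mean_potential_def[abs_def] mean_kernel_def)
  show "mean_potential x = 0" if "x \<notin> cball 0 1" for x :: 'a using that by (simp add: mean_potential_zero)
qed auto

text \<open>The mean \<open>\<Theta>\<close> of \<open>v\<close> over dilates of
  \<open>mean_kernel\<close> does not increase with the radius, because its derivative is a negative
  multiple of the weak Laplacian of \<open>v\<close> tested with a dilated
  \<open>mean_potential\<close>. Comparison of radius \<open>d\<close> with radius 0, and
  \<open>mean_kernel \<ge> 3\<close> on the ball of radius 1/2, give the claim.\<close>

lemma mean_value:
  fixes x :: "'a::euclidean_space"
  assumes v: "has_grad v gv UNIV" and vp: "\<And>y. v y \<ge> 0" and ws: "weak_supersol v gv (\<lambda>_. 0) Q" and xd: "cball x d \<subseteq> Q" and d: "d > 0"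
  shows "3 * (LBINT y. indicator (ball x (d / 2)) y * v y) \<le> d ^ DIM('a) * (v x * (LBINT z. mean_kernel (z::'a)))"
proof -
  define \<Theta> where "\<Theta> \<delta> = (LBINT z. v (x + \<delta> *\<^sub>R z) * mean_kernel z)" for \<delta>
  define \<Theta>' where "\<Theta>' \<delta> = (LBINT z. gv (x + \<delta> *\<^sub>R z) \<bullet> (mean_kernel z *\<^sub>R z))" for \<delta>
  have cv: "continuous_on UNIV v" and cgv: "continuous_on UNIV gv" using has_grad_continuous[OF v] has_grad_continuous_grad[OF v] .
  have cvx: "continuous_on UNIV (\<lambda>z. v (x + \<delta> *\<^sub>R z))" for \<delta> by (intro continuous_on_compose2[OF cv] continuous_intros) auto
  have cgx: "continuous_on UNIV (\<lambda>z. gv (x + \<delta> *\<^sub>R z))" for \<delta> by (intro continuous_on_compose2[OF cgv] continuous_intros) auto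
  have ckz: "C0c (\<lambda>z::'a. mean_kernel z *\<^sub>R z)" by (intro C0c_intros mean_kernel_C0c continuous_intros)
  have ci: "C0c (\<lambda>z. v (x + \<delta> *\<^sub>R z) * mean_kernel z)" for \<delta> by (intro C0c_intros mean_kernel_C0c cvx)
  have cj: "C0c (\<lambda>z. gv (x + \<delta> *\<^sub>R z) \<bullet> (mean_kernel z *\<^sub>R z))" for \<delta> by (rule C0c_inner_right[OF ckz cgx])
  have der: "(\<Theta> has_real_derivative \<Theta>' \<delta>) (at \<delta>)" for \<delta>
  proof -
    have "bounded (gv ` cball x (\<bar>\<delta>\<bar> + 1))" by (intro compact_imp_bounded compact_continuous_image continuous_on_subset[OF cgv]) auto
    then obtain M where M: "\<And>y. y \<in> cball x (\<bar>\<delta>\<bar> + 1) \<Longrightarrow> norm (gv y) \<le> M" unfolding bounded_iff by blast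
    have "(\<Theta> has_derivative (\<bullet>) (LBINT z. gv (x + \<delta> *\<^sub>R z) \<bullet> (mean_kernel z *\<^sub>R z))) (at \<delta>)"
      unfolding \<Theta>_def
    proof (rule has_derivative_lebesgue_integral[where r=1 and B="\<lambda>z. M * (4 * indicator (cball 0 1) z)"])
      show "integrable lborel (\<lambda>z. v (x + \<delta> *\<^sub>R z) * mean_kernel z)" for \<delta> by (rule C0c_integrable[OF ci])
      show "((\<lambda>\<delta>. v (x + \<delta> *\<^sub>R z) * mean_kernel z) has_derivative (\<bullet>) (gv (x + \<delta> *\<^sub>R z) \<bullet> (mean_kernel z *\<^sub>R z))) (at \<delta>)" for \<delta> z
      proof -
        have "((\<lambda>\<delta>. x + \<delta> *\<^sub>R z) has_derivative (\<lambda>h. h *\<^sub>R z)) (at \<delta>)" by (auto intro!: derivative_eq_intros)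
        from has_derivative_mult_left[OF has_derivative_compose[OF this has_gradD[OF v UNIV_I]], of "mean_kernel z"]
        show ?thesis by (rule has_derivative_eq_rhs) (auto simp: fun_eq_iff)
      qed
      show "norm (gv (x + t *\<^sub>R z) \<bullet> (mean_kernel z *\<^sub>R z)) \<le> M * (4 * indicator (cball 0 1) z)" if t: "t \<in> ball \<delta> 1" for t z
      proof (cases "norm z \<le> 1")
        case True
        have "\<bar>t\<bar> \<le> \<bar>\<delta>\<bar> + 1" using t by (auto simp: dist_real_def)
        then have "\<bar>t\<bar> * norm z \<le> (\<bar>\<delta>\<bar> + 1) * 1" using True by (intro mult_mono) auto
        then have g: "norm (gv (x + t *\<^sub>R z)) \<le> M" by (intro M) (simp add: dist_norm)
        have "norm (mean_kernel z *\<^sub>R z) \<le> 4 * 1" unfolding norm_scaleR using mean_kernel_le[of z] mean_kernel_nonneg[of z] True by (intro mult_mono) auto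
        then have "norm (gv (x + t *\<^sub>R z)) * norm (mean_kernel z *\<^sub>R z) \<le> M * 4" using g order_trans[OF norm_ge_zero g] by (intro mult_mono) auto
        then show ?thesis using True Cauchy_Schwarz_ineq2[of "gv (x + t *\<^sub>R z)" "mean_kernel z *\<^sub>R z"] by simp
      qed (simp add: mean_kernel_zero)
      show "integrable lborel (\<lambda>z::'a. M * (4 * indicator (cball 0 1) z))"
        by (intro integrable_mult_right integrable_real_indicator) (use emeasure_lborel_cball_finite[of "0::'a" 1] in simp_all)
      show "(\<lambda>z. gv (x + \<delta> *\<^sub>R z) \<bullet> (mean_kernel z *\<^sub>R z)) \<in> borel_measurable lborel" using C0c_measurable[OF cj] by simp
    qed simp
    then show ?thesis unfolding has_field_derivative_def \<Theta>'_def by (rule has_derivative_eq_rhs) (auto simp: fun_eq_iff)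
  qed
  have neg: "\<Theta>' \<delta> \<le> 0" if \<delta>: "0 \<le> \<delta>" "\<delta> \<le> d" for \<delta>
  proof (cases "\<delta> = 0")
    case True
    \<comment> \<open>At radius 0 there is no test function to dilate; the derivative vanishes as
      the integral of a directional derivative of \<open>mean_potential\<close>.\<close>
    have "(LBINT z. (- mean_kernel z *\<^sub>R z) \<bullet> gv x) = 0" by (rule integral_directional_derivative_zero[OF mean_potential_C1c])
    then have "(LBINT z. - (gv x \<bullet> (mean_kernel z *\<^sub>R z))) = 0" by (simp add: inner_commute)
    then show ?thesis using True by (simp add: \<Theta>'_def)
  next
    case False
    then have \<delta>0: "\<delta> > 0" using \<delta> by simp
    define \<zeta> where "\<zeta> y = mean_potential ((1 / \<delta>) *\<^sub>R (y - x))" for y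
    define g where "g y = - (1 / \<delta>) *\<^sub>R (mean_kernel ((1 / \<delta>) *\<^sub>R (y - x)) *\<^sub>R ((1 / \<delta>) *\<^sub>R (y - x)))" for y
    have hhg: "has_grad mean_potential (\<lambda>z::'a. - mean_kernel z *\<^sub>R z) UNIV" using mean_potential_C1c unfolding C1c_def by blast
    have "C1c Q \<zeta> g"
    proof (rule C1cI)
      show "has_grad \<zeta> g UNIV" unfolding has_grad_def
      proof (intro conjI ballI)
        fix y
        have "((\<lambda>y. (1 / \<delta>) *\<^sub>R (y - x)) has_derivative (\<lambda>h. (1 / \<delta>) *\<^sub>R h)) (at y)" by (auto intro!: derivative_eq_intros)
        from has_derivative_compose[OF this has_gradD[OF hhg UNIV_I]]
        show "(\<zeta> has_derivative (\<bullet>) (g y)) (at y)" unfolding \<zeta>_def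
          by (rule has_derivative_eq_rhs) (auto simp: fun_eq_iff g_def)
        show "continuous_on UNIV g" unfolding g_def by (intro continuous_intros continuous_on_compose2[OF mean_kernel_continuous]) auto
      qed
      show "compact (cball x \<delta>)" by simp
      show "cball x \<delta> \<subseteq> Q" using xd \<delta> by (auto intro: subset_cball[THEN subsetD])
      show "\<zeta> y = 0" if "y \<notin> cball x \<delta>" for y unfolding \<zeta>_def
      proof (rule mean_potential_zero)
        have "norm (y - x) \<ge> \<delta>" using that by (simp add: dist_norm norm_minus_commute)
        then have "norm (y - x) / \<delta> \<ge> 1" using \<delta>0 by simp
        then show "1 \<le> norm ((1 / \<delta>) *\<^sub>R (y - x))" unfolding norm_scaleR using \<delta>0 by simp
      qed
    qed
    then have "(LBINT y. 0 * v y * \<zeta> y) \<le> (LBINT y. gv y \<bullet> g y)"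
      using ws mean_potential_nonneg unfolding weak_supersol_def \<zeta>_def by blast
    then have "0 \<le> (LBINT y. gv y \<bullet> g y)" by simp
    also have "\<dots> = (LBINT y. gv (y + x) \<bullet> g (y + x))" by (rule lborel_integral_translation[symmetric])
    also have "\<dots> = \<delta> ^ DIM('a) * (LBINT z. gv (\<delta> *\<^sub>R z + x) \<bullet> g (\<delta> *\<^sub>R z + x))"
    proof (rule lborel_integral_scale[OF _ \<delta>0])
      have "continuous_on UNIV g" unfolding g_def by (intro continuous_intros continuous_on_compose2[OF mean_kernel_continuous]) auto
      then have "continuous_on UNIV (\<lambda>y. gv y \<bullet> g y)" by (intro continuous_on_inner cgv)
      then have "continuous_on UNIV (\<lambda>y. gv (y + x) \<bullet> g (y + x))"
        by (rule continuous_on_compose2) (intro continuous_intros, simp)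
      then show "(\<lambda>y. gv (y + x) \<bullet> g (y + x)) \<in> borel_measurable borel" by (rule borel_measurable_continuous_onI)
    qed
    finally have p1: "0 \<le> \<delta> ^ DIM('a) * (LBINT z. gv (\<delta> *\<^sub>R z + x) \<bullet> g (\<delta> *\<^sub>R z + x))" .
    have p2: "(\<lambda>z. gv (\<delta> *\<^sub>R z + x) \<bullet> g (\<delta> *\<^sub>R z + x)) = (\<lambda>z. - (1 / \<delta>) * (gv (x + \<delta> *\<^sub>R z) \<bullet> (mean_kernel z *\<^sub>R z)))"
      using \<delta>0 by (simp add: g_def fun_eq_iff add.commute)
    have p3: "(LBINT z. - (1 / \<delta>) * (gv (x + \<delta> *\<^sub>R z) \<bullet> (mean_kernel z *\<^sub>R z))) = - (1 / \<delta>) * \<Theta>' \<delta>" unfolding \<Theta>'_def by (rule integral_mult_right_zero)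
    have "0 \<le> \<delta> ^ DIM('a) * (- (1 / \<delta>) * \<Theta>' \<delta>)" using p1 unfolding p2 p3 .
    moreover have "\<delta> ^ DIM('a) > 0" using \<delta>0 by simp
    ultimately have "0 \<le> - (1 / \<delta>) * \<Theta>' \<delta>" by (simp only: zero_le_mult_iff) linarith
    then show ?thesis using \<delta>0 by (simp add: divide_le_0_iff zero_le_divide_iff)
  qed
  have "\<Theta> d \<le> \<Theta> 0" by (rule DERIV_nonpos_imp_nonincreasing) (use der neg d in \<open>auto intro: less_imp_le\<close>)
  also have "\<Theta> 0 = v x * (LBINT z. mean_kernel (z::'a))" by (simp add: \<Theta>_def)
  finally have 1: "\<Theta> d \<le> v x * (LBINT z. mean_kernel (z::'a))" .
  have [measurable]: "ball x (d / 2) \<in> sets borel" by simp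
  have mv[measurable]: "v \<in> borel_measurable borel" using cv by (rule borel_measurable_continuous_onI)
  have "(LBINT y. indicator (ball x (d / 2)) y * v y) = (LBINT y. indicator (ball x (d / 2)) (y + x) * v (y + x))"
    by (rule lborel_integral_translation[symmetric])
  also have "\<dots> = d ^ DIM('a) * (LBINT z. indicator (ball x (d / 2)) (d *\<^sub>R z + x) * v (d *\<^sub>R z + x))"
    by (rule lborel_integral_scale[OF _ d]) measurable
  finally have q1: "(LBINT y. indicator (ball x (d / 2)) y * v y) = d ^ DIM('a) * (LBINT z. indicator (ball x (d / 2)) (d *\<^sub>R z + x) * v (d *\<^sub>R z + x))" .
  have q2: "(\<lambda>z. indicator (ball x (d / 2)) (d *\<^sub>R z + x) * v (d *\<^sub>R z + x)) = (\<lambda>z. indicator (ball 0 (1/2)) z * v (x + d *\<^sub>R z))"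
  proof
    fix z
    have "d *\<^sub>R z + x \<in> ball x (d / 2) \<longleftrightarrow> z \<in> ball 0 (1/2)" using d by (simp add: dist_norm field_simps)
    then show "indicator (ball x (d / 2)) (d *\<^sub>R z + x) * v (d *\<^sub>R z + x) = indicator (ball 0 (1/2)) z * v (x + d *\<^sub>R z)"
      by (simp add: indicator_def add.commute)
  qed
  have 2: "(LBINT y. indicator (ball x (d / 2)) y * v y) = d ^ DIM('a) * (LBINT z. indicator (ball 0 (1/2)) z * v (x + d *\<^sub>R z))"
    using q1 unfolding q2 .
  have "3 * (LBINT z. indicator (ball 0 (1/2)) z * v (x + d *\<^sub>R z)) = (LBINT z. 3 * (indicator (ball 0 (1/2)) z * v (x + d *\<^sub>R z)))" by simp
  also have "\<dots> \<le> \<Theta> d" unfolding \<Theta>_def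
  proof (rule integral_mono'[OF C0c_integrable[OF ci]])
    show "3 * (indicator (ball 0 (1/2)) z * v (x + d *\<^sub>R z)) \<le> v (x + d *\<^sub>R z) * mean_kernel z" for z
      using mult_left_mono[OF mean_kernel_ge[of z] vp[of "x + d *\<^sub>R z"]] by (simp add: mult_ac)
    show "0 \<le> v (x + d *\<^sub>R z) * mean_kernel z" for z by (intro mult_nonneg_nonneg vp mean_kernel_nonneg)
  qed
  also note 1
  finally have 3: "3 * (LBINT z. indicator (ball 0 (1/2)) z * v (x + d *\<^sub>R z)) \<le> v x * (LBINT z. mean_kernel (z::'a))" .
  have "d ^ DIM('a) * (3 * (LBINT z. indicator (ball 0 (1/2)) z * v (x + d *\<^sub>R z))) \<le> d ^ DIM('a) * (v x * (LBINT z. mean_kernel (z::'a)))"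
    using 3 by (rule mult_left_mono) (use d in simp)
  then show ?thesis unfolding 2 by (simp only: mult.left_commute)
qed

text \<open>Mass is moved by at most \<open>e \<le> r\<close> under mollification, so what
  \<open>U\<close> has in the ball of radius \<open>r\<close> is found again in the doubled ball.
  Exchanging the integrals makes this precise.\<close>

lemma conv_ball_ge:
  fixes U :: "'a::euclidean_space \<Rightarrow> real"
  assumes U: "L1loc U" and Un: "\<And>y. U y \<ge> 0" and e: "e > 0" "e \<le> r"
  shows "(\<integral>\<^sup>+y. ennreal (indicator (ball x r) y * U y) \<partial>lborel) \<le> (\<integral>\<^sup>+z. ennreal (indicator (ball x (2 * r)) z * (LBINT y. U y *\<^sub>R mollifier e (z - y))) \<partial>lborel)"
proof -
  note mf = mollifier_facts[OF e(1), where 'a='a]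
  have cm: "C0c (mollifier e :: 'a \<Rightarrow> real)" using C1c_C0c(1)[OF test_fun_C1c[OF mollifier_test_fun[OF e(1)]]] .
  have [measurable]: "(mollifier e :: 'a \<Rightarrow> real) \<in> borel_measurable borel" "U \<in> borel_measurable borel"
    using C0c_measurable[OF cm] U by (auto simp: L1loc_def)
  have m1: "(\<integral>\<^sup>+z. ennreal (mollifier e (z - y)) \<partial>lborel) = 1" for y :: 'a
  proof -
    have "(\<integral>\<^sup>+z. ennreal (mollifier e (z + - y)) \<partial>lborel) = (\<integral>\<^sup>+z. ennreal (mollifier e (z::'a)) \<partial>lborel)"
      by (rule lborel_nn_integral_translation) measurable
    also have "\<dots> = ennreal 1" using nn_integral_eq_integral[OF C0c_integrable[OF cm]] mf by simp
    finally show ?thesis by simp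
  qed
  have "(\<integral>\<^sup>+z. ennreal (indicator (ball x (2 * r)) z * (LBINT y. U y *\<^sub>R mollifier e (z - y))) \<partial>lborel)
    = (\<integral>\<^sup>+z. (\<integral>\<^sup>+y. indicator (ball x (2 * r)) z * ennreal (U y) * ennreal (mollifier e (z - y)) \<partial>lborel) \<partial>lborel)"
  proof (rule nn_integral_cong)
    fix z
    have "ennreal (LBINT y. U y *\<^sub>R mollifier e (z - y)) = (\<integral>\<^sup>+y. ennreal (U y *\<^sub>R mollifier e (z - y)) \<partial>lborel)"
      by (rule nn_integral_eq_integral[symmetric, OF conv_integrable[OF U cm]]) (use Un mf in auto)
    also have "\<dots> = (\<integral>\<^sup>+y. ennreal (U y) * ennreal (mollifier e (z - y)) \<partial>lborel)" using Un mf by (simp add: ennreal_mult)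
    finally have "ennreal (indicator (ball x (2 * r)) z * (LBINT y. U y *\<^sub>R mollifier e (z - y))) = indicator (ball x (2 * r)) z * (\<integral>\<^sup>+y. ennreal (U y) * ennreal (mollifier e (z - y)) \<partial>lborel)"
      by (simp add: indicator_def)
    also have "\<dots> = (\<integral>\<^sup>+y. indicator (ball x (2 * r)) z * (ennreal (U y) * ennreal (mollifier e (z - y))) \<partial>lborel)"
      by (rule nn_integral_cmult[symmetric]) measurable
    finally show "ennreal (indicator (ball x (2 * r)) z * (LBINT y. U y *\<^sub>R mollifier e (z - y))) = (\<integral>\<^sup>+y. indicator (ball x (2 * r)) z * ennreal (U y) * ennreal (mollifier e (z - y)) \<partial>lborel)"
      by (simp only: mult.assoc)
  qed
  also have "\<dots> = (\<integral>\<^sup>+y. (\<integral>\<^sup>+z. indicator (ball x (2 * r)) z * ennreal (U y) * ennreal (mollifier e (z - y)) \<partial>lborel) \<partial>lborel)"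
  proof (rule lborel_pair.Fubini'[symmetric])
    have s: "sets (lborel \<Otimes>\<^sub>M lborel) = sets (borel \<Otimes>\<^sub>M (borel :: 'a measure))" by (intro sets_pair_measure_cong sets_lborel)
    have [measurable]: "ball x (2 * r) \<in> sets borel" by simp
    show "(\<lambda>(z, y). indicator (ball x (2 * r)) z * ennreal (U y) * ennreal (mollifier e (z - y))) \<in> borel_measurable (lborel \<Otimes>\<^sub>M lborel)"
      unfolding measurable_cong_sets[OF s refl] by measurable
  qed
  also have "\<dots> \<ge> (\<integral>\<^sup>+y. ennreal (indicator (ball x r) y * U y) \<partial>lborel)"
  proof (rule nn_integral_mono)
    fix y
    show "ennreal (indicator (ball x r) y * U y) \<le> (\<integral>\<^sup>+z. indicator (ball x (2 * r)) z * ennreal (U y) * ennreal (mollifier e (z - y)) \<partial>lborel)"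
    proof (cases "y \<in> ball x r")
      case True
      have "indicator (ball x (2 * r)) z * ennreal (U y) * ennreal (mollifier e (z - y)) = ennreal (U y) * ennreal (mollifier e (z - y))" for z
      proof (cases "norm (z - y) < e")
        case t: True
        have "dist x z \<le> dist x y + dist y z" by (rule dist_triangle)
        then have "z \<in> ball x (2 * r)" using True t e by (simp add: dist_norm norm_minus_commute)
        then show ?thesis by simp
      qed (simp add: mf(4))
      then have "(\<integral>\<^sup>+z. indicator (ball x (2 * r)) z * ennreal (U y) * ennreal (mollifier e (z - y)) \<partial>lborel) = ennreal (U y) * 1"
        unfolding m1[of y, symmetric] by (simp add: nn_integral_cmult)
      then show ?thesis using True by simp
    qed simp
  qed
  finally show ?thesis .
qed

lemma fgrad_inner: "i \<in> Basis \<Longrightarrow> fgrad f x \<bullet> i = dderiv [i] f x"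
  by (simp add: fgrad_def inner_sum_left inner_Basis if_distrib sum.delta cong: if_cong)

lemma dderiv_eq_0:
  assumes S: "open S" and f: "\<And>x. x \<in> S \<Longrightarrow> f x = 0"
  shows "x \<in> S \<Longrightarrow> dderiv vs f x = 0"
proof (induction vs arbitrary: x)
  case Nil then show ?case using f by simp
next
  case (Cons v vs)
  have "frechet_derivative (dderiv vs f) (at x) = frechet_derivative (\<lambda>_. 0) (at x)"
    by (rule frechet_derivative_cong_open[OF S Cons.prems]) (rule Cons.IH)
  then show ?case by simp
qed

lemma mollifier_dderiv:
  assumes e: "e > 0"
  shows "\<And>z::'a::euclidean_space. norm z > e \<Longrightarrow> dderiv vs (mollifier e) z = 0"
    and "C1c (cball (0::'a) e) (dderiv vs (mollifier e)) (fgrad (dderiv vs (mollifier e)))"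
proof -
  have "open (- cball (0::'a) e)" by (intro open_Compl) simp
  then have z: "dderiv vs (mollifier e) z = 0" if "z \<in> - cball 0 e" for z :: 'a
    by (rule dderiv_eq_0[OF _ _ that]) (rule mollifier_facts(4)[OF e], simp)
  show "norm z > e \<Longrightarrow> dderiv vs (mollifier e) z = 0" for z :: 'a using z[of z] by simp
  show "C1c (cball (0::'a) e) (dderiv vs (mollifier e)) (fgrad (dderiv vs (mollifier e)))"
    by (rule C1cI[of _ _ "cball 0 e"]) (use z in \<open>auto intro!: smooth_on_has_grad smooth_on_dderiv mollifier_facts(1)[OF e]\<close>)
qed

lemma mollifier_laplacian:
  assumes e: "e > 0"
  shows "\<And>z::'a::euclidean_space. norm z > e \<Longrightarrow> laplacian (mollifier e) z = 0" and "C0c (laplacian (mollifier e :: 'a \<Rightarrow> real))"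
proof -
  show z: "norm z > e \<Longrightarrow> laplacian (mollifier e) z = 0" for z :: 'a
    unfolding laplacian_def by (intro sum.neutral ballI mollifier_dderiv(1)[OF e])
  have "continuous_on UNIV (dderiv vs (mollifier e :: 'a \<Rightarrow> real))" for vs :: "'a list"
    by (rule C0c_continuous[OF C1c_C0c(1)[OF mollifier_dderiv(2)[OF e]]])
  then have "continuous_on UNIV (laplacian (mollifier e :: 'a \<Rightarrow> real))"
    unfolding laplacian_def[abs_def] by (intro continuous_on_sum)
  then show "C0c (laplacian (mollifier e :: 'a \<Rightarrow> real))" unfolding C0c_def using z by blast
qed

lemma integrable_bounded_mult:
  fixes f \<phi> :: "'a::euclidean_space \<Rightarrow> real"
  assumes f: "integrable lborel (\<lambda>y. indicator K y * f y)" and [measurable]: "f \<in> borel_measurable borel" "\<phi> \<in> borel_measurable borel"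
    and b: "\<And>y. y \<in> K \<Longrightarrow> \<bar>\<phi> y\<bar> \<le> M" and z: "\<And>y. y \<notin> K \<Longrightarrow> \<phi> y = 0"
  shows "integrable lborel (\<lambda>y. f y * \<phi> y)"
proof (rule Bochner_Integration.integrable_bound)
  show "integrable lborel (\<lambda>y. M * (indicator K y * f y))" using f by simp
  show "AE y in lborel. norm (f y * \<phi> y) \<le> norm (M * (indicator K y * f y))"
  proof (rule AE_I2)
    fix y show "norm (f y * \<phi> y) \<le> norm (M * (indicator K y * f y))"
    proof (cases "y \<in> K")
      case True
      then have "\<bar>\<phi> y\<bar> \<le> \<bar>M\<bar>" using b by force
      then have "\<bar>\<phi> y\<bar> * \<bar>f y\<bar> \<le> \<bar>M\<bar> * \<bar>f y\<bar>" by (rule mult_right_mono) simp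
      then show ?thesis using True by (simp add: abs_mult mult.commute)
    qed (simp add: z)
  qed
qed measurable

section \<open>Mollified supersolutions and the strong maximum principle\<close>

text \<open>A Borel representative that is nonnegative everywhere, so that all integrals run over
  the whole space with \<open>lborel\<close>. The cone has been forgotten: it enters here only as an
  open set that avoids the origin.\<close>

locale supersol =
  fixes \<Omega> :: "'a::euclidean_space set" and u :: "'a \<Rightarrow> real" and c p :: real
  assumes op: "open \<Omega>" and zero: "0 \<notin> \<Omega>" and c: "c > 0" and p: "p > 1"
    and um[measurable]: "u \<in> borel_measurable borel" and un: "\<And>x. u x \<ge> 0"
    and Lp: "\<And>K. compact K \<Longrightarrow> K \<subseteq> \<Omega> \<Longrightarrow> integrable lborel (\<lambda>y. indicator K y * u y powr p)"
    and ineq: "\<And>\<phi>. test_fun \<Omega> \<phi> \<Longrightarrow> (\<And>x. \<phi> x \<ge> 0) \<Longrightarrow>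
      (LBINT y. u y powr p * \<phi> y) \<le> (LBINT y. u y * (- laplacian \<phi> y - c / (norm y)\<^sup>2 * \<phi> y))"
begin

lemma integrable_on_compact:
  assumes K: "compact K" "K \<subseteq> \<Omega>"
  shows "integrable lborel (\<lambda>y. indicator K y * u y)"
proof (rule Bochner_Integration.integrable_bound)
  have [measurable]: "K \<in> sets borel" using K(1) by (simp add: borel_compact)
  have "emeasure lborel K < \<infinity>" using K(1) by (rule emeasure_compact_finite)
  then have "integrable lborel (indicator K :: 'a \<Rightarrow> real)" by (intro integrable_real_indicator) auto
  then show "integrable lborel (\<lambda>y. indicator K y + indicator K y * u y powr p)" using Lp[OF K] by (rule Bochner_Integration.integrable_add)
  show "(\<lambda>y. indicator K y * u y) \<in> borel_measurable lborel" by measurable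
  have b: "u y \<le> 1 + u y powr p" for y
  proof (cases "u y \<le> 1")
    case False
    then have "u y powr 1 \<le> u y powr p" using p by (intro powr_mono) auto
    then show ?thesis using False by simp
  qed (simp add: add_increasing2)
  show "AE y in lborel. norm (indicator K y * u y) \<le> norm (indicator K y + indicator K y * u y powr p)"
  proof (rule AE_I2)
    fix y show "norm (indicator K y * u y) \<le> norm (indicator K y + indicator K y * u y powr p)"
      using b[of y] un[of y] powr_ge_zero[of "u y" p] by (cases "y \<in> K") simp_all
  qed
qed

text \<open>The value 1 off Q makes the mollification positive everywhere.\<close>
definition patched :: "'a set \<Rightarrow> 'a \<Rightarrow> real" where "patched Q y = (if y \<in> Q then u y else 1)"

lemma patched_nonneg: "patched Q y \<ge> 0" using un by (simp add: patched_def)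

lemma patched_L1loc:
  assumes K: "compact K" "K \<subseteq> \<Omega>"
  shows "L1loc (patched K)"
  unfolding L1loc_def
proof (intro conjI allI)
  have [measurable]: "K \<in> sets borel" using K(1) by (simp add: borel_compact)
  show m[measurable]: "patched K \<in> borel_measurable borel" unfolding patched_def[abs_def] by measurable
  fix r
  show "integrable lborel (\<lambda>y. indicator (cball 0 r) y * patched K y)"
  proof (rule Bochner_Integration.integrable_bound)
    have "emeasure lborel (cball (0::'a) r) < \<infinity>" by (rule emeasure_compact_finite) simp
    then have "integrable lborel (indicator (cball 0 r) :: 'a \<Rightarrow> real)" by (intro integrable_real_indicator) auto
    then show "integrable lborel (\<lambda>y. indicator (cball 0 r) y + indicator K y * u y)" using integrable_on_compact[OF K] by (rule Bochner_Integration.integrable_add)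
    have [measurable]: "cball (0::'a) r \<in> sets borel" by simp
    show "(\<lambda>y. indicator (cball 0 r) y * patched K y) \<in> borel_measurable lborel" by measurable
    show "AE y in lborel. norm (indicator (cball 0 r) y * patched K y) \<le> norm (indicator (cball 0 r) y + indicator K y * u y)"
      by (rule AE_I2) (use un in \<open>auto simp: patched_def indicator_def\<close>)
  qed
qed

definition mollified :: "'a set \<Rightarrow> real \<Rightarrow> 'a \<Rightarrow> real" where "mollified K e x = (LBINT y. patched K y *\<^sub>R mollifier e (x - y))"
definition mollified_grad :: "'a set \<Rightarrow> real \<Rightarrow> 'a \<Rightarrow> 'a" where "mollified_grad K e x = (LBINT y. patched K y *\<^sub>R fgrad (mollifier e) (x - y))"
definition mollified_laplacian :: "'a set \<Rightarrow> real \<Rightarrow> 'a \<Rightarrow> real" where "mollified_laplacian K e x = (LBINT y. patched K y *\<^sub>R laplacian (mollifier e) (x - y))"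

lemma mollifier_C0c: "e > 0 \<Longrightarrow> C0c (mollifier e :: 'a \<Rightarrow> real)"
  by (rule C1c_C0c(1)[OF test_fun_C1c[OF mollifier_test_fun]])

lemma mollified_nonneg: "e > 0 \<Longrightarrow> mollified K e x \<ge> 0"
  unfolding mollified_def by (intro integral_nonneg_AE AE_I2 scaleR_nonneg_nonneg patched_nonneg mollifier_facts(2))

text \<open>The distributional inequality tested with the mollifier centred at \<open>x\<close>. The
  potential is replaced by its lower bound \<open>b\<close> on the small ball, and Jensen's
  inequality puts the power outside the mean.\<close>

lemma mollified_laplacian_ineq:
  assumes K: "compact K" "K \<subseteq> \<Omega>" and e: "e > 0" and x: "cball x e \<subseteq> K"
    and b: "\<And>y. y \<in> cball x e \<Longrightarrow> b \<le> c / (norm y)\<^sup>2"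
  shows "b * mollified K e x + mollified K e x powr p \<le> - mollified_laplacian K e x"
proof -
  note mf = mollifier_facts[OF e, where 'a='a]
  define \<phi> where "\<phi> y = mollifier e (x - y)" for y
  define B where "B = cball x e"
  have B: "compact B" "B \<subseteq> \<Omega>" using x K by (auto simp: B_def)
  have tf: "test_fun \<Omega> \<phi>" unfolding \<phi>_def by (rule mollifier_translate_test_fun[OF e]) (use B in \<open>simp add: B_def\<close>)
  have lap: "laplacian \<phi> y = laplacian (mollifier e) (x - y)" for y unfolding \<phi>_def by (rule laplacian_reflect[OF mf(1)])
  have cont: "continuous_on UNIV \<phi>" using test_fun_C1c[OF tf] has_grad_continuous unfolding C1c_def by blast
  have clap: "continuous_on UNIV (laplacian \<phi>)" unfolding lap[abs_def]
    by (rule continuous_on_compose2[OF C0c_continuous[OF mollifier_laplacian(2)[OF e]]]) (auto intro!: continuous_intros)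
  have z: "\<phi> y = 0" "laplacian \<phi> y = 0" if "y \<notin> B" for y
    using that mf(4)[of "x - y"] mollifier_laplacian(1)[OF e, of "x - y"] by (auto simp: \<phi>_def lap B_def dist_norm)
  have \<phi>n: "\<phi> y \<ge> 0" for y by (simp add: \<phi>_def mf)
  have cu: "patched K y = u y" if "y \<in> B" for y using that x by (auto simp: patched_def B_def)
  define V where "V = (LBINT y. u y * \<phi> y)"
  have V: "mollified K e x = V" unfolding mollified_def V_def
    by (rule Bochner_Integration.integral_cong[OF refl]) (metis \<phi>_def cu mult_zero_right real_scaleR_def z(1))
  have L: "mollified_laplacian K e x = (LBINT y. u y * laplacian \<phi> y)" unfolding mollified_laplacian_def
    by (rule Bochner_Integration.integral_cong[OF refl]) (metis lap cu mult_zero_right real_scaleR_def z(2))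
  have bdd: "\<exists>M. \<forall>y\<in>B. \<bar>h y\<bar> \<le> M" if "continuous_on B h" for h :: "'a \<Rightarrow> real"
  proof -
    have "bounded (h ` B)" by (intro compact_imp_bounded compact_continuous_image that B)
    then show ?thesis by (auto simp: bounded_iff)
  qed
  have int: "integrable lborel (\<lambda>y. f y * h y)"
    if f: "integrable lborel (\<lambda>y. indicator B y * f y)" "f \<in> borel_measurable borel" and h: "continuous_on B h" "h \<in> borel_measurable borel" "\<And>y. y \<notin> B \<Longrightarrow> h y = 0" for f h :: "'a \<Rightarrow> real"
  proof -
    obtain M where "\<forall>y\<in>B. \<bar>h y\<bar> \<le> M" using bdd[OF h(1)] by blast
    then show ?thesis by (intro integrable_bounded_mult[OF f h(2), of M]) (use h(3) in auto)
  qed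
  have [measurable]: "\<phi> \<in> borel_measurable borel" "laplacian \<phi> \<in> borel_measurable borel"
    using cont clap by (auto intro: borel_measurable_continuous_onI)
  have cB: "continuous_on B \<phi>" "continuous_on B (laplacian \<phi>)" using cont clap by (auto intro: continuous_on_subset)
  have y0: "norm y \<noteq> 0" if "y \<in> B" for y using that B zero by auto
  have i1: "integrable lborel (\<lambda>y. u y * \<phi> y)" by (rule int[OF integrable_on_compact[OF B] um cB(1)]) (auto simp: z)
  have i2: "integrable lborel (\<lambda>y. u y * laplacian \<phi> y)" by (rule int[OF integrable_on_compact[OF B] um cB(2)]) (auto simp: z)
  have i3: "integrable lborel (\<lambda>y. u y * (c / (norm y)\<^sup>2 * \<phi> y))"
    by (rule int[OF integrable_on_compact[OF B] um]) (use y0 in \<open>auto simp: z intro!: continuous_intros cB(1)\<close>)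
  have i4: "integrable lborel (\<lambda>y. u y powr p * \<phi> y)" by (rule int[OF Lp[OF B] _ cB(1)]) (auto simp: z)
  have one: "(LBINT y. \<phi> y) = 1"
  proof -
    have "\<phi> y = mollifier e (y + - x)" for y unfolding \<phi>_def mollifier_def by (simp add: inner_diff_left inner_diff_right inner_commute algebra_simps)
    then have "(LBINT y. \<phi> y) = (LBINT y. mollifier e (y + - x))" by simp
    also have "\<dots> = 1" using lborel_integral_translation[of "mollifier e" "- x"] mf(5) by simp
    finally show ?thesis .
  qed
  have i5: "integrable lborel \<phi>" using C0c_integrable[OF C1c_C0c(1)[OF test_fun_C1c[OF tf]]] .
  have Vn: "V \<ge> 0" unfolding V_def using un \<phi>n by (intro integral_nonneg_AE AE_I2) simp
  \<comment> \<open>The tangent of the power at the mean \<open>V\<close>, integrated against the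
    weight \<open>\<phi>\<close> of integral 1. \<open>powr_tangent'\<close> wants a positive point
    of tangency, hence the case \<open>V = 0\<close>.\<close>
  have jensen: "V powr p \<le> (LBINT y. u y powr p * \<phi> y)"
  proof (cases "V = 0")
    case True then show ?thesis using \<phi>n by (auto intro!: integral_nonneg_AE)
  next
    case False
    then have Vp: "V > 0" using Vn by simp
    define q where "q = p * V powr (p - 1)"
    have "V powr p = (V powr p - q * V) * 1 + q * V" by simp
    also have "\<dots> = (LBINT y. (V powr p - q * V) * \<phi> y + q * (u y * \<phi> y))"
      using i1 i5 by (subst Bochner_Integration.integral_add) (auto simp: one V_def)
    also have "\<dots> \<le> (LBINT y. u y powr p * \<phi> y)"
    proof (rule integral_mono)
      show "integrable lborel (\<lambda>y. (V powr p - q * V) * \<phi> y + q * (u y * \<phi> y))" using i1 i5 by auto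
      fix y
      have "(V powr p + q * (u y - V)) * \<phi> y \<le> u y powr p * \<phi> y"
        unfolding q_def by (intro mult_right_mono powr_tangent' un Vp p \<phi>n)
      then show "(V powr p - q * V) * \<phi> y + q * (u y * \<phi> y) \<le> u y powr p * \<phi> y" by (simp add: algebra_simps)
    qed (rule i4)
    finally show ?thesis .
  qed
  have "b * V = (LBINT y. b * (u y * \<phi> y))" by (simp add: V_def)
  also have "\<dots> \<le> (LBINT y. u y * (c / (norm y)\<^sup>2 * \<phi> y))"
  proof (rule integral_mono[OF _ i3])
    show "integrable lborel (\<lambda>y. b * (u y * \<phi> y))" using i1 by simp
    fix y
    show "b * (u y * \<phi> y) \<le> u y * (c / (norm y)\<^sup>2 * \<phi> y)"
    proof (cases "y \<in> B")
      case True
      then have "b \<le> c / (norm y)\<^sup>2" using b by (simp add: B_def)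
      then have "b * (u y * \<phi> y) \<le> c / (norm y)\<^sup>2 * (u y * \<phi> y)" by (rule mult_right_mono) (simp add: un \<phi>n)
      then show ?thesis by (simp only: mult.left_commute)
    qed (simp add: z)
  qed
  finally have bV: "b * V \<le> (LBINT y. u y * (c / (norm y)\<^sup>2 * \<phi> y))" .
  have "(LBINT y. u y powr p * \<phi> y) \<le> (LBINT y. u y * (- laplacian \<phi> y - c / (norm y)\<^sup>2 * \<phi> y))"
    by (rule ineq[OF tf \<phi>n])
  also have "\<dots> = (LBINT y. - (u y * laplacian \<phi> y) - u y * (c / (norm y)\<^sup>2 * \<phi> y))"
    by (simp only: right_diff_distrib mult_minus_right)
  also have "\<dots> = - (LBINT y. u y * laplacian \<phi> y) - (LBINT y. u y * (c / (norm y)\<^sup>2 * \<phi> y))"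
    by (subst Bochner_Integration.integral_diff[OF integrable_minus[OF i2] i3]) simp
  finally show ?thesis unfolding V L using jensen bV by linarith
qed

lemma mollified_has_grad:
  assumes K: "compact K" "K \<subseteq> \<Omega>" and e: "e > 0"
  shows "has_grad (mollified K e) (mollified_grad K e) UNIV"
  using conv_has_grad[OF patched_L1loc[OF K] test_fun_C1c[OF mollifier_test_fun[OF e]]]
  unfolding mollified_def[abs_def] mollified_grad_def[abs_def] .

text \<open>All derivatives fall on the mollifier, so gradient components and Laplacian are again
  convolutions of \<open>patched K\<close>.\<close>

lemma mollified_weak_supersol:
  assumes K: "compact K" "K \<subseteq> \<Omega>" and e: "e > 0"
    and q: "\<And>x. x \<in> Q \<Longrightarrow> q x * mollified K e x \<le> - mollified_laplacian K e x" and nn: "\<And>x. x \<in> Q \<Longrightarrow> 0 \<le> - mollified_laplacian K e x"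
  shows "weak_supersol (mollified K e) (mollified_grad K e) q Q"
proof -
  note U = patched_L1loc[OF K]
  define w where "w i x = (LBINT y. patched K y *\<^sub>R fgrad (dderiv [i] (mollifier e)) (x - y))" for i x :: 'a
  have cf: "C0c (fgrad (dderiv vs (mollifier e)))" and cd: "C0c (dderiv vs (mollifier e))" for vs :: "'a list"
    using C1c_C0c[OF mollifier_dderiv(2)[OF e]] by blast+
  have g: "mollified_grad K e x \<bullet> i = (LBINT y. patched K y *\<^sub>R dderiv [i] (mollifier e) (x - y))" if i: "i \<in> Basis" for x i
  proof -
    have "mollified_grad K e x \<bullet> i = (LBINT y. (patched K y *\<^sub>R fgrad (mollifier e) (x - y)) \<bullet> i)" unfolding mollified_grad_def
      by (rule integral_inner_left[symmetric]) (use conv_integrable[OF U cf[of "[]"]] in simp)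
    then show ?thesis by (simp add: fgrad_inner[OF i] del: dderiv.simps)
  qed
  have w2: "w i x \<bullet> i = (LBINT y. patched K y *\<^sub>R dderiv [i, i] (mollifier e) (x - y))" if i: "i \<in> Basis" for x i
  proof -
    have "w i x \<bullet> i = (LBINT y. (patched K y *\<^sub>R fgrad (dderiv [i] (mollifier e)) (x - y)) \<bullet> i)" unfolding w_def
      by (rule integral_inner_left[symmetric]) (rule conv_integrable[OF U cf])
    then show ?thesis by (simp add: fgrad_inner[OF i])
  qed
  have lm: "(\<Sum>i\<in>Basis. w i x \<bullet> i) = mollified_laplacian K e x" for x
  proof -
    have "(\<Sum>i\<in>Basis. w i x \<bullet> i) = (\<Sum>i\<in>Basis. \<integral>y. patched K y *\<^sub>R dderiv [i, i] (mollifier e) (x - y) \<partial>lborel)"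
      by (intro sum.cong refl w2)
    also have "\<dots> = (LBINT y. (\<Sum>i\<in>Basis. patched K y *\<^sub>R dderiv [i, i] (mollifier e) (x - y)))"
      by (rule Bochner_Integration.integral_sum[symmetric]) (rule conv_integrable[OF U cd])
    also have "\<dots> = mollified_laplacian K e x" unfolding mollified_laplacian_def laplacian_def by (simp only: scaleR_sum_right)
    finally show ?thesis .
  qed
  show ?thesis
  proof (rule weak_supersol_of_laplacian[OF mollified_has_grad[OF K e], of w])
    show "has_grad (\<lambda>x. mollified_grad K e x \<bullet> i) (w i) UNIV" if i: "i \<in> Basis" for i
      using conv_has_grad[OF U mollifier_dderiv(2)[OF e, of "[i]"]] unfolding g[OF i] w_def .
  qed (use q nn lm in auto)
qed

text \<open>The bound \<open>b = 0\<close> and omission of the power leave a superharmonic function,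
  as required by \<open>mean_value\<close>.\<close>

lemma mollified_superharmonic:
  assumes K: "compact K" "K \<subseteq> \<Omega>" and e: "e > 0" and Q: "\<And>x. x \<in> Q \<Longrightarrow> cball x e \<subseteq> K"
  shows "weak_supersol (mollified K e) (mollified_grad K e) (\<lambda>_. 0) Q"
proof (rule mollified_weak_supersol[OF K e])
  fix x assume x: "x \<in> Q"
  have "0 * mollified K e x + mollified K e x powr p \<le> - mollified_laplacian K e x"
    by (rule mollified_laplacian_ineq[OF K e Q[OF x]]) (use c in simp)
  moreover have "mollified K e x powr p \<ge> 0" by simp
  ultimately show "0 \<le> - mollified_laplacian K e x" by linarith
  then show "0 * mollified K e x \<le> - mollified_laplacian K e x" by simp
qed

lemma mollified_supersolution:
  assumes K: "compact K" "K \<subseteq> \<Omega>" and e: "e > 0" and Q: "\<And>x. x \<in> Q \<Longrightarrow> cball x e \<subseteq> K"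
    and b: "\<And>x y. x \<in> Q \<Longrightarrow> y \<in> cball x e \<Longrightarrow> b x \<le> c / (norm y)\<^sup>2"
  shows "weak_supersol (mollified K e) (mollified_grad K e) (\<lambda>x. b x + mollified K e x powr (p - 1)) Q"
proof (rule mollified_weak_supersol[OF K e])
  fix x assume x: "x \<in> Q"
  have "(b x + mollified K e x powr (p - 1)) * mollified K e x = b x * mollified K e x + mollified K e x powr p"
    using powr_mult_base[OF mollified_nonneg[OF e, of K x], of "p - 1"] by (simp add: algebra_simps)
  also have "\<dots> \<le> - mollified_laplacian K e x" by (rule mollified_laplacian_ineq[OF K e Q[OF x] b[OF x]])
  finally show "(b x + mollified K e x powr (p - 1)) * mollified K e x \<le> - mollified_laplacian K e x" .
  have "0 * mollified K e x + mollified K e x powr p \<le> - mollified_laplacian K e x"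
    by (rule mollified_laplacian_ineq[OF K e Q[OF x]]) (use c in simp)
  moreover have "mollified K e x powr p \<ge> 0" by simp
  ultimately show "0 \<le> - mollified_laplacian K e x" by linarith
qed

end

section \<open>Lower bounds from local mass and the strong maximum principle\<close>

context supersol begin

definition mass :: "'a \<Rightarrow> real \<Rightarrow> real" where "mass x r = (LBINT y. indicator (ball x r) y * u y)"

lemma mass_integrable:
  assumes "cball x r \<subseteq> \<Omega>"
  shows "integrable lborel (\<lambda>y. indicator (ball x r) y * u y)"
proof (rule Bochner_Integration.integrable_bound[OF integrable_on_compact[OF _ assms]])
  have [measurable]: "ball x r \<in> sets borel" by simp
  show "(\<lambda>y. indicator (ball x r) y * u y) \<in> borel_measurable lborel" by measurable
qed (auto simp: indicator_def un)

lemma mass_pos: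
  assumes x: "cball x r \<subseteq> \<Omega>" and n: "\<not> (AE y in lborel. y \<in> ball x r \<longrightarrow> u y = 0)"
  shows "mass x r > 0"
proof -
  have nn: "0 \<le> indicator (ball x r) y * u y" for y using un by simp
  have "mass x r \<noteq> 0"
  proof
    assume "mass x r = 0"
    then have "AE y in lborel. indicator (ball x r) y * u y = 0"
      unfolding mass_def using integral_nonneg_eq_0_iff_AE[OF mass_integrable[OF x]] nn by simp
    then have "AE y in lborel. y \<in> ball x r \<longrightarrow> u y = 0" by (rule AE_mp) (auto simp: indicator_def)
    with n show False by simp
  qed
  moreover have "mass x r \<ge> 0" unfolding mass_def by (rule integral_nonneg_AE, rule AE_I2, rule nn)
  ultimately show ?thesis by linarith
qed

lemma mass_mono:
  assumes "cball y s \<subseteq> \<Omega>" "ball x r \<subseteq> ball y s" "cball x r \<subseteq> \<Omega>"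
  shows "mass x r \<le> mass y s"
  unfolding mass_def
  by (rule integral_mono[OF mass_integrable[OF assms(3)] mass_integrable[OF assms(1)]])
     (use assms(2) un in \<open>auto simp: indicator_def\<close>)

text \<open>The right side is a multiple of the value at \<open>x\<close>, the left side knows
  neither \<open>K\<close> nor \<open>e\<close>. This is the source of lower bounds uniform in the
  mollification.\<close>

lemma mollified_mean_lower:
  assumes K: "compact K" "K \<subseteq> \<Omega>" and e: "e > 0" and Q: "\<And>y. y \<in> Q \<Longrightarrow> cball y e \<subseteq> K"
    and d: "d > 0" "cball x d \<subseteq> Q" "e \<le> d / 4"
  shows "3 * mass x (d / 4) \<le> d ^ DIM('a) * (mollified K e x * (LBINT z. mean_kernel (z::'a)))"
proof -
  have BK: "cball x d \<subseteq> K"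
  proof
    fix y assume "y \<in> cball x d"
    then have "cball y e \<subseteq> K" using Q d(2) by blast
    then show "y \<in> K" using e by (auto dest!: subsetD[where c=y])
  qed
  have B4: "cball x (d / 4) \<subseteq> \<Omega>" 
  proof -
    have "cball x (d / 4) \<subseteq> cball x d" by (rule subset_cball) (use d(1) in simp)
    then show ?thesis using BK K(2) by blast
  qed
  have B4K: "ball x (d / 4) \<subseteq> K" using BK d(1) by (auto simp: subset_eq)
  have cmv: "continuous_on UNIV (mollified K e)" using mollified_has_grad[OF K e] by (rule has_grad_continuous)
  have imv: "integrable lborel (\<lambda>z. indicator (ball x (d / 2)) z * mollified K e z)"
  proof (rule Bochner_Integration.integrable_bound)
    show "integrable lborel (\<lambda>z. indicator (cball x (d / 2)) z *\<^sub>R mollified K e z)"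
      by (rule borel_integrable_compact) (use cmv in \<open>auto intro: continuous_on_subset\<close>)
    have [measurable]: "ball x (d / 2) \<in> sets borel" "mollified K e \<in> borel_measurable borel" using cmv by (auto intro: borel_measurable_continuous_onI)
    show "(\<lambda>z. indicator (ball x (d / 2)) z * mollified K e z) \<in> borel_measurable lborel" by measurable
  qed (auto simp: indicator_def)
  have eq: "indicator (ball x (d / 4)) y * patched K y = indicator (ball x (d / 4)) y * u y" for y
    using B4K by (auto simp: indicator_def patched_def)
  have "ennreal (mass x (d / 4)) = (\<integral>\<^sup>+y. ennreal (indicator (ball x (d / 4)) y * patched K y) \<partial>lborel)"
    unfolding mass_def eq by (rule nn_integral_eq_integral[symmetric, OF mass_integrable[OF B4]]) (simp add: un)
  also have "\<dots> \<le> (\<integral>\<^sup>+z. ennreal (indicator (ball x (2 * (d / 4))) z * (LBINT y. patched K y *\<^sub>R mollifier e (z - y))) \<partial>lborel)"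
    by (rule conv_ball_ge[OF patched_L1loc[OF K] patched_nonneg e d(3)])
  also have "\<dots> = (\<integral>\<^sup>+z. ennreal (indicator (ball x (d / 2)) z * mollified K e z) \<partial>lborel)" by (simp add: mollified_def)
  also have "\<dots> = ennreal (LBINT z. indicator (ball x (d / 2)) z * mollified K e z)"
    by (rule nn_integral_eq_integral[OF imv]) (simp add: mollified_nonneg[OF e])
  finally have "mass x (d / 4) \<le> (LBINT z. indicator (ball x (d / 2)) z * mollified K e z)"
    by (subst (asm) ennreal_le_iff) (auto intro!: integral_nonneg_AE simp: mollified_nonneg[OF e])
  moreover have "3 * (LBINT z. indicator (ball x (d / 2)) z * mollified K e z) \<le> d ^ DIM('a) * (mollified K e x * (LBINT z. mean_kernel (z::'a)))"
    by (rule mean_value[OF mollified_has_grad[OF K e] mollified_nonneg[OF e] mollified_superharmonic[OF K e Q] d(2,1)])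
  ultimately show ?thesis by linarith
qed

lemma compact_thickening:
  fixes Q :: "'a set"
  assumes "compact Q"
  shows "compact (\<Union>x\<in>Q. cball x e)"
proof -
  have "(\<Union>x\<in>Q. cball x e) = (\<Union>x\<in>Q. \<Union>y\<in>cball 0 e. {x + y})"
  proof (intro equalityI subsetI)
    fix z assume "z \<in> (\<Union>x\<in>Q. cball x e)"
    then obtain x where "x \<in> Q" "dist x z \<le> e" by auto
    then have "x \<in> Q" "z - x \<in> cball 0 e" "z = x + (z - x)" by (auto simp: dist_norm norm_minus_commute)
    then show "z \<in> (\<Union>x\<in>Q. \<Union>y\<in>cball 0 e. {x + y})" by blast
  next
    fix z assume "z \<in> (\<Union>x\<in>Q. \<Union>y\<in>cball 0 e. {x + y})"
    then obtain x y where "x \<in> Q" "norm y \<le> e" "z = x + y" by auto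
    then show "z \<in> (\<Union>x\<in>Q. cball x e)" by (intro UN_I[of x]) (auto simp: dist_norm)
  qed
  then show ?thesis using compact_sums'[OF assms, of "cball 0 e"] by simp
qed

text \<open>The points near which \<open>u\<close> vanishes almost everywhere form an open set
  \<open>Z\<close>; the mean value inequality shows that its complement in \<open>\<Omega>\<close>
  is open too. Connectedness leaves \<open>Z\<close> empty or all of
  \<open>\<Omega>\<close>.\<close>

lemma strong_maximum_principle:
  assumes con: "connected \<Omega>" and nz: "\<not> (AE x in lborel. x \<in> \<Omega> \<longrightarrow> u x = 0)"
    and x: "x \<in> \<Omega>" and r: "r > 0"
  shows "\<not> (AE y in lborel. y \<in> ball x r \<longrightarrow> u y = 0)"
proof -
  define P where "P x r \<longleftrightarrow> (AE y in lborel. y \<in> ball x r \<longrightarrow> u y = 0)" for x r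
  have Pm: "P y s" if "P x r" "ball y s \<subseteq> ball x r" for x r y s
    using that(1) unfolding P_def by (rule AE_mp, intro AE_I2 impI) (use that(2) in blast)
  define Z where "Z = {x \<in> \<Omega>. \<exists>r>0. P x r}"
  have openZ: "open Z"
    unfolding open_contains_ball
  proof (rule ballI)
    fix x assume "x \<in> Z"
    then obtain r where r: "x \<in> \<Omega>" "r > 0" "P x r" by (auto simp: Z_def)
    obtain s where s: "s > 0" "ball x s \<subseteq> \<Omega>" using op r(1) open_contains_ball by blast
    have "ball x (min s r) \<subseteq> Z"
    proof
      fix y assume y: "y \<in> ball x (min s r)"
      have "open (ball x r)" "y \<in> ball x r" using y by auto
      then obtain t where "t > 0" "ball y t \<subseteq> ball x r" using open_contains_ball by blast
      then show "y \<in> Z" using Pm[OF r(3)] y s by (auto simp: Z_def)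
    qed
    then show "\<exists>e>0. ball x e \<subseteq> Z" using s r by (intro exI[of _ "min s r"]) auto
  qed
  have openC: "open (\<Omega> - Z)"
    unfolding open_contains_ball
  proof (rule ballI)
    fix x assume x: "x \<in> \<Omega> - Z"
    then obtain s where s: "s > 0" "cball x s \<subseteq> \<Omega>" using op open_contains_cball by blast
    \<comment> \<open>Nested radii: the ball of radius \<open>4 * d\<close> carries the data, on
      radius \<open>2 * d\<close> the mollification is superharmonic, the mean value inequality at
      \<open>y\<close> uses radius \<open>d\<close>, and masses are compared on radii
      \<open>d / 8\<close> and \<open>d / 4\<close>.\<close>
    define d where "d = s / 4"
    have d: "d > 0" using s by (simp add: d_def)
    have sub: "cball x (t * d) \<subseteq> \<Omega>" if "t \<le> 4" for t
    proof -
      have "t * d \<le> 4 * d" using that d by (intro mult_right_mono) auto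
      then show ?thesis using s(2) by (auto simp: d_def subset_eq)
    qed
    have "ball x (d / 8) \<subseteq> \<Omega> - Z"
    proof
      fix y assume y: "y \<in> ball x (d / 8)"
      then have dxy: "dist x y < d / 8" by simp
      have yO: "y \<in> \<Omega>" using sub[of 1] dxy d by auto
      moreover have "y \<notin> Z"
      proof
        assume "y \<in> Z"
        then obtain t where t: "t > 0" "P y t" by (auto simp: Z_def)
        \<comment> \<open>With \<open>e \<le> t\<close> the mollification at \<open>y\<close> sees
          only points where \<open>u\<close> vanishes almost everywhere; its value is therefore
          0.\<close>
        define e where "e = min t (d / 4)"
        have e: "e > 0" "e \<le> t" "e \<le> d / 4" using t d by (auto simp: e_def)
        define K where "K = cball x (4 * d)"
        have K: "compact K" "K \<subseteq> \<Omega>" using sub[of 4] by (auto simp: K_def)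
        have Q: "cball z e \<subseteq> K" if "z \<in> cball x (2 * d)" for z
        proof
          fix w assume "w \<in> cball z e"
          then show "w \<in> K" using that e d dist_triangle[of x w z] by (auto simp: K_def)
        qed
        have cQ: "cball y d \<subseteq> cball x (2 * d)"
        proof
          fix w assume "w \<in> cball y d"
          then show "w \<in> cball x (2 * d)" using dxy d dist_triangle[of x w y] by auto
        qed
        have "3 * mass y (d / 4) \<le> d ^ DIM('a) * (mollified K e y * (LBINT z. mean_kernel (z::'a)))"
          by (rule mollified_mean_lower[OF K e(1) Q d cQ e(3)])
        moreover have "mollified K e y = 0"
        proof -
          have yK: "ball y e \<subseteq> K" by (rule order_trans[OF ball_subset_cball Q]) (use dxy d in auto)
          have "AE z in lborel. patched K z *\<^sub>R mollifier e (y - z) = 0"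
            using t(2) unfolding P_def
          proof (rule AE_mp, intro AE_I2 impI)
            fix z assume z: "z \<in> ball y t \<longrightarrow> u z = 0"
            show "patched K z *\<^sub>R mollifier e (y - z) = 0"
            proof (cases "z \<in> ball y e")
              case True
              then have "z \<in> K" "u z = 0" using yK z e(2) by auto
              then show ?thesis by (simp add: patched_def)
            next
              case False
              then show ?thesis using mollifier_facts(4)[OF e(1), of "y - z"] by (simp add: dist_norm)
            qed
          qed
          then show ?thesis unfolding mollified_def by (rule integral_eq_zero_AE)
        qed
        moreover have "mass x (d / 8) \<le> mass y (d / 4)"
        proof (rule mass_mono)
          have "cball y (d / 4) \<subseteq> cball y d" by (rule subset_cball) (use d in simp)
          from order_trans[OF order_trans[OF this cQ] sub[of 2]] show "cball y (d / 4) \<subseteq> \<Omega>" by simp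
          show "cball x (d / 8) \<subseteq> \<Omega>" using sub[of "1/8"] by simp
          show "ball x (d / 8) \<subseteq> ball y (d / 4)"
          proof
            fix w assume "w \<in> ball x (d / 8)"
            then show "w \<in> ball y (d / 4)" using dxy dist_triangle[of y w x] by (auto simp: dist_commute)
          qed
        qed
        moreover have "mass x (d / 8) > 0"
        proof (rule mass_pos)
          show "cball x (d / 8) \<subseteq> \<Omega>" using sub[of "1/8"] by simp
          show "\<not> (AE y in lborel. y \<in> ball x (d / 8) \<longrightarrow> u y = 0)"
          proof
            assume "AE y in lborel. y \<in> ball x (d / 8) \<longrightarrow> u y = 0"
            then have "P x (d / 8)" unfolding P_def .
            then have "x \<in> Z" unfolding Z_def using x d by (intro CollectI conjI exI[of _ "d / 8"]) auto
            with x show False by simp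
          qed
        qed
        ultimately show False by simp
      qed
      ultimately show "y \<in> \<Omega> - Z" by simp
    qed
    then show "\<exists>e>0. ball x e \<subseteq> \<Omega> - Z" using d by (intro exI[of _ "d / 8"]) auto
  qed
  have "Z \<subseteq> \<Omega>" by (auto simp: Z_def)
  then have "Z = {} \<or> \<Omega> - Z = {}"
    using connectedD[OF con openZ openC] by blast
  moreover have "\<Omega> - Z \<noteq> {}"
  proof
    assume "\<Omega> - Z = {}"
    then have all: "\<And>x. x \<in> \<Omega> \<Longrightarrow> \<exists>r>0. P x r" by (auto simp: Z_def)
    then have "\<forall>x\<in>\<Omega>. \<exists>r. r > 0 \<and> P x r" by auto
    from bchoice[OF this] obtain R where R: "\<And>x. x \<in> \<Omega> \<Longrightarrow> R x > 0 \<and> P x (R x)" by auto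
    \<comment> \<open>The exceptional null sets belong to uncountably many balls; Lindelof reduces
      them to countably many.\<close>
    obtain F where F: "F \<subseteq> (\<lambda>x. ball x (R x)) ` \<Omega>" "countable F" "\<Union>F = (\<Union>x\<in>\<Omega>. ball x (R x))"
      by (rule Lindelof[of "(\<lambda>x. ball x (R x)) ` \<Omega>"]) auto
    have "AE y in lborel. \<forall>B\<in>F. y \<in> B \<longrightarrow> u y = 0"
    proof (rule AE_ball_countable'[OF _ F(2)])
      fix B assume "B \<in> F"
      then obtain x where "x \<in> \<Omega>" "B = ball x (R x)" using F(1) by auto
      then show "AE y in lborel. y \<in> B \<longrightarrow> u y = 0" using R[of x] by (simp add: P_def)
    qed
    moreover have "\<Omega> \<subseteq> \<Union>F" unfolding F(3) using R by auto
    ultimately have "AE y in lborel. y \<in> \<Omega> \<longrightarrow> u y = 0" by (elim AE_mp) (rule AE_I2, blast)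
    with nz show False by simp
  qed
  ultimately have "Z = {}" by blast
  then show ?thesis using x r by (auto simp: Z_def P_def)
qed

end

lemma mean_kernel_integral_pos: "(LBINT z. mean_kernel (z::'a::euclidean_space)) > 0"
proof -
  have p: "mean_kernel (0::'a) > 0" by (simp add: mean_kernel_def)
  have "0 < (\<integral>\<^sup>+(x::'a). ennreal (mean_kernel x) * indicator UNIV x \<partial>lborel)"
    by (rule nn_integral_pos_continuous[where f=mean_kernel, OF mean_kernel_continuous _ _ p]) auto
  also have "\<dots> = ennreal (LBINT z. mean_kernel (z::'a))"
    using nn_integral_eq_integral[OF C0c_integrable[OF mean_kernel_C0c]] by (simp add: mean_kernel_nonneg)
  finally show ?thesis by simp
qed

lemma open_not_null:
  fixes S :: "'a::euclidean_space set"
  assumes "open S" "x \<in> S"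
  shows "\<not> (AE y in lborel. y \<notin> S)"
proof
  assume "AE y in lborel. y \<notin> S"
  then have "AE y in lborel. ennreal 1 * indicator S y = 0" by (rule AE_mp) (auto simp: indicator_def)
  then have "(\<integral>\<^sup>+y. ennreal 1 * indicator S y \<partial>lborel) = (\<integral>\<^sup>+y. 0 \<partial>(lborel::'a measure))" by (rule nn_integral_cong_AE)
  moreover have "0 < (\<integral>\<^sup>+y. ennreal 1 * indicator S y \<partial>lborel)"
    by (rule nn_integral_pos_continuous[where f="\<lambda>_. 1", OF _ assms]) auto
  ultimately show False by simp
qed

text \<open>With \<open>t = min 1 (\<eta> / (3 * c))\<close> the point \<open>y\<close> has norm at
  most \<open>(1 + t)\<close> times that of \<open>x\<close>, and
  \<open>(1 + t)^2 <= 1 + 3 t\<close> because \<open>t <= 1\<close>; then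
  \<open>(c - \<eta>) (1 + 3 t) <= c\<close>.\<close>

lemma potential_le:
  fixes x y :: "'a::euclidean_space"
  assumes c: "c > 0" and \<eta>: "\<eta> > 0" and r: "r > 0" "norm x \<ge> r" and y: "y \<noteq> 0" "norm y \<le> norm x + e"
    and e: "e \<le> r * min 1 (\<eta> / (3 * c))"
  shows "(c - \<eta>) / (norm x)\<^sup>2 \<le> c / (norm y)\<^sup>2"
proof (cases "c \<le> \<eta>")
  case True
  then have "(c - \<eta>) / (norm x)\<^sup>2 \<le> 0" by (simp add: divide_nonpos_nonneg)
  also have "0 \<le> c / (norm y)\<^sup>2" using c by simp
  finally show ?thesis .
next
  case False
  define t where "t = min 1 (\<eta> / (3 * c))"
  have t: "t > 0" "t \<le> 1" "3 * t * c \<le> \<eta>"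
  proof -
    show "t > 0" using c \<eta> by (simp add: t_def)
    show "t \<le> 1" by (simp add: t_def)
    have "t \<le> \<eta> / (3 * c)" by (simp add: t_def)
    then show "3 * t * c \<le> \<eta>" using c by (simp add: field_simps)
  qed
  have nx: "norm x > 0" using r by linarith
  have "e \<le> r * t" using e by (simp add: t_def)
  also have "\<dots> \<le> norm x * t" using r t by (intro mult_right_mono) auto
  finally have "norm y \<le> norm x * (1 + t)" using y(2) by (simp add: algebra_simps)
  then have "(norm y)\<^sup>2 \<le> (norm x * (1 + t))\<^sup>2" by (intro power_mono) auto
  also have "\<dots> = (norm x)\<^sup>2 * (1 + 2 * t + t * t)" by (simp add: power_mult_distrib power2_eq_square algebra_simps)
  also have "\<dots> \<le> (norm x)\<^sup>2 * (1 + 3 * t)"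
  proof (rule mult_left_mono)
    have "t * t \<le> 1 * t" using t by (intro mult_right_mono) auto
    then show "1 + 2 * t + t * t \<le> 1 + 3 * t" by simp
  qed simp
  finally have "(c - \<eta>) * (norm y)\<^sup>2 \<le> (c - \<eta>) * ((norm x)\<^sup>2 * (1 + 3 * t))" using False by (intro mult_left_mono) auto
  also have "\<dots> = (norm x)\<^sup>2 * ((c - \<eta>) * (1 + 3 * t))" by (simp only: mult.left_commute)
  also have "\<dots> \<le> (norm x)\<^sup>2 * c"
  proof (rule mult_left_mono)
    have "\<eta> * t \<ge> 0" using \<eta> t by simp
    then have "(c - \<eta>) * (1 + 3 * t) \<le> c - \<eta> + 3 * t * c" by (simp add: algebra_simps)
    then show "(c - \<eta>) * (1 + 3 * t) \<le> c" using t(3) by linarith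
  qed simp
  finally have "(c - \<eta>) * (norm y)\<^sup>2 \<le> c * (norm x)\<^sup>2" by (simp only: mult.commute)
  moreover have "(norm y)\<^sup>2 > 0" "(norm x)\<^sup>2 > 0" using y(1) nx by simp_all
  ultimately show ?thesis by (simp add: divide_simps)
qed

context supersol begin

text \<open>A zero at \<open>x\<close> makes \<open>patched K\<close> vanish almost everywhere on
  the ball about \<open>x\<close>. If the ball lies in \<open>K\<close>, this contradicts the
  assumption on \<open>u\<close>; otherwise the ball meets the open complement of \<open>K\<close>,
  where the value is 1.\<close>

lemma mollified_pos:
  assumes smp: "\<And>x r. x \<in> \<Omega> \<Longrightarrow> r > 0 \<Longrightarrow> \<not> (AE y in lborel. y \<in> ball x r \<longrightarrow> u y = 0)"
    and K: "compact K" "K \<subseteq> \<Omega>" and e: "e > 0"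
  shows "mollified K e x > 0"
proof (rule ccontr)
  assume "\<not> ?thesis"
  then have z: "mollified K e x = 0" using mollified_nonneg[OF e, of K x] by linarith
  have "AE y in lborel. patched K y *\<^sub>R mollifier e (x - y) = 0"
  proof (subst integral_nonneg_eq_0_iff_AE[symmetric])
    show "integrable lborel (\<lambda>y. patched K y *\<^sub>R mollifier e (x - y))" by (rule conv_integrable[OF patched_L1loc[OF K] mollifier_C0c[OF e]])
    show "AE y in lborel. 0 \<le> patched K y *\<^sub>R mollifier e (x - y)" by (intro AE_I2 scaleR_nonneg_nonneg patched_nonneg mollifier_facts(2)[OF e])
    show "(LBINT y. patched K y *\<^sub>R mollifier e (x - y)) = 0" using z by (simp add: mollified_def)
  qed
  then have ae: "AE y in lborel. y \<in> ball x e \<longrightarrow> patched K y = 0"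
  proof (rule AE_mp, intro AE_I2 impI)
    fix y assume y: "patched K y *\<^sub>R mollifier e (x - y) = 0" "y \<in> ball x e"
    have "mollifier e (x - y) > 0" using y(2) by (intro mollifier_facts(3)[OF e]) (simp add: dist_norm)
    then show "patched K y = 0" using y(1) by simp
  qed
  show False
  proof (cases "ball x e \<subseteq> K")
    case True
    have "x \<in> ball x e" using e by simp
    then have "x \<in> \<Omega>" using True K(2) by blast
    moreover have "AE y in lborel. y \<in> ball x e \<longrightarrow> u y = 0"
      using ae by (rule AE_mp, intro AE_I2 impI) (use True in \<open>auto simp: patched_def subset_eq\<close>)
    ultimately show False using smp e by blast
  next
    case False
    then obtain y where y: "y \<in> ball x e - K" by blast
    have "open (ball x e - K)" by (rule open_Diff) (use compact_imp_closed[OF K(1)] in auto)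
    moreover have "AE y in lborel. y \<notin> ball x e - K"
      using ae by (rule AE_mp, intro AE_I2 impI) (auto simp: patched_def split: if_splits)
    ultimately show False using open_not_null y by blast
  qed
qed

text \<open>A finite cover of \<open>K1\<close> by small balls gives a positive \<open>k\<close>
  from the masses of \<open>u\<close> on them, before \<open>Q\<close> and \<open>\<eta>\<close> are
  known. The coefficient may be lowered from \<open>c\<close> to any positive \<open>c'\<close>,
  which weakens the inequality.\<close>

lemma mollified_family:
  assumes con: "connected \<Omega>" and nz: "\<not> (AE x in lborel. x \<in> \<Omega> \<longrightarrow> u x = 0)"
    and c': "0 < c'" "c' \<le> c" and K1: "compact K1" "K1 \<subseteq> \<Omega>"
  shows "\<exists>k>0. \<forall>Q \<eta>. compact Q \<longrightarrow> Q \<subseteq> \<Omega> \<longrightarrow> \<eta> > 0 \<longrightarrow>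
        (\<exists>v gv. has_grad v gv UNIV \<and> (\<forall>x. v x > 0) \<and>
           weak_supersol v gv (\<lambda>x. (c' - \<eta>) / (norm x)\<^sup>2 + v x powr (p - 1)) Q \<and> (\<forall>x\<in>K1. k \<le> v x))"
proof -
  note smp = strong_maximum_principle[OF con nz]
  define KK where "KK = (LBINT z. mean_kernel (z::'a))"
  have KK: "KK > 0" unfolding KK_def by (rule mean_kernel_integral_pos)
  have "\<forall>x\<in>K1. \<exists>d. d > 0 \<and> cball x (4 * d) \<subseteq> \<Omega>"
  proof
    fix x assume "x \<in> K1"
    then obtain s where "s > 0" "cball x s \<subseteq> \<Omega>" using op K1 open_contains_cball by blast
    then show "\<exists>d. d > 0 \<and> cball x (4 * d) \<subseteq> \<Omega>" by (intro exI[of _ "s / 4"]) auto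
  qed
  from bchoice[OF this] obtain D where D: "\<And>x. x \<in> K1 \<Longrightarrow> D x > 0" "\<And>x. x \<in> K1 \<Longrightarrow> cball x (4 * D x) \<subseteq> \<Omega>" by auto
  have sub: "cball x (t * D x) \<subseteq> \<Omega>" if "t \<le> 4" "x \<in> K1" for t x
  proof -
    have "t * D x \<le> 4 * D x" using that D(1)[of x] by (intro mult_right_mono) auto
    from order_trans[OF subset_cball[OF this] D(2)[OF that(2)]] show ?thesis .
  qed
  have sub': "cball x (D x / 8) \<subseteq> \<Omega>" if "x \<in> K1" for x using sub[of "1/8" x] that by simp
  define m where "m x = 3 * mass x (D x / 8) / (D x ^ DIM('a) * KK)" for x
  have m: "m x > 0" if x: "x \<in> K1" for x
  proof -
    have "mass x (D x / 8) > 0"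
    proof (rule mass_pos[OF sub'[OF x]], rule smp)
      show "x \<in> \<Omega>" using x K1 by blast
      show "0 < D x / 8" using D(1)[OF x] by simp
    qed
    then show ?thesis using D(1)[OF x] KK by (simp add: m_def)
  qed
  obtain F where F: "F \<subseteq> K1" "finite F" "K1 \<subseteq> (\<Union>x\<in>F. ball x (D x / 8))"
  proof (rule compactE_image[OF K1(1), of K1 "\<lambda>x. ball x (D x / 8)"])
    show "K1 \<subseteq> (\<Union>x\<in>K1. ball x (D x / 8))" using D(1) by force
  qed (auto intro: that)
  \<comment> \<open>The entry 1 keeps the minimum meaningful when the cover is empty.\<close>
  define k where "k = Min (insert 1 (m ` F))"
  have kpos: "k > 0" unfolding k_def using F m by (subst Min_gr_iff) auto
  have km: "k \<le> m x" if "x \<in> F" for x unfolding k_def using F that by (intro Min_le) auto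
  have main: "\<exists>v gv. has_grad v gv UNIV \<and> (\<forall>x. v x > 0) \<and>
           weak_supersol v gv (\<lambda>x. (c' - \<eta>) / (norm x)\<^sup>2 + v x powr (p - 1)) Q \<and> (\<forall>x\<in>K1. k \<le> v x)"
    if Q: "compact Q" "Q \<subseteq> \<Omega>" and \<eta>: "\<eta> > 0" for Q \<eta>
  proof -
    \<comment> \<open>The balls about the centres are added so that the mean value inequality is
      available at the points of \<open>K1\<close>, whatever \<open>Q\<close> is.\<close>
    define Q2 where "Q2 = Q \<union> (\<Union>x\<in>F. cball x (2 * D x))"
    have Q2: "compact Q2" unfolding Q2_def using Q F(2) by (intro compact_Un compact_UN) auto
    have Q2O: "Q2 \<subseteq> \<Omega>" unfolding Q2_def using Q(2) sub[of 2] F(1) by auto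
    obtain \<delta> where \<delta>: "\<delta> > 0" "(\<Union>x\<in>Q2. cball x \<delta>) \<subseteq> \<Omega>"
      by (rule compact_subset_open_imp_cball_epsilon_subset[OF Q2 op Q2O])
    define K where "K = (\<Union>x\<in>Q2. cball x \<delta>)"
    have K: "compact K" "K \<subseteq> \<Omega>" unfolding K_def using \<delta>(2) by (auto intro: compact_thickening[OF Q2])
    have "0 \<notin> Q2" using Q2O zero by blast
    from separate_point_closed[OF compact_imp_closed[OF Q2] this]
    obtain \<rho> where \<rho>: "\<rho> > 0" "\<And>x. x \<in> Q2 \<Longrightarrow> \<rho> \<le> norm x" by auto
    \<comment> \<open>Three demands on the radius: averages stay in \<open>K\<close>, the potential
      changes by no more than \<open>\<eta>\<close> permits, and the mean value bound applies at
      every centre.\<close>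
    define A where "A = insert \<delta> (insert (\<rho> * min 1 (\<eta> / (3 * c'))) ((\<lambda>x. D x / 4) ` F))"
    define e where "e = Min A"
    have fA: "finite A" "A \<noteq> {}" using F(2) by (simp_all add: A_def)
    have e: "e > 0" unfolding e_def
    proof (subst Min_gr_iff[OF fA], rule ballI)
      fix a assume "a \<in> A"
      then consider "a = \<delta>" | "a = \<rho> * min 1 (\<eta> / (3 * c'))" | x where "x \<in> F" "a = D x / 4" by (auto simp: A_def)
      then show "0 < a"
      proof cases
        case 2
        then show ?thesis using \<rho>(1) \<eta> c'(1) by simp
      next
        case 3
        then show ?thesis using D(1)[of x] F(1) by auto
      qed (use \<delta> in simp)
    qed
    have eA: "e \<le> a" if "a \<in> A" for a unfolding e_def by (rule Min_le[OF fA(1) that])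
    have e\<delta>: "e \<le> \<delta>" by (rule eA) (simp add: A_def)
    have e\<rho>: "e \<le> \<rho> * min 1 (\<eta> / (3 * c'))" by (rule eA) (simp only: A_def insert_iff, simp)
    have eD: "e \<le> D x / 4" if "x \<in> F" for x by (rule eA) (use that in \<open>auto simp: A_def\<close>)
    have QK: "cball x e \<subseteq> K" if "x \<in> Q2" for x
      using subset_cball[OF e\<delta>, of x] that unfolding K_def by blast
    have WS2: "weak_supersol (mollified K e) (mollified_grad K e) (\<lambda>x. (c' - \<eta>) / (norm x)\<^sup>2 + mollified K e x powr (p - 1)) Q2"
    proof (rule mollified_supersolution[OF K e QK])
      fix x y assume x: "x \<in> Q2" and y: "y \<in> cball x e"
      have "y \<noteq> 0" using QK[OF x] y K(2) zero by blast
      moreover have "norm y \<le> norm x + e"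
      proof -
        have "norm y \<le> norm x + norm (y - x)" by (rule norm_triangle_sub)
        then show ?thesis using y by (simp add: dist_norm norm_minus_commute)
      qed
      ultimately have "(c' - \<eta>) / (norm x)\<^sup>2 \<le> c' / (norm y)\<^sup>2" by (rule potential_le[OF c'(1) \<eta> \<rho>(1) \<rho>(2)[OF x] _ _ e\<rho>])
      also have "\<dots> \<le> c / (norm y)\<^sup>2" using c'(2) by (rule divide_right_mono) simp
      finally show "(c' - \<eta>) / (norm x)\<^sup>2 \<le> c / (norm y)\<^sup>2" .
    qed
    have ws: "weak_supersol (mollified K e) (mollified_grad K e) (\<lambda>x. (c' - \<eta>) / (norm x)\<^sup>2 + mollified K e x powr (p - 1)) Q"
      unfolding weak_supersol_def
    proof (intro allI impI)
      fix \<zeta> :: "'a \<Rightarrow> real" and g assume C: "C1c Q \<zeta> g" and n: "\<forall>x. 0 \<le> \<zeta> x"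
      have "C1c Q2 \<zeta> g" by (rule C1c_mono[OF C]) (simp add: Q2_def)
      then show "(LBINT x. ((c' - \<eta>) / (norm x)\<^sup>2 + mollified K e x powr (p - 1)) * mollified K e x * \<zeta> x) \<le> (LBINT x. mollified_grad K e x \<bullet> g x)"
        using WS2[unfolded weak_supersol_def, rule_format, of \<zeta> g] n by simp
    qed
    have low: "k \<le> mollified K e x" if x: "x \<in> K1" for x
    proof -
      obtain y where y: "y \<in> F" "x \<in> ball y (D y / 8)" using F(3) x by blast
      have yK: "y \<in> K1" using y F by blast
      define d where "d = D y"
      have d: "d > 0" unfolding d_def by (rule D(1)[OF yK])
      have dyx: "dist y x < d / 8" using y(2) by (simp add: d_def)
      have cy: "cball x d \<subseteq> cball y (2 * d)"
      proof
        fix w assume "w \<in> cball x d"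
        then show "w \<in> cball y (2 * d)" using dyx d dist_triangle[of y w x] by auto
      qed
      have cQ: "cball x d \<subseteq> Q2" using cy y(1) unfolding Q2_def d_def by blast
      have e4: "e \<le> d / 4" using eD[OF y(1)] by (simp add: d_def)
      have "3 * mass x (d / 4) \<le> d ^ DIM('a) * (mollified K e x * KK)"
        unfolding KK_def by (rule mollified_mean_lower[OF K e QK d cQ e4])
      moreover have "mass y (d / 8) \<le> mass x (d / 4)"
      proof (rule mass_mono)
        have 1: "cball x (d / 4) \<subseteq> cball x d" by (rule subset_cball) (use d in simp)
        show "cball x (d / 4) \<subseteq> \<Omega>" by (rule order_trans[OF 1 order_trans[OF cQ Q2O]])
        show "cball y (d / 8) \<subseteq> \<Omega>" unfolding d_def by (rule sub'[OF yK])
        show "ball y (d / 8) \<subseteq> ball x (d / 4)"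
        proof
          fix w assume "w \<in> ball y (d / 8)"
          then show "w \<in> ball x (d / 4)" using dyx dist_triangle[of x w y] by (auto simp: dist_commute)
        qed
      qed
      ultimately have "3 * mass y (d / 8) \<le> mollified K e x * (d ^ DIM('a) * KK)" by (simp add: mult_ac)
      moreover have "d ^ DIM('a) * KK > 0" using d KK by simp
      ultimately have "m y \<le> mollified K e x" unfolding m_def d_def[symmetric] by (simp add: pos_divide_le_eq)
      then show ?thesis using km[OF y(1)] by linarith
    qed
    show ?thesis
      by (rule exI[of _ "mollified K e"], rule exI[of _ "mollified_grad K e"], intro conjI allI ballI mollified_has_grad[OF K e] mollified_pos[OF smp K e] ws low)
  qed
  show ?thesis by (rule exI[of _ k]) (use kpos main in blast)
qed

end

section \<open>Conclusion\<close>

lemma angular_poincare_le: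
  assumes "angular_poincare \<Sigma> l" "hom_adm \<Sigma> \<psi> g" "ball_integral (\<lambda>x. (\<psi> x)\<^sup>2) = ennreal X" "X > 0"
    "ball_integral (\<lambda>x. (norm x)\<^sup>2 * (norm (g x))\<^sup>2) = ennreal Y" "Y \<ge> 0"
  shows "l \<le> Y / X"
proof (cases "l \<le> 0")
  case True
  have "0 \<le> Y / X" using assms(4,6) by simp
  then show ?thesis using True by linarith
next
  case False
  have "ennreal l * ennreal X \<le> ennreal Y" using assms(1,2) unfolding angular_poincare_def assms(3)[symmetric] assms(5)[symmetric] by blast
  then have "ennreal (l * X) \<le> ennreal Y" using False assms(4) by (simp add: ennreal_mult)
  then have "l * X \<le> Y" using assms(6) by simp
  then show ?thesis using assms(4) by (simp add: pos_le_divide_eq)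
qed

text \<open>The supremum of the admissible constants is admissible, since for each fixed function
  the inequality passes to the limit; maximality is then immediate.\<close>

lemma angular_poincare_supremum:
  fixes \<Sigma> :: "'a::euclidean_space set"
  assumes b: "\<And>l. angular_poincare \<Sigma> l \<Longrightarrow> l \<le> M"
  obtains lam where "lam \<ge> 0" "angular_poincare \<Sigma> lam" "\<And>e. e > 0 \<Longrightarrow> \<not> angular_poincare \<Sigma> (lam + e)"
proof -
  define L where "L = {l. angular_poincare \<Sigma> l}"
  have 0: "0 \<in> L" by (simp add: L_def angular_poincare_def)
  have bdd: "bdd_above L" using b by (intro bdd_aboveI[of _ M]) (auto simp: L_def)
  define lam where "lam = Sup L"
  have lam: "lam \<ge> 0" unfolding lam_def by (rule cSup_upper[OF 0 bdd])
  have "angular_poincare \<Sigma> lam"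
    unfolding angular_poincare_def
  proof (intro allI impI)
    fix \<psi> g assume h: "hom_adm \<Sigma> \<psi> g"
    let ?A = "ball_integral (\<lambda>x::'a. (\<psi> x)\<^sup>2)" and ?B = "ball_integral (\<lambda>x::'a. (norm x)\<^sup>2 * (norm (g x))\<^sup>2)"
    have le: "ennreal (lam - 1 / real (Suc n)) * ?A \<le> ?B" for n
    proof -
      obtain l where l: "l \<in> L" "lam - 1 / real (Suc n) < l"
      proof (rule less_cSupE[of "lam - 1 / real (Suc n)" L])
        show "lam - 1 / real (Suc n) < Sup L" unfolding lam_def by simp
        show "L \<noteq> {}" using 0 by blast
      qed
      have "ennreal (lam - 1 / real (Suc n)) * ?A \<le> ennreal l * ?A" using l(2) by (intro mult_right_mono ennreal_leI) auto
      also have "\<dots> \<le> ?B" using l(1) h by (simp add: L_def angular_poincare_def)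
      finally show ?thesis .
    qed
    have "(\<lambda>n. lam - 1 / real (Suc n)) \<longlonglongrightarrow> lam - 0"
      by (intro tendsto_intros LIMSEQ_Suc[OF lim_1_over_n])
    then have t: "(\<lambda>n. ennreal (lam - 1 / real (Suc n))) \<longlonglongrightarrow> ennreal lam" by (intro tendsto_ennrealI) simp
    show "ennreal lam * ?A \<le> ?B"
    \<comment> \<open>Multiplication by an infinite factor is not continuous at 0; in that case a
      single positive member of the sequence forces the right side to be infinite, and for
      \<open>lam = 0\<close> the left side is 0.\<close>
    proof (cases "?A = \<infinity>")
      case True
      show ?thesis
      proof (cases "lam = 0")
        case False
        then have lp: "lam > 0" using lam by simp
        then obtain n where "1 / real (Suc n) < lam" by (metis nat_approx_posE inverse_eq_divide)
        then have "ennreal (lam - 1 / real (Suc n)) * ?A = \<infinity>" using True by (simp add: ennreal_mult_top)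
        then have "?B = \<infinity>" using le[of n] by (simp add: top_unique)
        then show ?thesis by simp
      qed simp
    next
      case False
      have "(\<lambda>n. ennreal (lam - 1 / real (Suc n)) * ?A) \<longlonglongrightarrow> ennreal lam * ?A"
        using ennreal_tendsto_cmult[OF _ t, of ?A] False by (simp add: mult.commute less_top)
      then show ?thesis by (rule LIMSEQ_le_const2) (use le in auto)
    qed
  qed
  moreover have "\<not> angular_poincare \<Sigma> (lam + e)" if "e > 0" for e
  proof
    assume "angular_poincare \<Sigma> (lam + e)"
    then have "lam + e \<le> lam" unfolding lam_def by (intro cSup_upper[OF _ bdd]) (simp add: L_def)
    with that show False by simp
  qed
  ultimately show ?thesis using that lam by blast
qed

section \<open>The truncated cone and the passage to a Borel representative\<close>

lemma trunc_cone_eq: "\<Sigma> \<subseteq> sphere 0 1 \<Longrightarrow> trunc_cone \<Sigma> R = {x \<in> cone_of \<Sigma>. norm x < R}"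
proof (intro set_eqI iffI)
  fix x assume S: "\<Sigma> \<subseteq> sphere 0 1" and "x \<in> trunc_cone \<Sigma> R"
  then obtain r s where x: "x = r *\<^sub>R s" "0 < r" "r < R" "s \<in> \<Sigma>" by (auto simp: trunc_cone_def)
  then have "norm s = 1" using S by auto
  then show "x \<in> {x \<in> cone_of \<Sigma>. norm x < R}" using x by (auto simp: cone_of_def)
next
  fix x assume S: "\<Sigma> \<subseteq> sphere 0 1" and "x \<in> {x \<in> cone_of \<Sigma>. norm x < R}"
  then obtain r s where x: "x = r *\<^sub>R s" "0 < r" "norm x < R" "s \<in> \<Sigma>" by (auto simp: cone_of_def)
  then have "norm s = 1" using S by auto
  then show "x \<in> trunc_cone \<Sigma> R" using x by (auto simp: trunc_cone_def)
qed

lemma open_trunc_cone: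
  assumes "openin (top_of_set (sphere 0 1)) \<Sigma>"
  shows "open (trunc_cone \<Sigma> R)"
proof -
  have Ss: "\<Sigma> \<subseteq> sphere 0 1" using openin_imp_subset[OF assms] by simp
  have "trunc_cone \<Sigma> R = {x. x \<noteq> 0 \<and> sgn x \<in> \<Sigma>} \<inter> ball 0 R"
    by (auto simp: trunc_cone_eq[OF Ss] cone_of_eq[OF Ss])
  then show ?thesis using sphere_openin_cone_open[OF assms] by (simp add: open_Int)
qed

lemma connected_trunc_cone:
  assumes "connected \<Sigma>"
  shows "connected (trunc_cone \<Sigma> R)"
proof -
  have "trunc_cone \<Sigma> R = (\<lambda>(r, \<sigma>). r *\<^sub>R \<sigma>) ` ({0<..<R} \<times> \<Sigma>)" (is "_ = ?f ` _")
  proof (intro equalityI subsetI)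
    fix x assume "x \<in> trunc_cone \<Sigma> R"
    then obtain r \<sigma> where "x = ?f (r, \<sigma>)" "(r, \<sigma>) \<in> {0<..<R} \<times> \<Sigma>" by (auto simp: trunc_cone_def)
    then show "x \<in> ?f ` ({0<..<R} \<times> \<Sigma>)" by (rule image_eqI)
  next
    fix x assume "x \<in> ?f ` ({0<..<R} \<times> \<Sigma>)"
    then obtain r \<sigma> where "x = r *\<^sub>R \<sigma>" "0 < r" "r < R" "\<sigma> \<in> \<Sigma>" by auto
    then show "x \<in> trunc_cone \<Sigma> R" unfolding trunc_cone_def by blast
  qed
  moreover have "connected ((\<lambda>(r, \<sigma>). r *\<^sub>R \<sigma>) ` ({0<..<R} \<times> \<Sigma>))"
    by (intro connected_continuous_image connected_Times assms) (auto simp: case_prod_unfold intro!: continuous_intros)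
  ultimately show ?thesis by simp
qed

lemma supersol_representative:
  fixes \<Omega> :: "'a::euclidean_space set"
  assumes op: "open \<Omega>" and zero: "0 \<notin> \<Omega>" and c: "c > 0" and p: "p > 1" and Lp: "Lp_loc p \<Omega> u" and un: "\<forall>x\<in>\<Omega>. u x \<ge> 0"
    and ineq: "\<And>\<phi>. test_fun \<Omega> \<phi> \<Longrightarrow> (\<forall>x. \<phi> x \<ge> 0) \<Longrightarrow>
           set_lebesgue_integral lebesgue \<Omega> (\<lambda>x. u x * (- laplacian \<phi> x - c / (norm x)\<^sup>2 * \<phi> x))
         \<ge> set_lebesgue_integral lebesgue \<Omega> (\<lambda>x. u x powr p * \<phi> x)"
  shows "\<exists>U. supersol \<Omega> U c p \<and> (AE x in lborel. x \<in> \<Omega> \<longrightarrow> u x = U x)"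
proof -
  have um[measurable]: "u \<in> borel_measurable lebesgue" using Lp by (simp add: Lp_loc_def)
  obtain g where g[measurable]: "g \<in> borel_measurable lborel" and gu: "AE x in lborel. u x = g x"
    using completion_ex_borel_measurable_real[OF um] by blast
  have [measurable]: "\<Omega> \<in> sets borel" using op by simp
  define U where "U x = (if x \<in> \<Omega> then max 0 (g x) else 0)" for x
  have Un: "U x \<ge> 0" for x by (simp add: U_def)
  have U[measurable]: "U \<in> borel_measurable borel" unfolding U_def[abs_def] using g by measurable
  have ae: "AE x in lborel. x \<in> \<Omega> \<longrightarrow> u x = U x"
    using gu by (rule AE_mp, intro AE_I2 impI) (use un in \<open>auto simp: U_def\<close>)
  have ael: "AE x in lebesgue. x \<in> \<Omega> \<longrightarrow> u x = U x" by (rule AE_completion[OF ae])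
  \<comment> \<open>The one transfer between Lebesgue integrals over \<open>\<Omega>\<close> and
    Borel integrals over the whole space; \<open>F\<close> will be a power and the identity.\<close>
  have conv: "set_lebesgue_integral lebesgue \<Omega> (\<lambda>x. F (u x) * h x) = (LBINT x. F (U x) * h x)"
    if F: "F \<in> borel_measurable borel" and h: "h \<in> borel_measurable borel" and z: "\<And>x. x \<notin> \<Omega> \<Longrightarrow> F (U x) * h x = 0"
    for F h :: "_ \<Rightarrow> real"
  proof -
    have hl[measurable]: "h \<in> borel_measurable lebesgue" "U \<in> borel_measurable lebesgue" and [measurable]: "\<Omega> \<in> sets lebesgue"
      using h by (auto intro: measurable_completion)
    note F[measurable] h[measurable]
    have "set_lebesgue_integral lebesgue \<Omega> (\<lambda>x. F (u x) * h x) = (\<integral>x. F (U x) * h x \<partial>lebesgue)"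
      unfolding set_lebesgue_integral_def
    proof (rule integral_cong_AE)
      show "AE x in lebesgue. indicator \<Omega> x *\<^sub>R (F (u x) * h x) = F (U x) * h x"
        using ael by (rule AE_mp, intro AE_I2 impI) (use z in \<open>auto simp: indicator_def\<close>)
    qed measurable
    also have "\<dots> = (LBINT x. F (U x) * h x)" by (rule integral_completion) measurable
    finally show ?thesis .
  qed
  have "supersol \<Omega> U c p"
  proof (rule supersol.intro[OF op zero c p U])
    show "U x \<ge> 0" for x by (rule Un)
    fix K assume K: "compact K" "K \<subseteq> \<Omega>"
    have [measurable]: "K \<in> sets borel" using K(1) by (simp add: borel_compact)
    have "(\<integral>\<^sup>+ y. ennreal (indicator K y * U y powr p) \<partial>lborel) = (\<integral>\<^sup>+ y. ennreal (indicator K y * U y powr p) \<partial>lebesgue)"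
      by (rule nn_integral_completion[symmetric])
    also have "\<dots> = (\<integral>\<^sup>+ y\<in>K. ennreal (\<bar>u y\<bar> powr p) \<partial>lebesgue)"
    proof (rule nn_integral_cong_AE)
      show "AE y in lebesgue. ennreal (indicator K y * U y powr p) = ennreal (\<bar>u y\<bar> powr p) * indicator K y"
        using ael by (rule AE_mp, intro AE_I2 impI) (use K(2) un Un in \<open>auto simp: indicator_def subset_eq\<close>)
    qed
    also have "\<dots> < \<infinity>" using Lp K by (simp add: Lp_loc_def)
    finally show "integrable lborel (\<lambda>y. indicator K y * U y powr p)"
      by (intro integrableI_nonneg) auto
  next
    fix \<phi> assume t: "test_fun \<Omega> \<phi>" and n: "\<And>x. \<phi> x \<ge> 0"
    have sm: "smooth_on UNIV \<phi>" using t by (simp add: test_fun_def)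
    have "\<phi> \<in> borel_measurable borel" "dderiv vs \<phi> \<in> borel_measurable borel" for vs
      using has_grad_continuous[OF smooth_on_has_grad[OF open_UNIV smooth_on_dderiv[OF sm]]] has_grad_continuous[OF smooth_on_has_grad[OF open_UNIV sm]]
      by (auto intro: borel_measurable_continuous_onI)
    then have [measurable]: "\<phi> \<in> borel_measurable borel" "laplacian \<phi> \<in> borel_measurable borel"
      unfolding laplacian_def[abs_def] by (auto intro!: borel_measurable_sum simp del: dderiv.simps)
    have z: "\<phi> x = 0" if "x \<notin> \<Omega>" for x
      using t that closure_subset[of "{x. \<phi> x \<noteq> 0}"] by (auto simp: test_fun_def tsupport_def)
    have "(LBINT y. U y powr p * \<phi> y) = set_lebesgue_integral lebesgue \<Omega> (\<lambda>x. u x powr p * \<phi> x)"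
      by (rule conv[symmetric, of "\<lambda>t. t powr p"]) (auto simp: z)
    also have "\<dots> \<le> set_lebesgue_integral lebesgue \<Omega> (\<lambda>x. u x * (- laplacian \<phi> x - c / (norm x)\<^sup>2 * \<phi> x))"
      using ineq[OF t] n by blast
    also have "\<dots> = (LBINT y. U y * (- laplacian \<phi> y - c / (norm y)\<^sup>2 * \<phi> y))"
      by (rule conv[of "\<lambda>t. t"]) (auto simp: U_def)
    finally show "(LBINT y. U y powr p * \<phi> y) \<le> (LBINT y. U y * (- laplacian \<phi> y - c / (norm y)\<^sup>2 * \<phi> y))" .
  qed
  with ae show ?thesis by blast
qed

theorem theorem0p1:
  fixes \<Sigma> :: "'a::euclidean_space set" and R c p :: real and u :: "'a \<Rightarrow> real"
  assumes "DIM('a) \<ge> 3"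
    and "sphere_domain \<Sigma>"
    and "R > 0"
    and "lambda1 \<Sigma> < c" and "c \<le> hardy_const \<Sigma>"
    and "p > 1"
    and "Lp_loc p (trunc_cone \<Sigma> R) u"
    and "\<forall>x\<in>trunc_cone \<Sigma> R. u x \<ge> 0"
    and "\<And>\<phi>. test_fun (trunc_cone \<Sigma> R) \<phi> \<Longrightarrow> (\<forall>x. \<phi> x \<ge> 0) \<Longrightarrow>
           set_lebesgue_integral lebesgue (trunc_cone \<Sigma> R)
             (\<lambda>x. u x * (- laplacian \<phi> x - c / (norm x)\<^sup>2 * \<phi> x))
         \<ge> set_lebesgue_integral lebesgue (trunc_cone \<Sigma> R) (\<lambda>x. u x powr p * \<phi> x)"
    and "p \<ge> p_Sigma \<Sigma> c"
  shows "AE x in lebesgue. x \<in> trunc_cone \<Sigma> R \<longrightarrow> u x = 0"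
proof -
  have S: "openin (top_of_set (sphere 0 1)) \<Sigma>" and con: "connected \<Sigma>" using assms(2) by (auto simp: sphere_domain_def)
  have Ss: "\<Sigma> \<subseteq> sphere 0 1" using openin_imp_subset[OF S] by simp
  define a where "a = (real DIM('a) - 2) / 2"
  have a: "a > 0" using assms(1) by (simp add: a_def)
  obtain \<psi> X Y where \<psi>: "smooth_on (- {0}) \<psi>" "hom_adm \<Sigma> \<psi> (fgrad \<psi>)"
    and X: "ball_integral (\<lambda>x. (\<psi> x)\<^sup>2) = ennreal X" "X > 0"
    and Y: "ball_integral (\<lambda>x. (norm x)\<^sup>2 * (norm (fgrad \<psi> x))\<^sup>2) = ennreal Y" "Y \<ge> 0" and YX: "Y < c * X"
    using lambda1_lessE[OF assms(2,4)] by (elim exE conjE)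
  have YXc: "Y / X < c" using YX X(2) by (simp add: pos_divide_less_eq)
  have "0 \<le> Y / X" using X(2) Y(2) by simp
  then have c: "c > 0" using YXc by linarith
  \<comment> \<open>Half the distance from \<open>Y / X\<close> to \<open>c\<close> is given away as
    the error of \<open>hardy_const_le\<close>; the other half makes \<open>hlt\<close>
    strict.\<close>
  have hc: "\<exists>u. test_fun (cone_of \<Sigma>) u \<and> (\<exists>x. u x \<noteq> 0)" "hardy_const \<Sigma> \<le> a\<^sup>2 + Y / X + (c - Y / X) / 2"
    using hardy_const_le[OF Ss \<psi> X Y, of "(c - Y / X) / 2"] YXc unfolding a_def by auto
  have hlt: "hardy_const \<Sigma> < a\<^sup>2 + c"
  proof -
    have "s + q + (c - q) / 2 < s + c" if "q < c" for s q :: real using that by (simp add: field_simps)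
    from this[OF YXc] hc(2) show ?thesis by (rule le_less_trans[rotated])
  qed
  obtain lam where lam: "lam \<ge> 0" "angular_poincare \<Sigma> lam" "\<And>e. e > 0 \<Longrightarrow> \<not> angular_poincare \<Sigma> (lam + e)"
    by (rule angular_poincare_supremum[OF angular_poincare_le[OF _ \<psi>(2) X Y]], assumption, rule that, assumption+)
  have hge: "a\<^sup>2 + lam \<le> hardy_const \<Sigma>" unfolding a_def by (rule hardy_const_ge[OF lam(2,1) Ss hc(1)])
  \<comment> \<open>\<open>lam\<close> is related to \<open>hardy_const\<close> only by
    \<open>hge\<close>, so \<open>c\<close> might exceed \<open>a\<^sup>2 + lam\<close>; lowering it
    keeps the root \<open>\<kappa>\<close> real and preserves the supersolution property.\<close>
  define c' where "c' = min c (a\<^sup>2 + lam)"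
  have "0 < a\<^sup>2 + lam" using a lam(1) by (intro add_pos_nonneg) simp_all
  then have c': "0 < c'" "c' \<le> c" "c' \<le> a\<^sup>2 + lam" using c by (simp_all add: c'_def)
  define \<kappa> where "\<kappa> = sqrt (a\<^sup>2 + lam - c')"
  have \<kappa>: "\<kappa> \<ge> 0" "\<kappa>\<^sup>2 = a\<^sup>2 + lam - c'" using c' by (simp_all add: \<kappa>_def)
  define \<alpha> where "\<alpha> = alpha_minus \<Sigma> c"
  have \<alpha>e: "\<alpha> = a - sqrt (hardy_const \<Sigma> - c)" by (simp add: \<alpha>_def alpha_minus_def a_def)
  \<comment> \<open>\<open>hlt\<close> is what makes \<open>\<alpha>\<close> positive, so that
    \<open>p_Sigma\<close> can be solved for \<open>2 / (p - 1)\<close>.\<close>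
  have "sqrt (hardy_const \<Sigma> - c) < sqrt (a\<^sup>2)" using hlt by (intro real_sqrt_less_mono) simp
  then have \<alpha>: "\<alpha> > 0" using a by (simp add: \<alpha>e)
  \<comment> \<open>If \<open>c' = c\<close> this is \<open>hge\<close>; otherwise
    \<open>\<kappa>\<close> is 0.\<close>
  have "\<kappa> \<le> sqrt (hardy_const \<Sigma> - c)" unfolding \<kappa>_def
    by (rule real_sqrt_le_mono) (use hge assms(5) in \<open>auto simp: c'_def min_def\<close>)
  then have \<alpha>\<kappa>: "\<alpha> \<le> a - \<kappa>" by (simp add: \<alpha>e)
  have "2 / \<alpha> \<le> p - 1" using assms(10) by (simp add: p_Sigma_def \<alpha>_def)
  then have "2 / (p - 1) \<le> \<alpha>" using \<alpha> assms(6) by (simp add: field_simps)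
  then have beta: "2 / (p - 1) \<le> a - \<kappa>" using \<alpha>\<kappa> by linarith
  define \<Omega> where "\<Omega> = trunc_cone \<Sigma> R"
  have \<Omega>e: "\<Omega> = {x \<in> cone_of \<Sigma>. norm x < R}" unfolding \<Omega>_def by (rule trunc_cone_eq[OF Ss])
  have op: "open \<Omega>" unfolding \<Omega>_def by (rule open_trunc_cone[OF S])
  have cO: "connected \<Omega>" unfolding \<Omega>_def by (rule connected_trunc_cone[OF con])
  have zero: "0 \<notin> \<Omega>" by (simp add: \<Omega>e cone_of_eq[OF Ss])
  obtain U where U: "supersol \<Omega> U c p" and ae: "AE x in lborel. x \<in> \<Omega> \<longrightarrow> u x = U x"
    using supersol_representative[OF op zero c assms(6), of u] assms(7-9) unfolding \<Omega>_def by blast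
  interpret supersol \<Omega> U c p by (rule U)
  have "AE x in lborel. x \<in> \<Omega> \<longrightarrow> U x = 0"
  proof (rule ccontr)
    assume nz: "\<not> (AE x in lborel. x \<in> \<Omega> \<longrightarrow> U x = 0)"
    \<comment> \<open>With \<open>r = R / 4\<close> the closed annuli reach only to radius
      \<open>R / 2\<close> and stay inside the open truncated cone.\<close>
    have sub: "{x \<in> cone_of \<Sigma>. norm x \<le> 2 * (R / 4)} \<subseteq> \<Omega>" unfolding \<Omega>e using assms(3) by auto
    show False
    proof (rule no_supersolution_family[OF S lam(2,1,3) a_def \<kappa> c'(1) assms(6) beta, of "R / 4"])
      show "0 < R / 4" using assms(3) by simp
      fix K1 assume K1: "compact K1" "K1 \<subseteq> {x \<in> cone_of \<Sigma>. norm x \<le> 2 * (R / 4)}"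
      from mollified_family[OF cO nz c'(1,2) K1(1) order_trans[OF K1(2) sub]]
      obtain k where "k > 0" and k: "\<And>Q \<eta>. compact Q \<Longrightarrow> Q \<subseteq> \<Omega> \<Longrightarrow> \<eta> > 0 \<Longrightarrow>
        (\<exists>v gv. has_grad v gv UNIV \<and> (\<forall>x. v x > 0) \<and>
           weak_supersol v gv (\<lambda>x. (c' - \<eta>) / (norm x)\<^sup>2 + v x powr (p - 1)) Q \<and> (\<forall>x\<in>K1. k \<le> v x))" by auto
      show "\<exists>k>0. \<forall>Q \<eta>. compact Q \<longrightarrow> Q \<subseteq> {x \<in> cone_of \<Sigma>. norm x \<le> 2 * (R / 4)} \<longrightarrow> \<eta> > 0 \<longrightarrow>
        (\<exists>v gv. has_grad v gv UNIV \<and> (\<forall>x. v x > 0) \<and>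
           weak_supersol v gv (\<lambda>x. (c' - \<eta>) / (norm x)\<^sup>2 + v x powr (p - 1)) Q \<and> (\<forall>x\<in>K1. k \<le> v x))"
      proof (rule exI[of _ k], intro conjI allI impI)
        show "k > 0" by fact
        fix Q \<eta> assume "compact Q" "Q \<subseteq> {x \<in> cone_of \<Sigma>. norm x \<le> 2 * (R / 4)}" "(\<eta>::real) > 0"
        then show "\<exists>v gv. has_grad v gv UNIV \<and> (\<forall>x. v x > 0) \<and>
           weak_supersol v gv (\<lambda>x. (c' - \<eta>) / (norm x)\<^sup>2 + v x powr (p - 1)) Q \<and> (\<forall>x\<in>K1. k \<le> v x)"
          using order_trans[OF _ sub] by (intro k)
      qed
    qed
  qed
  with ae have "AE x in lborel. x \<in> \<Omega> \<longrightarrow> u x = 0" by eventually_elim simp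
  then show ?thesis unfolding \<Omega>_def by (rule AE_completion)
qed

end
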